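(* Let $\mathscr T$ be a rigidly-compactly generated tensor triangulated category such that the comparison map $\rho\colon\mathrm{Spc}(\mathscr T^c)\to\mathrm{Spec}^h(\mathrm{End}^*_{\mathscr T}(\mathbb 1))$ is a homeomorphism. Then $\rho(\mathrm{Supp}(t))=\mathrm{Supp}_{\mathrm{BIK}}(t)$ for any $t\in\mathscr T$.
   Context: A rigidly-compactly generated tensor triangulated category $\mathscr T$ is a triangulated category with small coproducts and a compatible closed symmetric monoidal structure $(\otimes,\mathbb 1)$, compactly generated, whose compact objects coincide with its rigid (dualizable) objects (so $\mathbb 1$ is compact). $\mathscr T^c$ is the full subcategory of compact objects. $\mathrm{Spc}(\mathscr T^c)$ is the set of prime thick tensor ideals $\mathscr P$ of $\mathscr T^c$; for $a\in\mathscr T^c$ put $\mathrm{supp}(a)=\{\mathscr P: a\notin\mathscr P\}$, and these sets form a basis of closed subsets of the topology. It is a spectral space. In a spectral space, a subset is Thomason if it is a union of closed subsets each having quasi-compact complement, and a subset $W$ is weakly visible if $W=U\cap V^c$ with $U,V$ Thomason. Tensor triangular support. For a Thomason subset $Y\subseteq \mathrm{Spc}(\mathscr T^c)$ let $\mathscr T^c_Y=\{a\in\mathscr T^c:\mathrm{supp}(a)\subseteq Y\}$. There is an exact triangle $e_Y\to\mathbb 1\to f_Y\to\Sigma e_Y$, unique up to unique isomorphism, with $e_Y\in\mathrm{Loc}\langle\mathscr T^c_Y\rangle$ and $\mathrm{Hom}_{\mathscr T}(s,f_Y)=0$ for all $s\in\mathrm{Loc}\langle\mathscr T^c_Y\rangle$.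 For weakly visible $W=U\cap V^c$ put $g_W=e_U\otimes f_V$ (well defined up to isomorphism). Then $\mathrm{Supp}(t)=\{\mathscr P: g_W\otimes t\neq0\text{ for every weakly visible }W\ni\mathscr P\}$. Canonical BIK support. $R=\mathrm{End}^*_{\mathscr T}(\mathbb 1)=\bigoplus_{n\in\mathbb Z}\mathrm{Hom}_{\mathscr T}(\mathbb 1,\Sigma^n\mathbb 1)$ is a graded-commutative $\mathbb Z$-graded ring acting canonically on $\mathscr T$ (by tensoring), so each $\mathrm{Hom}^*_{\mathscr T}(x,t)=\bigoplus_n\mathrm{Hom}_{\mathscr T}(x,\Sigma^nt)$ is a graded $R$-module. $\mathrm{Spec}^h(R)$ is the spectral space of homogeneous prime ideals with the Zariski topology. For a graded $R$-module $M$, $\mathrm{supp}_RM$ is the set of weakly associated primes: those $\mathfrak p\in\mathrm{Spec}^h(R)$ minimal among the homogeneous primes containing $\mathrm{Ann}(m)$ for some homogeneous $m\in M$. For specialization closed $\mathcal V\subseteq\mathrm{Spec}^h(R)$, the subcategory $\mathscr T_{\mathcal V}=\{t:\mathrm{supp}_R\mathrm{Hom}^*_{\mathscr T}(x,t)\subseteq\mathcal V\ \forall x\in\mathscr T^c\}$ is localizing and its inclusion has a right adjoint; it gives localization triangles $\varGamma_{\mathcal V}t\to t\to L_{\mathcal V}t\to$ with $\varGamma_{\mathcal V}t\in\mathscr T_{\mathcal V}$ and $\mathrm{Hom}_{\mathscr T}(s,L_{\mathcal V}t)=0$ for all $s\in\mathscr T_{\mathcal V}$. Let $\mathcal V(\mathfrak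 a)=\{\mathfrak q\supseteq\mathfrak a\}$ and $\mathcal Z(\mathfrak p)=\{\mathfrak q:\mathfrak q\not\subseteq\mathfrak p\}$. Then $\mathrm{Supp}_{\mathrm{BIK}}(t)$ is the set of $\mathfrak p\in\mathrm{Spec}^h(R)$ such that $\varGamma_{\mathcal V(\mathfrak a)}L_{\mathcal Z(\mathfrak p)}t\neq0$ for every finitely generated (homogeneous) ideal $\mathfrak a\subseteq\mathfrak p$. Comparison map. $\rho(\mathscr P)$ is the ideal of $R$ generated by the homogeneous $f\in R$ with $\mathrm{cone}(f)\notin\mathscr P$; this is a homogeneous prime and $\rho$ is continuous. *)

theory Defs
  imports "HOL-Analysis.Function_Topology" "HOL-Algebra.Ideal" "HOL-Algebra.Product_Groups"
begin

unbundle cardinal_syntax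

text \<open>
  A category together with the data of a tensor triangulated structure.  The objects are the
  elements of type \<open>'o\<close> and the arrows those of type \<open>'m\<close>; \<open>f \<cdot> g\<close> (first \<open>g\<close>, then \<open>f\<close>) and
  \<open>f \<boxplus> g\<close> are meaningful only for composable and for parallel arrows.

  HOL does not distinguish small sets from classes, so the data include a set
  \<open>univ\<close> of indices whose cardinality plays the role of the universe: a set is small if its
  cardinality is smaller than that of \<open>univ\<close>.  Every small set is thus in bijection with a
  small subset of \<open>univ\<close>.
\<close>

record ('o, 'm, 'u) tt_data =
  univ :: "'u set"
  src :: "'m \<Rightarrow> 'o"
  tgt :: "'m \<Rightarrow> 'o"
  idm :: "'o \<Rightarrow> 'm"
  cmp :: "'m \<Rightarrow> 'm \<Rightarrow> 'm"  (infixr "\<cdot>\<index>" 70)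
  zerom :: "'o \<Rightarrow> 'o \<Rightarrow> 'm"
  addm :: "'m \<Rightarrow> 'm \<Rightarrow> 'm"  (infixl "\<boxplus>\<index>" 65)
  shO :: "'o \<Rightarrow> 'o"
  shM :: "'m \<Rightarrow> 'm"
  tri :: "('m \<times> 'm \<times> 'm) set"
  tensO :: "'o \<Rightarrow> 'o \<Rightarrow> 'o"  (infixr "\<boxtimes>\<index>" 80)
  tensM :: "'m \<Rightarrow> 'm \<Rightarrow> 'm"  (infixr "\<boxtimes>\<^sub>m\<index>" 80)
  unit_obj :: "'o"  ("\<bbbone>\<index>")
  assoc :: "'o \<Rightarrow> 'o \<Rightarrow> 'o \<Rightarrow> 'm"
  lunit :: "'o \<Rightarrow> 'm"
  runit :: "'o \<Rightarrow> 'm"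
  braid :: "'o \<Rightarrow> 'o \<Rightarrow> 'm"
  susp :: "'o \<Rightarrow> 'o \<Rightarrow> 'm"  \<comment> \<open>\<open>susp a b : \<Sigma>a \<otimes> b \<rightarrow> \<Sigma>(a \<otimes> b)\<close>\<close>

locale tt_struct =
  fixes T :: "('o, 'm, 'u) tt_data" (structure)
begin

definition small :: "'a set \<Rightarrow> bool" where
  "small A \<longleftrightarrow> |A| <o |univ T|"

definition Hom :: "'o \<Rightarrow> 'o \<Rightarrow> 'm set" where
  "Hom a b = {f. src T f = a \<and> tgt T f = b}"

definition hom_group :: "'o \<Rightarrow> 'o \<Rightarrow> 'm monoid" where
  "hom_group a b = \<lparr>carrier = Hom a b, monoid.mult = (\<lambda>f g. f \<boxplus> g), one = zerom T a b\<rparr>"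

definition negm :: "'m \<Rightarrow> 'm" where
  "negm f = m_inv (hom_group (src T f) (tgt T f)) f"

definition inverse_arrows :: "'m \<Rightarrow> 'm \<Rightarrow> bool" where
  "inverse_arrows f g \<longleftrightarrow> g \<in> Hom (tgt T f) (src T f) \<and>
     g \<cdot> f = idm T (src T f) \<and> f \<cdot> g = idm T (tgt T f)"

definition iso :: "'m \<Rightarrow> bool" where
  "iso f \<longleftrightarrow> (\<exists>g. inverse_arrows f g)"

definition minv :: "'m \<Rightarrow> 'm" where
  "minv f = (THE g. inverse_arrows f g)"

definition zero_object :: "'o \<Rightarrow> bool" where
  "zero_object z \<longleftrightarrow> (\<forall>y. (\<exists>!f. f \<in> Hom z y) \<and> (\<exists>!f. f \<in> Hom y z))"

definition biproduct :: "'o \<Rightarrow> 'o \<Rightarrow> 'o \<Rightarrow> bool" where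
  "biproduct x y b \<longleftrightarrow> (\<exists>i j p q. i \<in> Hom x b \<and> j \<in> Hom y b \<and> p \<in> Hom b x \<and> q \<in> Hom b y \<and>
     p \<cdot> i = idm T x \<and> q \<cdot> j = idm T y \<and> p \<cdot> j = zerom T y x \<and> q \<cdot> i = zerom T x y \<and>
     (i \<cdot> p) \<boxplus> (j \<cdot> q) = idm T b)"

definition coproduct :: "'u set \<Rightarrow> ('u \<Rightarrow> 'o) \<Rightarrow> 'o \<Rightarrow> ('u \<Rightarrow> 'm) \<Rightarrow> bool" where
  "coproduct I X d \<iota> \<longleftrightarrow> (\<forall>i\<in>I. \<iota> i \<in> Hom (X i) d) \<and>
     (\<forall>y \<phi>. (\<forall>i\<in>I. \<phi> i \<in> Hom (X i) y) \<longrightarrow>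
        (\<exists>!g. g \<in> Hom d y \<and> (\<forall>i\<in>I. g \<cdot> \<iota> i = \<phi> i)))"

definition small_coproduct :: "'u set \<Rightarrow> ('u \<Rightarrow> 'o) \<Rightarrow> 'o \<Rightarrow> ('u \<Rightarrow> 'm) \<Rightarrow> bool" where
  "small_coproduct I X d \<iota> \<longleftrightarrow> I \<subseteq> univ T \<and> small I \<and> coproduct I X d \<iota>"

definition shO_int :: "int \<Rightarrow> 'o \<Rightarrow> 'o" where
  "shO_int n = (if 0 \<le> n then shO T ^^ nat n else inv_into UNIV (shO T) ^^ nat (- n))"

definition shM_int :: "int \<Rightarrow> 'm \<Rightarrow> 'm" where
  "shM_int n = (if 0 \<le> n then shM T ^^ nat n else inv_into UNIV (shM T) ^^ nat (- n))"

primrec susp_nat :: "nat \<Rightarrow> 'o \<Rightarrow> 'o \<Rightarrow> 'm" where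
  "susp_nat 0 a b = idm T (a \<boxtimes> b)"
| "susp_nat (Suc k) a b = shM T (susp_nat k a b) \<cdot> susp T ((shO T ^^ k) a) b"

text \<open>
  The canonical isomorphism \<open>\<Sigma>\<^sup>n a \<otimes> b \<rightarrow> \<Sigma>\<^sup>n(a \<otimes> b)\<close>; for \<open>n = - k < 0\<close> it is the inverse of
  \<open>\<Sigma>\<^sup>n\<close> applied to \<open>a \<otimes> b = \<Sigma>\<^sup>k(\<Sigma>\<^sup>n a) \<otimes> b \<rightarrow> \<Sigma>\<^sup>k(\<Sigma>\<^sup>n a \<otimes> b)\<close>.
\<close>

definition susp_int :: "int \<Rightarrow> 'o \<Rightarrow> 'o \<Rightarrow> 'm" where
  "susp_int n a b = (if 0 \<le> n then susp_nat (nat n) a b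
     else minv (shM_int n (susp_nat (nat (- n)) (shO_int n a) b)))"

definition susp_right :: "'o \<Rightarrow> 'o \<Rightarrow> 'm" where
  "susp_right a b = shM T (braid T b a) \<cdot> susp T b a \<cdot> braid T a (shO T b)"

definition rigid :: "'o \<Rightarrow> bool" where
  "rigid x \<longleftrightarrow> (\<exists>d ev coev. ev \<in> Hom (d \<boxtimes> x) \<bbbone> \<and> coev \<in> Hom \<bbbone> (x \<boxtimes> d) \<and>
     runit T x \<cdot> (idm T x \<boxtimes>\<^sub>m ev) \<cdot> assoc T x d x \<cdot> (coev \<boxtimes>\<^sub>m idm T x) = lunit T x \<and>
     lunit T d \<cdot> (ev \<boxtimes>\<^sub>m idm T d) \<cdot> minv (assoc T d x d) \<cdot> (idm T d \<boxtimes>\<^sub>m coev) = runit T d)"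

text \<open>
  An object \<open>c\<close> is compact if the canonical map
  \<open>\<Oplus>\<^sub>i Hom(c, X\<^sub>i) \<rightarrow> Hom(c, \<Coprod>\<^sub>i X\<^sub>i)\<close> is bijective for all small coproducts.
\<close>

definition compact :: "'o \<Rightarrow> bool" where
  "compact c \<longleftrightarrow> (\<forall>I X d \<iota>. small_coproduct I X d \<iota> \<longrightarrow>
     bij_betw (\<lambda>\<phi>. finprod (hom_group c d) (\<lambda>i. \<iota> i \<cdot> \<phi> i) {i \<in> I. \<phi> i \<noteq> zerom T c (X i)})
       (carrier (sum_group I (\<lambda>i. hom_group c (X i)))) (Hom c d))"

definition triangulated_sub :: "'o set \<Rightarrow> bool" where
  "triangulated_sub S \<longleftrightarrow> (\<forall>z. zero_object z \<longrightarrow> z \<in> S) \<and>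
     (\<forall>x. shO T x \<in> S \<longleftrightarrow> x \<in> S) \<and>
     (\<forall>f g h. (f, g, h) \<in> tri T \<longrightarrow> src T f \<in> S \<longrightarrow> tgt T f \<in> S \<longrightarrow> tgt T g \<in> S)"

definition thick :: "'o set \<Rightarrow> bool" where
  "thick S \<longleftrightarrow> triangulated_sub S \<and> (\<forall>x y b. biproduct x y b \<longrightarrow> b \<in> S \<longrightarrow> x \<in> S)"

definition localizing :: "'o set \<Rightarrow> bool" where
  "localizing S \<longleftrightarrow> triangulated_sub S \<and>
     (\<forall>I X d \<iota>. small_coproduct I X d \<iota> \<longrightarrow> (\<forall>i\<in>I. X i \<in> S) \<longrightarrow> d \<in> S)"

definition Loc :: "'o set \<Rightarrow> 'o set" where
  "Loc S = \<Inter>{L. localizing L \<and> S \<subseteq> L}"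

definition localization_triangle :: "'o set \<Rightarrow> 'o \<Rightarrow> 'o \<Rightarrow> 'o \<Rightarrow> bool" where
  "localization_triangle L x e f \<longleftrightarrow>
     (\<exists>u v w. (u, v, w) \<in> tri T \<and> u \<in> Hom e x \<and> v \<in> Hom x f) \<and>
     e \<in> L \<and> (\<forall>s\<in>L. Hom s f = {zerom T s f})"

end

subsection \<open>Rigidly-compactly generated tensor triangulated categories\<close>

text \<open>
  The cardinality of the universe is only required to be uncountable and regular.  If there is
  a nonzero object in a locally small category as below, then it is also a strong limit, because
  \<open>Hom(\<Coprod>\<^sub>I \<bbbone>, \<bbbone>) = \<Prod>\<^sub>I Hom(\<bbbone>, \<bbbone>)\<close> is small for small \<open>I\<close>.
\<close>

locale locally_small_category = tt_struct T for T :: "('o, 'm, 'u) tt_data" (structure) +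
  assumes uncountable_univ: "|UNIV :: nat set| <o |univ T|"
    and regular_univ: "regularCard |univ T|"
    and small_Hom: "small (Hom a b)"
    and idm_Hom: "idm T a \<in> Hom a a"
    and cmp_Hom: "\<lbrakk>f \<in> Hom a b; g \<in> Hom b c\<rbrakk> \<Longrightarrow> g \<cdot> f \<in> Hom a c"
    and cmp_idm: "f \<in> Hom a b \<Longrightarrow> f \<cdot> idm T a = f"
    and idm_cmp: "f \<in> Hom a b \<Longrightarrow> idm T b \<cdot> f = f"
    and cmp_assoc: "\<lbrakk>f \<in> Hom a b; g \<in> Hom b c; h \<in> Hom c d\<rbrakk> \<Longrightarrow> (h \<cdot> g) \<cdot> f = h \<cdot> (g \<cdot> f)"

locale additive_category = locally_small_category T for T :: "('o, 'm, 'u) tt_data" (structure) +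
  assumes hom_group: "comm_group (hom_group a b)"
    and cmp_addm: "\<lbrakk>f \<in> Hom a b; g \<in> Hom a b; h \<in> Hom b c\<rbrakk> \<Longrightarrow> h \<cdot> (f \<boxplus> g) = (h \<cdot> f) \<boxplus> (h \<cdot> g)"
    and addm_cmp: "\<lbrakk>h \<in> Hom a b; f \<in> Hom b c; g \<in> Hom b c\<rbrakk> \<Longrightarrow> (f \<boxplus> g) \<cdot> h = (f \<cdot> h) \<boxplus> (g \<cdot> h)"
    and ex_zero_object: "\<exists>z. zero_object z"
    and ex_biproduct: "\<exists>b. biproduct x y b"

locale triangulated_category = additive_category T for T :: "('o, 'm, 'u) tt_data" (structure) +
  assumes shO_bij: "bij (shO T)"
    and shM_bij: "bij (shM T)"
    and shM_Hom: "f \<in> Hom a b \<Longrightarrow> shM T f \<in> Hom (shO T a) (shO T b)"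
    and shM_idm: "shM T (idm T a) = idm T (shO T a)"
    and shM_cmp: "\<lbrakk>f \<in> Hom a b; g \<in> Hom b c\<rbrakk> \<Longrightarrow> shM T (g \<cdot> f) = shM T g \<cdot> shM T f"
    and shM_addm: "\<lbrakk>f \<in> Hom a b; g \<in> Hom a b\<rbrakk> \<Longrightarrow> shM T (f \<boxplus> g) = shM T f \<boxplus> shM T g"
    and tri_Hom: "(f, g, h) \<in> tri T \<Longrightarrow>
      tgt T f = src T g \<and> tgt T g = src T h \<and> tgt T h = shO T (src T f)"
    and tri_iso: "\<lbrakk>(f, g, h) \<in> tri T; f' \<in> Hom x' y'; g' \<in> Hom y' z'; h' \<in> Hom z' (shO T x');
      u \<in> Hom (src T f) x'; v \<in> Hom (src T g) y'; w \<in> Hom (src T h) z'; iso u; iso v; iso w;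
      v \<cdot> f = f' \<cdot> u; w \<cdot> g = g' \<cdot> v; shM T u \<cdot> h = h' \<cdot> w\<rbrakk> \<Longrightarrow> (f', g', h') \<in> tri T"
    and tri_idm: "zero_object z \<Longrightarrow> (idm T x, zerom T x z, zerom T z (shO T x)) \<in> tri T"
    and tri_complete: "\<exists>g h. (f, g, h) \<in> tri T"
    and tri_rotate: "\<lbrakk>f \<in> Hom x y; g \<in> Hom y z; h \<in> Hom z (shO T x)\<rbrakk> \<Longrightarrow>
      (f, g, h) \<in> tri T \<longleftrightarrow> (g, h, negm (shM T f)) \<in> tri T"
    and tri_morphism: "\<lbrakk>(f, g, h) \<in> tri T; (f', g', h') \<in> tri T;
      u \<in> Hom (src T f) (src T f'); v \<in> Hom (src T g) (src T g'); v \<cdot> f = f' \<cdot> u\<rbrakk> \<Longrightarrow>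
      \<exists>w \<in> Hom (src T h) (src T h'). w \<cdot> g = g' \<cdot> v \<and> shM T u \<cdot> h = h' \<cdot> w"
    and octahedral: "\<lbrakk>f \<in> Hom x y; g \<in> Hom y z;
      (f, f1, f2) \<in> tri T; (g, g1, g2) \<in> tri T; (g \<cdot> f, h1, h2) \<in> tri T\<rbrakk> \<Longrightarrow>
      \<exists>u v. (u, v, shM T f1 \<cdot> g2) \<in> tri T \<and>
        u \<in> Hom (tgt T f1) (tgt T h1) \<and> v \<in> Hom (tgt T h1) (tgt T g1) \<and>
        u \<cdot> f1 = h1 \<cdot> g \<and> h2 \<cdot> u = f2 \<and> v \<cdot> h1 = g1 \<and> g2 \<cdot> v = shM T f \<cdot> h2"

locale closed_symmetric_monoidal_category = locally_small_category T
  for T :: "('o, 'm, 'u) tt_data" (structure) +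
  assumes tensM_Hom: "\<lbrakk>f \<in> Hom a b; g \<in> Hom c d\<rbrakk> \<Longrightarrow> f \<boxtimes>\<^sub>m g \<in> Hom (a \<boxtimes> c) (b \<boxtimes> d)"
    and tensM_idm: "idm T a \<boxtimes>\<^sub>m idm T b = idm T (a \<boxtimes> b)"
    and tensM_cmp: "\<lbrakk>f \<in> Hom a b; f' \<in> Hom b c; g \<in> Hom x y; g' \<in> Hom y z\<rbrakk> \<Longrightarrow>
      (f' \<cdot> f) \<boxtimes>\<^sub>m (g' \<cdot> g) = (f' \<boxtimes>\<^sub>m g') \<cdot> (f \<boxtimes>\<^sub>m g)"
    and assoc_Hom: "assoc T a b c \<in> Hom ((a \<boxtimes> b) \<boxtimes> c) (a \<boxtimes> (b \<boxtimes> c))"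
    and assoc_iso: "iso (assoc T a b c)"
    and assoc_natural: "\<lbrakk>f \<in> Hom a a'; g \<in> Hom b b'; h \<in> Hom c c'\<rbrakk> \<Longrightarrow>
      assoc T a' b' c' \<cdot> ((f \<boxtimes>\<^sub>m g) \<boxtimes>\<^sub>m h) = (f \<boxtimes>\<^sub>m (g \<boxtimes>\<^sub>m h)) \<cdot> assoc T a b c"
    and lunit_Hom: "lunit T a \<in> Hom (\<bbbone> \<boxtimes> a) a"
    and lunit_iso: "iso (lunit T a)"
    and lunit_natural: "f \<in> Hom a b \<Longrightarrow> lunit T b \<cdot> (idm T \<bbbone> \<boxtimes>\<^sub>m f) = f \<cdot> lunit T a"
    and runit_Hom: "runit T a \<in> Hom (a \<boxtimes> \<bbbone>) a"
    and runit_iso: "iso (runit T a)"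
    and runit_natural: "f \<in> Hom a b \<Longrightarrow> runit T b \<cdot> (f \<boxtimes>\<^sub>m idm T \<bbbone>) = f \<cdot> runit T a"
    and braid_Hom: "braid T a b \<in> Hom (a \<boxtimes> b) (b \<boxtimes> a)"
    and braid_natural: "\<lbrakk>f \<in> Hom a a'; g \<in> Hom b b'\<rbrakk> \<Longrightarrow>
      braid T a' b' \<cdot> (f \<boxtimes>\<^sub>m g) = (g \<boxtimes>\<^sub>m f) \<cdot> braid T a b"
    and braid_braid: "braid T b a \<cdot> braid T a b = idm T (a \<boxtimes> b)"
    and pentagon: "assoc T a b (c \<boxtimes> d) \<cdot> assoc T (a \<boxtimes> b) c d =
      (idm T a \<boxtimes>\<^sub>m assoc T b c d) \<cdot> assoc T a (b \<boxtimes> c) d \<cdot> (assoc T a b c \<boxtimes>\<^sub>m idm T d)"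
    and unit_triangle: "(idm T a \<boxtimes>\<^sub>m lunit T b) \<cdot> assoc T a \<bbbone> b = runit T a \<boxtimes>\<^sub>m idm T b"
    and hexagon: "assoc T b c a \<cdot> braid T a (b \<boxtimes> c) \<cdot> assoc T a b c =
      (idm T b \<boxtimes>\<^sub>m braid T a c) \<cdot> assoc T b a c \<cdot> (braid T a b \<boxtimes>\<^sub>m idm T c)"
    and internal_hom: "\<exists>h ev. ev \<in> Hom (h \<boxtimes> b) c \<and>
      (\<forall>a. \<forall>f \<in> Hom (a \<boxtimes> b) c. \<exists>!g. g \<in> Hom a h \<and> ev \<cdot> (g \<boxtimes>\<^sub>m idm T b) = f)"

text \<open>
  Compatibility of the two structures: the tensor product is exact in each variable, coherently,
  and the two ways of moving both suspensions out of \<open>\<Sigma>a \<otimes> \<Sigma>b\<close> differ by a sign.  Exactness in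
  the second variable follows from that in the first by means of the symmetry.
\<close>

locale tensor_triangulated_category =
  triangulated_category T + closed_symmetric_monoidal_category T
  for T :: "('o, 'm, 'u) tt_data" (structure) +
  assumes tensM_addm: "\<lbrakk>f \<in> Hom a b; g \<in> Hom a b; h \<in> Hom c d\<rbrakk> \<Longrightarrow>
      (f \<boxplus> g) \<boxtimes>\<^sub>m h = (f \<boxtimes>\<^sub>m h) \<boxplus> (g \<boxtimes>\<^sub>m h)"
    and susp_Hom: "susp T a b \<in> Hom (shO T a \<boxtimes> b) (shO T (a \<boxtimes> b))"
    and susp_iso: "iso (susp T a b)"
    and susp_natural: "\<lbrakk>f \<in> Hom a a'; g \<in> Hom b b'\<rbrakk> \<Longrightarrow>
      susp T a' b' \<cdot> (shM T f \<boxtimes>\<^sub>m g) = shM T (f \<boxtimes>\<^sub>m g) \<cdot> susp T a b"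
    and susp_assoc: "susp T a (b \<boxtimes> c) \<cdot> assoc T (shO T a) b c =
      shM T (assoc T a b c) \<cdot> susp T (a \<boxtimes> b) c \<cdot> (susp T a b \<boxtimes>\<^sub>m idm T c)"
    and susp_runit: "shM T (runit T a) \<cdot> susp T a \<bbbone> = runit T (shO T a)"
    and tens_tri: "(f, g, h) \<in> tri T \<Longrightarrow>
      (f \<boxtimes>\<^sub>m idm T w, g \<boxtimes>\<^sub>m idm T w, susp T (src T f) w \<cdot> (h \<boxtimes>\<^sub>m idm T w)) \<in> tri T"
    and susp_sign: "shM T (susp T a b) \<cdot> susp_right (shO T a) b =
      negm (shM T (susp_right a b) \<cdot> susp T a (shO T b))"

locale rigidly_compactly_generated = tensor_triangulated_category T
  for T :: "('o, 'm, 'u) tt_data" (structure) +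
  assumes ex_coproduct: "\<lbrakk>I \<subseteq> univ T; small I\<rbrakk> \<Longrightarrow> \<exists>d \<iota>. coproduct I X d \<iota>"
    and compactly_generated: "\<exists>G. small G \<and> (\<forall>g\<in>G. compact g) \<and>
      (\<forall>t. (\<forall>g\<in>G. \<forall>n. Hom (shO_int n g) t = {zerom T (shO_int n g) t}) \<longrightarrow> zero_object t)"
    and compact_iff_rigid: "compact x \<longleftrightarrow> rigid x"

subsection \<open>Topological notions\<close>

definition thomason :: "'a topology \<Rightarrow> 'a set \<Rightarrow> bool" where
  "thomason X Y \<longleftrightarrow>
     (\<exists>C. (\<forall>Z\<in>C. closedin X Z \<and> compactin X (topspace X - Z)) \<and> Y = \<Union>C)"

definition weakly_visible :: "'a topology \<Rightarrow> 'a set \<Rightarrow> bool" where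
  "weakly_visible X W \<longleftrightarrow> (\<exists>U V. thomason X U \<and> thomason X V \<and> W = U \<inter> (topspace X - V))"

context tt_struct
begin

subsection \<open>The spectrum and the tensor triangular support\<close>

definition thick_ideal :: "'o set \<Rightarrow> bool" where
  "thick_ideal J \<longleftrightarrow> J \<subseteq> Collect compact \<and> thick J \<and> (\<forall>a x. compact a \<longrightarrow> x \<in> J \<longrightarrow> a \<boxtimes> x \<in> J)"

definition Spc :: "'o set set" where
  "Spc = {P. thick_ideal P \<and> P \<noteq> Collect compact \<and>
     (\<forall>a b. compact a \<longrightarrow> compact b \<longrightarrow> a \<boxtimes> b \<in> P \<longrightarrow> a \<in> P \<or> b \<in> P)}"

definition supp :: "'o \<Rightarrow> 'o set set" where
  "supp a = {P \<in> Spc. a \<notin> P}"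

text \<open>
  The complements of the supports are closed under finite intersections, since
  \<open>supp (a \<oplus> b) = supp a \<union> supp b\<close>, so they form a basis of this topology.
\<close>

definition Spc_top :: "'o set topology" where
  "Spc_top = topology_generated_by {Spc - supp a | a. compact a}"

definition compacts_on :: "'o set set \<Rightarrow> 'o set" where
  "compacts_on Y = {a. compact a \<and> supp a \<subseteq> Y}"

text \<open>
  The objects \<open>e\<^sub>Y\<close>, \<open>f\<^sub>Y\<close> and \<open>g\<^sub>W\<close> exist and are unique up to isomorphism; they are rendered as
  relations that hold for all their representatives.
\<close>

definition idempotent_triangle :: "'o set set \<Rightarrow> 'o \<Rightarrow> 'o \<Rightarrow> bool" where
  "idempotent_triangle Y e f \<longleftrightarrow> localization_triangle (Loc (compacts_on Y)) \<bbbone> e f"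

definition is_g :: "'o set set \<Rightarrow> 'o \<Rightarrow> bool" where
  "is_g W g \<longleftrightarrow> (\<exists>U V e\<^sub>U f\<^sub>U e\<^sub>V f\<^sub>V. thomason Spc_top U \<and> thomason Spc_top V \<and>
     W = U \<inter> (topspace Spc_top - V) \<and>
     idempotent_triangle U e\<^sub>U f\<^sub>U \<and> idempotent_triangle V e\<^sub>V f\<^sub>V \<and> g = e\<^sub>U \<boxtimes> f\<^sub>V)"

definition Supp :: "'o \<Rightarrow> 'o set set" where
  "Supp t = {P \<in> Spc. \<forall>W g. weakly_visible Spc_top W \<longrightarrow> P \<in> W \<longrightarrow> is_g W g \<longrightarrow>
     \<not> zero_object (g \<boxtimes> t)}"

subsection \<open>The graded endomorphism ring of the unit and its homogeneous spectrum\<close>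

abbreviation End_deg :: "int \<Rightarrow> 'm monoid" where
  "End_deg n \<equiv> hom_group \<bbbone> (shO_int n \<bbbone>)"

text \<open>
  Elements of the direct sum are finitely supported families.  The product of \<open>r\<close> in degree \<open>i\<close>
  and \<open>s\<close> in degree \<open>j\<close> is the composite \<open>\<Sigma>\<^sup>j r \<cdot> s : \<bbbone> \<rightarrow> \<Sigma>\<^sup>j \<bbbone> \<rightarrow> \<Sigma>\<^sup>j\<^sup>+\<^sup>i \<bbbone>\<close>.
\<close>

definition EndR :: "(int \<Rightarrow> 'm) ring" where
  "EndR = \<lparr>carrier = carrier (sum_group UNIV End_deg),
     monoid.mult = (\<lambda>r s n. finprod (End_deg n) (\<lambda>i. shM_int (n - i) (r i) \<cdot> s (n - i))
       {i. r i \<noteq> zerom T \<bbbone> (shO_int i \<bbbone>)}),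
     one = (\<lambda>n. if n = 0 then idm T \<bbbone> else zerom T \<bbbone> (shO_int n \<bbbone>)),
     zero = (\<lambda>n. zerom T \<bbbone> (shO_int n \<bbbone>)),
     add = (\<lambda>r s n. r n \<boxplus> s n)\<rparr>"

definition homog :: "int \<Rightarrow> 'm \<Rightarrow> int \<Rightarrow> 'm" where
  "homog n f = (\<lambda>i. if i = n then f else zerom T \<bbbone> (shO_int i \<bbbone>))"

definition homog_elems :: "(int \<Rightarrow> 'm) set" where
  "homog_elems = {homog n f | n f. f \<in> Hom \<bbbone> (shO_int n \<bbbone>)}"

definition homog_ideal :: "(int \<Rightarrow> 'm) set \<Rightarrow> bool" where
  "homog_ideal I \<longleftrightarrow> ideal I EndR \<and> (\<forall>r\<in>I. \<forall>n. homog n (r n) \<in> I)"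

definition Spech :: "(int \<Rightarrow> 'm) set set" where
  "Spech = {p. homog_ideal p \<and> p \<noteq> carrier EndR \<and>
     (\<forall>r\<in>homog_elems. \<forall>s\<in>homog_elems. r \<otimes>\<^bsub>EndR\<^esub> s \<in> p \<longrightarrow> r \<in> p \<or> s \<in> p)}"

definition Spech_top :: "(int \<Rightarrow> 'm) set topology" where
  "Spech_top = topology_generated_by {{p \<in> Spech. r \<notin> p} | r. r \<in> homog_elems}"

definition comparison :: "'o set \<Rightarrow> (int \<Rightarrow> 'm) set" where
  "comparison P = genideal EndR {homog n f | n f. f \<in> Hom \<bbbone> (shO_int n \<bbbone>) \<and>
     (\<exists>g h. (f, g, h) \<in> tri T \<and> tgt T g \<notin> P)}"

subsection \<open>The canonical BIK support\<close>

text \<open>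
  The map \<open>t \<rightarrow> \<Sigma>\<^sup>i t\<close> induced by \<open>r : \<bbbone> \<rightarrow> \<Sigma>\<^sup>i \<bbbone>\<close> by tensoring with \<open>t\<close>; it acts on
  \<open>m : x \<rightarrow> \<Sigma>\<^sup>n t\<close> through composition.
\<close>

definition canonical_map :: "int \<Rightarrow> 'm \<Rightarrow> 'o \<Rightarrow> 'm" where
  "canonical_map i r t =
     shM_int i (lunit T t) \<cdot> susp_int i \<bbbone> t \<cdot> (r \<boxtimes>\<^sub>m idm T t) \<cdot> minv (lunit T t)"

text \<open>
  The annihilator of a homogeneous \<open>m : x \<rightarrow> \<Sigma>\<^sup>n t\<close>: the product with \<open>r\<close> has the component
  \<open>\<Sigma>\<^sup>n(r\<^sub>i) \<cdot> m\<close> in degree \<open>n + i\<close>, so it vanishes iff all of these do.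
\<close>

definition Ann :: "'o \<Rightarrow> 'o \<Rightarrow> int \<Rightarrow> 'm \<Rightarrow> (int \<Rightarrow> 'm) set" where
  "Ann x t n m = {r \<in> carrier EndR.
     \<forall>i. shM_int n (canonical_map i (r i) t) \<cdot> m = zerom T x (shO_int (n + i) t)}"

definition weak_ass :: "'o \<Rightarrow> 'o \<Rightarrow> (int \<Rightarrow> 'm) set set" where
  "weak_ass x t = {p \<in> Spech. \<exists>n. \<exists>m \<in> Hom x (shO_int n t). Ann x t n m \<subseteq> p \<and>
     (\<forall>q \<in> Spech. Ann x t n m \<subseteq> q \<longrightarrow> q \<subseteq> p \<longrightarrow> q = p)}"

definition torsion_sub :: "(int \<Rightarrow> 'm) set set \<Rightarrow> 'o set" where
  "torsion_sub V = {t. \<forall>x. compact x \<longrightarrow> weak_ass x t \<subseteq> V}"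

definition Vset :: "(int \<Rightarrow> 'm) set \<Rightarrow> (int \<Rightarrow> 'm) set set" where
  "Vset a = {q \<in> Spech. a \<subseteq> q}"

definition Zset :: "(int \<Rightarrow> 'm) set \<Rightarrow> (int \<Rightarrow> 'm) set set" where
  "Zset p = {q \<in> Spech. \<not> q \<subseteq> p}"

definition is_Gamma :: "(int \<Rightarrow> 'm) set set \<Rightarrow> 'o \<Rightarrow> 'o \<Rightarrow> bool" where
  "is_Gamma V t g \<longleftrightarrow> (\<exists>l. localization_triangle (torsion_sub V) t g l)"

definition is_L :: "(int \<Rightarrow> 'm) set set \<Rightarrow> 'o \<Rightarrow> 'o \<Rightarrow> bool" where
  "is_L V t l \<longleftrightarrow> (\<exists>g. localization_triangle (torsion_sub V) t g l)"

definition fg_homog_ideal :: "(int \<Rightarrow> 'm) set \<Rightarrow> bool" where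
  "fg_homog_ideal a \<longleftrightarrow> homog_ideal a \<and> (\<exists>F. finite F \<and> F \<subseteq> carrier EndR \<and> a = genideal EndR F)"

definition Supp_BIK :: "'o \<Rightarrow> (int \<Rightarrow> 'm) set set" where
  "Supp_BIK t = {p \<in> Spech. \<forall>a l g. fg_homog_ideal a \<longrightarrow> a \<subseteq> p \<longrightarrow>
     is_L (Zset p) t l \<longrightarrow> is_Gamma (Vset a) l g \<longrightarrow> \<not> zero_object g}"

end

end

theory Submission
  imports Defs
begin

text \<open>
  Call \<open>\<V> \<subseteq> Spec\<^sup>h(R)\<close> good if, for \<open>Y = \<rho>\<^sup>-\<^sup>1(\<V>)\<close>, the localizing subcategory generated by the compact
  objects supported on \<open>Y\<close> is \<open>T\<^sub>\<V>\<close>; then \<open>\<Gamma>\<^sub>\<V> t = e\<^sub>Y \<otimes> t\<close> and \<open>L\<^sub>\<V> t = f\<^sub>Y \<otimes> t\<close>.  Both \<open>\<V>(\<aa>)\<close>, for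
  a finitely generated ideal, and \<open>\<Z>(\<pp>)\<close> are good.  On the one hand, compact objects supported on \<open>Y\<close>
  are \<open>\<V>\<close>-torsion: if \<open>Ann(c) \<subseteq> \<qq>\<close>, then some prime \<open>P\<close> with \<open>\<rho>(P) \<subseteq> \<qq>\<close> does not contain \<open>c\<close>, and
  then \<open>\<rho>(P) \<in> \<V>\<close> gives \<open>\<qq> \<in> \<V>\<close>.  On the other hand, torsion objects are detected by the Koszul objects on
  finitely many elements, which are supported on \<open>Y\<close>.

  Consequently \<open>\<Gamma>\<close> for \<open>\<V>(\<aa>)\<close> applied to \<open>L\<close> for \<open>\<Z>(\<pp>)\<close> is tensoring with \<open>g\<^sub>W\<close>, where \<open>W\<close> is the preimage of
  \<open>{\<qq>. \<aa> \<subseteq> \<qq> \<subseteq> \<pp>}\<close>.  Since \<open>\<rho>\<close> is a homeomorphism, these \<open>W\<close> are cofinal among the weakly visible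
  neighbourhoods of the point over \<open>\<pp>\<close>, and \<open>W' \<subseteq> W\<close> makes \<open>g\<^sub>W'\<close> a tensor multiple of \<open>g\<^sub>W\<close>.
\<close>

subsection \<open>Additive and triangulated categories\<close>

text \<open>The subcategory of torsion objects is defined by weakly associated primes, and in that
  form nothing makes it a tensor ideal or compactly generated. The way in is to rewrite membership
  as vanishing of the localizations of all graded Hom modules at every prime outside the given set.
  This is visibly a localizing condition and can be compared with compact objects, by Zorn's lemma
  on tensor ideals in one direction and by Koszul objects in the other. A second obstacle is size:
  the compact objects on Y need not form a small set. Localization triangles are therefore built
  from Koszul objects on a small set of generators. Moving cones across Hom
  (\<open>orth_cone\<close>) then makes the right orthogonal a tensor ideal, which is what turns
  \<Gamma> and L into tensor products. The action of R commutes with suspension only up to sign; as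
  only vanishing, bijectivity and membership in ideals matter, signs are absorbed in the relation
  \<open>\<doteq>\<close>. The ring axioms of \<open>EndR\<close> come with any homogeneous ideal,
  and primality of \<rho>(P) comes from the homeomorphism.\<close>

context tt_struct
begin

text \<open>As a simp rule this turns typing conditions into equations between sources and targets,
  so that composability is settled by rewriting. It is switched off where \<open>Hom\<close> should
  stay opaque.\<close>

lemma Hom_iff [simp]: "f \<in> Hom a b \<longleftrightarrow> src T f = a \<and> tgt T f = b"
  by (simp add: Hom_def)

definition isomorphic :: "'o \<Rightarrow> 'o \<Rightarrow> bool"  (infix "\<simeq>" 50) where
  "x \<simeq> y \<longleftrightarrow> (\<exists>f \<in> Hom x y. iso f)"

end

section \<open>Isomorphisms, small sets and coproducts\<close>

context locally_small_category
begin

lemma src_idm [simp]: "src T (idm T a) = a" and tgt_idm [simp]: "tgt T (idm T a) = a"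
  using idm_Hom by auto

lemma src_cmp [simp]: "src T g = tgt T f \<Longrightarrow> src T (g \<cdot> f) = src T f"
  and tgt_cmp [simp]: "src T g = tgt T f \<Longrightarrow> tgt T (g \<cdot> f) = tgt T g"
  using cmp_Hom[of f "src T f" "tgt T f" g "tgt T g"] by auto

lemma cmp_assoc' [simp]: "src T h = tgt T g \<Longrightarrow> src T g = tgt T f \<Longrightarrow> (h \<cdot> g) \<cdot> f = h \<cdot> (g \<cdot> f)"
  using cmp_assoc[of f "src T f" "tgt T f" g "tgt T g" h "tgt T h"] by simp

lemma cmp_idm' [simp]: "src T f = a \<Longrightarrow> f \<cdot> idm T a = f"
  and idm_cmp' [simp]: "tgt T f = b \<Longrightarrow> idm T b \<cdot> f = f"
  using cmp_idm[of f "src T f" "tgt T f"] idm_cmp[of f "src T f" "tgt T f"] by auto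

text \<open>Composites are normalized to the right, so an equation between composites of two arrows
  does not match inside a longer one. Here and in \<open>cmp_eq_cmp1\<close> it receives a tail
  \<open>u\<close>; most diagram chases below are chains of these two rules.\<close>

lemma cmp_eq_cmp:
  "f \<cdot> g = h \<cdot> k \<Longrightarrow> src T f = tgt T g \<Longrightarrow> src T h = tgt T k \<Longrightarrow> src T g = tgt T u \<Longrightarrow>
    src T k = tgt T u \<Longrightarrow> f \<cdot> (g \<cdot> u) = h \<cdot> (k \<cdot> u)"
  by (metis cmp_assoc')

lemma cmp_eq_cmp1:
  "f \<cdot> g = h \<Longrightarrow> src T f = tgt T g \<Longrightarrow> src T g = tgt T u \<Longrightarrow> f \<cdot> (g \<cdot> u) = h \<cdot> u"
  by (metis cmp_assoc')

lemma inverse_arrows_unique: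
  assumes "inverse_arrows f g" "inverse_arrows f h"
  shows "g = h"
proof -
  have [simp]: "src T g = tgt T f" "tgt T g = src T f" "src T h = tgt T f" "tgt T h = src T f"
    and 1: "g \<cdot> f = idm T (src T f)" "f \<cdot> h = idm T (tgt T f)"
    using assms by (auto simp: inverse_arrows_def)
  have "g = g \<cdot> (f \<cdot> h)" by (simp add: 1)
  also have "\<dots> = (g \<cdot> f) \<cdot> h" by (subst cmp_assoc') simp_all
  finally show ?thesis by (simp add: 1)
qed

lemma minv_eqI: "inverse_arrows f g \<Longrightarrow> minv f = g"
  unfolding minv_def using inverse_arrows_unique by blast

lemma inverse_arrows_minv: "iso f \<Longrightarrow> inverse_arrows f (minv f)"
  using minv_eqI by (auto simp: iso_def)

lemma src_minv [simp]: "iso f \<Longrightarrow> src T (minv f) = tgt T f"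
  and tgt_minv [simp]: "iso f \<Longrightarrow> tgt T (minv f) = src T f"
  and minv_cmp [simp]: "iso f \<Longrightarrow> minv f \<cdot> f = idm T (src T f)"
  and cmp_minv [simp]: "iso f \<Longrightarrow> f \<cdot> minv f = idm T (tgt T f)"
  using inverse_arrows_minv[of f] by (auto simp: inverse_arrows_def)

lemma minv_cmp_cmp [simp]: "iso f \<Longrightarrow> tgt T u = src T f \<Longrightarrow> minv f \<cdot> (f \<cdot> u) = u"
  using cmp_eq_cmp1[OF minv_cmp, of f u] by simp

lemma cmp_minv_cmp [simp]: "iso f \<Longrightarrow> tgt T u = tgt T f \<Longrightarrow> f \<cdot> (minv f \<cdot> u) = u"
  using cmp_eq_cmp1[OF cmp_minv, of f u] by simp

lemma isoI:
  "src T g = tgt T f \<Longrightarrow> tgt T g = src T f \<Longrightarrow> g \<cdot> f = idm T (src T f) \<Longrightarrow>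
    f \<cdot> g = idm T (tgt T f) \<Longrightarrow> iso f"
  unfolding iso_def inverse_arrows_def by auto

lemma iso_minv [simp]: "iso f \<Longrightarrow> iso (minv f)"
  by (rule isoI[of f]) auto

lemma minv_minv [simp]: "iso f \<Longrightarrow> minv (minv f) = f"
  by (rule minv_eqI) (auto simp: inverse_arrows_def)

lemma iso_idm [simp]: "iso (idm T a)"
  by (rule isoI[of "idm T a"]) auto

lemma minv_idm [simp]: "minv (idm T a) = idm T a"
  by (rule minv_eqI) (auto simp: inverse_arrows_def)

lemma iso_cmp [simp]: "iso f \<Longrightarrow> iso g \<Longrightarrow> src T g = tgt T f \<Longrightarrow> iso (g \<cdot> f)"
  by (rule isoI[of "minv f \<cdot> minv g"]) auto

lemma minv_of_cmp: "iso f \<Longrightarrow> iso g \<Longrightarrow> src T g = tgt T f \<Longrightarrow> minv (g \<cdot> f) = minv f \<cdot> minv g"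
  by (rule minv_eqI) (auto simp: inverse_arrows_def)

lemma iso_cancel_left:
  "iso h \<Longrightarrow> tgt T f = src T h \<Longrightarrow> tgt T g = src T h \<Longrightarrow> h \<cdot> f = h \<cdot> g \<longleftrightarrow> f = g"
  by (metis minv_cmp_cmp)

lemma iso_cancel_right:
  assumes "iso h" "src T f = tgt T h" "src T g = tgt T h"
  shows "f \<cdot> h = g \<cdot> h \<longleftrightarrow> f = g"
proof
  assume "f \<cdot> h = g \<cdot> h"
  then have "(f \<cdot> h) \<cdot> minv h = (g \<cdot> h) \<cdot> minv h" by simp
  then show "f = g" using assms by simp
qed simp

lemma iso_left_inverse_cmp:
  "iso h \<Longrightarrow> tgt T f = tgt T h \<Longrightarrow> tgt T g = src T h \<Longrightarrow> minv h \<cdot> f = g \<longleftrightarrow> f = h \<cdot> g"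
  by (metis minv_cmp_cmp cmp_minv_cmp)

lemma isomorphic_refl [simp]: "x \<simeq> x"
  unfolding isomorphic_def by (rule bexI[of _ "idm T x"]) auto

lemma isomorphic_sym: "x \<simeq> y \<Longrightarrow> y \<simeq> x"
  unfolding isomorphic_def by (metis Hom_iff iso_minv src_minv tgt_minv)

lemma isomorphic_trans [trans]: "x \<simeq> y \<Longrightarrow> y \<simeq> z \<Longrightarrow> x \<simeq> z"
  unfolding isomorphic_def by (metis Hom_iff iso_cmp src_cmp tgt_cmp)

lemma isomorphicI: "iso f \<Longrightarrow> src T f = x \<Longrightarrow> tgt T f = y \<Longrightarrow> x \<simeq> y"
  unfolding isomorphic_def by auto

text \<open>An infinite regular cardinal is stable: a small family of small sets has a small
  disjoint union. Infinity comes from the uncountability of the universe.\<close>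

lemma stable_univ: "stable |univ T|"
proof (rule regularCard_stable)
  have "infinite (univ T)"
    using uncountable_univ card_of_ordLeq_infinite infinite_UNIV_nat ordLess_imp_ordLeq by blast
  then show "\<not> finite (Field ( |univ T| ))" by (simp add: Field_card_of)
qed (simp_all add: regular_univ card_of_Card_order)

lemma small_subset: "small B \<Longrightarrow> A \<subseteq> B \<Longrightarrow> small A"
  unfolding small_def using card_of_mono1 ordLeq_ordLess_trans by blast

lemma small_image: "small A \<Longrightarrow> small (f ` A)"
  unfolding small_def using card_of_image ordLeq_ordLess_trans by blast

lemma small_Sigma: "small A \<Longrightarrow> (\<And>a. a \<in> A \<Longrightarrow> small (B a)) \<Longrightarrow> small (Sigma A B)"
  unfolding small_def by (rule stable_elim[OF stable_univ])

lemma small_nat: "small (A :: nat set)"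
  using small_subset[of "UNIV :: nat set"] uncountable_univ by (auto simp: small_def)

lemma small_countable: "countable A \<Longrightarrow> small A"
  using small_image[OF small_nat[of "to_nat_on A ` A"], of "from_nat_into A"]
  by (simp add: image_comp)

text \<open>Coproducts are given only for index sets inside \<open>univ\<close>; families over other
  small sets, such as sets of arrows, are transported along this bijection.\<close>

lemma small_reindex:
  assumes "small A"
  obtains I h where "I \<subseteq> univ T" "small I" "bij_betw h I A"
proof -
  have "|A| \<le>o |univ T|" using assms ordLess_imp_ordLeq unfolding small_def by blast
  then obtain k where k: "inj_on k A" "k ` A \<subseteq> univ T" by (metis card_of_ordLeq)
  have "bij_betw (inv_into A k) (k ` A) A" by (simp add: bij_betw_inv_into inj_on_imp_bij_betw k)
  then show ?thesis using that k small_image[OF assms] by blast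
qed

lemma coproduct_Hom: "coproduct I X d \<iota> \<Longrightarrow> i \<in> I \<Longrightarrow> src T (\<iota> i) = X i \<and> tgt T (\<iota> i) = d"
  by (auto simp: coproduct_def)

lemma coproduct_ex:
  "coproduct I X d \<iota> \<Longrightarrow> (\<And>i. i \<in> I \<Longrightarrow> \<phi> i \<in> Hom (X i) y) \<Longrightarrow>
    \<exists>g. g \<in> Hom d y \<and> (\<forall>i\<in>I. g \<cdot> \<iota> i = \<phi> i)"
  unfolding coproduct_def by metis

lemma coproduct_eqI:
  assumes "coproduct I X d \<iota>" "g \<in> Hom d y" "g' \<in> Hom d y" "\<And>i. i \<in> I \<Longrightarrow> g \<cdot> \<iota> i = g' \<cdot> \<iota> i"
  shows "g = g'"
proof -
  have "\<forall>i\<in>I. g' \<cdot> \<iota> i \<in> Hom (X i) y" using assms by (auto simp: coproduct_def)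
  then have "\<exists>!k. k \<in> Hom d y \<and> (\<forall>i\<in>I. k \<cdot> \<iota> i = g' \<cdot> \<iota> i)"
    using assms(1)[unfolded coproduct_def, THEN conjunct2, rule_format, of "\<lambda>i. g' \<cdot> \<iota> i" y] by blast
  then show ?thesis using assms(2-4) by blast
qed

end

section \<open>Zero arrows, zero objects and finite sums of arrows\<close>

context additive_category
begin

lemma addm_Hom: "f \<in> Hom a b \<Longrightarrow> g \<in> Hom a b \<Longrightarrow> f \<boxplus> g \<in> Hom a b"
proof -
  interpret comm_group "hom_group a b" by (rule hom_group)
  show "f \<in> Hom a b \<Longrightarrow> g \<in> Hom a b \<Longrightarrow> f \<boxplus> g \<in> Hom a b" using m_closed[of f g] by (simp add: hom_group_def)
qed

lemma src_addm [simp]: "src T g = src T f \<Longrightarrow> tgt T g = tgt T f \<Longrightarrow> src T (f \<boxplus> g) = src T f"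
  and tgt_addm [simp]: "src T g = src T f \<Longrightarrow> tgt T g = tgt T f \<Longrightarrow> tgt T (f \<boxplus> g) = tgt T f"
  using addm_Hom[of f "src T f" "tgt T f" g] by auto

lemma src_zerom [simp]: "src T (zerom T a b) = a" and tgt_zerom [simp]: "tgt T (zerom T a b) = b"
proof -
  interpret comm_group "hom_group a b" by (rule hom_group)
  show "src T (zerom T a b) = a" "tgt T (zerom T a b) = b" using one_closed by (auto simp: hom_group_def)
qed

lemma addm_assoc [simp]:
  assumes "src T f = src T g" "src T h = src T g" "tgt T f = tgt T g" "tgt T h = tgt T g"
  shows "(f \<boxplus> g) \<boxplus> h = f \<boxplus> (g \<boxplus> h)"
proof -
  interpret comm_group "hom_group (src T g) (tgt T g)" by (rule hom_group)
  show ?thesis using m_assoc[of f g h] assms by (simp add: hom_group_def)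
qed

lemma addm_comm:
  assumes "src T f = src T g" "tgt T f = tgt T g"
  shows "f \<boxplus> g = g \<boxplus> f"
proof -
  interpret comm_group "hom_group (src T g) (tgt T g)" by (rule hom_group)
  show ?thesis using m_comm[of f g] assms by (simp add: hom_group_def)
qed

lemma addm_zerom [simp]: "src T f = a \<Longrightarrow> tgt T f = b \<Longrightarrow> f \<boxplus> zerom T a b = f"
  and zerom_addm [simp]: "src T f = a \<Longrightarrow> tgt T f = b \<Longrightarrow> zerom T a b \<boxplus> f = f"
proof -
  interpret comm_group "hom_group a b" by (rule hom_group)
  show "src T f = a \<Longrightarrow> tgt T f = b \<Longrightarrow> f \<boxplus> zerom T a b = f"
    using r_one[of f] by (simp add: hom_group_def)
  show "src T f = a \<Longrightarrow> tgt T f = b \<Longrightarrow> zerom T a b \<boxplus> f = f"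
    using l_one[of f] by (simp add: hom_group_def)
qed

lemma src_negm [simp]: "src T (negm f) = src T f" and tgt_negm [simp]: "tgt T (negm f) = tgt T f"
  and addm_negm [simp]: "f \<boxplus> negm f = zerom T (src T f) (tgt T f)"
  and negm_addm [simp]: "negm f \<boxplus> f = zerom T (src T f) (tgt T f)"
proof -
  interpret comm_group "hom_group (src T f) (tgt T f)" by (rule hom_group)
  have f: "f \<in> carrier (hom_group (src T f) (tgt T f))" by (simp add: hom_group_def)
  show "src T (negm f) = src T f" "tgt T (negm f) = tgt T f"
    using inv_closed[OF f] by (auto simp: hom_group_def negm_def)
  show "f \<boxplus> negm f = zerom T (src T f) (tgt T f)"
    using r_inv[OF f] by (auto simp: hom_group_def negm_def)
  show "negm f \<boxplus> f = zerom T (src T f) (tgt T f)"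
    using l_inv[OF f] by (auto simp: hom_group_def negm_def)
qed

lemma addm_cancel_left:
  assumes "src T f = src T h" "tgt T f = tgt T h" "src T g = src T h" "tgt T g = tgt T h"
  shows "h \<boxplus> f = h \<boxplus> g \<longleftrightarrow> f = g"
proof
  assume "h \<boxplus> f = h \<boxplus> g"
  then have "(negm h \<boxplus> h) \<boxplus> f = (negm h \<boxplus> h) \<boxplus> g" using assms by (simp del: negm_addm)
  then show "f = g" using assms by simp
qed simp

lemma negm_eqI: "f \<boxplus> g = zerom T (src T f) (tgt T f) \<Longrightarrow> src T g = src T f \<Longrightarrow> tgt T g = tgt T f \<Longrightarrow> negm f = g"
  using addm_cancel_left[of "negm f" f g] by simp

lemma negm_negm [simp]: "negm (negm f) = f"
  by (rule negm_eqI) auto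

lemma negm_zerom [simp]: "negm (zerom T a b) = zerom T a b"
  by (rule negm_eqI) auto

lemma addm_negm_eq_zero:
  "src T g = src T f \<Longrightarrow> tgt T g = tgt T f \<Longrightarrow> f \<boxplus> negm g = zerom T (src T f) (tgt T f) \<longleftrightarrow> f = g"
  by (metis negm_eqI negm_negm addm_negm src_negm tgt_negm)

lemma cmp_addm' : "src T f = src T g \<Longrightarrow> tgt T f = tgt T g \<Longrightarrow> src T h = tgt T g \<Longrightarrow>
    h \<cdot> (f \<boxplus> g) = (h \<cdot> f) \<boxplus> (h \<cdot> g)"
  using cmp_addm[of f "src T f" "tgt T f" g h "tgt T h"] by simp

lemma addm_cmp' : "src T f = src T g \<Longrightarrow> tgt T f = tgt T g \<Longrightarrow> tgt T h = src T g \<Longrightarrow>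
    (f \<boxplus> g) \<cdot> h = (f \<cdot> h) \<boxplus> (g \<cdot> h)"
  using addm_cmp[of h "src T h" "tgt T h" f "tgt T f" g] by simp

lemma cmp_zerom [simp]: "src T h = b \<Longrightarrow> h \<cdot> zerom T a b = zerom T a (tgt T h)"
proof -
  assume h: "src T h = b"
  let ?z = "h \<cdot> zerom T a b"
  have "?z \<boxplus> ?z = ?z \<boxplus> zerom T a (tgt T h)"
    using h by (simp flip: cmp_addm')
  then show ?thesis using h addm_cancel_left[of ?z ?z "zerom T a (tgt T h)"] by simp
qed

lemma zerom_cmp [simp]: "tgt T h = a \<Longrightarrow> zerom T a b \<cdot> h = zerom T (src T h) b"
proof -
  assume h: "tgt T h = a"
  let ?z = "zerom T a b \<cdot> h"
  have "?z \<boxplus> ?z = ?z \<boxplus> zerom T (src T h) b"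
    using h by (simp flip: addm_cmp')
  then show ?thesis using h addm_cancel_left[of ?z ?z "zerom T (src T h) b"] by simp
qed

lemma cmp_negm [simp]: "src T h = tgt T f \<Longrightarrow> h \<cdot> negm f = negm (h \<cdot> f)"
  by (rule negm_eqI[symmetric]) (auto simp flip: cmp_addm')

lemma negm_cmp [simp]: "tgt T h = src T f \<Longrightarrow> negm f \<cdot> h = negm (f \<cdot> h)"
  by (rule negm_eqI[symmetric]) (auto simp flip: addm_cmp')

lemma negm_eq_zerom [simp]: "negm f = zerom T a b \<longleftrightarrow> f = zerom T a b"
  by (metis negm_negm negm_zerom)

lemma negm_inject [simp]: "negm f = negm g \<longleftrightarrow> f = g"
  by (metis negm_negm)

lemma iso_cmp_eq_zerom:
  "iso h \<Longrightarrow> tgt T f = src T h \<Longrightarrow> a = src T f \<Longrightarrow> b = tgt T h \<Longrightarrow>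
    h \<cdot> f = zerom T a b \<longleftrightarrow> f = zerom T (src T f) (tgt T f)"
  using iso_cancel_left[of h f "zerom T (src T f) (tgt T f)"] by simp

lemma cmp_iso_eq_zerom:
  "iso h \<Longrightarrow> src T f = tgt T h \<Longrightarrow> a = src T h \<Longrightarrow> b = tgt T f \<Longrightarrow>
    f \<cdot> h = zerom T a b \<longleftrightarrow> f = zerom T (src T f) (tgt T f)"
  using iso_cancel_right[of h f "zerom T (src T f) (tgt T f)"] by simp

lemma zero_object_iff: "zero_object z \<longleftrightarrow> idm T z = zerom T z z"
proof
  assume "zero_object z"
  then have "\<exists>!f. f \<in> Hom z z" by (simp add: zero_object_def)
  then show "idm T z = zerom T z z" by (metis Hom_iff src_idm src_zerom tgt_idm tgt_zerom)
next
  assume *: "idm T z = zerom T z z"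
  have "f = zerom T z y" if "f \<in> Hom z y" for f y
    using that cmp_idm'[of f z] unfolding * by simp
  moreover have "f = zerom T y z" if "f \<in> Hom y z" for f y
    using that idm_cmp'[of f z] unfolding * by simp
  ultimately show "zero_object z"
    unfolding zero_object_def by (metis Hom_iff src_zerom tgt_zerom)
qed

lemma zero_object_from: "zero_object z \<Longrightarrow> src T f = z \<Longrightarrow> f = zerom T z (tgt T f)"
  by (metis zero_object_iff cmp_idm' cmp_zerom)

lemma zero_object_to: "zero_object z \<Longrightarrow> tgt T f = z \<Longrightarrow> f = zerom T (src T f) z"
  by (metis zero_object_iff idm_cmp' zerom_cmp)

lemma zero_object_isomorphic: "x \<simeq> y \<Longrightarrow> zero_object x \<Longrightarrow> zero_object y"
proof -
  assume "x \<simeq> y" and z: "zero_object x"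
  then obtain f where f: "src T f = x" "tgt T f = y" "iso f" by (auto simp: isomorphic_def)
  have "idm T y = f \<cdot> minv f" using f by simp
  also have "\<dots> = zerom T y y" using zero_object_from[OF z f(1)] f by (metis src_minv tgt_minv zerom_cmp)
  finally show ?thesis by (simp add: zero_object_iff)
qed

text \<open>The universal property applied to Kronecker data: zero arrows provide projections, which
  later read off the components of an arrow into a coproduct.\<close>

lemma coproduct_proj:
  assumes c: "coproduct I X d \<iota>"
  shows "\<exists>\<pi>. \<forall>i\<in>I. \<pi> i \<in> Hom d (X i) \<and> \<pi> i \<cdot> \<iota> i = idm T (X i) \<and>
    (\<forall>j\<in>I. j \<noteq> i \<longrightarrow> \<pi> i \<cdot> \<iota> j = zerom T (X j) (X i))"
proof -
  have "\<exists>p. p \<in> Hom d (X i) \<and> (\<forall>j\<in>I. p \<cdot> \<iota> j = (if j = i then idm T (X i) else zerom T (X j) (X i)))" for i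
    by (rule coproduct_ex[OF c]) auto
  then obtain \<pi> where "\<forall>i. \<pi> i \<in> Hom d (X i) \<and> (\<forall>j\<in>I. \<pi> i \<cdot> \<iota> j = (if j = i then idm T (X i) else zerom T (X j) (X i)))"
    by metis
  then show ?thesis by (intro exI[of _ \<pi>]) auto
qed

text \<open>The hom groups are written multiplicatively, so a finite sum of arrows is a
  \<open>finprod\<close>.\<close>

abbreviation msum :: "'o \<Rightarrow> 'o \<Rightarrow> ('i \<Rightarrow> 'm) \<Rightarrow> 'i set \<Rightarrow> 'm" where
  "msum a b \<phi> A \<equiv> finprod (hom_group a b) \<phi> A"

lemma msum_Hom: "(\<And>i. i \<in> A \<Longrightarrow> \<phi> i \<in> Hom a b) \<Longrightarrow> msum a b \<phi> A \<in> Hom a b"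
proof -
  interpret comm_group "hom_group a b" by (rule hom_group)
  show "(\<And>i. i \<in> A \<Longrightarrow> \<phi> i \<in> Hom a b) \<Longrightarrow> msum a b \<phi> A \<in> Hom a b"
    using finprod_closed[of \<phi> A] by (auto simp: hom_group_def Pi_def)
qed

lemma msum_empty [simp]: "msum a b \<phi> {} = zerom T a b"
proof -
  interpret comm_group "hom_group a b" by (rule hom_group)
  show ?thesis using finprod_empty by (simp add: hom_group_def)
qed

lemma msum_insert:
  assumes "finite A" "i \<notin> A" "\<And>j. j \<in> insert i A \<Longrightarrow> \<phi> j \<in> Hom a b"
  shows "msum a b \<phi> (insert i A) = \<phi> i \<boxplus> msum a b \<phi> A"
proof -
  interpret comm_group "hom_group a b" by (rule hom_group)
  show ?thesis using finprod_insert[of A i \<phi>] assms by (simp add: hom_group_def Pi_def)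
qed

lemma msum_cong:
  assumes "\<And>i. i \<in> A \<Longrightarrow> \<phi> i = \<psi> i" "\<And>i. i \<in> A \<Longrightarrow> \<psi> i \<in> Hom a b"
  shows "msum a b \<phi> A = msum a b \<psi> A"
proof -
  interpret comm_group "hom_group a b" by (rule hom_group)
  show ?thesis by (rule finprod_cong') (use assms in \<open>auto simp: hom_group_def\<close>)
qed

lemma cmp_msum:
  assumes "finite A" "\<And>i. i \<in> A \<Longrightarrow> \<phi> i \<in> Hom a b" "h \<in> Hom b c"
  shows "h \<cdot> msum a b \<phi> A = msum a c (\<lambda>i. h \<cdot> \<phi> i) A"
  using assms
proof (induction A rule: finite_induct)
  case (insert i A)
  have 1: "msum a b \<phi> A \<in> Hom a b" by (rule msum_Hom) (use insert in auto)
  have 2: "msum a b \<phi> (insert i A) = \<phi> i \<boxplus> msum a b \<phi> A"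
    "msum a c (\<lambda>i. h \<cdot> \<phi> i) (insert i A) = h \<cdot> \<phi> i \<boxplus> msum a c (\<lambda>i. h \<cdot> \<phi> i) A"
    by (rule msum_insert; use insert in auto)+
  show ?case unfolding 2 using insert 1 by (simp add: cmp_addm')
qed simp

lemma msum_cmp:
  assumes "finite A" "\<And>i. i \<in> A \<Longrightarrow> \<phi> i \<in> Hom b c" "h \<in> Hom a b"
  shows "msum b c \<phi> A \<cdot> h = msum a c (\<lambda>i. \<phi> i \<cdot> h) A"
  using assms
proof (induction A rule: finite_induct)
  case (insert i A)
  have 1: "msum b c \<phi> A \<in> Hom b c" by (rule msum_Hom) (use insert in auto)
  have 2: "msum b c \<phi> (insert i A) = \<phi> i \<boxplus> msum b c \<phi> A"
    "msum a c (\<lambda>i. \<phi> i \<cdot> h) (insert i A) = \<phi> i \<cdot> h \<boxplus> msum a c (\<lambda>i. \<phi> i \<cdot> h) A"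
    by (rule msum_insert; use insert in auto)+
  show ?case unfolding 2 using insert 1 by (simp add: addm_cmp')
qed simp

lemma msum_mono_neutral:
  assumes "finite B" "A \<subseteq> B" "\<And>i. i \<in> B - A \<Longrightarrow> \<phi> i = zerom T a b" "\<And>i. i \<in> B \<Longrightarrow> \<phi> i \<in> Hom a b"
  shows "msum a b \<phi> A = msum a b \<phi> B"
proof -
  interpret comm_group "hom_group a b" by (rule hom_group)
  show ?thesis by (rule finprod_mono_neutral_cong_left) (use assms in \<open>auto simp: hom_group_def\<close>)
qed

lemma msum_delta:
  assumes "finite A" "j \<in> A" "f \<in> Hom a b" "\<And>i. i \<in> A \<Longrightarrow> \<phi> i = (if i = j then f else zerom T a b)"
  shows "msum a b \<phi> A = f"
proof -
  have "msum a b \<phi> {j} = msum a b \<phi> A"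
    by (rule msum_mono_neutral) (use assms in auto)
  moreover have "msum a b \<phi> {j} = f"
    using msum_insert[of "{}" j \<phi> a b] assms by simp
  ultimately show ?thesis by simp
qed

lemma msum_add:
  assumes "finite A" "\<And>i. i \<in> A \<Longrightarrow> \<phi> i \<in> Hom a b" "\<And>i. i \<in> A \<Longrightarrow> \<psi> i \<in> Hom a b"
  shows "msum a b (\<lambda>i. \<phi> i \<boxplus> \<psi> i) A = msum a b \<phi> A \<boxplus> msum a b \<psi> A"
proof -
  interpret comm_group "hom_group a b" by (rule hom_group)
  show ?thesis using finprod_multf[of \<phi> A \<psi>] assms by (auto simp: hom_group_def)
qed

end

text \<open>Because the suspension is invertible, a statement about its n-th power is usually
  equivalent to the one about the next power. A single equivalence then replaces separate inductions
  upwards and downwards.\<close>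

lemma int_equiv_induct:
  assumes "P 0" "\<And>i::int. P i \<longleftrightarrow> P (i + 1)"
  shows "P n"
proof (induction n rule: int_induct[where k = 0])
  case (step2 i)
  then show ?case using assms(2)[of "i - 1"] by simp
qed (use assms in auto)

text \<open>The common form of \<open>shO_int\<close> and \<open>shM_int\<close>, so that the laws
  of integer powers are proved once for an arbitrary bijection.\<close>

definition zpow :: "('a \<Rightarrow> 'a) \<Rightarrow> int \<Rightarrow> 'a \<Rightarrow> 'a" where
  "zpow f n = (if 0 \<le> n then f ^^ nat n else inv_into UNIV f ^^ nat (- n))"

lemma zpow_0 [simp]: "zpow f 0 x = x"
  by (simp add: zpow_def)

lemma zpow_Suc:
  assumes "bij f"
  shows "zpow f (n + 1) x = f (zpow f n x)"
proof (cases "0 \<le> n")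
  case True
  then show ?thesis by (simp add: zpow_def nat_add_distrib)
next
  case False
  then obtain k where k: "nat (- n) = Suc k" by (cases "nat (- n)") auto
  then have n: "n = - int (Suc k)" using False by simp
  show ?thesis
    unfolding zpow_def n using assms by (cases k) (simp_all add: surj_f_inv_f bij_is_surj nat_add_distrib)
qed

lemma zpow_add:
  assumes "bij f"
  shows "zpow f m (zpow f n x) = zpow f (m + n) x"
proof (induction m rule: int_equiv_induct)
  case (2 i)
  have "zpow f (i + 1) (zpow f n x) = f (zpow f i (zpow f n x))" "zpow f (i + 1 + n) x = f (zpow f (i + n) x)"
    using zpow_Suc[OF assms, of i] zpow_Suc[OF assms, of "i + n" x] by (auto simp: ac_simps)
  then show ?case using bij_is_inj[OF assms] by (auto simp: inj_eq)
qed simp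

section \<open>The suspension and its powers\<close>

context triangulated_category
begin

lemma src_shM [simp]: "src T (shM T f) = shO T (src T f)" and tgt_shM [simp]: "tgt T (shM T f) = shO T (tgt T f)"
  using shM_Hom[of f "src T f" "tgt T f"] by auto

lemma shM_cmp': "src T g = tgt T f \<Longrightarrow> shM T (g \<cdot> f) = shM T g \<cdot> shM T f"
  using shM_cmp[of f "src T f" "tgt T f" g "tgt T g"] by simp

lemma shM_addm': "src T g = src T f \<Longrightarrow> tgt T g = tgt T f \<Longrightarrow> shM T (f \<boxplus> g) = shM T f \<boxplus> shM T g"
  using shM_addm[of f "src T f" "tgt T f" g] by simp

lemma shM_inject [simp]: "shM T f = shM T g \<longleftrightarrow> f = g"
  using shM_bij by (auto simp: bij_def inj_eq)

lemma shO_inject [simp]: "shO T x = shO T y \<longleftrightarrow> x = y"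
  using shO_bij by (auto simp: bij_def inj_eq)

lemma shM_surj: "\<exists>g. f = shM T g"
  using shM_bij by (metis bij_pointE)

declare shM_idm [simp]

lemma shM_zerom [simp]: "shM T (zerom T a b) = zerom T (shO T a) (shO T b)"
proof -
  let ?z = "shM T (zerom T a b)"
  have "?z \<boxplus> ?z = ?z \<boxplus> zerom T (shO T a) (shO T b)" by (simp flip: shM_addm')
  then show ?thesis using addm_cancel_left[of ?z ?z "zerom T (shO T a) (shO T b)"] by simp
qed

lemma shM_negm [simp]: "shM T (negm f) = negm (shM T f)"
  by (rule negm_eqI[symmetric]) (auto simp flip: shM_addm')

lemma shM_eq_zerom [simp]: "shM T f = zerom T (shO T a) (shO T b) \<longleftrightarrow> f = zerom T a b"
  by (metis shM_inject shM_zerom)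

lemma iso_shM [simp]: "iso (shM T f) \<longleftrightarrow> iso f"
proof
  assume i: "iso (shM T f)"
  obtain g where g: "minv (shM T f) = shM T g" using shM_surj by blast
  then have [simp]: "src T g = tgt T f" "tgt T g = src T f" using i by (metis shO_inject src_minv tgt_minv src_shM tgt_shM)+
  have "shM T (g \<cdot> f) = shM T (idm T (src T f))" "shM T (f \<cdot> g) = shM T (idm T (tgt T f))"
    using i by (simp_all add: shM_cmp' del: shM_inject flip: g)
  then show "iso f" by (intro isoI[of g]) (simp_all only: shM_inject, simp_all)
next
  assume "iso f"
  then show "iso (shM T f)"
    by (intro isoI[of "shM T (minv f)"]) (auto simp del: shM_inject simp flip: shM_cmp')
qed

lemma shM_minv: "iso f \<Longrightarrow> shM T (minv f) = minv (shM T f)"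
  by (rule minv_eqI[symmetric]) (auto simp: inverse_arrows_def simp flip: shM_cmp')

lemma shO_int_zpow: "shO_int n = zpow (shO T) n" and shM_int_zpow: "shM_int n = zpow (shM T) n"
  by (simp_all add: shO_int_def shM_int_def zpow_def)

lemma shO_int_0 [simp]: "shO_int 0 x = x" and shM_int_0 [simp]: "shM_int 0 f = f"
  by (simp_all add: shO_int_zpow shM_int_zpow)

lemma shO_shO_int [simp]: "shO T (shO_int n x) = shO_int (n + 1) x"
  and shM_shM_int [simp]: "shM T (shM_int n f) = shM_int (n + 1) f"
  by (simp_all add: shO_int_zpow shM_int_zpow zpow_Suc shO_bij shM_bij)

lemma shO_int_add [simp]: "shO_int m (shO_int n x) = shO_int (m + n) x"
  and shM_int_add [simp]: "shM_int m (shM_int n f) = shM_int (m + n) f"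
  by (simp_all add: shO_int_zpow shM_int_zpow zpow_add shO_bij shM_bij)

lemma shO_int_1: "shO_int 1 x = shO T x" and shM_int_1: "shM_int 1 f = shM T f"
  using shO_shO_int[of 0 x] shM_shM_int[of 0 f] by simp_all

lemma shO_int_shO [simp]: "shO_int n (shO T x) = shO_int (n + 1) x"
  and shM_int_shM [simp]: "shM_int n (shM T f) = shM_int (n + 1) f"
  by (simp_all flip: shO_int_1 shM_int_1)

lemma src_shM_int [simp]: "src T (shM_int n f) = shO_int n (src T f)"
  and tgt_shM_int [simp]: "tgt T (shM_int n f) = shO_int n (tgt T f)"
proof -
  have "src T (shM_int n f) = shO_int n (src T f) \<and> tgt T (shM_int n f) = shO_int n (tgt T f)"
    by (induction n rule: int_equiv_induct) (simp_all flip: shO_shO_int shM_shM_int)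
  then show "src T (shM_int n f) = shO_int n (src T f)" "tgt T (shM_int n f) = shO_int n (tgt T f)" by auto
qed

lemma shM_int_cmp: "src T g = tgt T f \<Longrightarrow> shM_int n (g \<cdot> f) = shM_int n g \<cdot> shM_int n f"
  by (induction n rule: int_equiv_induct) (simp_all add: shM_cmp'[symmetric] flip: shM_shM_int)

lemma shM_int_addm:
  "src T g = src T f \<Longrightarrow> tgt T g = tgt T f \<Longrightarrow> shM_int n (f \<boxplus> g) = shM_int n f \<boxplus> shM_int n g"
  by (induction n rule: int_equiv_induct) (simp_all add: shM_addm'[symmetric] flip: shM_shM_int)

lemma shM_int_inject [simp]: "shM_int n f = shM_int n g \<longleftrightarrow> f = g"
  by (metis shM_int_add shM_int_0 add.left_inverse)

lemma shO_int_inject [simp]: "shO_int n x = shO_int n y \<longleftrightarrow> x = y"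
  by (metis shO_int_add shO_int_0 add.left_inverse)

lemma shM_int_idm [simp]: "shM_int n (idm T a) = idm T (shO_int n a)"
  by (induction n rule: int_equiv_induct) (simp_all add: shM_idm[symmetric] del: shM_idm flip: shM_shM_int shO_shO_int)

lemma shM_int_zerom [simp]: "shM_int n (zerom T a b) = zerom T (shO_int n a) (shO_int n b)"
  by (induction n rule: int_equiv_induct)
    (simp_all add: shM_zerom[symmetric] del: shM_zerom shM_eq_zerom flip: shM_shM_int shO_shO_int)

lemma shM_int_negm [simp]: "shM_int n (negm f) = negm (shM_int n f)"
  by (induction n rule: int_equiv_induct) (simp_all add: shM_negm[symmetric] del: shM_negm flip: shM_shM_int)

lemma iso_shM_int [simp]: "iso (shM_int n f) \<longleftrightarrow> iso f"
  by (induction n rule: int_equiv_induct) (simp_all flip: shM_shM_int)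

lemma shM_int_eq_zerom:
  "a = shO_int n (src T f) \<Longrightarrow> b = shO_int n (tgt T f) \<Longrightarrow>
    shM_int n f = zerom T a b \<longleftrightarrow> f = zerom T (src T f) (tgt T f)"
  by (metis shM_int_inject shM_int_zerom)

lemma zero_object_shO [simp]: "zero_object (shO T z) \<longleftrightarrow> zero_object z"
  by (simp add: zero_object_iff flip: shM_idm shM_zerom del: shM_eq_zerom)

lemma zero_object_shO_int [simp]: "zero_object (shO_int n z) \<longleftrightarrow> zero_object z"
  by (induction n rule: int_equiv_induct) (simp_all flip: shO_shO_int)

section \<open>Exactness of triangles, the five lemma and retracts\<close>

lemma tri_typed:
  assumes "(f, g, h) \<in> tri T"
  shows "src T g = tgt T f" "src T h = tgt T g" "tgt T h = shO T (src T f)"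
  using tri_Hom[OF assms] by auto

lemma tri_rotated: "(f, g, h) \<in> tri T \<Longrightarrow> (g, h, negm (shM T f)) \<in> tri T"
  using tri_rotate[of f "src T f" "tgt T f" g "tgt T g" h] tri_typed[of f g h] by simp

lemma tri_zerom_idm: "zero_object z \<Longrightarrow> (zerom T z w, idm T w, zerom T w (shO T z)) \<in> tri T"
  using tri_rotate[of "zerom T z w" z w "idm T w" w "zerom T w (shO T z)"] tri_idm[of "shO T z" w] by simp

text \<open>The triangle x = x \<rightarrow> 0 maps to the given one by the identity and
  \<open>f\<close>; the third component shows that \<open>g \<cdot> f\<close> factors over a zero
  object.\<close>

lemma tri_cmp_zero1:
  assumes t: "(f, g, h) \<in> tri T"
  shows "g \<cdot> f = zerom T (src T f) (tgt T g)"
proof -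
  note [simp] = tri_typed[OF t]
  obtain z where z: "zero_object z" using ex_zero_object by blast
  have "\<exists>w\<in>Hom (src T (zerom T z (shO T (src T f)))) (src T h).
      w \<cdot> zerom T (src T f) z = g \<cdot> f \<and> shM T (idm T (src T f)) \<cdot> zerom T z (shO T (src T f)) = h \<cdot> w"
    by (rule tri_morphism[OF tri_idm[OF z, of "src T f"] t]) auto
  then show ?thesis by auto
qed

lemma tri_cmp_zero3: "(f, g, h) \<in> tri T \<Longrightarrow> shM T f \<cdot> h = zerom T (tgt T g) (shO T (tgt T f))"
  using tri_cmp_zero1[OF tri_rotated[OF tri_rotated], of f g h] tri_typed[of f g h] by simp

text \<open>Exactness of Hom into an object w: an arrow that kills \<open>f\<close> is part of a
  morphism to the triangle 0 \<rightarrow> w = w, and its third component is the extension. The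
  names \<open>a\<close>, \<open>b\<close> for the ends of the zero arrow let the premise match in
  whatever form simplification leaves it.\<close>

lemma tri_weak_cokernel:
  assumes t: "(f, g, h) \<in> tri T" and m: "src T m = tgt T f" "m \<cdot> f = zerom T a b"
    and ab: "a = src T f" "b = tgt T m"
  shows "\<exists>n. src T n = tgt T g \<and> tgt T n = tgt T m \<and> n \<cdot> g = m"
proof -
  note [simp] = tri_typed[OF t]
  obtain z where z: "zero_object z" using ex_zero_object by blast
  have "\<exists>w\<in>Hom (src T h) (src T (zerom T (tgt T m) (shO T z))).
      w \<cdot> g = idm T (tgt T m) \<cdot> m \<and> shM T (zerom T (src T f) z) \<cdot> h = zerom T (tgt T m) (shO T z) \<cdot> w"
    by (rule tri_morphism[OF t tri_zerom_idm[OF z, of "tgt T m"]]) (use m ab in auto)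
  then obtain w where "w \<in> Hom (src T h) (src T (zerom T (tgt T m) (shO T z)))" "w \<cdot> g = idm T (tgt T m) \<cdot> m" by blast
  then show ?thesis by (intro exI[of _ w]) simp
qed

lemma tri_weak_cokernel2:
  assumes "(f, g, h) \<in> tri T" "src T m = tgt T g" "m \<cdot> g = zerom T a b" "a = tgt T f" "b = tgt T m"
  shows "\<exists>n. src T n = shO T (src T f) \<and> tgt T n = tgt T m \<and> n \<cdot> h = m"
  using tri_weak_cokernel[OF tri_rotated[OF assms(1)] assms(2,3)] tri_typed[OF assms(1)] assms(4,5) by simp

lemma tri_weak_cokernel3:
  assumes "(f, g, h) \<in> tri T" "src T m = shO T (src T f)" "m \<cdot> h = zerom T a b" "a = tgt T g" "b = tgt T m"
  shows "\<exists>n. src T n = shO T (tgt T f) \<and> tgt T n = tgt T m \<and> n \<cdot> shM T f = m"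
proof -
  have "\<exists>n. src T n = shO T (src T g) \<and> tgt T n = tgt T m \<and> n \<cdot> negm (shM T f) = m"
    by (rule tri_weak_cokernel2[OF tri_rotated[OF assms(1)], of m a b]) (use tri_typed[OF assms(1)] assms(2-5) in simp_all)
  then obtain n where "src T n = shO T (src T g)" "tgt T n = tgt T m" "n \<cdot> negm (shM T f) = m" by blast
  then show ?thesis using tri_typed[OF assms(1)] by (intro exI[of _ "negm n"]) simp
qed

text \<open>The axiom supplies only third components, whereas here a first one is wanted. Both
  triangles are rotated, so that the filler is the suspension of the desired arrow, and it is
  desuspended because \<open>shM\<close> is surjective.\<close>

lemma tri_weak_kernel:
  assumes t: "(f, g, h) \<in> tri T" and m: "tgt T m = tgt T f" "g \<cdot> m = zerom T a b"
    and ab: "a = src T m" "b = tgt T g"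
  shows "\<exists>n. src T n = src T m \<and> tgt T n = src T f \<and> f \<cdot> n = m"
proof -
  note [simp] = tri_typed[OF t]
  let ?z = "src T m"
  obtain z where z: "zero_object z" using ex_zero_object by blast
  have t1: "(zerom T ?z z, zerom T z (shO T ?z), negm (idm T (shO T ?z))) \<in> tri T"
    using tri_rotated[OF tri_idm[OF z, of ?z]] by simp
  have "\<exists>w\<in>Hom (src T (negm (idm T (shO T ?z)))) (src T (negm (shM T f))).
      w \<cdot> zerom T z (shO T ?z) = h \<cdot> zerom T z (tgt T g) \<and>
      shM T m \<cdot> negm (idm T (shO T ?z)) = negm (shM T f) \<cdot> w"
    by (rule tri_morphism[OF t1 tri_rotated[OF t]]) (use m ab in auto)
  then obtain w where w: "src T w = shO T ?z" "tgt T w = shO T (src T f)"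
     "shM T m \<cdot> negm (idm T (shO T ?z)) = negm (shM T f) \<cdot> w" by auto
  obtain n where n: "w = shM T n" using shM_surj by blast
  with w have n': "src T n = ?z" "tgt T n = src T f" by auto
  moreover have "shM T (f \<cdot> n) = shM T m" using w n m(1) n' by (simp add: shM_cmp' del: shM_inject)
  ultimately show ?thesis by (intro exI[of _ n]) simp
qed

lemma tri_weak_kernel2:
  assumes "(f, g, h) \<in> tri T" "tgt T m = tgt T g" "h \<cdot> m = zerom T a b" "a = src T m" "b = shO T (src T f)"
  shows "\<exists>n. src T n = src T m \<and> tgt T n = tgt T f \<and> g \<cdot> n = m"
  using tri_weak_kernel[OF tri_rotated[OF assms(1)] assms(2,3)] tri_typed[OF assms(1)] assms(4,5) by simp

lemma tri_weak_kernel3: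
  assumes "(f, g, h) \<in> tri T" "tgt T m = shO T (src T f)" "shM T f \<cdot> m = zerom T a b" "a = src T m"
    "b = shO T (tgt T f)"
  shows "\<exists>n. src T n = src T m \<and> tgt T n = tgt T g \<and> h \<cdot> n = m"
  using tri_weak_kernel2[OF tri_rotated[OF assms(1)], of m a b] tri_typed[OF assms(1)] assms(2-5) by simp

lemma iso_if_left_right_inverse:
  assumes "src T l = tgt T f" "tgt T l = src T f" "src T r = tgt T f" "tgt T r = src T f"
    and "l \<cdot> f = idm T (src T f)" "f \<cdot> r = idm T (tgt T f)"
  shows "iso f"
proof -
  have "l = l \<cdot> (f \<cdot> r)" using assms by simp
  also have "\<dots> = (l \<cdot> f) \<cdot> r" using assms(1-4) by simp
  also have "\<dots> = r" using assms by simp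
  finally show ?thesis using assms by (intro isoI[of l]) auto
qed

text \<open>If \<open>f\<close> is invertible, then \<open>g\<close> and \<open>h\<close> vanish,
  and the identity of the cone, which kills \<open>g\<close>, factors through \<open>h\<close>.
  Conversely, if \<open>g\<close> and \<open>h\<close> vanish, weak kernels and weak cokernels of
  zero arrows give one-sided inverses of \<open>f\<close>.\<close>

lemma tri_iso_iff:
  assumes t: "(f, g, h) \<in> tri T"
  shows "iso f \<longleftrightarrow> zero_object (tgt T g)"
proof -
  note [simp] = tri_typed[OF t]
  show ?thesis
  proof
    assume i: "iso f"
    have "g = zerom T (src T g) (tgt T g)" using tri_cmp_zero1[OF t] i by (simp add: cmp_iso_eq_zerom)
    moreover have "h = zerom T (src T h) (tgt T h)"
      using tri_cmp_zero3[OF t] i by (subst (asm) iso_cmp_eq_zerom) auto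
    moreover obtain n where "src T n = shO T (src T f)" "tgt T n = tgt T g" "n \<cdot> h = idm T (tgt T g)"
      using tri_weak_cokernel2[OF t, of "idm T (tgt T g)" "tgt T f" "tgt T g"] calculation by auto
    ultimately show "zero_object (tgt T g)" by (simp add: zero_object_iff)
  next
    assume z: "zero_object (tgt T g)"
    have g0: "g = zerom T (tgt T f) (tgt T g)" and h0: "h = zerom T (tgt T g) (shO T (src T f))"
      using zero_object_to[OF z, of g] zero_object_from[OF z, of h] by auto
    obtain r where r: "src T r = tgt T f" "tgt T r = src T f" "f \<cdot> r = idm T (tgt T f)"
      using tri_weak_kernel[OF t, of "idm T (tgt T f)" "tgt T f" "tgt T g"] g0 by auto
    obtain n where n: "src T n = shO T (tgt T f)" "tgt T n = shO T (src T f)" "n \<cdot> shM T f = idm T (shO T (src T f))"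
      using tri_weak_cokernel3[OF t, of "idm T (shO T (src T f))" "tgt T g" "shO T (src T f)"] h0 by auto
    obtain l where l: "n = shM T l" using shM_surj by blast
    with n have l': "src T l = tgt T f" "tgt T l = src T f" by auto
    then have "shM T (l \<cdot> f) = shM T (idm T (src T f))" using n l by (simp add: shM_cmp' del: shM_inject)
    then show "iso f" using l' r by (intro iso_if_left_right_inverse[of l f r]) (simp_all only: shM_inject)
  qed
qed

text \<open>With e = 1 + d and d d = 0 the inverse is 1 - d.\<close>

lemma iso_if_square_zero:
  assumes e: "src T e = a" "tgt T e = a"
    and d: "(e \<boxplus> negm (idm T a)) \<cdot> (e \<boxplus> negm (idm T a)) = zerom T a a"
  shows "iso e"
proof -
  define d where "d = e \<boxplus> negm (idm T a)"
  have [simp]: "src T d = a" "tgt T d = a" using e by (simp_all add: d_def)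
  have ed: "e = idm T a \<boxplus> d"
    using e by (metis (no_types, lifting) d_def addm_assoc addm_comm addm_zerom negm_addm src_idm src_negm tgt_idm tgt_negm)
  have dd: "d \<cdot> d = zerom T a a" using assms(3) by (simp add: d_def)
  show ?thesis unfolding ed
    by (rule isoI[of "idm T a \<boxplus> negm d"]) (auto simp: addm_cmp' cmp_addm' dd)
qed

lemma iso_if_iso_cmps:
  assumes [simp]: "src T g = tgt T f" "tgt T g = src T f" and i: "iso (g \<cdot> f)" "iso (f \<cdot> g)"
  shows "iso f"
proof (rule iso_if_left_right_inverse[of "minv (g \<cdot> f) \<cdot> g" _ "g \<cdot> minv (f \<cdot> g)"])
  show "(minv (g \<cdot> f) \<cdot> g) \<cdot> f = idm T (src T f)" using minv_cmp[OF i(1)] i by simp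
  show "f \<cdot> g \<cdot> minv (f \<cdot> g) = idm T (tgt T f)" using i by (subst cmp_assoc'[symmetric]) simp_all
qed (use i in auto)

text \<open>The difference d = e - 1 kills \<open>g\<close>, hence factors through \<open>h\<close>;
  since \<open>h\<close> kills d as well, d d = 0.\<close>

lemma tri_endo_iso:
  assumes t: "(f, g, h) \<in> tri T" and e: "src T e = tgt T g" "tgt T e = tgt T g" "e \<cdot> g = g" "h \<cdot> e = h"
  shows "iso e"
proof (rule iso_if_square_zero)
  note [simp] = tri_typed[OF t]
  let ?d = "e \<boxplus> negm (idm T (tgt T g))"
  have "?d \<cdot> g = zerom T (tgt T f) (tgt T g)" using e by (simp add: addm_cmp')
  then obtain n where n: "src T n = shO T (src T f)" "tgt T n = tgt T g" "n \<cdot> h = ?d"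
    using tri_weak_cokernel2[OF t, of ?d "tgt T f" "tgt T g"] e by auto
  have hd: "h \<cdot> ?d = zerom T (tgt T g) (shO T (src T f))" using e by (simp add: cmp_addm')
  have "?d \<cdot> ?d = (n \<cdot> h) \<cdot> ?d" unfolding n(3) ..
  also have "\<dots> = n \<cdot> (h \<cdot> ?d)" using n(1) e by simp
  also have "\<dots> = zerom T (tgt T g) (tgt T g)" using hd n by simp
  finally show "?d \<cdot> ?d = zerom T (tgt T g) (tgt T g)" .
qed (use e in auto)

text \<open>The inverses of \<open>u\<close> and \<open>v\<close> extend to some arrow w' in the
  other direction. It need not be inverse to \<open>w\<close>, but both composites are endomorphisms
  as in \<open>tri_endo_iso\<close>, hence invertible.\<close>

lemma tri_five:
  assumes t: "(f, g, h) \<in> tri T" and t': "(f', g', h') \<in> tri T"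
    and u: "iso u" "src T u = src T f" "tgt T u = src T f'"
    and v: "iso v" "src T v = tgt T f" "tgt T v = tgt T f'"
    and w: "src T w = tgt T g" "tgt T w = tgt T g'"
    and sq: "v \<cdot> f = f' \<cdot> u" "w \<cdot> g = g' \<cdot> v" "shM T u \<cdot> h = h' \<cdot> w"
  shows "iso w"
proof -
  note [simp] = tri_typed[OF t] tri_typed[OF t'] u v w
  have sq': "minv v \<cdot> f' = f \<cdot> minv u"
  proof -
    have "v \<cdot> (f \<cdot> minv u) = f'" using cmp_eq_cmp[OF sq(1), of "minv u"] by simp
    then show ?thesis using iso_left_inverse_cmp[OF v(1), of f' "f \<cdot> minv u"] by simp
  qed
  obtain w' where w': "src T w' = tgt T g'" "tgt T w' = tgt T g" "w' \<cdot> g' = g \<cdot> minv v"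
      "shM T (minv u) \<cdot> h' = h \<cdot> w'"
    using tri_morphism[OF t' t, of "minv u" "minv v"] sq' by auto
  note [simp] = w'(1,2)
  have "w' \<cdot> (w \<cdot> g) = g" by (simp add: sq(2) cmp_eq_cmp1[OF w'(3)] )
  moreover have "h \<cdot> (w' \<cdot> w) = h"
    using cmp_eq_cmp[OF w'(4)[symmetric], of w] by (simp add: sq(3)[symmetric] shM_minv)
  ultimately have 1: "iso (w' \<cdot> w)" by (intro tri_endo_iso[OF t]) auto
  have "w \<cdot> (w' \<cdot> g') = g'"
    using cmp_eq_cmp[OF sq(2), of "minv v"] by (simp add: w'(3))
  moreover have "h' \<cdot> (w \<cdot> w') = h'"
    using cmp_eq_cmp[OF sq(3)[symmetric], of w'] by (simp add: w'(4)[symmetric] shM_minv)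
  ultimately have 2: "iso (w \<cdot> w')" by (intro tri_endo_iso[OF t']) auto
  show ?thesis by (rule iso_if_iso_cmps[OF _ _ 1 2]) auto
qed

lemma tri_cone_isomorphic:
  assumes t: "(f, g, h) \<in> tri T" and t': "(f', g', h') \<in> tri T"
    and u: "iso u" "src T u = src T f" "tgt T u = src T f'"
    and v: "iso v" "src T v = tgt T f" "tgt T v = tgt T f'"
    and sq: "v \<cdot> f = f' \<cdot> u"
  shows "tgt T g \<simeq> tgt T g'"
proof -
  note [simp] = tri_typed[OF t] tri_typed[OF t']
  obtain w where "src T w = tgt T g" "tgt T w = tgt T g'" "w \<cdot> g = g' \<cdot> v" "shM T u \<cdot> h = h' \<cdot> w"
    using tri_morphism[OF t t', of u v] u v sq by auto
  then show ?thesis using tri_five[OF t t' u v _ _ sq] isomorphicI by auto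
qed

text \<open>The complement is the cone of the section \<open>s\<close>: the third arrow of that
  triangle vanishes because \<open>r\<close> splits \<open>s\<close>. This lets thick subcategories,
  defined by summands, be used with retracts.\<close>

lemma retract_biproduct:
  assumes s: "s \<in> Hom x b" and r: "r \<in> Hom b x" and rs: "r \<cdot> s = idm T x"
  shows "\<exists>y. biproduct x y b"
proof -
  obtain g h where t: "(s, g, h) \<in> tri T" using tri_complete by blast
  note [simp] = tri_typed[OF t] s[unfolded Hom_iff] r[unfolded Hom_iff]
  have "h = shM T (r \<cdot> s) \<cdot> h" by (simp add: rs)
  also have "\<dots> = shM T r \<cdot> (shM T s \<cdot> h)" by (simp add: shM_cmp')
  also have "\<dots> = zerom T (tgt T g) (shO T x)" using tri_cmp_zero3[OF t] by simp
  finally have h0: "h = zerom T (tgt T g) (shO T x)" .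
  have "\<exists>n. src T n = src T (idm T (tgt T g)) \<and> tgt T n = tgt T s \<and> g \<cdot> n = idm T (tgt T g)"
    by (rule tri_weak_kernel2[OF t, of _ "tgt T g" "shO T x"]) (simp_all add: h0)
  then obtain t' where t': "src T t' = tgt T g" "tgt T t' = b" "g \<cdot> t' = idm T (tgt T g)" by auto
  note [simp] = t'(1,2)
  have gs: "g \<cdot> s = zerom T x (tgt T g)" using tri_cmp_zero1[OF t] by simp
  \<comment> \<open>A section of \<open>g\<close> corrected by its part along \<open>s\<close>, so
    that \<open>r\<close> kills it.\<close>
  define j where "j = t' \<boxplus> negm (s \<cdot> (r \<cdot> t'))"
  have [simp]: "src T j = tgt T g" "tgt T j = b" by (simp_all add: j_def)
  have rj: "r \<cdot> j = zerom T (tgt T g) x"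
    using cmp_eq_cmp1[OF rs, of "r \<cdot> t'"] by (simp add: j_def cmp_addm')
  have gj: "g \<cdot> j = idm T (tgt T g)"
    using cmp_eq_cmp1[OF gs, of "r \<cdot> t'"] t'(3) by (simp add: j_def cmp_addm')
  \<comment> \<open>The defect of the biproduct equation. It kills \<open>s\<close>, so it factors
    through \<open>g\<close>; it also kills the section \<open>j\<close> of \<open>g\<close>, so
    that factor is zero.\<close>
  define d where "d = idm T b \<boxplus> negm (s \<cdot> r \<boxplus> j \<cdot> g)"
  have [simp]: "src T d = b" "tgt T d = b" by (simp_all add: d_def)
  have "d \<cdot> s = zerom T x b" by (simp add: d_def addm_cmp' rs gs)
  then have "\<exists>n. src T n = tgt T g \<and> tgt T n = tgt T d \<and> n \<cdot> g = d"
    by (intro tri_weak_cokernel[OF t, of _ x b]) simp_all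
  then obtain n where n: "src T n = tgt T g" "tgt T n = tgt T d" "n \<cdot> g = d" by blast
  have "n = n \<cdot> (g \<cdot> j)" using n by (simp add: gj)
  also have "\<dots> = (n \<cdot> g) \<cdot> j" using n(1,2) by simp
  also have "\<dots> = d \<cdot> j" by (simp only: n(3))
  also have "\<dots> = zerom T (tgt T g) b" by (simp add: d_def addm_cmp' rj gj)
  finally have "d = zerom T b b" using n(3)[symmetric] by simp
  then have "idm T b = s \<cdot> r \<boxplus> j \<cdot> g"
    unfolding d_def using addm_negm_eq_zero[of "s \<cdot> r \<boxplus> j \<cdot> g" "idm T b"] by simp
  then show ?thesis unfolding biproduct_def
    by (intro exI[of _ "tgt T g"] exI[of _ s] exI[of _ j] exI[of _ r] exI[of _ g]) (simp add: rs gs rj gj)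
qed

text \<open>Closure under isomorphism is a case of closure under cones: an isomorphism x
  \<rightarrow> y makes y a cone of an arrow 0 \<rightarrow> x.\<close>

lemma triangulated_sub_isomorphic:
  assumes S: "triangulated_sub S" and "x \<simeq> y" "x \<in> S"
  shows "y \<in> S"
proof -
  obtain f where f: "iso f" "src T f = x" "tgt T f = y" using \<open>x \<simeq> y\<close> by (auto simp: isomorphic_def)
  obtain z where z: "zero_object z" using ex_zero_object by blast
  have "(zerom T z x, f, zerom T y (shO T z)) \<in> tri T"
    by (rule tri_iso[OF tri_zerom_idm[OF z, of x], of _ z x _ y _ "idm T z" "idm T x" f]) (use f in auto)
  moreover have "z \<in> S" using S z by (simp add: triangulated_sub_def)
  ultimately have "tgt T f \<in> S"
    using S \<open>x \<in> S\<close> unfolding triangulated_sub_def by (metis src_zerom tgt_zerom)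
  then show ?thesis using f by simp
qed

lemma triangulated_sub_zero: "triangulated_sub S \<Longrightarrow> zero_object z \<Longrightarrow> z \<in> S"
  and triangulated_sub_shO: "triangulated_sub S \<Longrightarrow> shO T x \<in> S \<longleftrightarrow> x \<in> S"
  and triangulated_sub_cone: "triangulated_sub S \<Longrightarrow> (f, g, h) \<in> tri T \<Longrightarrow> src T f \<in> S \<Longrightarrow> tgt T f \<in> S \<Longrightarrow> tgt T g \<in> S"
  unfolding triangulated_sub_def by blast+

lemma triangulated_sub_shO_int: "triangulated_sub S \<Longrightarrow> shO_int n x \<in> S \<longleftrightarrow> x \<in> S"
  by (induction n rule: int_equiv_induct) (simp_all add: triangulated_sub_shO flip: shO_shO_int)

lemma triangulated_sub_middle:
  assumes S: "triangulated_sub S" and t: "(f, g, h) \<in> tri T" and "src T f \<in> S" "tgt T g \<in> S"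
  shows "tgt T f \<in> S"
  using triangulated_sub_cone[OF S tri_rotated[OF tri_rotated[OF t]]] tri_typed[OF t] assms
    triangulated_sub_shO[OF S] by simp

lemma thick_retract:
  "thick S \<Longrightarrow> s \<in> Hom x b \<Longrightarrow> r \<in> Hom b x \<Longrightarrow> r \<cdot> s = idm T x \<Longrightarrow> b \<in> S \<Longrightarrow> x \<in> S"
  using retract_biproduct unfolding thick_def by blast

text \<open>Each first object lies in \<open>L\<close> and has no arrows to the other third object,
  so the arrows to \<open>x\<close> factor through each other; cones of matching arrows are then
  isomorphic.\<close>

lemma localization_triangle_unique:
  assumes S: "\<And>s. s \<in> L \<Longrightarrow> shO T s \<in> L"
    and 1: "localization_triangle L x e f" and 2: "localization_triangle L x e' f'"
  shows "e \<simeq> e' \<and> f \<simeq> f'"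
proof -
  have *: "\<exists>k. k \<in> Hom e e' \<and> u = u' \<cdot> k"
    if t: "(u, v, w) \<in> tri T" "u \<in> Hom e x" "v \<in> Hom x f" "(u', v', w') \<in> tri T" "u' \<in> Hom e' x" "v' \<in> Hom x f'"
      and e: "e \<in> L" and f': "\<And>s. s \<in> L \<Longrightarrow> Hom s f' = {zerom T s f'}" for e f e' f' u v w u' v' w'
  proof -
    have "v' \<cdot> u \<in> Hom e f'" using t by simp
    then have "v' \<cdot> u = zerom T e f'" using f'[OF e] by blast
    then have "\<exists>n. src T n = src T u \<and> tgt T n = src T u' \<and> u' \<cdot> n = u"
      by (rule tri_weak_kernel[OF t(4), rotated]) (use t in auto)
    then show ?thesis using t by auto
  qed
  \<comment> \<open>An endomorphism of e over x is the identity: the suspension of the difference is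
    killed by that of u, hence comes from an arrow from the suspension of e to f, and closure of
    \<open>L\<close> under suspension makes that arrow zero.\<close>
  have **: "k = idm T e" if t: "(u, v, w) \<in> tri T" "u \<in> Hom e x" "v \<in> Hom x f"
    and k: "k \<in> Hom e e" "u \<cdot> k = u" and e: "e \<in> L" and f: "\<And>s. s \<in> L \<Longrightarrow> Hom s f = {zerom T s f}"
    for e f u v w k
  proof -
    note [simp] = tri_typed[OF t(1)] t(2,3)[unfolded Hom_iff] k(1)[unfolded Hom_iff]
    let ?d = "k \<boxplus> negm (idm T e)"
    have "u \<cdot> ?d = zerom T e x" using k(2) by (simp add: cmp_addm')
    then have "shM T (u \<cdot> ?d) = zerom T (shO T e) (shO T x)" by simp
    then have "shM T u \<cdot> shM T ?d = zerom T (shO T e) (shO T x)" by (subst (asm) shM_cmp') auto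
    then have "\<exists>n. src T n = src T (shM T ?d) \<and> tgt T n = tgt T v \<and> w \<cdot> n = shM T ?d"
      by (intro tri_weak_kernel3[OF t(1), of _ "shO T e" "shO T x"]) simp_all
    then obtain n where n: "src T n = src T (shM T ?d)" "tgt T n = tgt T v" "w \<cdot> n = shM T ?d" by blast
    have n0: "n = zerom T (shO T e) f" 
    proof -
      have "n \<in> Hom (shO T e) f" using n(1,2) by simp
      then show ?thesis using f[OF S[OF e]] by blast
    qed
    then have "shM T ?d = zerom T (shO T e) (shO T e)" using n(3) unfolding n0 by simp
    then have "?d = zerom T e e" by simp
    then show ?thesis using addm_negm_eq_zero[of "idm T e" k] by simp
  qed
  obtain u v w where t: "(u, v, w) \<in> tri T" "u \<in> Hom e x" "v \<in> Hom x f" and e: "e \<in> L"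
    and f: "\<And>s. s \<in> L \<Longrightarrow> Hom s f = {zerom T s f}"
    using 1 unfolding localization_triangle_def by blast
  obtain u' v' w' where t': "(u', v', w') \<in> tri T" "u' \<in> Hom e' x" "v' \<in> Hom x f'" and e': "e' \<in> L"
    and f': "\<And>s. s \<in> L \<Longrightarrow> Hom s f' = {zerom T s f'}"
    using 2 unfolding localization_triangle_def by blast
  obtain k where k: "k \<in> Hom e e'" "u = u' \<cdot> k" using *[OF t t' e f'] by blast
  obtain k' where k': "k' \<in> Hom e' e" "u' = u \<cdot> k'" using *[OF t' t e' f] by blast
  note [simp] = k(1)[unfolded Hom_iff] k'(1)[unfolded Hom_iff] t(2,3)[unfolded Hom_iff] t'(2,3)[unfolded Hom_iff]
  have "k' \<cdot> k = idm T e" using k' k by (intro **[OF t _ _ e f]) (auto simp flip: cmp_assoc')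
  moreover have "k \<cdot> k' = idm T e'" using k' k by (intro **[OF t' _ _ e' f']) (auto simp flip: cmp_assoc')
  ultimately have i: "iso k" by (intro isoI[of k']) auto
  have "tgt T v \<simeq> tgt T v'"
    by (rule tri_cone_isomorphic[OF t(1) t'(1) i _ _ iso_idm[of x]]) (use k in auto)
  then show ?thesis using i isomorphicI by auto
qed

end

subsection \<open>Tensor products\<close>

context closed_symmetric_monoidal_category
begin

lemma src_tensM [simp]: "src T (f \<boxtimes>\<^sub>m g) = src T f \<boxtimes> src T g"
  and tgt_tensM [simp]: "tgt T (f \<boxtimes>\<^sub>m g) = tgt T f \<boxtimes> tgt T g"
  using tensM_Hom[of f "src T f" "tgt T f" g "src T g" "tgt T g"] by auto

lemma src_assoc [simp]: "src T (assoc T a b c) = (a \<boxtimes> b) \<boxtimes> c"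
  and tgt_assoc [simp]: "tgt T (assoc T a b c) = a \<boxtimes> (b \<boxtimes> c)"
  using assoc_Hom[of a b c] by auto

lemma src_lunit [simp]: "src T (lunit T a) = \<bbbone> \<boxtimes> a" and tgt_lunit [simp]: "tgt T (lunit T a) = a"
  using lunit_Hom[of a] by auto

lemma src_runit [simp]: "src T (runit T a) = a \<boxtimes> \<bbbone>" and tgt_runit [simp]: "tgt T (runit T a) = a"
  using runit_Hom[of a] by auto

lemma src_braid [simp]: "src T (braid T a b) = a \<boxtimes> b" and tgt_braid [simp]: "tgt T (braid T a b) = b \<boxtimes> a"
  using braid_Hom[of a b] by auto

declare assoc_iso [simp] lunit_iso [simp] runit_iso [simp] tensM_idm [simp] braid_braid [simp]

lemma braid_iso [simp]: "iso (braid T a b)"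
  by (rule isoI[of "braid T b a"]) auto

lemma tens_merge:
  "src T f' = tgt T f \<Longrightarrow> src T g' = tgt T g \<Longrightarrow> (f' \<boxtimes>\<^sub>m g') \<cdot> (f \<boxtimes>\<^sub>m g) = (f' \<cdot> f) \<boxtimes>\<^sub>m (g' \<cdot> g)"
  using tensM_cmp[of f "src T f" "tgt T f" f' "tgt T f'" g "src T g" "tgt T g" g' "tgt T g'"] by simp

lemma tens_merge_cmp:
  "src T f' = tgt T f \<Longrightarrow> src T g' = tgt T g \<Longrightarrow> tgt T u = src T f \<boxtimes> src T g \<Longrightarrow>
    (f' \<boxtimes>\<^sub>m g') \<cdot> ((f \<boxtimes>\<^sub>m g) \<cdot> u) = ((f' \<cdot> f) \<boxtimes>\<^sub>m (g' \<cdot> g)) \<cdot> u"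
  using cmp_eq_cmp1[OF tens_merge, of f' f g' g u] by simp

lemmas tens_merges = tens_merge tens_merge_cmp

lemma iso_tens [simp]: "iso f \<Longrightarrow> iso g \<Longrightarrow> iso (f \<boxtimes>\<^sub>m g)"
  by (rule isoI[of "minv f \<boxtimes>\<^sub>m minv g"]) (auto simp: tens_merge)

lemma minv_tens: "iso f \<Longrightarrow> iso g \<Longrightarrow> minv (f \<boxtimes>\<^sub>m g) = minv f \<boxtimes>\<^sub>m minv g"
  by (rule minv_eqI) (auto simp: inverse_arrows_def tens_merge)

lemma assoc_nat: "src T f = a \<Longrightarrow> src T g = b \<Longrightarrow> src T h = c \<Longrightarrow> tgt T f = a' \<Longrightarrow> tgt T g = b' \<Longrightarrow> tgt T h = c' \<Longrightarrow>
    assoc T a' b' c' \<cdot> ((f \<boxtimes>\<^sub>m g) \<boxtimes>\<^sub>m h) = (f \<boxtimes>\<^sub>m (g \<boxtimes>\<^sub>m h)) \<cdot> assoc T a b c"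
  by (rule assoc_natural) auto

lemma lunit_nat: "src T f = a \<Longrightarrow> tgt T f = b \<Longrightarrow> lunit T b \<cdot> (idm T \<bbbone> \<boxtimes>\<^sub>m f) = f \<cdot> lunit T a"
  by (rule lunit_natural) auto

lemma runit_nat: "src T f = a \<Longrightarrow> tgt T f = b \<Longrightarrow> runit T b \<cdot> (f \<boxtimes>\<^sub>m idm T \<bbbone>) = f \<cdot> runit T a"
  by (rule runit_natural) auto

lemma braid_nat: "src T f = a \<Longrightarrow> tgt T f = a' \<Longrightarrow> src T g = b \<Longrightarrow> tgt T g = b' \<Longrightarrow>
    braid T a' b' \<cdot> (f \<boxtimes>\<^sub>m g) = (g \<boxtimes>\<^sub>m f) \<cdot> braid T a b"
  by (rule braid_natural) auto

text \<open>Tensoring with the unit is naturally isomorphic to the identity. The coherence laws for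
  units that follow are Kelly's consequences of the pentagon and the triangle, verified after
  tensoring with the unit.\<close>

lemma unit_tens_faithful:
  assumes "src T f = src T g" "tgt T f = tgt T g" "idm T \<bbbone> \<boxtimes>\<^sub>m f = idm T \<bbbone> \<boxtimes>\<^sub>m g"
  shows "f = g"
proof -
  have "f \<cdot> lunit T (src T f) = g \<cdot> lunit T (src T g)"
    using lunit_nat[of f "src T f" "tgt T f"] lunit_nat[of g "src T g" "tgt T g"] assms by simp
  then show ?thesis by (simp add: assms(1) iso_cancel_right)
qed

lemma tens_unit_faithful:
  assumes "src T f = src T g" "tgt T f = tgt T g" "f \<boxtimes>\<^sub>m idm T \<bbbone> = g \<boxtimes>\<^sub>m idm T \<bbbone>"
  shows "f = g"
proof -
  have "f \<cdot> runit T (src T f) = g \<cdot> runit T (src T g)"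
    using runit_nat[of f "src T f" "tgt T f"] runit_nat[of g "src T g" "tgt T g"] assms by simp
  then show ?thesis by (simp add: assms(1) iso_cancel_right)
qed

text \<open>Kelly's argument: the pentagon for \<bbbone>, \<bbbone>, a, b and two unit triangles
  give the equation after tensoring with the unit on the left.\<close>

lemma lunit_tens: "lunit T (a \<boxtimes> b) \<cdot> assoc T \<bbbone> a b = lunit T a \<boxtimes>\<^sub>m idm T b"
proof (rule unit_tens_faithful)
  let ?r = "assoc T \<bbbone> (\<bbbone> \<boxtimes> a) b \<cdot> (assoc T \<bbbone> \<bbbone> a \<boxtimes>\<^sub>m idm T b)"
  have "(idm T \<bbbone> \<boxtimes>\<^sub>m (lunit T (a \<boxtimes> b) \<cdot> assoc T \<bbbone> a b)) \<cdot> ?r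
      = (idm T \<bbbone> \<boxtimes>\<^sub>m lunit T (a \<boxtimes> b)) \<cdot> ((idm T \<bbbone> \<boxtimes>\<^sub>m assoc T \<bbbone> a b) \<cdot> ?r)"
    by (simp add: tens_merges)
  also have "\<dots> = (idm T \<bbbone> \<boxtimes>\<^sub>m lunit T (a \<boxtimes> b)) \<cdot> (assoc T \<bbbone> \<bbbone> (a \<boxtimes> b) \<cdot> assoc T (\<bbbone> \<boxtimes> \<bbbone>) a b)"
    by (simp add: pentagon)
  also have "\<dots> = (runit T \<bbbone> \<boxtimes>\<^sub>m idm T (a \<boxtimes> b)) \<cdot> assoc T (\<bbbone> \<boxtimes> \<bbbone>) a b"
    using cmp_eq_cmp1[OF unit_triangle[of \<bbbone> "a \<boxtimes> b"]] by simp
  also have "\<dots> = assoc T \<bbbone> a b \<cdot> ((runit T \<bbbone> \<boxtimes>\<^sub>m idm T a) \<boxtimes>\<^sub>m idm T b)"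
    by (subst assoc_nat) auto
  also have "\<dots> = assoc T \<bbbone> a b \<cdot> (((idm T \<bbbone> \<boxtimes>\<^sub>m lunit T a) \<boxtimes>\<^sub>m idm T b) \<cdot> (assoc T \<bbbone> \<bbbone> a \<boxtimes>\<^sub>m idm T b))"
    by (simp add: tens_merge unit_triangle)
  also have "\<dots> = (idm T \<bbbone> \<boxtimes>\<^sub>m (lunit T a \<boxtimes>\<^sub>m idm T b)) \<cdot> ?r"
    using cmp_eq_cmp[OF assoc_nat[of "idm T \<bbbone>" \<bbbone> "lunit T a" "\<bbbone> \<boxtimes> a" "idm T b" b \<bbbone> a b]] by simp
  finally show "idm T \<bbbone> \<boxtimes>\<^sub>m (lunit T (a \<boxtimes> b) \<cdot> assoc T \<bbbone> a b) = idm T \<bbbone> \<boxtimes>\<^sub>m lunit T a \<boxtimes>\<^sub>m idm T b"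
    by (subst (asm) iso_cancel_right) auto
qed auto

text \<open>The mirror image of \<open>lunit_tens\<close>, by the pentagon for a, b, \<bbbone>,
  \<bbbone>.\<close>

lemma runit_tens: "(idm T a \<boxtimes>\<^sub>m runit T b) \<cdot> assoc T a b \<bbbone> = runit T (a \<boxtimes> b)"
proof (rule tens_unit_faithful)
  let ?p = "idm T a \<boxtimes>\<^sub>m (idm T b \<boxtimes>\<^sub>m lunit T \<bbbone>)"
  have "assoc T a b \<bbbone> \<cdot> (runit T (a \<boxtimes> b) \<boxtimes>\<^sub>m idm T \<bbbone>)
      = assoc T a b \<bbbone> \<cdot> ((idm T (a \<boxtimes> b) \<boxtimes>\<^sub>m lunit T \<bbbone>) \<cdot> assoc T (a \<boxtimes> b) \<bbbone> \<bbbone>)"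
    by (simp add: unit_triangle)
  also have "\<dots> = ?p \<cdot> (assoc T a b (\<bbbone> \<boxtimes> \<bbbone>) \<cdot> assoc T (a \<boxtimes> b) \<bbbone> \<bbbone>)"
    using cmp_eq_cmp[OF assoc_nat[of "idm T a" a "idm T b" b "lunit T \<bbbone>" "\<bbbone> \<boxtimes> \<bbbone>" a b \<bbbone>]] by simp
  also have "\<dots> = ?p \<cdot> ((idm T a \<boxtimes>\<^sub>m assoc T b \<bbbone> \<bbbone>) \<cdot> (assoc T a (b \<boxtimes> \<bbbone>) \<bbbone> \<cdot> (assoc T a b \<bbbone> \<boxtimes>\<^sub>m idm T \<bbbone>)))"
    by (simp add: pentagon)
  also have "\<dots> = (idm T a \<boxtimes>\<^sub>m (runit T b \<boxtimes>\<^sub>m idm T \<bbbone>)) \<cdot> (assoc T a (b \<boxtimes> \<bbbone>) \<bbbone> \<cdot> (assoc T a b \<bbbone> \<boxtimes>\<^sub>m idm T \<bbbone>))"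
    by (simp add: tens_merges unit_triangle)
  also have "\<dots> = assoc T a b \<bbbone> \<cdot> (((idm T a \<boxtimes>\<^sub>m runit T b) \<boxtimes>\<^sub>m idm T \<bbbone>) \<cdot> (assoc T a b \<bbbone> \<boxtimes>\<^sub>m idm T \<bbbone>))"
    using cmp_eq_cmp[OF assoc_nat[of "idm T a" a "runit T b" "b \<boxtimes> \<bbbone>" "idm T \<bbbone>" \<bbbone> a b \<bbbone>, symmetric]] by simp
  finally show "((idm T a \<boxtimes>\<^sub>m runit T b) \<cdot> assoc T a b \<bbbone>) \<boxtimes>\<^sub>m idm T \<bbbone> = runit T (a \<boxtimes> b) \<boxtimes>\<^sub>m idm T \<bbbone>"
    by (subst (asm) iso_cancel_left) (auto simp: tens_merge)
qed auto

text \<open>Naturality of the left unitor along itself identifies its value at \<bbbone> \<otimes>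
  \<bbbone> with a tensor product; the two descriptions of that arrow are then compared through the
  unit triangle.\<close>

lemma lunit_unit: "lunit T \<bbbone> = runit T \<bbbone>"
proof (rule tens_unit_faithful)
  have "lunit T (\<bbbone> \<boxtimes> \<bbbone>) = idm T \<bbbone> \<boxtimes>\<^sub>m lunit T \<bbbone>"
    using lunit_nat[of "lunit T \<bbbone>" "\<bbbone> \<boxtimes> \<bbbone>" \<bbbone>] by (simp add: iso_cancel_left)
  then show "lunit T \<bbbone> \<boxtimes>\<^sub>m idm T \<bbbone> = runit T \<bbbone> \<boxtimes>\<^sub>m idm T \<bbbone>"
    using lunit_tens[of \<bbbone> \<bbbone>] unit_triangle[of \<bbbone> \<bbbone>] by simp
qed auto

text \<open>The hexagon for a, \<bbbone>, \<bbbone>, with the unitors removed by naturality of the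
  braiding and of the left unitor; the leftover braiding cancels because it is invertible.\<close>

lemma lunit_braid: "lunit T a \<cdot> braid T a \<bbbone> = runit T a"
proof (rule tens_unit_faithful)
  let ?c = \<bbbone>
  have "braid T a ?c \<cdot> (runit T a \<boxtimes>\<^sub>m idm T ?c) = braid T a ?c \<cdot> ((idm T a \<boxtimes>\<^sub>m lunit T ?c) \<cdot> assoc T a \<bbbone> ?c)"
    by (simp add: unit_triangle)
  also have "\<dots> = (lunit T ?c \<boxtimes>\<^sub>m idm T a) \<cdot> (braid T a (\<bbbone> \<boxtimes> ?c) \<cdot> assoc T a \<bbbone> ?c)"
    using cmp_eq_cmp[OF braid_nat[of "idm T a" a a "lunit T ?c" "\<bbbone> \<boxtimes> ?c" ?c]] by simp
  also have "\<dots> = lunit T (?c \<boxtimes> a) \<cdot> (assoc T \<bbbone> ?c a \<cdot> (braid T a (\<bbbone> \<boxtimes> ?c) \<cdot> assoc T a \<bbbone> ?c))"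
    by (simp flip: lunit_tens)
  also have "\<dots> = lunit T (?c \<boxtimes> a) \<cdot> ((idm T \<bbbone> \<boxtimes>\<^sub>m braid T a ?c) \<cdot> (assoc T \<bbbone> a ?c \<cdot> (braid T a \<bbbone> \<boxtimes>\<^sub>m idm T ?c)))"
    by (simp only: hexagon)
  also have "\<dots> = braid T a ?c \<cdot> (lunit T (a \<boxtimes> ?c) \<cdot> (assoc T \<bbbone> a ?c \<cdot> (braid T a \<bbbone> \<boxtimes>\<^sub>m idm T ?c)))"
    using cmp_eq_cmp[OF lunit_nat[of "braid T a ?c" "a \<boxtimes> ?c" "?c \<boxtimes> a"]] by simp
  also have "\<dots> = braid T a ?c \<cdot> ((lunit T a \<boxtimes>\<^sub>m idm T ?c) \<cdot> (braid T a \<bbbone> \<boxtimes>\<^sub>m idm T ?c))"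
    using cmp_eq_cmp1[OF lunit_tens[of a ?c]] by simp
  finally show "(lunit T a \<cdot> braid T a \<bbbone>) \<boxtimes>\<^sub>m idm T \<bbbone> = runit T a \<boxtimes>\<^sub>m idm T \<bbbone>"
    by (subst (asm) iso_cancel_left) (auto simp: tens_merge)
qed auto

lemma runit_braid: "runit T a \<cdot> braid T \<bbbone> a = lunit T a"
  unfolding lunit_braid[symmetric] by simp

section \<open>Tensor products up to isomorphism, coproducts and duals\<close>

lemma tens_isomorphic: "x \<simeq> x' \<Longrightarrow> y \<simeq> y' \<Longrightarrow> x \<boxtimes> y \<simeq> x' \<boxtimes> y'"
  unfolding isomorphic_def by (metis Hom_iff iso_tens src_tensM tgt_tensM)

lemma tens_assoc_isomorphic: "(x \<boxtimes> y) \<boxtimes> z \<simeq> x \<boxtimes> (y \<boxtimes> z)"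
  by (rule isomorphicI[of "assoc T x y z"]) auto

lemma tens_comm_isomorphic: "x \<boxtimes> y \<simeq> y \<boxtimes> x"
  by (rule isomorphicI[of "braid T x y"]) auto

lemma unit_tens_isomorphic: "\<bbbone> \<boxtimes> x \<simeq> x"
  by (rule isomorphicI[of "lunit T x"]) auto

lemma tens_left_comm_isomorphic: "x \<boxtimes> (y \<boxtimes> z) \<simeq> y \<boxtimes> (x \<boxtimes> z)"
proof -
  have "x \<boxtimes> (y \<boxtimes> z) \<simeq> (x \<boxtimes> y) \<boxtimes> z" by (rule isomorphic_sym[OF tens_assoc_isomorphic])
  also have "\<dots> \<simeq> (y \<boxtimes> x) \<boxtimes> z" by (intro tens_isomorphic tens_comm_isomorphic isomorphic_refl)
  also have "\<dots> \<simeq> y \<boxtimes> (x \<boxtimes> z)" by (rule tens_assoc_isomorphic)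
  finally show ?thesis .
qed

text \<open>The internal hom makes tensoring with \<open>b\<close> a left adjoint, and left adjoints
  preserve coproducts: the family is curried, glued over \<open>d\<close> and uncurried
  again.\<close>

lemma coproduct_tens:
  assumes c: "coproduct I X d \<iota>"
  shows "coproduct I (\<lambda>i. X i \<boxtimes> b) (d \<boxtimes> b) (\<lambda>i. \<iota> i \<boxtimes>\<^sub>m idm T b)"
  unfolding coproduct_def
proof (intro conjI ballI allI impI)
  show "\<iota> i \<boxtimes>\<^sub>m idm T b \<in> Hom (X i \<boxtimes> b) (d \<boxtimes> b)" if "i \<in> I" for i
    using coproduct_Hom[OF c that] by simp
next
  fix y \<phi>
  assume \<phi>: "\<forall>i\<in>I. \<phi> i \<in> Hom (X i \<boxtimes> b) y"
  obtain h ev where ev: "ev \<in> Hom (h \<boxtimes> b) y"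
    and univ: "\<And>a f. f \<in> Hom (a \<boxtimes> b) y \<Longrightarrow> \<exists>!g. g \<in> Hom a h \<and> ev \<cdot> (g \<boxtimes>\<^sub>m idm T b) = f"
    using internal_hom[of b y] by blast
  have "\<forall>i\<in>I. \<exists>g. g \<in> Hom (X i) h \<and> ev \<cdot> (g \<boxtimes>\<^sub>m idm T b) = \<phi> i" using univ \<phi> by blast
  then obtain \<psi> where \<psi>: "\<And>i. i \<in> I \<Longrightarrow> \<psi> i \<in> Hom (X i) h \<and> ev \<cdot> (\<psi> i \<boxtimes>\<^sub>m idm T b) = \<phi> i" by metis
  obtain g where g: "g \<in> Hom d h" "\<And>i. i \<in> I \<Longrightarrow> g \<cdot> \<iota> i = \<psi> i"
    using coproduct_ex[OF c, of \<psi> h] \<psi> by blast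
  show "\<exists>!g. g \<in> Hom (d \<boxtimes> b) y \<and> (\<forall>i\<in>I. g \<cdot> (\<iota> i \<boxtimes>\<^sub>m idm T b) = \<phi> i)"
  proof (rule ex1I)
    show "ev \<cdot> (g \<boxtimes>\<^sub>m idm T b) \<in> Hom (d \<boxtimes> b) y \<and>
        (\<forall>i\<in>I. (ev \<cdot> (g \<boxtimes>\<^sub>m idm T b)) \<cdot> (\<iota> i \<boxtimes>\<^sub>m idm T b) = \<phi> i)"
      using ev g \<psi> coproduct_Hom[OF c] by (simp add: tens_merge)
  next
    fix k assume k: "k \<in> Hom (d \<boxtimes> b) y \<and> (\<forall>i\<in>I. k \<cdot> (\<iota> i \<boxtimes>\<^sub>m idm T b) = \<phi> i)"
    then obtain k' where k': "k' \<in> Hom d h" "ev \<cdot> (k' \<boxtimes>\<^sub>m idm T b) = k" using univ by blast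
    have "k' = g"
    proof (rule coproduct_eqI[OF c k'(1) g(1)])
      fix i assume i: "i \<in> I"
      have "ev \<cdot> ((k' \<cdot> \<iota> i) \<boxtimes>\<^sub>m idm T b) = (ev \<cdot> (k' \<boxtimes>\<^sub>m idm T b)) \<cdot> (\<iota> i \<boxtimes>\<^sub>m idm T b)"
        using ev k'(1) coproduct_Hom[OF c i] by (simp add: tens_merge)
      also have "\<dots> = \<phi> i" unfolding k'(2) using k i by blast
      finally have 1: "k' \<cdot> \<iota> i \<in> Hom (X i) h \<and> ev \<cdot> ((k' \<cdot> \<iota> i) \<boxtimes>\<^sub>m idm T b) = \<phi> i"
        using k'(1) coproduct_Hom[OF c i] by simp
      show "k' \<cdot> \<iota> i = g \<cdot> \<iota> i" unfolding g(2)[OF i] using univ[of "\<phi> i" "X i"] 1 \<psi>[OF i] \<phi> i by blast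
    qed
    then show "k = ev \<cdot> (g \<boxtimes>\<^sub>m idm T b)" using k' by simp
  qed
qed

lemma rigid_unit: "rigid \<bbbone>"
  unfolding rigid_def
proof (intro exI conjI)
  show "lunit T \<bbbone> \<in> Hom (\<bbbone> \<boxtimes> \<bbbone>) \<bbbone>" "minv (lunit T \<bbbone>) \<in> Hom \<bbbone> (\<bbbone> \<boxtimes> \<bbbone>)" by auto
  have 1: "minv (lunit T \<bbbone> \<boxtimes>\<^sub>m idm T \<bbbone>) = minv (lunit T \<bbbone>) \<boxtimes>\<^sub>m idm T \<bbbone>" by (simp add: minv_tens)
  show "runit T \<bbbone> \<cdot> (idm T \<bbbone> \<boxtimes>\<^sub>m lunit T \<bbbone>) \<cdot> assoc T \<bbbone> \<bbbone> \<bbbone> \<cdot> (minv (lunit T \<bbbone>) \<boxtimes>\<^sub>m idm T \<bbbone>) = lunit T \<bbbone>"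
    using cmp_eq_cmp1[OF unit_triangle[of \<bbbone> \<bbbone>], of "minv (lunit T \<bbbone>) \<boxtimes>\<^sub>m idm T \<bbbone>"]
    by (simp add: tens_merge lunit_unit)
  have 2: "minv (assoc T \<bbbone> \<bbbone> \<bbbone>) \<cdot> (idm T \<bbbone> \<boxtimes>\<^sub>m minv (lunit T \<bbbone>)) = minv (runit T \<bbbone> \<boxtimes>\<^sub>m idm T \<bbbone>)"
    unfolding unit_triangle[symmetric] by (simp add: minv_of_cmp minv_tens)
  show "lunit T \<bbbone> \<cdot> (lunit T \<bbbone> \<boxtimes>\<^sub>m idm T \<bbbone>) \<cdot> minv (assoc T \<bbbone> \<bbbone> \<bbbone>) \<cdot> (idm T \<bbbone> \<boxtimes>\<^sub>m minv (lunit T \<bbbone>)) = runit T \<bbbone>"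
    unfolding 2 by (simp add: minv_tens tens_merge lunit_unit)
qed

text \<open>One of the two duality equations, read as a splitting. It will show that scalars killing
  a tensor power of a rigid object kill the object itself.\<close>

lemma rigid_retract:
  assumes "rigid x"
  obtains d s r where "s \<in> Hom x (x \<boxtimes> (d \<boxtimes> x))" "r \<in> Hom (x \<boxtimes> (d \<boxtimes> x)) x" "r \<cdot> s = idm T x"
proof -
  obtain d ev coev where *: "ev \<in> Hom (d \<boxtimes> x) \<bbbone>" "coev \<in> Hom \<bbbone> (x \<boxtimes> d)"
    "runit T x \<cdot> (idm T x \<boxtimes>\<^sub>m ev) \<cdot> assoc T x d x \<cdot> (coev \<boxtimes>\<^sub>m idm T x) = lunit T x"
    using assms unfolding rigid_def by blast
  show ?thesis
  proof (rule that)
    show "(runit T x \<cdot> (idm T x \<boxtimes>\<^sub>m ev)) \<cdot> (assoc T x d x \<cdot> (coev \<boxtimes>\<^sub>m idm T x) \<cdot> minv (lunit T x)) = idm T x"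
      using cmp_eq_cmp1[OF *(3), of "minv (lunit T x)"] *(1,2) by simp
  qed (use * in auto)
qed

text \<open>The left adjoint \<open>- \<otimes> a\<close> of \<open>- \<otimes> d\<close>, in the form of a factorization through the unit.\<close>

lemma rigid_transpose:
  assumes "rigid a"
  obtains d \<eta> \<epsilon> where
    "\<And>x. \<eta> x \<in> Hom x ((x \<boxtimes> a) \<boxtimes> d)" "\<And>y. \<epsilon> y \<in> Hom ((y \<boxtimes> d) \<boxtimes> a) y"
    "\<And>f y y'. f \<in> Hom y y' \<Longrightarrow> \<epsilon> y' \<cdot> ((f \<boxtimes>\<^sub>m idm T d) \<boxtimes>\<^sub>m idm T a) = f \<cdot> \<epsilon> y"
    "\<And>x. \<epsilon> (x \<boxtimes> a) \<cdot> (\<eta> x \<boxtimes>\<^sub>m idm T a) = idm T (x \<boxtimes> a)"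
proof -
  obtain d ev coev where ev [simp]: "src T ev = d \<boxtimes> a" "tgt T ev = \<bbbone>" "src T coev = \<bbbone>" "tgt T coev = a \<boxtimes> d"
    and *: "runit T a \<cdot> (idm T a \<boxtimes>\<^sub>m ev) \<cdot> assoc T a d a \<cdot> (coev \<boxtimes>\<^sub>m idm T a) = lunit T a"
    using assms unfolding rigid_def by auto
  define \<eta> where "\<eta> = (\<lambda>x. minv (assoc T x a d) \<cdot> (idm T x \<boxtimes>\<^sub>m coev) \<cdot> minv (runit T x))"
  define \<epsilon> where "\<epsilon> = (\<lambda>y. runit T y \<cdot> (idm T y \<boxtimes>\<^sub>m ev) \<cdot> assoc T y d a)"
  show ?thesis
  proof (rule that[of \<eta> d \<epsilon>])
    show "\<eta> x \<in> Hom x ((x \<boxtimes> a) \<boxtimes> d)" "\<epsilon> y \<in> Hom ((y \<boxtimes> d) \<boxtimes> a) y" for x y by (simp_all add: \<eta>_def \<epsilon>_def)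
  next
    fix f y y' assume f: "f \<in> Hom y y'"
    then have [simp]: "src T f = y" "tgt T f = y'" by auto
    have "\<epsilon> y' \<cdot> ((f \<boxtimes>\<^sub>m idm T d) \<boxtimes>\<^sub>m idm T a) = runit T y' \<cdot> (idm T y' \<boxtimes>\<^sub>m ev) \<cdot> (f \<boxtimes>\<^sub>m idm T (d \<boxtimes> a)) \<cdot> assoc T y d a"
      using assoc_nat[of f y "idm T d" d "idm T a" a y' d a] by (simp add: \<epsilon>_def)
    also have "\<dots> = runit T y' \<cdot> (f \<boxtimes>\<^sub>m idm T \<bbbone>) \<cdot> (idm T y \<boxtimes>\<^sub>m ev) \<cdot> assoc T y d a"
      by (simp add: tens_merges)
    also have "\<dots> = f \<cdot> \<epsilon> y"
      using cmp_eq_cmp[OF runit_nat[of f y y']] by (simp add: \<epsilon>_def)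
    finally show "\<epsilon> y' \<cdot> ((f \<boxtimes>\<^sub>m idm T d) \<boxtimes>\<^sub>m idm T a) = f \<cdot> \<epsilon> y" .
  next
    fix x
    let ?c = "(idm T x \<boxtimes>\<^sub>m coev) \<boxtimes>\<^sub>m idm T a"
    \<comment> \<open>The equations \<open>A\<close> to \<open>E\<close> move the associators and
      unitors aside until the whole composite has the form of the identity of \<open>x\<close>
      tensored with the left side of the duality equation.\<close>
    have A: "assoc T (x \<boxtimes> a) d a \<cdot> (minv (assoc T x a d) \<boxtimes>\<^sub>m idm T a) =
        minv (assoc T x a (d \<boxtimes> a)) \<cdot> ((idm T x \<boxtimes>\<^sub>m assoc T a d a) \<cdot> assoc T x (a \<boxtimes> d) a)"
    proof -
      have "assoc T x a (d \<boxtimes> a) \<cdot> (assoc T (x \<boxtimes> a) d a \<cdot> (minv (assoc T x a d) \<boxtimes>\<^sub>m idm T a)) =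
         (idm T x \<boxtimes>\<^sub>m assoc T a d a) \<cdot> assoc T x (a \<boxtimes> d) a"
        using cmp_eq_cmp[OF pentagon[of x a d a], of "minv (assoc T x a d) \<boxtimes>\<^sub>m idm T a"] by (simp add: tens_merge)
      then show ?thesis by (subst iso_left_inverse_cmp[symmetric]) auto
    qed
    have B: "assoc T x (a \<boxtimes> d) a \<cdot> ?c = (idm T x \<boxtimes>\<^sub>m (coev \<boxtimes>\<^sub>m idm T a)) \<cdot> assoc T x \<bbbone> a"
      by (rule assoc_nat) auto
    have C: "assoc T x \<bbbone> a \<cdot> (minv (runit T x) \<boxtimes>\<^sub>m idm T a) = idm T x \<boxtimes>\<^sub>m minv (lunit T a)"
    proof -
      have "(idm T x \<boxtimes>\<^sub>m lunit T a) \<cdot> (assoc T x \<bbbone> a \<cdot> (minv (runit T x) \<boxtimes>\<^sub>m idm T a)) = idm T (x \<boxtimes> a)"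
        using cmp_eq_cmp1[OF unit_triangle[of x a], of "minv (runit T x) \<boxtimes>\<^sub>m idm T a"] by (simp add: tens_merge)
      moreover have "(idm T x \<boxtimes>\<^sub>m lunit T a) \<cdot> (idm T x \<boxtimes>\<^sub>m minv (lunit T a)) = idm T (x \<boxtimes> a)" by (simp add: tens_merge)
      ultimately show ?thesis
        using iso_cancel_left[of "idm T x \<boxtimes>\<^sub>m lunit T a" "assoc T x \<bbbone> a \<cdot> (minv (runit T x) \<boxtimes>\<^sub>m idm T a)"
            "idm T x \<boxtimes>\<^sub>m minv (lunit T a)"] by simp
    qed
    have D: "(idm T (x \<boxtimes> a) \<boxtimes>\<^sub>m ev) \<cdot> minv (assoc T x a (d \<boxtimes> a)) = minv (assoc T x a \<bbbone>) \<cdot> (idm T x \<boxtimes>\<^sub>m (idm T a \<boxtimes>\<^sub>m ev))"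
    proof -
      have "assoc T x a \<bbbone> \<cdot> ((idm T (x \<boxtimes> a) \<boxtimes>\<^sub>m ev) \<cdot> minv (assoc T x a (d \<boxtimes> a))) = idm T x \<boxtimes>\<^sub>m (idm T a \<boxtimes>\<^sub>m ev)"
        using cmp_eq_cmp[OF assoc_nat[of "idm T x" x "idm T a" a ev "d \<boxtimes> a" x a \<bbbone>], of "minv (assoc T x a (d \<boxtimes> a))"]
        by simp
      then show ?thesis by (subst iso_left_inverse_cmp[symmetric]) auto
    qed
    have E: "runit T (x \<boxtimes> a) \<cdot> minv (assoc T x a \<bbbone>) = idm T x \<boxtimes>\<^sub>m runit T a"
      by (simp flip: runit_tens)
    have "\<epsilon> (x \<boxtimes> a) \<cdot> (\<eta> x \<boxtimes>\<^sub>m idm T a) = runit T (x \<boxtimes> a) \<cdot> ((idm T (x \<boxtimes> a) \<boxtimes>\<^sub>m ev) \<cdot> (assoc T (x \<boxtimes> a) d a \<cdot>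
      ((minv (assoc T x a d) \<boxtimes>\<^sub>m idm T a) \<cdot> (?c \<cdot> (minv (runit T x) \<boxtimes>\<^sub>m idm T a)))))"
      by (simp add: \<eta>_def \<epsilon>_def tens_merges)
    also have "\<dots> = runit T (x \<boxtimes> a) \<cdot> ((idm T (x \<boxtimes> a) \<boxtimes>\<^sub>m ev) \<cdot> (minv (assoc T x a (d \<boxtimes> a)) \<cdot>
       ((idm T x \<boxtimes>\<^sub>m assoc T a d a) \<cdot> (assoc T x (a \<boxtimes> d) a \<cdot> (?c \<cdot> (minv (runit T x) \<boxtimes>\<^sub>m idm T a))))))"
      using cmp_eq_cmp[OF A, of "?c \<cdot> (minv (runit T x) \<boxtimes>\<^sub>m idm T a)"] by simp
    also have "assoc T x (a \<boxtimes> d) a \<cdot> (?c \<cdot> (minv (runit T x) \<boxtimes>\<^sub>m idm T a)) =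
       (idm T x \<boxtimes>\<^sub>m (coev \<boxtimes>\<^sub>m idm T a)) \<cdot> (assoc T x \<bbbone> a \<cdot> (minv (runit T x) \<boxtimes>\<^sub>m idm T a))"
      by (rule cmp_eq_cmp[OF B]) auto
    also have "\<dots> = (idm T x \<boxtimes>\<^sub>m (coev \<boxtimes>\<^sub>m idm T a)) \<cdot> (idm T x \<boxtimes>\<^sub>m minv (lunit T a))" by (simp only: C)
    also have "(idm T (x \<boxtimes> a) \<boxtimes>\<^sub>m ev) \<cdot> (minv (assoc T x a (d \<boxtimes> a)) \<cdot>
       ((idm T x \<boxtimes>\<^sub>m assoc T a d a) \<cdot> ((idm T x \<boxtimes>\<^sub>m (coev \<boxtimes>\<^sub>m idm T a)) \<cdot> (idm T x \<boxtimes>\<^sub>m minv (lunit T a))))) =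
       minv (assoc T x a \<bbbone>) \<cdot> ((idm T x \<boxtimes>\<^sub>m (idm T a \<boxtimes>\<^sub>m ev)) \<cdot>
       ((idm T x \<boxtimes>\<^sub>m assoc T a d a) \<cdot> ((idm T x \<boxtimes>\<^sub>m (coev \<boxtimes>\<^sub>m idm T a)) \<cdot> (idm T x \<boxtimes>\<^sub>m minv (lunit T a)))))"
      by (rule cmp_eq_cmp[OF D]) auto
    also have "runit T (x \<boxtimes> a) \<cdot> \<dots> = (idm T x \<boxtimes>\<^sub>m runit T a) \<cdot> ((idm T x \<boxtimes>\<^sub>m (idm T a \<boxtimes>\<^sub>m ev)) \<cdot>
       ((idm T x \<boxtimes>\<^sub>m assoc T a d a) \<cdot> ((idm T x \<boxtimes>\<^sub>m (coev \<boxtimes>\<^sub>m idm T a)) \<cdot> (idm T x \<boxtimes>\<^sub>m minv (lunit T a)))))"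
      by (rule cmp_eq_cmp1[OF E]) auto
    also have "\<dots> = idm T x \<boxtimes>\<^sub>m ((runit T a \<cdot> (idm T a \<boxtimes>\<^sub>m ev) \<cdot> assoc T a d a \<cdot> (coev \<boxtimes>\<^sub>m idm T a)) \<cdot> minv (lunit T a))"
      by (simp add: tens_merges)
    also have "\<dots> = idm T (x \<boxtimes> a)" unfolding * by simp
    finally show "\<epsilon> (x \<boxtimes> a) \<cdot> (\<eta> x \<boxtimes>\<^sub>m idm T a) = idm T (x \<boxtimes> a)" .
  qed
qed

end

section \<open>Additivity and suspension of the tensor product\<close>

context tensor_triangulated_category
begin

lemma src_susp [simp]: "src T (susp T a b) = shO T a \<boxtimes> b" and tgt_susp [simp]: "tgt T (susp T a b) = shO T (a \<boxtimes> b)"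
  using susp_Hom[of a b] by auto

declare susp_iso [simp]

lemma addm_tens: "src T f = src T g \<Longrightarrow> tgt T f = tgt T g \<Longrightarrow> (f \<boxplus> g) \<boxtimes>\<^sub>m h = (f \<boxtimes>\<^sub>m h) \<boxplus> (g \<boxtimes>\<^sub>m h)"
  using tensM_addm[of f "src T f" "tgt T f" g h "src T h" "tgt T h"] by simp

lemma zerom_tens [simp]: "zerom T a b \<boxtimes>\<^sub>m h = zerom T (a \<boxtimes> src T h) (b \<boxtimes> tgt T h)"
proof -
  let ?z = "zerom T a b \<boxtimes>\<^sub>m h"
  have "?z \<boxplus> ?z = ?z \<boxplus> zerom T (a \<boxtimes> src T h) (b \<boxtimes> tgt T h)" by (simp flip: addm_tens)
  then show ?thesis using addm_cancel_left[of ?z ?z "zerom T (a \<boxtimes> src T h) (b \<boxtimes> tgt T h)"] by simp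
qed

lemma zero_object_tens_left: "zero_object z \<Longrightarrow> zero_object (z \<boxtimes> x)"
  by (simp add: zero_object_iff tensM_idm[symmetric] del: tensM_idm)

lemma shO_tens_isomorphic: "shO T x \<boxtimes> y \<simeq> shO T (x \<boxtimes> y)"
  by (rule isomorphicI[of "susp T x y"]) auto

end

subsection \<open>Compact and rigid objects\<close>

context additive_category
begin

lemma msum_zero: "(\<And>i. i \<in> A \<Longrightarrow> \<phi> i = zerom T a b) \<Longrightarrow> msum a b \<phi> A = zerom T a b"
proof -
  interpret comm_group "hom_group a b" by (rule hom_group)
  show "(\<And>i. i \<in> A \<Longrightarrow> \<phi> i = zerom T a b) \<Longrightarrow> msum a b \<phi> A = zerom T a b"
    using finprod_one_eqI[of A \<phi>] by (simp add: hom_group_def)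
qed

lemma msum_induct:
  assumes "finite B" "\<And>a. a \<in> B \<Longrightarrow> \<psi> a \<in> Hom c d" "P (zerom T c d)"
    and "\<And>a m. a \<in> B \<Longrightarrow> m \<in> Hom c d \<Longrightarrow> P m \<Longrightarrow> P (\<psi> a \<boxplus> m)"
  shows "P (msum c d \<psi> B)"
proof -
  have "P (msum c d \<psi> A)" if "A \<subseteq> B" for A
    using finite_subset[OF that assms(1)] that
  proof (induction A rule: finite_induct)
    case (insert a A)
    have "msum c d \<psi> A \<in> Hom c d" by (rule msum_Hom) (use assms(2) insert in auto)
    moreover have "msum c d \<psi> (insert a A) = \<psi> a \<boxplus> msum c d \<psi> A"
      by (rule msum_insert) (use assms(2) insert in auto)
    ultimately show ?case using assms(4) insert by simp
  qed (simp add: assms(3))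
  then show ?thesis by blast
qed

text \<open>Arrows into a coproduct that are finite sums of arrows through single summands.
  Generating them inductively makes closure under sums, composition and suspension easy, whereas
  \<open>compact\<close> speaks of a bijection from a direct sum of groups.\<close>

inductive fin_comb :: "'u set \<Rightarrow> ('u \<Rightarrow> 'o) \<Rightarrow> 'o \<Rightarrow> ('u \<Rightarrow> 'm) \<Rightarrow> 'o \<Rightarrow> 'm \<Rightarrow> bool" for I X d \<iota> c where
  fin_comb_zero: "fin_comb I X d \<iota> c (zerom T c d)"
| fin_comb_step: "i \<in> I \<Longrightarrow> \<phi> \<in> Hom c (X i) \<Longrightarrow> fin_comb I X d \<iota> c m \<Longrightarrow> fin_comb I X d \<iota> c (\<iota> i \<cdot> \<phi> \<boxplus> m)"

lemma fin_comb_Hom: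
  assumes c: "coproduct I X d \<iota>" and "fin_comb I X d \<iota> c m"
  shows "m \<in> Hom c d"
  using assms(2) by (induction rule: fin_comb.induct) (use coproduct_Hom[OF c] in auto)

lemma fin_comb_add:
  assumes c: "coproduct I X d \<iota>" and "fin_comb I X d \<iota> c m" "fin_comb I X d \<iota> c m'"
  shows "fin_comb I X d \<iota> c (m \<boxplus> m')"
  using assms(2)
proof (induction rule: fin_comb.induct)
  case fin_comb_zero
  then show ?case using fin_comb_Hom[OF c assms(3)] assms(3) by simp
next
  case (fin_comb_step i \<phi> m)
  have "(\<iota> i \<cdot> \<phi> \<boxplus> m) \<boxplus> m' = \<iota> i \<cdot> \<phi> \<boxplus> (m \<boxplus> m')"
    using fin_comb_Hom[OF c assms(3)] fin_comb_Hom[OF c fin_comb_step(3)] fin_comb_step(2) coproduct_Hom[OF c fin_comb_step(1)]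
    by simp
  then show ?case using fin_comb.fin_comb_step[of i I \<phi> c X d \<iota>, OF fin_comb_step(1,2,4)] by simp
qed

lemma fin_comb_cmp:
  assumes c: "coproduct I X d \<iota>" and "fin_comb I X d \<iota> c m" and k: "k \<in> Hom c' c"
  shows "fin_comb I X d \<iota> c' (m \<cdot> k)"
  using assms(2)
proof (induction rule: fin_comb.induct)
  case fin_comb_zero
  then show ?case using k fin_comb.fin_comb_zero by simp
next
  case (fin_comb_step i \<phi> m)
  have "(\<iota> i \<cdot> \<phi> \<boxplus> m) \<cdot> k = \<iota> i \<cdot> (\<phi> \<cdot> k) \<boxplus> m \<cdot> k"
    using k fin_comb_Hom[OF c fin_comb_step(3)] fin_comb_step(2) coproduct_Hom[OF c fin_comb_step(1)]
    by (simp add: addm_cmp')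
  moreover have "\<phi> \<cdot> k \<in> Hom c' (X i)" using k fin_comb_step(2) by simp
  ultimately show ?case using fin_comb.fin_comb_step[OF fin_comb_step(1) _ fin_comb_step(4)] by metis
qed

lemma carrier_sum_hom_group:
  "carrier (sum_group I (\<lambda>i. hom_group c (X i))) =
    {\<phi> \<in> \<Pi>\<^sub>E i\<in>I. Hom c (X i). finite {i \<in> I. \<phi> i \<noteq> zerom T c (X i)}}"
  by (subst carrier_sum_group) (use hom_group in \<open>auto simp: comm_group_def hom_group_def\<close>)

text \<open>The coefficients of a finite combination are recovered by the projections, so the
  decomposition of an arrow is unique whenever it exists.\<close>

lemma coproduct_proj_msum:
  assumes c: "coproduct I X d \<iota>" and \<pi>: "\<And>i. i \<in> I \<Longrightarrow> \<pi> i \<in> Hom d (X i) \<and> \<pi> i \<cdot> \<iota> i = idm T (X i) \<and>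
    (\<forall>j\<in>I. j \<noteq> i \<longrightarrow> \<pi> i \<cdot> \<iota> j = zerom T (X j) (X i))"
    and A: "finite A" "A \<subseteq> I" and \<phi>: "\<And>i. i \<in> A \<Longrightarrow> \<phi> i \<in> Hom a (X i)" and j: "j \<in> I"
  shows "\<pi> j \<cdot> msum a d (\<lambda>i. \<iota> i \<cdot> \<phi> i) A = (if j \<in> A then \<phi> j else zerom T a (X j))"
proof -
  have "\<pi> j \<cdot> msum a d (\<lambda>i. \<iota> i \<cdot> \<phi> i) A = msum a (X j) (\<lambda>i. \<pi> j \<cdot> (\<iota> i \<cdot> \<phi> i)) A"
    by (rule cmp_msum) (use A \<phi> coproduct_Hom[OF c] \<pi>[OF j] in auto)
  also have "\<dots> = msum a (X j) (\<lambda>i. if i = j then \<phi> j else zerom T a (X j)) A"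
  proof (rule msum_cong)
    fix i assume i: "i \<in> A"
    then have iI: "i \<in> I" using A by blast
    have "\<pi> j \<cdot> (\<iota> i \<cdot> \<phi> i) = (\<pi> j \<cdot> \<iota> i) \<cdot> \<phi> i"
      using \<pi>[OF j, THEN conjunct1] coproduct_Hom[OF c iI] \<phi>[OF i] by simp
    also have "\<dots> = (if i = j then \<phi> j else zerom T a (X j))"
    proof (cases "i = j")
      case True
      then show ?thesis using \<pi>[OF j] \<phi>[OF i] by simp
    next
      case False
      then have "\<pi> j \<cdot> \<iota> i = zerom T (X i) (X j)" using \<pi>[OF j] iI by blast
      then show ?thesis using \<phi>[OF i] False by simp
    qed
    finally show "\<pi> j \<cdot> (\<iota> i \<cdot> \<phi> i) = (if i = j then \<phi> j else zerom T a (X j))" .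
    show "(if i = j then \<phi> j else zerom T a (X j)) \<in> Hom a (X j)" using \<phi>[OF i] by (cases "i = j") simp_all
  qed
  also have "\<dots> = (if j \<in> A then \<phi> j else zerom T a (X j))"
  proof (cases "j \<in> A")
    case True
    then show ?thesis using msum_delta[OF A(1) True \<phi>[OF True]] by simp
  next
    case False
    then have "msum a (X j) (\<lambda>i. if i = j then \<phi> j else zerom T a (X j)) A = zerom T a (X j)"
      by (intro msum_zero) auto
    then show ?thesis using False by simp
  qed
  finally show ?thesis .
qed

text \<open>Injectivity of the canonical map is automatic by the projections. For surjectivity, a
  preimage is built along the finite combination, adding one term to one coordinate at a
  time.\<close>

lemma compactI:
  assumes *: "\<And>I X d \<iota> m. small_coproduct I X d \<iota> \<Longrightarrow> m \<in> Hom c d \<Longrightarrow> fin_comb I X d \<iota> c m"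
  shows "compact c"
  unfolding compact_def
proof (intro allI impI)
  fix I X d \<iota> assume sc: "small_coproduct I X d \<iota>"
  then have cp: "coproduct I X d \<iota>" by (simp add: small_coproduct_def)
  let ?C = "carrier (sum_group I (\<lambda>i. hom_group c (X i)))"
  let ?S = "\<lambda>\<phi>. {i \<in> I. \<phi> i \<noteq> zerom T c (X i)}"
  let ?F = "\<lambda>\<phi>. msum c d (\<lambda>i. \<iota> i \<cdot> \<phi> i) (?S \<phi>)"
  have C: "\<phi> i \<in> Hom c (X i)" "finite (?S \<phi>)" if "\<phi> \<in> ?C" "i \<in> I" for \<phi> i
    using that by (auto simp: carrier_sum_hom_group PiE_iff)
  obtain \<pi> where \<pi>: "\<And>i. i \<in> I \<Longrightarrow> \<pi> i \<in> Hom d (X i) \<and> \<pi> i \<cdot> \<iota> i = idm T (X i) \<and>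
    (\<forall>j\<in>I. j \<noteq> i \<longrightarrow> \<pi> i \<cdot> \<iota> j = zerom T (X j) (X i))"
    using coproduct_proj[OF cp] by blast
  have proj: "\<pi> j \<cdot> ?F \<phi> = \<phi> j" if "\<phi> \<in> ?C" "j \<in> I" for \<phi> j
    using coproduct_proj_msum[OF cp \<pi>, of "?S \<phi>" \<phi> c j] C[OF that(1)] that(2) by auto
  show "bij_betw ?F ?C (Hom c d)"
    unfolding bij_betw_def
  proof
    show "inj_on ?F ?C"
    proof (rule inj_onI)
      fix \<phi> \<psi> assume a: "\<phi> \<in> ?C" "\<psi> \<in> ?C" "?F \<phi> = ?F \<psi>"
      show "\<phi> = \<psi>"
      proof (rule PiE_ext[of _ I "\<lambda>i. Hom c (X i)"])
        show "\<phi> i = \<psi> i" if "i \<in> I" for i using proj[OF a(1) that] proj[OF a(2) that] a(3) by simp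
      qed (use a in \<open>auto simp: carrier_sum_hom_group\<close>)
    qed
    have "?F \<phi> \<in> Hom c d" if "\<phi> \<in> ?C" for \<phi>
      by (rule msum_Hom) (use C[OF that] coproduct_Hom[OF cp] in auto)
    moreover have "m \<in> ?F ` ?C" if "m \<in> Hom c d" for m
      using *[OF sc that]
    proof (induction rule: fin_comb.induct)
      case fin_comb_zero
      have 1: "?F (\<lambda>i\<in>I. zerom T c (X i)) = zerom T c d" by (rule msum_zero) auto
      have 2: "(\<lambda>i\<in>I. zerom T c (X i)) \<in> ?C" by (auto simp: carrier_sum_hom_group)
      show ?case by (rule image_eqI[where f = ?F, OF 1[symmetric] 2])
    next
      case (fin_comb_step i \<psi> m)
      then obtain \<phi> where \<phi>: "\<phi> \<in> ?C" "m = ?F \<phi>" by blast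
      let ?\<phi> = "\<phi>(i := \<psi> \<boxplus> \<phi> i)"
      \<comment> \<open>Adding \<open>\<psi>\<close> may cancel the coordinate \<open>i\<close>, so
        the sums are compared over this set, which contains the supports of the old and the new
        family.\<close>
      let ?B = "insert i (?S \<phi>)"
      have fB: "finite ?B" "?B \<subseteq> I" using C(2)[OF \<phi>(1) fin_comb_step(1)] fin_comb_step(1) by auto
      have \<phi>': "?\<phi> j \<in> Hom c (X j)" if "j \<in> I" for j
        using C(1)[OF \<phi>(1) that] fin_comb_step(1,2) by auto
      have sub: "?S ?\<phi> \<subseteq> ?B" by auto
      have inC: "?\<phi> \<in> ?C"
        using \<phi>' \<phi>(1) fin_comb_step(1) finite_subset[OF sub fB(1)]
        by (auto simp: carrier_sum_hom_group PiE_iff extensional_def)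
      have i\<phi>: "\<iota> j \<cdot> \<phi> j \<in> Hom c d" "\<iota> j \<cdot> ?\<phi> j \<in> Hom c d" if "j \<in> I" for j
        using C(1)[OF \<phi>(1) that] \<phi>'[OF that] coproduct_Hom[OF cp that] by auto
      have i\<psi>: "\<iota> i \<cdot> \<psi> \<in> Hom c d" using fin_comb_step(1,2) coproduct_Hom[OF cp] by simp
      have "?F ?\<phi> = msum c d (\<lambda>j. \<iota> j \<cdot> ?\<phi> j) ?B"
      proof (rule msum_mono_neutral[OF fB(1) sub])
        fix j assume "j \<in> ?B - ?S ?\<phi>"
        then have j: "j \<in> I" and 0: "?\<phi> j = zerom T c (X j)" using fB(2) by blast+
        show "\<iota> j \<cdot> ?\<phi> j = zerom T c d" unfolding 0 using coproduct_Hom[OF cp j] by simp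
      next
        show "\<iota> j \<cdot> ?\<phi> j \<in> Hom c d" if "j \<in> ?B" for j using i\<phi>(2) fB(2) that by blast
      qed
      also have "\<dots> = msum c d (\<lambda>j. (if j = i then \<iota> i \<cdot> \<psi> else zerom T c d) \<boxplus> \<iota> j \<cdot> \<phi> j) ?B"
      proof (rule msum_cong)
        fix j assume "j \<in> ?B"
        then have j: "j \<in> I" using fB by blast
        show "\<iota> j \<cdot> ?\<phi> j = (if j = i then \<iota> i \<cdot> \<psi> else zerom T c d) \<boxplus> \<iota> j \<cdot> \<phi> j"
          using C(1)[OF \<phi>(1) j] fin_comb_step(2) coproduct_Hom[OF cp j] by (auto simp: cmp_addm')
        show "(if j = i then \<iota> i \<cdot> \<psi> else zerom T c d) \<boxplus> \<iota> j \<cdot> \<phi> j \<in> Hom c d"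
          using i\<phi>(1)[OF j] i\<psi> by (auto intro: addm_Hom)
      qed
      also have "\<dots> = msum c d (\<lambda>j. if j = i then \<iota> i \<cdot> \<psi> else zerom T c d) ?B \<boxplus> msum c d (\<lambda>j. \<iota> j \<cdot> \<phi> j) ?B"
        by (rule msum_add) (use fB i\<phi> i\<psi> in auto)
      also have "msum c d (\<lambda>j. if j = i then \<iota> i \<cdot> \<psi> else zerom T c d) ?B = \<iota> i \<cdot> \<psi>"
        by (rule msum_delta[OF fB(1)]) (use i\<psi> in auto)
      also have "msum c d (\<lambda>j. \<iota> j \<cdot> \<phi> j) ?B = ?F \<phi>"
        by (rule msum_mono_neutral[OF fB(1), symmetric]) (use fB i\<phi> coproduct_Hom[OF cp] in auto)
      finally have "?F ?\<phi> = \<iota> i \<cdot> \<psi> \<boxplus> m" unfolding \<phi>(2) .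
      from image_eqI[where f = ?F, OF this[symmetric] inC] show ?case .
    qed
    ultimately show "?F ` ?C = Hom c d" by blast
  qed
qed

lemma compact_msum:
  assumes "compact c" "small_coproduct I X d \<iota>" "m \<in> Hom c d"
  shows "\<exists>A \<phi>. finite A \<and> A \<subseteq> I \<and> (\<forall>i\<in>A. \<phi> i \<in> Hom c (X i)) \<and> msum c d (\<lambda>i. \<iota> i \<cdot> \<phi> i) A = m"
proof -
  let ?C = "carrier (sum_group I (\<lambda>i. hom_group c (X i)))"
  let ?S = "\<lambda>\<phi>. {i \<in> I. \<phi> i \<noteq> zerom T c (X i)}"
  have "m \<in> (\<lambda>\<phi>. msum c d (\<lambda>i. \<iota> i \<cdot> \<phi> i) (?S \<phi>)) ` ?C"
    using assms unfolding compact_def bij_betw_def by blast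
  then obtain \<phi> where \<phi>: "\<phi> \<in> ?C" "msum c d (\<lambda>i. \<iota> i \<cdot> \<phi> i) (?S \<phi>) = m" by auto
  then show ?thesis
    by (intro exI[of _ "?S \<phi>"] exI[of _ \<phi>]) (auto simp: carrier_sum_hom_group PiE_iff)
qed

lemma fin_comb_msum:
  assumes "coproduct I X d \<iota>" "finite A" "A \<subseteq> I" "\<And>i. i \<in> A \<Longrightarrow> \<phi> i \<in> Hom c (X i)"
  shows "fin_comb I X d \<iota> c (msum c d (\<lambda>i. \<iota> i \<cdot> \<phi> i) A)"
proof (rule msum_induct[OF assms(2)])
  show "\<iota> a \<cdot> \<phi> a \<in> Hom c d" if "a \<in> A" for a
    using coproduct_Hom[OF assms(1), of a] assms(3,4) that by auto
  show "fin_comb I X d \<iota> c (\<iota> a \<cdot> \<phi> a \<boxplus> m)" if "a \<in> A" "fin_comb I X d \<iota> c m" for a m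
    using fin_comb_step assms(3,4) that by blast
qed (rule fin_comb_zero)

lemma compactD:
  assumes "compact c" "small_coproduct I X d \<iota>" "m \<in> Hom c d"
  shows "fin_comb I X d \<iota> c m"
proof -
  obtain A \<phi> where "finite A" "A \<subseteq> I" "\<forall>i\<in>A. \<phi> i \<in> Hom c (X i)" and m: "msum c d (\<lambda>i. \<iota> i \<cdot> \<phi> i) A = m"
    using compact_msum[OF assms] by blast
  then show ?thesis using fin_comb_msum[of I X d \<iota> A \<phi> c] assms(2) unfolding m[symmetric] small_coproduct_def by blast
qed

lemma compact_retract:
  assumes s: "s \<in> Hom x b" and r: "r \<in> Hom b x" and rs: "r \<cdot> s = idm T x" and b: "compact b"
  shows "compact x"
proof (rule compactI)
  fix I X d \<iota> m assume sc: "small_coproduct I X d \<iota>" and m: "m \<in> Hom x d"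
  have "m \<cdot> r \<in> Hom b d" using m r by simp
  from fin_comb_cmp[OF _ compactD[OF b sc this] s] sc have "fin_comb I X d \<iota> x ((m \<cdot> r) \<cdot> s)"
    by (simp only: small_coproduct_def)
  moreover have "(m \<cdot> r) \<cdot> s = m" using m r s rs by simp
  ultimately show "fin_comb I X d \<iota> x m" by simp
qed

lemma compact_zero: "zero_object z \<Longrightarrow> compact z"
  by (rule compactI) (metis Hom_iff fin_comb_zero zero_object_from)

end

section \<open>Suspensions and cones of compact objects; orthogonality\<close>

context triangulated_category
begin

lemma coproduct_shO_int:
  assumes c: "coproduct I X d \<iota>"
  shows "coproduct I (\<lambda>i. shO_int n (X i)) (shO_int n d) (\<lambda>i. shM_int n (\<iota> i))"
  unfolding coproduct_def
proof (intro conjI ballI allI impI)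
  show "shM_int n (\<iota> i) \<in> Hom (shO_int n (X i)) (shO_int n d)" if "i \<in> I" for i
    using coproduct_Hom[OF c that] by simp
next
  fix y \<phi> assume \<phi>: "\<forall>i\<in>I. \<phi> i \<in> Hom (shO_int n (X i)) y"
  obtain g where g: "g \<in> Hom d (shO_int (- n) y)" "\<And>i. i \<in> I \<Longrightarrow> g \<cdot> \<iota> i = shM_int (- n) (\<phi> i)"
    using coproduct_ex[OF c, of "\<lambda>i. shM_int (- n) (\<phi> i)" "shO_int (- n) y"] \<phi> by auto
  show "\<exists>!g. g \<in> Hom (shO_int n d) y \<and> (\<forall>i\<in>I. g \<cdot> shM_int n (\<iota> i) = \<phi> i)"
  proof (rule ex1I[of _ "shM_int n g"])
    have "shM_int n g \<cdot> shM_int n (\<iota> i) = \<phi> i" if "i \<in> I" for i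
    proof -
      have "shM_int n g \<cdot> shM_int n (\<iota> i) = shM_int n (g \<cdot> \<iota> i)"
        using g(1) coproduct_Hom[OF c that] by (simp add: shM_int_cmp)
      then show ?thesis unfolding g(2)[OF that] by simp
    qed
    then show "shM_int n g \<in> Hom (shO_int n d) y \<and> (\<forall>i\<in>I. shM_int n g \<cdot> shM_int n (\<iota> i) = \<phi> i)"
      using g(1) by simp
  next
    fix k assume k: "k \<in> Hom (shO_int n d) y \<and> (\<forall>i\<in>I. k \<cdot> shM_int n (\<iota> i) = \<phi> i)"
    have "shM_int (- n) k = g"
    proof (rule coproduct_eqI[OF c _ g(1)])
      show "shM_int (- n) k \<in> Hom d (shO_int (- n) y)" using k by simp
      fix i assume i: "i \<in> I"
      have "shM_int (- n) k \<cdot> \<iota> i = shM_int (- n) (k \<cdot> shM_int n (\<iota> i))"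
        using k coproduct_Hom[OF c i] by (simp add: shM_int_cmp)
      also have "\<dots> = g \<cdot> \<iota> i" using g(2)[OF i] k i by auto
      finally show "shM_int (- n) k \<cdot> \<iota> i = g \<cdot> \<iota> i" .
    qed
    then have "shM_int n (shM_int (- n) k) = shM_int n g" by simp
    then show "k = shM_int n g" by simp
  qed
qed

lemma small_coproduct_shO_int:
  "small_coproduct I X d \<iota> \<Longrightarrow> small_coproduct I (\<lambda>i. shO_int n (X i)) (shO_int n d) (\<lambda>i. shM_int n (\<iota> i))"
  by (simp add: small_coproduct_def coproduct_shO_int)

lemma fin_comb_shM_int:
  assumes c: "coproduct I X d \<iota>" and "fin_comb I X d \<iota> c m"
  shows "fin_comb I (\<lambda>i. shO_int n (X i)) (shO_int n d) (\<lambda>i. shM_int n (\<iota> i)) (shO_int n c) (shM_int n m)"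
  using assms(2)
proof (induction rule: fin_comb.induct)
  case (fin_comb_step i \<phi> m)
  have "shM_int n (\<iota> i \<cdot> \<phi> \<boxplus> m) = shM_int n (\<iota> i) \<cdot> shM_int n \<phi> \<boxplus> shM_int n m"
    using fin_comb_Hom[OF c fin_comb_step(3)] fin_comb_step(2) coproduct_Hom[OF c fin_comb_step(1)]
    by (simp add: shM_int_addm shM_int_cmp)
  moreover have "shM_int n \<phi> \<in> Hom (shO_int n c) (shO_int n (X i))" using fin_comb_step(2) by simp
  ultimately show ?case
    using fin_comb.fin_comb_step[where \<iota> = "\<lambda>i. shM_int n (\<iota> i)" and X = "\<lambda>i. shO_int n (X i)", OF fin_comb_step(1) _ fin_comb_step(4)]
    by metis
qed (simp add: fin_comb.fin_comb_zero)

lemma compact_shO_int: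
  assumes c: "compact c"
  shows "compact (shO_int n c)"
proof (rule compactI)
  fix I X d \<iota> m assume sc: "small_coproduct I X d \<iota>" and m: "m \<in> Hom (shO_int n c) d"
  have sc': "small_coproduct I (\<lambda>i. shO_int (- n) (X i)) (shO_int (- n) d) (\<lambda>i. shM_int (- n) (\<iota> i))"
    by (rule small_coproduct_shO_int[OF sc])
  have "fin_comb I (\<lambda>i. shO_int (- n) (X i)) (shO_int (- n) d) (\<lambda>i. shM_int (- n) (\<iota> i)) c (shM_int (- n) m)"
    by (rule compactD[OF c sc']) (use m in simp)
  from fin_comb_shM_int[OF _ this, of n] sc' show "fin_comb I X d \<iota> (shO_int n c) m"
    by (simp add: small_coproduct_def)
qed

lemma compact_shO_int_iff [simp]: "compact (shO_int n c) \<longleftrightarrow> compact c"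
  using compact_shO_int[of c n] compact_shO_int[of "shO_int n c" "- n"] by auto

lemma compact_shO_iff [simp]: "compact (shO T c) \<longleftrightarrow> compact c"
  using compact_shO_int_iff[of 1 c] by (simp add: shO_int_1)

text \<open>An arrow \<open>m\<close> out of the cone restricts along \<open>g\<close> to a finite
  combination. Its coefficients are projections of \<open>m \<cdot> g\<close>, so they kill
  \<open>f\<close> and extend over the cone. After subtracting the extended combination, the rest of
  \<open>m\<close> kills \<open>g\<close>, hence comes through \<open>h\<close> from a suspension of
  the source of \<open>f\<close>, which is compact too.\<close>

lemma compact_cone:
  assumes t: "(f, g, h) \<in> tri T" and x: "compact (src T f)" and y: "compact (tgt T f)"
  shows "compact (tgt T g)"
proof (rule compactI)
  note [simp] = tri_typed[OF t]
  fix I X d \<iota> m assume sc: "small_coproduct I X d \<iota>" and m: "m \<in> Hom (tgt T g) d"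
  then have c: "coproduct I X d \<iota>" by (simp add: small_coproduct_def)
  have m' [simp]: "src T m = tgt T g" "tgt T m = d" using m by auto
  obtain \<pi> where \<pi>: "\<And>i. i \<in> I \<Longrightarrow> \<pi> i \<in> Hom d (X i) \<and> \<pi> i \<cdot> \<iota> i = idm T (X i) \<and>
    (\<forall>j\<in>I. j \<noteq> i \<longrightarrow> \<pi> i \<cdot> \<iota> j = zerom T (X j) (X i))"
    using coproduct_proj[OF c] by blast
  have mg: "m \<cdot> g \<in> Hom (tgt T f) d" by simp
  obtain A \<phi> where A: "finite A" "A \<subseteq> I" and \<phi>: "\<And>i. i \<in> A \<Longrightarrow> \<phi> i \<in> Hom (tgt T f) (X i)"
    and sum: "msum (tgt T f) d (\<lambda>i. \<iota> i \<cdot> \<phi> i) A = m \<cdot> g"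
    using compact_msum[OF y sc mg] by blast
  have "\<exists>k. k \<in> Hom (tgt T g) (X i) \<and> k \<cdot> g = \<phi> i" if i: "i \<in> A" for i
  proof -
    have iI: "i \<in> I" using i A by blast
    have "\<phi> i = \<pi> i \<cdot> (m \<cdot> g)"
      using coproduct_proj_msum[OF c \<pi> A \<phi> iI] sum i by simp
    then have "\<phi> i \<cdot> f = \<pi> i \<cdot> (m \<cdot> (g \<cdot> f))" using \<pi>[OF iI] by simp
    also have "\<dots> = zerom T (src T f) (X i)" using tri_cmp_zero1[OF t] \<pi>[OF iI] by simp
    finally have "\<exists>n. src T n = tgt T g \<and> tgt T n = tgt T (\<phi> i) \<and> n \<cdot> g = \<phi> i"
      using \<phi>[OF i] by (intro tri_weak_cokernel[OF t, of _ "src T f" "X i"]) simp_all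
    then show ?thesis using \<phi>[OF i] by auto
  qed
  then obtain k where k: "\<And>i. i \<in> A \<Longrightarrow> k i \<in> Hom (tgt T g) (X i) \<and> k i \<cdot> g = \<phi> i" by metis
  define b where "b = msum (tgt T g) d (\<lambda>i. \<iota> i \<cdot> k i) A"
  have b: "fin_comb I X d \<iota> (tgt T g) b"
    unfolding b_def by (rule fin_comb_msum[OF c A]) (use k in blast)
  have ik: "\<iota> i \<cdot> k i \<in> Hom (tgt T g) d" if "i \<in> A" for i
    using k[OF that] coproduct_Hom[OF c, of i] A that by auto
  have b' [simp]: "src T b = tgt T g" "tgt T b = d" using fin_comb_Hom[OF c b] by auto
  have "b \<cdot> g = msum (tgt T f) d (\<lambda>i. (\<iota> i \<cdot> k i) \<cdot> g) A"
    unfolding b_def by (rule msum_cmp) (use A ik in auto)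
  also have "\<dots> = msum (tgt T f) d (\<lambda>i. \<iota> i \<cdot> \<phi> i) A"
  proof (rule msum_cong)
    fix i assume i: "i \<in> A"
    then have "i \<in> I" using A by blast
    then show "(\<iota> i \<cdot> k i) \<cdot> g = \<iota> i \<cdot> \<phi> i" "\<iota> i \<cdot> \<phi> i \<in> Hom (tgt T f) d"
      using k[OF i] \<phi>[OF i] coproduct_Hom[OF c] by auto
  qed
  finally have bg: "b \<cdot> g = m \<cdot> g" using sum by simp
  have "(m \<boxplus> negm b) \<cdot> g = zerom T (tgt T f) d" by (simp add: addm_cmp' bg)
  then have "\<exists>n. src T n = shO T (src T f) \<and> tgt T n = tgt T (m \<boxplus> negm b) \<and> n \<cdot> h = m \<boxplus> negm b"
    by (intro tri_weak_cokernel2[OF t, of _ "tgt T f" d]) simp_all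
  then obtain l where l: "src T l = shO T (src T f)" "tgt T l = tgt T (m \<boxplus> negm b)" "l \<cdot> h = m \<boxplus> negm b" by blast
  have "fin_comb I X d \<iota> (shO T (src T f)) l"
    by (rule compactD[OF _ sc]) (use x l in simp_all)
  then have "fin_comb I X d \<iota> (tgt T g) (l \<cdot> h)" by (rule fin_comb_cmp[OF c]) simp
  then have "fin_comb I X d \<iota> (tgt T g) (l \<cdot> h \<boxplus> b)" using b by (rule fin_comb_add[OF c])
  then show "fin_comb I X d \<iota> (tgt T g) m" unfolding l(3) by simp
qed

text \<open>Vanishing of Hom in all degrees at once, which makes the relation invariant under
  suspension in either variable.\<close>

definition orth :: "'o \<Rightarrow> 'o \<Rightarrow> bool" where
  "orth s y \<longleftrightarrow> (\<forall>n m. m \<in> Hom s (shO_int n y) \<longrightarrow> m = zerom T s (shO_int n y))"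

lemma orthD: "orth s y \<Longrightarrow> src T m = s \<Longrightarrow> tgt T m = shO_int n y \<Longrightarrow> m = zerom T s (shO_int n y)"
  unfolding orth_def by auto

lemma orth_Hom: "orth s y \<Longrightarrow> Hom s y = {zerom T s y}"
  using orthD[of s y _ 0] by auto

lemma orth_shO_int_right [simp]: "orth s (shO_int k y) \<longleftrightarrow> orth s y"
proof -
  have "orth s (shO_int k y)" if "orth s y" for k y using that unfolding orth_def by simp
  from this[of y k] this[of "shO_int k y" "- k"] show ?thesis by auto
qed

lemma orth_shO_int_left [simp]: "orth (shO_int k s) y \<longleftrightarrow> orth s y"
proof -
  have "orth (shO_int k s) y" if o: "orth s y" for k s
    unfolding orth_def
  proof (intro allI impI)
    fix n m assume m: "m \<in> Hom (shO_int k s) (shO_int n y)"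
    have "shM_int (- k) m = zerom T s (shO_int (- k + n) y)" by (rule orthD[OF o]) (use m in simp_all)
    then have "shM_int k (shM_int (- k) m) = shM_int k (zerom T s (shO_int (- k + n) y))" by simp
    then show "m = zerom T (shO_int k s) (shO_int n y)" by simp
  qed
  from this[of s k] this[of "shO_int k s" "- k"] show ?thesis by auto
qed

lemma orth_shO_left [simp]: "orth (shO T s) y \<longleftrightarrow> orth s y" and orth_shO_right [simp]: "orth s (shO T y) \<longleftrightarrow> orth s y"
  by (simp_all flip: shO_int_1)

lemma orth_zero_left: "zero_object s \<Longrightarrow> orth s y"
  unfolding orth_def using zero_object_from by fastforce

lemma orth_zero_right: "zero_object y \<Longrightarrow> orth s y"
  unfolding orth_def using zero_object_to zero_object_shO_int by (metis Hom_iff)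

text \<open>This is why orthogonality to a localizing subcategory may be tested on generators
  (\<open>Loc_orth\<close>).\<close>

lemma localizing_orth_left: "localizing {s. orth s y}"
  unfolding localizing_def triangulated_sub_def
proof (intro conjI allI impI; (elim CollectE)?; (intro CollectI)?)
  fix f g h assume t: "(f, g, h) \<in> tri T" and f: "orth (src T f) y" "orth (tgt T f) y"
  note [simp] = tri_typed[OF t]
  show "orth (tgt T g) y"
    unfolding orth_def
  proof (intro allI impI)
    fix n m assume m: "m \<in> Hom (tgt T g) (shO_int n y)"
    then have [simp]: "src T m = tgt T g" "tgt T m = shO_int n y" by auto
    have "m \<cdot> g = zerom T (tgt T f) (shO_int n y)" by (rule orthD[OF f(2)]) simp_all
    then have "\<exists>k. src T k = shO T (src T f) \<and> tgt T k = tgt T m \<and> k \<cdot> h = m"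
      by (rule tri_weak_cokernel2[OF t, rotated]) simp_all
    then obtain k where k: "src T k = shO T (src T f)" "tgt T k = tgt T m" "k \<cdot> h = m" by blast
    have "k = zerom T (shO T (src T f)) (shO_int n y)"
      by (rule orthD[of "shO T (src T f)"]) (use f k in simp_all)
    then show "m = zerom T (tgt T g) (shO_int n y)" unfolding k(3)[symmetric] by simp
  qed
next
  fix I X d \<iota> assume sc: "small_coproduct I X d \<iota>" and X: "\<forall>i\<in>I. X i \<in> {s. orth s y}"
  then have c: "coproduct I X d \<iota>" by (simp add: small_coproduct_def)
  show "orth d y"
    unfolding orth_def
  proof (intro allI impI)
    fix n m assume m: "m \<in> Hom d (shO_int n y)"
    show "m = zerom T d (shO_int n y)"
    proof (rule coproduct_eqI[OF c m])
      fix i assume i: "i \<in> I"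
      have "m \<cdot> \<iota> i = zerom T (X i) (shO_int n y)"
        by (rule orthD) (use X i m coproduct_Hom[OF c i] in auto)
      then show "m \<cdot> \<iota> i = zerom T d (shO_int n y) \<cdot> \<iota> i" using coproduct_Hom[OF c i] by simp
    qed simp
  qed
qed (auto simp: orth_zero_left)

lemma localizing_triangulated: "localizing L \<Longrightarrow> triangulated_sub L"
  by (simp add: localizing_def)

lemma localizing_Loc: "localizing (Loc S)"
  unfolding localizing_def triangulated_sub_def Loc_def by blast

lemma Loc_superset: "S \<subseteq> Loc S"
  unfolding Loc_def by blast

lemma Loc_minimal: "localizing L \<Longrightarrow> S \<subseteq> L \<Longrightarrow> Loc S \<subseteq> L"
  unfolding Loc_def by blast

lemma Loc_mono: "S \<subseteq> S' \<Longrightarrow> Loc S \<subseteq> Loc S'"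
  using Loc_minimal[OF localizing_Loc] Loc_superset by blast

lemma Loc_orth: "(\<And>s. s \<in> S \<Longrightarrow> orth s y) \<Longrightarrow> s \<in> Loc S \<Longrightarrow> orth s y"
  using Loc_minimal[OF localizing_orth_left, of S y] by blast

end

section \<open>Localizing subcategories and compact objects under the tensor product\<close>

context tensor_triangulated_category
begin

lemma localizing_tens_left:
  assumes L: "localizing L"
  shows "localizing {s. s \<boxtimes> t \<in> L}"
  unfolding localizing_def triangulated_sub_def
proof (intro conjI allI impI; (elim CollectE)?; (intro CollectI)?)
  note S = localizing_triangulated[OF L]
  show "z \<boxtimes> t \<in> L" if "zero_object z" for z
    using triangulated_sub_zero[OF S] zero_object_tens_left[OF that] by blast
  show "shO T x \<in> {s. s \<boxtimes> t \<in> L} \<longleftrightarrow> x \<in> {s. s \<boxtimes> t \<in> L}" for x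
    using triangulated_sub_isomorphic[OF S] shO_tens_isomorphic[of x t] isomorphic_sym triangulated_sub_shO[OF S]
    by blast
  show "tgt T g \<boxtimes> t \<in> L" if "(f, g, h) \<in> tri T" "src T f \<boxtimes> t \<in> L" "tgt T f \<boxtimes> t \<in> L" for f g h
    using triangulated_sub_cone[OF S tens_tri[OF that(1), of t]] that by simp
  show "d \<boxtimes> t \<in> L" if sc: "small_coproduct I X d \<iota>" "\<forall>i\<in>I. X i \<in> {s. s \<boxtimes> t \<in> L}" for I X d \<iota>
  proof -
    have "small_coproduct I (\<lambda>i. X i \<boxtimes> t) (d \<boxtimes> t) (\<lambda>i. \<iota> i \<boxtimes>\<^sub>m idm T t)"
      using sc(1) coproduct_tens unfolding small_coproduct_def by blast
    then show ?thesis using L sc(2) unfolding localizing_def by blast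
  qed
qed

lemma localizing_tens_right:
  assumes L: "localizing L"
  shows "localizing {t. s \<boxtimes> t \<in> L}"
proof -
  have "{t. s \<boxtimes> t \<in> L} = {t. t \<boxtimes> s \<in> L}"
    using triangulated_sub_isomorphic[OF localizing_triangulated[OF L]] tens_comm_isomorphic by blast
  then show ?thesis using localizing_tens_left[OF L] by simp
qed

text \<open>An arrow from x \<otimes> a to a coproduct is transposed to one from \<open>x\<close> to
  the coproduct tensored with the dual of \<open>a\<close>, which is again a coproduct. Compactness
  of \<open>x\<close> decomposes it, and naturality of the counit \<open>\<epsilon>\<close> carries
  the decomposition back.\<close>

lemma compact_tens_rigid:
  assumes x: "compact x" and a: "rigid a"
  shows "compact (x \<boxtimes> a)"
proof (rule compactI)
  fix I X d \<iota> m assume sc: "small_coproduct I X d \<iota>" and m: "m \<in> Hom (x \<boxtimes> a) d"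
  then have c: "coproduct I X d \<iota>" by (simp add: small_coproduct_def)
  obtain b \<eta> \<epsilon> where \<eta>: "\<And>x. \<eta> x \<in> Hom x ((x \<boxtimes> a) \<boxtimes> b)" and \<epsilon>: "\<And>y. \<epsilon> y \<in> Hom ((y \<boxtimes> b) \<boxtimes> a) y"
    and nat: "\<And>f y y'. f \<in> Hom y y' \<Longrightarrow> \<epsilon> y' \<cdot> ((f \<boxtimes>\<^sub>m idm T b) \<boxtimes>\<^sub>m idm T a) = f \<cdot> \<epsilon> y"
    and unit: "\<And>x. \<epsilon> (x \<boxtimes> a) \<cdot> (\<eta> x \<boxtimes>\<^sub>m idm T a) = idm T (x \<boxtimes> a)"
    by (rule rigid_transpose[OF a]) (rule that; assumption)
  have [simp]: "src T (\<eta> x) = x" "tgt T (\<eta> x) = (x \<boxtimes> a) \<boxtimes> b" "src T (\<epsilon> y) = (y \<boxtimes> b) \<boxtimes> a" "tgt T (\<epsilon> y) = y" for x y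
    using \<eta>[of x] \<epsilon>[of y] by auto
  have [simp]: "src T m = x \<boxtimes> a" "tgt T m = d" using m by auto
  have sc': "small_coproduct I (\<lambda>i. X i \<boxtimes> b) (d \<boxtimes> b) (\<lambda>i. \<iota> i \<boxtimes>\<^sub>m idm T b)"
    using sc coproduct_tens unfolding small_coproduct_def by blast
  define m' where "m' = (m \<boxtimes>\<^sub>m idm T b) \<cdot> \<eta> x"
  have m': "m' \<in> Hom x (d \<boxtimes> b)" by (simp add: m'_def)
  have "fin_comb I X d \<iota> (x \<boxtimes> a) (\<epsilon> d \<cdot> (m' \<boxtimes>\<^sub>m idm T a))"
    using compactD[OF x sc' m']
  proof (induction rule: fin_comb.induct)
    case (fin_comb_step i \<phi> n)
    have \<iota> [simp]: "src T (\<iota> i) = X i" "tgt T (\<iota> i) = d" using coproduct_Hom[OF c fin_comb_step(1)] by auto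
    have \<phi> [simp]: "src T \<phi> = x" "tgt T \<phi> = X i \<boxtimes> b" using fin_comb_step(2) by auto
    have n [simp]: "src T n = x" "tgt T n = d \<boxtimes> b"
      using fin_comb_Hom[OF _ fin_comb_step(3)] sc' by (auto simp: small_coproduct_def)
    have "\<epsilon> d \<cdot> (((\<iota> i \<boxtimes>\<^sub>m idm T b) \<cdot> \<phi> \<boxplus> n) \<boxtimes>\<^sub>m idm T a)
       = \<epsilon> d \<cdot> (((\<iota> i \<boxtimes>\<^sub>m idm T b) \<boxtimes>\<^sub>m idm T a) \<cdot> (\<phi> \<boxtimes>\<^sub>m idm T a)) \<boxplus> \<epsilon> d \<cdot> (n \<boxtimes>\<^sub>m idm T a)"
      by (simp add: addm_tens tens_merge cmp_addm')
    also have "\<epsilon> d \<cdot> (((\<iota> i \<boxtimes>\<^sub>m idm T b) \<boxtimes>\<^sub>m idm T a) \<cdot> (\<phi> \<boxtimes>\<^sub>m idm T a)) = \<iota> i \<cdot> (\<epsilon> (X i) \<cdot> (\<phi> \<boxtimes>\<^sub>m idm T a))"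
      by (rule cmp_eq_cmp[OF nat]) simp_all
    finally have eq: "\<epsilon> d \<cdot> (((\<iota> i \<boxtimes>\<^sub>m idm T b) \<cdot> \<phi> \<boxplus> n) \<boxtimes>\<^sub>m idm T a)
       = \<iota> i \<cdot> (\<epsilon> (X i) \<cdot> (\<phi> \<boxtimes>\<^sub>m idm T a)) \<boxplus> \<epsilon> d \<cdot> (n \<boxtimes>\<^sub>m idm T a)" .
    show ?case unfolding eq
      by (rule fin_comb.fin_comb_step[OF fin_comb_step(1) _ fin_comb_step(4)]) simp
  qed (simp add: fin_comb.fin_comb_zero)
  moreover have "\<epsilon> d \<cdot> (m' \<boxtimes>\<^sub>m idm T a) = m"
  proof -
    have "\<epsilon> d \<cdot> (m' \<boxtimes>\<^sub>m idm T a) = \<epsilon> d \<cdot> (((m \<boxtimes>\<^sub>m idm T b) \<boxtimes>\<^sub>m idm T a) \<cdot> (\<eta> x \<boxtimes>\<^sub>m idm T a))"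
      by (simp add: m'_def tens_merge)
    also have "\<dots> = m \<cdot> (\<epsilon> (x \<boxtimes> a) \<cdot> (\<eta> x \<boxtimes>\<^sub>m idm T a))"
      by (rule cmp_eq_cmp[OF nat]) simp_all
    finally show ?thesis by (simp add: unit)
  qed
  ultimately show "fin_comb I X d \<iota> (x \<boxtimes> a) m" by simp
qed

end

subsection \<open>Localization\<close>

context rigidly_compactly_generated
begin

lemma compact_tens: "compact x \<Longrightarrow> compact a \<Longrightarrow> compact (x \<boxtimes> a)"
  using compact_tens_rigid compact_iff_rigid by blast

lemma compact_unit: "compact \<bbbone>"
  using rigid_unit compact_iff_rigid by blast

text \<open>The index set may have any type, in particular consist of pairs of an object and an
  arrow; the bijection \<open>h\<close> leads back to indices in \<open>univ\<close>.\<close>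

definition small_coprod :: "'a set \<Rightarrow> ('a \<Rightarrow> 'o) \<Rightarrow> 'o \<Rightarrow> ('a \<Rightarrow> 'm) \<Rightarrow> bool" where
  "small_coprod A X d \<iota> \<longleftrightarrow> (\<exists>I h. bij_betw h I A \<and> small_coproduct I (\<lambda>i. X (h i)) d (\<lambda>i. \<iota> (h i)))"

lemma ex_small_coprod:
  assumes A: "small A"
  shows "\<exists>d \<iota>. small_coprod A X d \<iota>"
proof -
  obtain I h where I: "I \<subseteq> univ T" "small I" and h: "bij_betw h I A" using small_reindex[OF A] by blast
  obtain d \<iota> where c: "coproduct I (\<lambda>i. X (h i)) d \<iota>" using ex_coproduct[OF I] by blast
  have "inv_into I h (h i) = i" if "i \<in> I" for i using h that by (auto simp: bij_betw_def)
  then have "coproduct I (\<lambda>i. X (h i)) d (\<lambda>i. \<iota> (inv_into I h (h i)))"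
    using c unfolding coproduct_def by simp
  then show ?thesis unfolding small_coprod_def small_coproduct_def
    using h I by (intro exI[of _ d] exI[of _ "\<lambda>a. \<iota> (inv_into I h a)"]) blast
qed

lemma small_coprod_Hom: "small_coprod A X d \<iota> \<Longrightarrow> a \<in> A \<Longrightarrow> \<iota> a \<in> Hom (X a) d"
  unfolding small_coprod_def small_coproduct_def bij_betw_def coproduct_def by blast

lemma small_coprod_ex:
  assumes "small_coprod A X d \<iota>" "\<And>a. a \<in> A \<Longrightarrow> \<phi> a \<in> Hom (X a) y"
  shows "\<exists>g. g \<in> Hom d y \<and> (\<forall>a\<in>A. g \<cdot> \<iota> a = \<phi> a)"
proof -
  obtain I h where h: "h ` I = A" and c: "coproduct I (\<lambda>i. X (h i)) d (\<lambda>i. \<iota> (h i))"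
    using assms(1) unfolding small_coprod_def small_coproduct_def bij_betw_def by blast
  show ?thesis using coproduct_ex[OF c, of "\<lambda>i. \<phi> (h i)" y] assms(2) h by blast
qed

lemma small_coprod_eqI:
  assumes "small_coprod A X d \<iota>" "g \<in> Hom d y" "g' \<in> Hom d y" "\<And>a. a \<in> A \<Longrightarrow> g \<cdot> \<iota> a = g' \<cdot> \<iota> a"
  shows "g = g'"
proof -
  obtain I h where h: "h ` I = A" and c: "coproduct I (\<lambda>i. X (h i)) d (\<lambda>i. \<iota> (h i))"
    using assms(1) unfolding small_coprod_def small_coproduct_def bij_betw_def by blast
  show ?thesis by (rule coproduct_eqI[OF c assms(2,3)]) (use assms(4) h in blast)
qed

lemma small_coprod_localizing:
  "small_coprod A X d \<iota> \<Longrightarrow> localizing L \<Longrightarrow> (\<And>a. a \<in> A \<Longrightarrow> X a \<in> L) \<Longrightarrow> d \<in> L"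
  unfolding small_coprod_def bij_betw_def localizing_def by blast

lemma small_coprod_msum:
  assumes sc: "small_coprod A X d \<iota>" and e: "compact e" and m: "m \<in> Hom e d"
  shows "\<exists>B \<psi>. finite B \<and> B \<subseteq> A \<and> (\<forall>a\<in>B. \<psi> a \<in> Hom e (X a)) \<and> msum e d (\<lambda>a. \<iota> a \<cdot> \<psi> a) B = m"
proof -
  obtain I h where h: "bij_betw h I A" and c: "small_coproduct I (\<lambda>i. X (h i)) d (\<lambda>i. \<iota> (h i))"
    using sc unfolding small_coprod_def by blast
  define k where "k = inv_into I h"
  have kh: "k (h i) = i" if "i \<in> I" for i
    using h that unfolding k_def by (auto simp: bij_betw_def)
  obtain B \<phi> where B: "finite B" "B \<subseteq> I" and \<phi>: "\<forall>i\<in>B. \<phi> i \<in> Hom e (X (h i))"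
    and sum: "msum e d (\<lambda>i. \<iota> (h i) \<cdot> \<phi> i) B = m" using compact_msum[OF e c m] by blast
  interpret H: comm_group "hom_group e d" by (rule hom_group)
  have inj: "inj_on h B" using h B(2) by (meson bij_betw_def inj_on_subset)
  have hB: "h ` B \<subseteq> A" using h B(2) by (auto simp: bij_betw_def)
  have ty: "\<iota> (h i) \<cdot> \<phi> i \<in> Hom e d" if "i \<in> B" for i
    using small_coprod_Hom[OF sc, of "h i"] hB \<phi> that by auto
  have ty': "(\<lambda>a. \<iota> a \<cdot> \<phi> (k a)) \<in> h ` B \<rightarrow> carrier (hom_group e d)"
  proof
    fix a assume "a \<in> h ` B"
    then obtain i where i: "i \<in> B" "a = h i" by blast
    then have "k a = i" using kh[of i] B(2) by blast
    then show "\<iota> a \<cdot> \<phi> (k a) \<in> carrier (hom_group e d)" using ty[OF i(1)] i(2) by (simp add: hom_group_def)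
  qed
  have "msum e d (\<lambda>a. \<iota> a \<cdot> \<phi> (k a)) (h ` B) = msum e d (\<lambda>i. \<iota> (h i) \<cdot> \<phi> (k (h i))) B"
    by (rule H.finprod_reindex[OF ty' inj])
  also have "\<dots> = msum e d (\<lambda>i. \<iota> (h i) \<cdot> \<phi> i) B"
  proof (rule msum_cong)
    fix i assume i: "i \<in> B"
    then have "k (h i) = i" using kh[of i] B(2) by blast
    then show "\<iota> (h i) \<cdot> \<phi> (k (h i)) = \<iota> (h i) \<cdot> \<phi> i" by simp
    show "\<iota> (h i) \<cdot> \<phi> i \<in> Hom e d" by (rule ty[OF i])
  qed
  finally have "msum e d (\<lambda>a. \<iota> a \<cdot> \<phi> (k a)) (h ` B) = m" using sum by simp
  moreover have "\<phi> (k a) \<in> Hom e (X a)" if a: "a \<in> h ` B" for a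
  proof -
    obtain i where i: "i \<in> B" "a = h i" using a by blast
    then have "k a = i" using kh[of i] B(2) by blast
    then show ?thesis using \<phi> i by simp
  qed
  ultimately show ?thesis using B(1) hB
    by (intro exI[of _ "h ` B"] exI[of _ "\<lambda>a. \<phi> (k a)"]) blast
qed

text \<open>Compactness writes the arrow as a finite combination, and its coefficients are the
  projections assumed to vanish.\<close>

lemma small_coprod_zeroI:
  assumes sc: "small_coprod A X d \<iota>" and e: "compact e" and m: "m \<in> Hom e d"
    and 0: "\<And>a \<pi>. a \<in> A \<Longrightarrow> \<pi> \<in> Hom d (X a) \<Longrightarrow> \<pi> \<cdot> \<iota> a = idm T (X a) \<Longrightarrow>
         (\<And>b. b \<in> A \<Longrightarrow> b \<noteq> a \<Longrightarrow> \<pi> \<cdot> \<iota> b = zerom T (X b) (X a)) \<Longrightarrow> \<pi> \<cdot> m = zerom T e (X a)"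
  shows "m = zerom T e d"
proof -
  obtain I h where h: "bij_betw h I A" and sc': "small_coproduct I (\<lambda>i. X (h i)) d (\<lambda>i. \<iota> (h i))"
    using sc unfolding small_coprod_def by blast
  then have c: "coproduct I (\<lambda>i. X (h i)) d (\<lambda>i. \<iota> (h i))" by (simp add: small_coproduct_def)
  have inj: "inj_on h I" and hI: "h ` I = A" using h by (auto simp: bij_betw_def)
  obtain \<pi> where \<pi>: "\<And>i. i \<in> I \<Longrightarrow> \<pi> i \<in> Hom d (X (h i)) \<and> \<pi> i \<cdot> \<iota> (h i) = idm T (X (h i)) \<and>
    (\<forall>j\<in>I. j \<noteq> i \<longrightarrow> \<pi> i \<cdot> \<iota> (h j) = zerom T (X (h j)) (X (h i)))"
    using coproduct_proj[OF c] by blast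
  have \<pi>0: "\<pi> i \<cdot> m = zerom T e (X (h i))" if i: "i \<in> I" for i
  proof (rule 0)
    fix b assume b: "b \<in> A" "b \<noteq> h i"
    then obtain j where j: "j \<in> I" "b = h j" using hI by blast
    then have "j \<noteq> i" using b by blast
    then show "\<pi> i \<cdot> \<iota> b = zerom T (X b) (X (h i))" using \<pi>[OF i] j by simp
  qed (use \<pi>[OF i] hI i in blast)+
  obtain B \<phi> where B: "finite B" "B \<subseteq> I" and \<phi>: "\<And>i. i \<in> B \<Longrightarrow> \<phi> i \<in> Hom e (X (h i))"
    and sum: "msum e d (\<lambda>i. \<iota> (h i) \<cdot> \<phi> i) B = m" using compact_msum[OF e sc' m] by blast
  have "msum e d (\<lambda>i. \<iota> (h i) \<cdot> \<phi> i) B = zerom T e d"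
  proof (rule msum_zero)
    fix i assume i: "i \<in> B"
    then have iI: "i \<in> I" using B by blast
    have "\<phi> i = \<pi> i \<cdot> m" using coproduct_proj_msum[OF c \<pi> B \<phi> iI] sum i by simp
    then have "\<phi> i = zerom T e (X (h i))" using \<pi>0[OF iI] by simp
    then show "\<iota> (h i) \<cdot> \<phi> i = zerom T e d" using coproduct_Hom[OF c iI] by simp
  qed
  then show ?thesis using sum by simp
qed

text \<open>Take the coproduct of all \<open>s\<close> in \<open>S\<close> over all arrows s
  \<rightarrow> e that \<open>\<beta>\<close> kills, and let the next object be the cone of its map
  to \<open>e\<close>. The map \<open>\<beta>\<close> extends over the cone, while all these arrows
  die there. Smallness of \<open>S\<close> and of the Hom sets makes the coproduct
  available.\<close>

lemma bousfield_step:
  assumes S: "small S" and L: "localizing L" "S \<subseteq> L" and e: "e \<in> L" and \<beta>: "\<beta> \<in> Hom e x"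
  shows "\<exists>e' u \<beta>'. e' \<in> L \<and> u \<in> Hom e e' \<and> \<beta>' \<in> Hom e' x \<and> \<beta>' \<cdot> u = \<beta> \<and>
    (\<forall>s\<in>S. \<forall>b\<in>Hom s e. \<beta> \<cdot> b = zerom T s x \<longrightarrow> u \<cdot> b = zerom T s e')"
proof -
  define A where "A = {(s, b). s \<in> S \<and> b \<in> Hom s e \<and> \<beta> \<cdot> b = zerom T s x}"
  have "small A"
    by (rule small_subset[OF small_Sigma[OF S small_Hom[of _ e]]]) (auto simp: A_def)
  then obtain P \<iota> where P: "small_coprod A fst P \<iota>" using ex_small_coprod by blast
  note \<iota> = small_coprod_Hom[OF P] and ex = small_coprod_ex[OF P] and eq = small_coprod_eqI[OF P]
    and PL = small_coprod_localizing[OF P]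
  obtain q where q: "q \<in> Hom P e" "\<forall>a\<in>A. q \<cdot> \<iota> a = snd a"
    using ex[of snd e] by (auto simp: A_def)
  obtain u w where t: "(q, u, w) \<in> tri T" using tri_complete by blast
  have [simp]: "src T \<beta> = e" "tgt T \<beta> = x" "src T q = P" "tgt T q = e" using \<beta> q by auto
  note [simp] = tri_typed[OF t]
  have "P \<in> L" by (rule PL[OF L(1)]) (use L(2) in \<open>auto simp: A_def\<close>)
  then have eL: "tgt T u \<in> L" using triangulated_sub_cone[OF localizing_triangulated[OF L(1)] t] e by simp
  have bq: "\<beta> \<cdot> q = zerom T P x"
  proof (rule eq[of _ x])
    fix a assume a: "a \<in> A"
    have "(\<beta> \<cdot> q) \<cdot> \<iota> a = \<beta> \<cdot> snd a" using \<iota>[OF a] q(2) a by simp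
    also have "\<dots> = zerom T P x \<cdot> \<iota> a" using a \<iota>[OF a] by (auto simp: A_def)
    finally show "(\<beta> \<cdot> q) \<cdot> \<iota> a = zerom T P x \<cdot> \<iota> a" .
  qed simp_all
  then have "\<exists>n. src T n = tgt T u \<and> tgt T n = tgt T \<beta> \<and> n \<cdot> u = \<beta>"
    by (intro tri_weak_cokernel[OF t, of _ P x]) simp_all
  then obtain \<beta>' where \<beta>': "src T \<beta>' = tgt T u" "tgt T \<beta>' = tgt T \<beta>" "\<beta>' \<cdot> u = \<beta>" by blast
  have kill: "u \<cdot> b = zerom T s (tgt T u)" if s: "s \<in> S" "b \<in> Hom s e" "\<beta> \<cdot> b = zerom T s x" for s b
  proof -
    have a: "(s, b) \<in> A" using s by (simp add: A_def)
    have "u \<cdot> b = u \<cdot> (q \<cdot> \<iota> (s, b))" using q(2) a by auto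
    also have "\<dots> = zerom T s (tgt T u)"
      using cmp_eq_cmp1[OF tri_cmp_zero1[OF t], of "\<iota> (s, b)"] \<iota>[OF a] by simp
    finally show ?thesis .
  qed
  show ?thesis using eL \<beta>' kill by (intro exI[of _ "tgt T u"] exI[of _ u] exI[of _ \<beta>']) simp
qed

text \<open>The coproduct of the objects of \<open>S\<close> over all their arrows to
  \<open>x\<close>.\<close>

lemma bousfield_start:
  assumes S: "small S" and L: "localizing L" "S \<subseteq> L"
  shows "\<exists>e \<beta>. e \<in> L \<and> \<beta> \<in> Hom e x \<and> (\<forall>s\<in>S. \<forall>b\<in>Hom s x. \<exists>b'\<in>Hom s e. \<beta> \<cdot> b' = b)"
proof -
  define A where "A = (SIGMA s:S. Hom s x)"
  have "small A" unfolding A_def by (rule small_Sigma[OF S small_Hom])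
  then obtain P \<iota> where P: "small_coprod A fst P \<iota>" using ex_small_coprod by blast
  note \<iota> = small_coprod_Hom[OF P] and ex = small_coprod_ex[OF P]
    and PL = small_coprod_localizing[OF P]
  obtain \<beta> where \<beta>: "\<beta> \<in> Hom P x" "\<forall>a\<in>A. \<beta> \<cdot> \<iota> a = snd a"
    using ex[of snd x] by (auto simp: A_def)
  have "P \<in> L" by (rule PL[OF L(1)]) (use L(2) in \<open>auto simp: A_def\<close>)
  moreover have "\<exists>b'\<in>Hom s P. \<beta> \<cdot> b' = b" if "s \<in> S" "b \<in> Hom s x" for s b
  proof -
    have "(s, b) \<in> A" using that by (simp add: A_def)
    then show ?thesis using \<iota> \<beta>(2) by (metis fst_conv snd_conv)
  qed
  ultimately show ?thesis using \<beta>(1) by blast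
qed

text \<open>
  The colocalization is the homotopy colimit of a sequence of approximations \<open>\<beta> : e \<rightarrow> x\<close> whose
  transition maps kill the kernel of \<open>Hom(s, e) \<rightarrow> Hom(s, x)\<close> for the generators \<open>s\<close>.
\<close>

lemma bousfield_colocalization:
  assumes S: "small S" and cS: "\<And>s. s \<in> S \<Longrightarrow> compact s"
    and sS: "\<And>s n. s \<in> S \<Longrightarrow> shO_int n s \<in> S"
    and L: "localizing L" "S \<subseteq> L"
  shows "\<exists>e \<gamma>. e \<in> L \<and> \<gamma> \<in> Hom e x \<and> (\<forall>s\<in>S. \<forall>b\<in>Hom s x. \<exists>b'\<in>Hom s e. \<gamma> \<cdot> b' = b) \<and>
    (\<forall>s\<in>S. \<forall>m\<in>Hom s e. \<gamma> \<cdot> m = zerom T s x \<longrightarrow> m = zerom T s e)"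
proof -
  define Q where "Q = (\<lambda>(e, \<beta>) (e', \<beta>'). \<exists>u. u \<in> Hom e e' \<and> \<beta>' \<cdot> u = \<beta> \<and>
    (\<forall>s\<in>S. \<forall>b\<in>Hom s e. \<beta> \<cdot> b = zerom T s x \<longrightarrow> u \<cdot> b = zerom T s e'))"
  \<comment> \<open>Surjectivity on arrows from \<open>S\<close> is demanded at stage 0 only; it
    reaches the colimit because the maps to \<open>x\<close> are compatible with the
    transitions.\<close>
  define R where "R = (\<lambda>(n::nat) (e, \<beta>). e \<in> L \<and> \<beta> \<in> Hom e x \<and>
    (n = 0 \<longrightarrow> (\<forall>s\<in>S. \<forall>b\<in>Hom s x. \<exists>b'\<in>Hom s e. \<beta> \<cdot> b' = b)))"
  have "\<exists>F. \<forall>n. R n (F n) \<and> Q (F n) (F (Suc n))"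
  proof (rule dependent_nat_choice)
    show "\<exists>p. R 0 p" using bousfield_start[OF S L, of x] by (auto simp: R_def)
    fix p n assume "R n p"
    then obtain e \<beta> where p: "p = (e, \<beta>)" "e \<in> L" "\<beta> \<in> Hom e x" by (cases p) (auto simp: R_def)
    obtain e' u \<beta>' where "e' \<in> L" "u \<in> Hom e e'" "\<beta>' \<in> Hom e' x" "\<beta>' \<cdot> u = \<beta>"
       "\<forall>s\<in>S. \<forall>b\<in>Hom s e. \<beta> \<cdot> b = zerom T s x \<longrightarrow> u \<cdot> b = zerom T s e'"
      using bousfield_step[OF S L p(2,3)] by blast
    then show "\<exists>p'. R (Suc n) p' \<and> Q p p'"
      unfolding p(1) by (intro exI[of _ "(e', \<beta>')"]) (auto simp: R_def Q_def)
  qed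
  then obtain F where F: "\<And>n. R n (F n)" "\<And>n. Q (F n) (F (Suc n))" by blast
  define E where "E = (\<lambda>n. fst (F n))"
  define \<beta> where "\<beta> = (\<lambda>n. snd (F n))"
  have EL: "E n \<in> L" and \<beta> [simp]: "src T (\<beta> n) = E n" "tgt T (\<beta> n) = x" for n
    using F(1)[of n] by (auto simp: R_def E_def \<beta>_def split: prod.splits)
  have \<beta>0: "\<exists>b'\<in>Hom s (E 0). \<beta> 0 \<cdot> b' = b" if "s \<in> S" "b \<in> Hom s x" for s b
    using F(1)[of 0] that by (auto simp: R_def E_def \<beta>_def split: prod.splits)
  have "\<forall>n. \<exists>u. u \<in> Hom (E n) (E (Suc n)) \<and> \<beta> (Suc n) \<cdot> u = \<beta> n \<and>
      (\<forall>s\<in>S. \<forall>b\<in>Hom s (E n). \<beta> n \<cdot> b = zerom T s x \<longrightarrow> u \<cdot> b = zerom T s (E (Suc n)))"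
    using F(2) by (simp add: Q_def E_def \<beta>_def case_prod_unfold del: Hom_iff)
  then obtain u where u: "\<And>n. u n \<in> Hom (E n) (E (Suc n))" and \<beta>u: "\<And>n. \<beta> (Suc n) \<cdot> u n = \<beta> n"
    and kill: "\<And>n s b. s \<in> S \<Longrightarrow> b \<in> Hom s (E n) \<Longrightarrow> \<beta> n \<cdot> b = zerom T s x \<Longrightarrow> u n \<cdot> b = zerom T s (E (Suc n))"
    by metis
  have [simp]: "src T (u n) = E n" "tgt T (u n) = E (Suc n)" for n using u[of n] by auto
  obtain D \<iota> where P: "small_coprod UNIV E D \<iota>" using ex_small_coprod[OF small_nat] by blast
  note \<iota> = small_coprod_Hom[OF P, OF UNIV_I] and ex = small_coprod_ex[OF P, simplified ball_UNIV]
    and eq = small_coprod_eqI[OF P] and DL = small_coprod_localizing[OF P]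
    and dec = small_coprod_msum[OF P] and zero = small_coprod_zeroI[OF P]
  have [simp]: "src T (\<iota> n) = E n" "tgt T (\<iota> n) = D" for n using \<iota>[of n] by auto
  \<comment> \<open>The identity minus the shift along the transitions; its cone is the homotopy
    colimit (telescope).\<close>
  obtain \<phi> where \<phi>: "\<phi> \<in> Hom D D" "\<And>n. \<phi> \<cdot> \<iota> n = \<iota> n \<boxplus> negm (\<iota> (Suc n) \<cdot> u n)"
    using ex[of "\<lambda>n. \<iota> n \<boxplus> negm (\<iota> (Suc n) \<cdot> u n)" D] by auto
  obtain \<beta>\<^sub>D where \<beta>\<^sub>D: "\<beta>\<^sub>D \<in> Hom D x" "\<And>n. \<beta>\<^sub>D \<cdot> \<iota> n = \<beta> n"
    using ex[of \<beta> x] by auto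
  have [simp]: "src T \<phi> = D" "tgt T \<phi> = D" "src T \<beta>\<^sub>D = D" "tgt T \<beta>\<^sub>D = x" using \<phi> \<beta>\<^sub>D by auto
  obtain j w where t: "(\<phi>, j, w) \<in> tri T" using tri_complete by blast
  note [simp] = tri_typed[OF t]
  define H where "H = tgt T j"
  have [simp]: "tgt T j = H" by (simp add: H_def)
  have HL: "H \<in> L"
    using triangulated_sub_cone[OF localizing_triangulated[OF L(1)] t] DL[OF L(1) EL] by simp
  have "\<beta>\<^sub>D \<cdot> \<phi> = zerom T D x"
  proof (rule eq[of _ x])
    fix n
    have "(\<beta>\<^sub>D \<cdot> \<phi>) \<cdot> \<iota> n = \<beta> n \<boxplus> negm (\<beta> (Suc n) \<cdot> u n)"
      using cmp_eq_cmp1[OF \<beta>\<^sub>D(2)[of "Suc n"], of "u n"] by (simp add: \<phi>(2) cmp_addm' \<beta>\<^sub>D(2))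
    then show "(\<beta>\<^sub>D \<cdot> \<phi>) \<cdot> \<iota> n = zerom T D x \<cdot> \<iota> n" by (simp add: \<beta>u)
  qed simp_all
  then have "\<exists>n. src T n = tgt T j \<and> tgt T n = tgt T \<beta>\<^sub>D \<and> n \<cdot> j = \<beta>\<^sub>D"
    by (intro tri_weak_cokernel[OF t, of _ D x]) simp_all
  then obtain \<gamma> where \<gamma>: "src T \<gamma> = tgt T j" "tgt T \<gamma> = tgt T \<beta>\<^sub>D" "\<gamma> \<cdot> j = \<beta>\<^sub>D" by blast
  note [simp] = \<gamma>(1,2)
  have ju: "j \<cdot> (\<iota> (Suc n) \<cdot> u n) = j \<cdot> \<iota> n" for n
  proof -
    have "j \<cdot> (\<phi> \<cdot> \<iota> n) = zerom T (E n) H"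
      using cmp_eq_cmp1[OF tri_cmp_zero1[OF t], of "\<iota> n"] by simp
    then have "j \<cdot> \<iota> n \<boxplus> negm (j \<cdot> (\<iota> (Suc n) \<cdot> u n)) = zerom T (E n) H" by (simp add: \<phi>(2) cmp_addm')
    then show ?thesis using addm_negm_eq_zero[of "j \<cdot> (\<iota> (Suc n) \<cdot> u n)" "j \<cdot> \<iota> n"] by simp
  qed
  \<comment> \<open>Projecting to stage 0 turns \<open>\<phi>\<close> into the projection itself,
    and projecting to stage n + 1 subtracts only the transition of the projection to stage n. So an
    arrow killed by \<open>\<phi>\<close> has all components zero, by induction on the
    stage.\<close>
  have \<phi>_inj: "a = zerom T c D" if c: "compact c" and a: "a \<in> Hom c D" and z0: "\<phi> \<cdot> a = zerom T c D" for c a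
  proof (rule zero[OF c a])
    fix k \<pi>\<^sub>k assume \<pi>\<^sub>k: "\<pi>\<^sub>k \<in> Hom D (E k)" "\<pi>\<^sub>k \<cdot> \<iota> k = idm T (E k)" "\<And>b. b \<in> UNIV \<Longrightarrow> b \<noteq> k \<Longrightarrow> \<pi>\<^sub>k \<cdot> \<iota> b = zerom T (E b) (E k)"
    have [simp]: "src T a = c" "tgt T a = D" using a by auto
    have "\<exists>\<pi>. \<pi> \<in> Hom D (E k) \<and> (\<forall>n. \<pi> \<cdot> \<iota> n = (if n = k then idm T (E k) else zerom T (E n) (E k)))" for k
      by (rule ex) auto
    then obtain \<pi> where \<pi>: "\<And>k. \<pi> k \<in> Hom D (E k)"
      "\<And>k n. \<pi> k \<cdot> \<iota> n = (if n = k then idm T (E k) else zerom T (E n) (E k))" by metis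
    have [simp]: "src T (\<pi> k) = D" "tgt T (\<pi> k) = E k" for k using \<pi>(1)[of k] by auto
    have \<pi>u: "\<pi> k \<cdot> (\<iota> (Suc n) \<cdot> u n) = (if Suc n = k then u n else zerom T (E n) (E k))" for k n
      using cmp_eq_cmp1[OF \<pi>(2)[of k "Suc n"], of "u n"] by (cases "Suc n = k") auto
    have \<pi>0: "\<pi> 0 \<cdot> \<phi> = \<pi> 0"
      by (rule eq[of _ "E 0"]) (simp_all add: \<phi>(2) cmp_addm' \<pi>u \<pi>(2))
    have \<pi>S: "\<pi> (Suc n) \<cdot> \<phi> = \<pi> (Suc n) \<boxplus> negm (u n \<cdot> \<pi> n)" for n
      by (rule eq[of _ "E (Suc n)"]) (auto simp: \<phi>(2) cmp_addm' addm_cmp' \<pi>u \<pi>(2))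
    have "\<pi> k \<cdot> a = zerom T c (E k)" for k
    proof (induction k)
      case 0
      have "\<pi> 0 \<cdot> a = (\<pi> 0 \<cdot> \<phi>) \<cdot> a" by (simp only: \<pi>0)
      also have "\<dots> = \<pi> 0 \<cdot> (\<phi> \<cdot> a)" by simp
      also have "\<dots> = zerom T c (E 0)" unfolding z0 by simp
      finally show ?case .
    next
      case (Suc k)
      have "(\<pi> (Suc k) \<cdot> \<phi>) \<cdot> a = \<pi> (Suc k) \<cdot> (\<phi> \<cdot> a)" by simp
      then have "(\<pi> (Suc k) \<boxplus> negm (u k \<cdot> \<pi> k)) \<cdot> a = zerom T c (E (Suc k))" by (simp add: z0 \<pi>S)
      then show ?case using Suc by (simp add: addm_cmp')
    qed
    moreover have "\<pi>\<^sub>k = \<pi> k" by (rule eq[OF \<pi>\<^sub>k(1) \<pi>(1)]) (use \<pi>\<^sub>k(2,3) \<pi>(2) in auto)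
    ultimately show "\<pi>\<^sub>k \<cdot> a = zerom T c (E k)" by simp
  qed
  \<comment> \<open>By injectivity of \<open>\<phi>\<close> on compact sources the arrow lifts to
    the coproduct \<open>D\<close>; its finitely many terms are pushed into one stage
    \<open>N\<close>; the transition out of that stage kills the result, because
    \<open>\<gamma>\<close> kills \<open>m\<close>.\<close>
  have \<gamma>_inj: "m = zerom T s H" if s: "s \<in> S" and m: "m \<in> Hom s H" and 0: "\<gamma> \<cdot> m = zerom T s x" for s m
  proof -
    have [simp]: "src T m = s" "tgt T m = H" using m by auto
    define a where "a = shM_int (- 1) (w \<cdot> m)"
    have a [simp]: "src T a = shO_int (- 1) s" "tgt T a = D" by (simp_all add: a_def)
    have wm: "w \<cdot> m = shM T a" by (simp add: a_def)
    have "shM T (\<phi> \<cdot> a) = shM T \<phi> \<cdot> (w \<cdot> m)" by (simp add: wm shM_cmp')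
    also have "\<dots> = zerom T s (shO T D)" using cmp_eq_cmp1[OF tri_cmp_zero3[OF t], of m] by simp
    also have "\<dots> = shM T (zerom T (shO_int (- 1) s) D)" by simp
    finally have "\<phi> \<cdot> a = zerom T (shO_int (- 1) s) D" by (simp only: shM_inject)
    then have "a = zerom T (shO_int (- 1) s) D" by (rule \<phi>_inj[rotated 2]) (use cS[OF s] in simp_all)
    then have "w \<cdot> m = zerom T s (shO T D)" unfolding wm by simp
    then have "\<exists>n. src T n = src T m \<and> tgt T n = tgt T \<phi> \<and> j \<cdot> n = m"
      by (intro tri_weak_kernel2[OF t, of _ s "shO T D"]) simp_all
    then obtain b where b: "src T b = src T m" "tgt T b = tgt T \<phi>" "j \<cdot> b = m" by blast
    have bD: "b \<in> Hom s D" using b(1,2) by simp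
    obtain B \<psi> where B: "finite B" "\<And>a. a \<in> B \<Longrightarrow> \<psi> a \<in> Hom s (E a)" "msum s D (\<lambda>a. \<iota> a \<cdot> \<psi> a) B = b"
      using dec[OF cS[OF s] bD] by blast
    \<comment> \<open>After \<open>j\<close> a term may be moved along the transitions to any later
      stage. This gives terms from different stages a common stage in which to be added.\<close>
    have push: "\<exists>b''\<in>Hom s (E (n + k)). j \<cdot> (\<iota> n \<cdot> b') = j \<cdot> (\<iota> (n + k) \<cdot> b'')" if b': "b' \<in> Hom s (E n)" for n k b'
    proof (induction k)
      case 0
      then show ?case using b' by (intro bexI[of _ b']) simp_all
    next
      case (Suc k)
      then obtain b'' where b'': "b'' \<in> Hom s (E (n + k))" "j \<cdot> (\<iota> n \<cdot> b') = j \<cdot> (\<iota> (n + k) \<cdot> b'')" by blast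
      have "j \<cdot> (\<iota> (Suc (n + k)) \<cdot> (u (n + k) \<cdot> b'')) = j \<cdot> (\<iota> (n + k) \<cdot> b'')"
        using cmp_eq_cmp[OF ju[of "n + k"], of b''] b''(1) by simp
      then show ?case using b'' by (intro bexI[of _ "u (n + k) \<cdot> b''"]) simp_all
    qed
    have "\<exists>N. \<exists>b'\<in>Hom s (E N). j \<cdot> (msum s D (\<lambda>a. \<iota> a \<cdot> \<psi> a) B) = j \<cdot> (\<iota> N \<cdot> b')"
    proof (rule msum_induct[OF B(1)])
      show "\<iota> a \<cdot> \<psi> a \<in> Hom s D" if "a \<in> B" for a using B(2)[OF that] by simp
      show "\<exists>N. \<exists>b'\<in>Hom s (E N). j \<cdot> zerom T s D = j \<cdot> (\<iota> N \<cdot> b')"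
        by (rule exI[of _ 0], rule bexI[of _ "zerom T s (E 0)"]) simp_all
      fix k m assume k: "k \<in> B" and m: "m \<in> Hom s D" and "\<exists>N. \<exists>b'\<in>Hom s (E N). j \<cdot> m = j \<cdot> (\<iota> N \<cdot> b')"
      then obtain N b' where b': "b' \<in> Hom s (E N)" "j \<cdot> m = j \<cdot> (\<iota> N \<cdot> b')" by blast
      obtain c1 where c1: "c1 \<in> Hom s (E (k + N))" "j \<cdot> (\<iota> k \<cdot> \<psi> k) = j \<cdot> (\<iota> (k + N) \<cdot> c1)"
        using push[OF B(2)[OF k], of N] by blast
      obtain c2 where c2: "c2 \<in> Hom s (E (N + k))" "j \<cdot> (\<iota> N \<cdot> b') = j \<cdot> (\<iota> (N + k) \<cdot> c2)"
        using push[OF b'(1), of k] by blast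
      have "j \<cdot> (\<iota> k \<cdot> \<psi> k \<boxplus> m) = j \<cdot> (\<iota> k \<cdot> \<psi> k) \<boxplus> j \<cdot> m" using m B(2)[OF k] by (simp add: cmp_addm')
      also have "\<dots> = j \<cdot> (\<iota> (k + N) \<cdot> c1) \<boxplus> j \<cdot> (\<iota> (k + N) \<cdot> c2)"
        using c1(2) c2(2) b'(2) by (simp add: add.commute)
      also have "\<dots> = j \<cdot> (\<iota> (k + N) \<cdot> (c1 \<boxplus> c2))" using c1(1) c2(1) by (simp add: cmp_addm' add.commute)
      finally show "\<exists>N. \<exists>b'\<in>Hom s (E N). j \<cdot> (\<iota> k \<cdot> \<psi> k \<boxplus> m) = j \<cdot> (\<iota> N \<cdot> b')"
        using c1(1) c2(1) by (intro exI[of _ "k + N"] bexI[of _ "c1 \<boxplus> c2"]) (simp_all add: add.commute)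
    qed
    then obtain N b' where b': "b' \<in> Hom s (E N)" "m = j \<cdot> (\<iota> N \<cdot> b')" unfolding B(3) b(3) by blast
    have [simp]: "src T b' = s" "tgt T b' = E N" using b'(1) by auto
    have "\<gamma> \<cdot> (j \<cdot> (\<iota> N \<cdot> b')) = \<beta>\<^sub>D \<cdot> (\<iota> N \<cdot> b')" by (rule cmp_eq_cmp1[OF \<gamma>(3)]) simp_all
    also have "\<dots> = \<beta> N \<cdot> b'" by (rule cmp_eq_cmp1[OF \<beta>\<^sub>D(2)]) simp_all
    finally have "\<beta> N \<cdot> b' = zerom T s x" using 0 b'(2) by simp
    then have k0: "u N \<cdot> b' = zerom T s (E (Suc N))" by (rule kill[OF s b'(1)])
    have "j \<cdot> (\<iota> N \<cdot> b') = j \<cdot> (\<iota> (Suc N) \<cdot> (u N \<cdot> b'))"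
      using cmp_eq_cmp[OF ju[of N], of b'] by simp
    then have "j \<cdot> (\<iota> N \<cdot> b') = zerom T s H" by (simp add: k0)
    then show ?thesis using b'(2) by simp
  qed
  have surj: "\<exists>b'\<in>Hom s H. \<gamma> \<cdot> b' = b" if s: "s \<in> S" "b \<in> Hom s x" for s b
  proof -
    obtain b' where b': "b' \<in> Hom s (E 0)" "\<beta> 0 \<cdot> b' = b" using \<beta>0[OF s] by blast
    have "\<gamma> \<cdot> (j \<cdot> (\<iota> 0 \<cdot> b')) = \<beta>\<^sub>D \<cdot> (\<iota> 0 \<cdot> b')" by (rule cmp_eq_cmp1[OF \<gamma>(3)]) (use b'(1) in simp_all)
    also have "\<dots> = \<beta> 0 \<cdot> b'" by (rule cmp_eq_cmp1[OF \<beta>\<^sub>D(2)]) (use b'(1) in simp_all)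
    finally show ?thesis using b' by (intro bexI[of _ "j \<cdot> (\<iota> 0 \<cdot> b')"]) simp_all
  qed
  have "\<gamma> \<in> Hom H x" by simp
  then show ?thesis using HL surj \<gamma>_inj by blast
qed

text \<open>The cone of the colocalization has no arrows from generators: such an arrow gives one to
  \<open>e\<close> killed by \<open>\<gamma>\<close>, hence zero, so it lifts to \<open>x\<close>
  and then to \<open>e\<close>, where it dies in the cone.\<close>

lemma ex_localization_triangle:
  assumes S: "small S" and cS: "\<And>s. s \<in> S \<Longrightarrow> compact s"
  shows "\<exists>e f. localization_triangle (Loc S) x e f"
proof -
  \<comment> \<open>Closing under suspensions keeps the set small and compact and stays inside
    \<open>Loc S\<close>.\<close>
  define S' where "S' = (\<lambda>(n, s). shO_int n s) ` (UNIV \<times> S)"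
  have S': "small S'"
    unfolding S'_def by (intro small_image small_Sigma[OF small_countable] S) auto
  have cS': "compact s" if "s \<in> S'" for s using that cS by (auto simp: S'_def)
  have sS': "shO_int n s \<in> S'" if s: "s \<in> S'" for n s
  proof -
    obtain p where "p \<in> UNIV \<times> S" "s = shO_int (fst p) (snd p)"
      using s unfolding S'_def case_prod_unfold by blast
    then show ?thesis unfolding S'_def by (intro image_eqI[of _ _ "(n + fst p, snd p)"]) auto
  qed
  have SS': "s \<in> S'" if "s \<in> S" for s using that by (force simp: S'_def intro: image_eqI[of _ _ "(0, s)"])
  have LS': "S' \<subseteq> Loc S"
    using Loc_superset[of S] triangulated_sub_shO_int[OF localizing_triangulated[OF localizing_Loc]]
    by (auto simp: S'_def)
  obtain e \<gamma> where e: "e \<in> Loc S" and \<gamma>: "\<gamma> \<in> Hom e x"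
    and surj: "\<And>s b. s \<in> S' \<Longrightarrow> b \<in> Hom s x \<Longrightarrow> \<exists>b'\<in>Hom s e. \<gamma> \<cdot> b' = b"
    and inj: "\<And>s m. s \<in> S' \<Longrightarrow> m \<in> Hom s e \<Longrightarrow> \<gamma> \<cdot> m = zerom T s x \<Longrightarrow> m = zerom T s e"
    using bousfield_colocalization[OF S' cS' sS' localizing_Loc LS', of x] by blast
  have [simp]: "src T \<gamma> = e" "tgt T \<gamma> = x" using \<gamma> by auto
  obtain v w where t: "(\<gamma>, v, w) \<in> tri T" using tri_complete by blast
  note [simp] = tri_typed[OF t]
  have y: "m = zerom T s (tgt T v)" if s: "s \<in> S'" and m: "m \<in> Hom s (tgt T v)" for s m
  proof -
    have [simp]: "src T m = s" "tgt T m = tgt T v" using m by auto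
    define a where "a = shM_int (- 1) (w \<cdot> m)"
    have a [simp]: "src T a = shO_int (- 1) s" "tgt T a = e" by (simp_all add: a_def)
    have wm: "w \<cdot> m = shM T a" by (simp add: a_def)
    have "shM T (\<gamma> \<cdot> a) = shM T \<gamma> \<cdot> (w \<cdot> m)" by (simp add: wm shM_cmp')
    also have "\<dots> = zerom T s (shO T x)" using cmp_eq_cmp1[OF tri_cmp_zero3[OF t], of m] by simp
    also have "\<dots> = shM T (zerom T (shO_int (- 1) s) x)" by simp
    finally have "\<gamma> \<cdot> a = zerom T (shO_int (- 1) s) x" by (simp only: shM_inject)
    then have "a = zerom T (shO_int (- 1) s) e" by (rule inj[OF sS'[OF s], rotated]) simp_all
    then have "w \<cdot> m = zerom T s (shO T e)" unfolding wm by simp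
    then have "\<exists>n. src T n = src T m \<and> tgt T n = tgt T \<gamma> \<and> v \<cdot> n = m"
      by (intro tri_weak_kernel2[OF t, of _ s "shO T e"]) simp_all
    then obtain b where b: "src T b = src T m" "tgt T b = tgt T \<gamma>" "v \<cdot> b = m" by blast
    then have "b \<in> Hom s x" by simp
    then obtain b' where b': "b' \<in> Hom s e" "\<gamma> \<cdot> b' = b" using surj[OF s] by blast
    have "v \<cdot> (\<gamma> \<cdot> b') = zerom T s (tgt T v)"
      using cmp_eq_cmp1[OF tri_cmp_zero1[OF t], of b'] b'(1) by simp
    then show ?thesis unfolding b'(2) b(3) .
  qed
  have "orth s (tgt T v)" if s: "s \<in> S" for s
    unfolding orth_def
  proof (intro allI impI)
    fix n m assume m: "m \<in> Hom s (shO_int n (tgt T v))"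
    have "shM_int (- n) m = zerom T (shO_int (- n) s) (tgt T v)"
      by (rule y[OF sS'[OF SS'[OF s]]]) (use m in simp_all)
    then have "shM_int n (shM_int (- n) m) = shM_int n (zerom T (shO_int (- n) s) (tgt T v))" by simp
    then show "m = zerom T s (shO_int n (tgt T v))" by simp
  qed
  then have "\<forall>s\<in>Loc S. Hom s (tgt T v) = {zerom T s (tgt T v)}" using Loc_orth orth_Hom by blast
  moreover have "v \<in> Hom x (tgt T v)" by simp
  ultimately show ?thesis unfolding localization_triangle_def using t \<gamma> e by blast
qed

lemma localization_triangle_orth:
  "localization_triangle (Loc S) x e f \<Longrightarrow> s \<in> Loc S \<Longrightarrow> orth s f"
  unfolding orth_def
proof (intro allI impI)
  fix n m assume t: "localization_triangle (Loc S) x e f" and s: "s \<in> Loc S" and m: "m \<in> Hom s (shO_int n f)"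
  have "shO_int (- n) s \<in> Loc S"
    using triangulated_sub_shO_int[OF localizing_triangulated[OF localizing_Loc]] s by blast
  then have "Hom (shO_int (- n) s) f = {zerom T (shO_int (- n) s) f}"
    using t unfolding localization_triangle_def by blast
  moreover have "shM_int (- n) m \<in> Hom (shO_int (- n) s) f" using m by simp
  ultimately have "shM_int (- n) m = zerom T (shO_int (- n) s) f" by blast
  then have "shM_int n (shM_int (- n) m) = shM_int n (zerom T (shO_int (- n) s) f)" by simp
  then show "m = zerom T s (shO_int n f)" by simp
qed

section \<open>Compact generation and tensor ideals\<close>

lemma ex_generators:
  "\<exists>G. small G \<and> (\<forall>g\<in>G. compact g) \<and> (\<forall>t. (\<forall>g\<in>G. orth g t) \<longrightarrow> zero_object t)"
proof -
  obtain G where G: "small G" "\<forall>g\<in>G. compact g"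
    "\<And>t. \<forall>g\<in>G. \<forall>n. Hom (shO_int n g) t = {zerom T (shO_int n g) t} \<Longrightarrow> zero_object t"
    using compactly_generated by blast
  have "zero_object t" if "\<forall>g\<in>G. orth g t" for t
    by (rule G(3)) (use that orth_Hom orth_shO_int_left in blast)
  then show ?thesis using G by blast
qed

text \<open>Localize at a small set of compact generators: the third object is orthogonal to all of
  them, hence zero, so every \<open>t\<close> is built from the first one.\<close>

lemma localizing_contains_all:
  assumes L: "localizing L" and c: "\<And>c. compact c \<Longrightarrow> c \<in> L"
  shows "t \<in> L"
proof -
  obtain G where G: "small G" "\<forall>g\<in>G. compact g" "\<forall>t. (\<forall>g\<in>G. orth g t) \<longrightarrow> zero_object t"
    using ex_generators by blast
  have GL: "Loc G \<subseteq> L" by (rule Loc_minimal[OF L]) (use G c in blast)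
  obtain e f where lt: "localization_triangle (Loc G) t e f" using ex_localization_triangle G by blast
  then have e: "e \<in> Loc G" unfolding localization_triangle_def by blast
  have "zero_object f" using G(3) localization_triangle_orth[OF lt] Loc_superset by blast
  then have "f \<in> L" using triangulated_sub_zero[OF localizing_triangulated[OF L]] by blast
  moreover obtain u v w where "(u, v, w) \<in> tri T" "u \<in> Hom e t" "v \<in> Hom t f"
    using lt unfolding localization_triangle_def by blast
  ultimately show ?thesis using triangulated_sub_middle[OF localizing_triangulated[OF L], of u v w] e GL by auto
qed

text \<open>A reduction in two variables: for fixed \<open>c\<close> the admissible \<open>t\<close>
  form a localizing subcategory containing the compact objects, hence everything; then for fixed
  \<open>t\<close> the admissible \<open>s\<close> form one containing \<open>C\<close>.\<close>

lemma Loc_ideal: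
  assumes C: "\<And>c a. c \<in> C \<Longrightarrow> compact a \<Longrightarrow> c \<boxtimes> a \<in> C" and s: "s \<in> Loc C"
  shows "s \<boxtimes> t \<in> Loc C"
proof -
  have "c \<boxtimes> t \<in> Loc C" if "c \<in> C" for c
    using localizing_contains_all[OF localizing_tens_right[OF localizing_Loc], of c C t] C[OF that] Loc_superset by blast
  then show ?thesis
    using Loc_minimal[OF localizing_tens_left[OF localizing_Loc], of C t C] s by blast
qed

end

subsection \<open>The canonical action\<close>

context triangulated_category
begin

text \<open>The signs of the graded theory affect neither the vanishing of a composite nor
  membership in an ideal, so equality up to sign is all that is recorded.\<close>

definition pm_eq :: "'m \<Rightarrow> 'm \<Rightarrow> bool"  (infix "\<doteq>" 50) where
  "f \<doteq> g \<longleftrightarrow> f = g \<or> f = negm g"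

lemma pm_refl [simp]: "f \<doteq> f"
  by (simp add: pm_eq_def)

lemma pm_sym: "f \<doteq> g \<Longrightarrow> g \<doteq> f"
  by (auto simp: pm_eq_def)

lemma pm_trans: "f \<doteq> g \<Longrightarrow> g \<doteq> h \<Longrightarrow> f \<doteq> h"
  by (auto simp: pm_eq_def)

lemma pm_negm [simp]: "negm f \<doteq> g \<longleftrightarrow> f \<doteq> g"
  by (metis pm_eq_def negm_negm)

lemma pm_cmp: "f \<doteq> g \<Longrightarrow> h \<doteq> k \<Longrightarrow> src T h = tgt T f \<Longrightarrow> h \<cdot> f \<doteq> k \<cdot> g"
  by (auto simp: pm_eq_def)

lemma pm_shM [simp]: "shM T f \<doteq> shM T g \<longleftrightarrow> f \<doteq> g"
  by (simp add: pm_eq_def flip: shM_negm)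

lemma pm_zerom: "f \<doteq> g \<Longrightarrow> f = zerom T a b \<longleftrightarrow> g = zerom T a b"
  by (auto simp: pm_eq_def)

lemma pm_cancel_right:
  assumes "iso h" "src T f = tgt T h" "src T g = tgt T h"
  shows "f \<cdot> h \<doteq> g \<cdot> h \<longleftrightarrow> f \<doteq> g"
  using iso_cancel_right[OF assms] iso_cancel_right[OF assms(1,2), of "negm g"] assms
  by (simp add: pm_eq_def)

end

section \<open>Iterated suspensions of tensor products\<close>

context tensor_triangulated_category
begin

lemma susp_nat: "susp T a b \<cdot> (shM T f \<boxtimes>\<^sub>m g) = shM T (f \<boxtimes>\<^sub>m g) \<cdot> susp T a' b'"
  if "src T f = a'" "tgt T f = a" "src T g = b'" "tgt T g = b"
  by (rule susp_natural) (use that in auto)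

lemma funpow_shO: "(shO T ^^ k) a = shO_int (int k) a"
  by (simp add: shO_int_def)

lemma susp_nat_typed:
  "src T (susp_nat k a b) = shO_int (int k) a \<boxtimes> b \<and> tgt T (susp_nat k a b) = shO_int (int k) (a \<boxtimes> b) \<and> iso (susp_nat k a b)"
  by (induction k) (simp_all add: funpow_shO add.commute)

lemma src_susp_nat [simp]: "src T (susp_nat k a b) = shO_int (int k) a \<boxtimes> b"
  and tgt_susp_nat [simp]: "tgt T (susp_nat k a b) = shO_int (int k) (a \<boxtimes> b)"
  and iso_susp_nat [simp]: "iso (susp_nat k a b)"
  using susp_nat_typed[of k a b] by auto

text \<open>The definition peels off the last suspension; the version peeling off the first is what
  the inverse in the negative degrees of \<open>susp_int\<close> requires.\<close>

lemma susp_nat_Suc': "susp_nat (Suc k) a b = shM_int (int k) (susp T a b) \<cdot> susp_nat k (shO T a) b"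
proof (induction k)
  case (Suc k)
  have "susp_nat (Suc (Suc k)) a b = shM T (susp_nat (Suc k) a b) \<cdot> susp T (shO_int (1 + int k) a) b"
    by (subst susp_nat.simps(2)) (simp only: funpow_shO of_nat_Suc)
  also have "\<dots> = shM_int (1 + int k) (susp T a b) \<cdot> (shM T (susp_nat k (shO T a) b) \<cdot> susp T (shO_int (1 + int k) a) b)"
    unfolding Suc.IH by (subst shM_cmp') (simp_all add: add.commute)
  also have "shM T (susp_nat k (shO T a) b) \<cdot> susp T (shO_int (1 + int k) a) b = susp_nat (Suc k) (shO T a) b"
    by (simp add: funpow_shO add.commute)
  finally show ?case by simp
qed simp

lemma susp_int_typed:
  "src T (susp_int n a b) = shO_int n a \<boxtimes> b \<and> tgt T (susp_int n a b) = shO_int n (a \<boxtimes> b) \<and> iso (susp_int n a b)"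
  by (simp add: susp_int_def)

lemma src_susp_int [simp]: "src T (susp_int n a b) = shO_int n a \<boxtimes> b"
  and tgt_susp_int [simp]: "tgt T (susp_int n a b) = shO_int n (a \<boxtimes> b)"
  and iso_susp_int [simp]: "iso (susp_int n a b)"
  using susp_int_typed[of n a b] by auto

lemma susp_int_0 [simp]: "susp_int 0 a b = idm T (a \<boxtimes> b)"
  by (simp add: susp_int_def)

text \<open>One recursion valid in all degrees. With it, naturality, additivity and coherence of
  \<open>susp_int\<close> all reduce to the corresponding law of \<open>susp\<close> by
  \<open>int_equiv_induct\<close>.\<close>

lemma susp_int_Suc: "susp_int (n + 1) a b = shM T (susp_int n a b) \<cdot> susp T (shO_int n a) b"
proof (cases "0 \<le> n")
  case True
  then show ?thesis by (simp add: susp_int_def nat_add_distrib funpow_shO)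
next
  case False
  then obtain k where k: "nat (- n) = Suc k" by (cases "nat (- n)") auto
  then have n: "n = - 1 - int k" using False by simp
  let ?c = "shO_int n a"
  let ?s = "shM_int (n + 1) (susp_nat k (shO_int (n + 1) a) b)"
  have "shM T (susp_int n a b) = minv (shM T (shM_int n (susp_nat (Suc k) ?c b)))"
    using False k by (simp add: susp_int_def shM_minv del: susp_nat.simps)
  also have "shM T (shM_int n (susp_nat (Suc k) ?c b)) = shM_int (n + 1) (shM_int (int k) (susp T ?c b) \<cdot> susp_nat k (shO T ?c) b)"
    unfolding susp_nat_Suc' by simp
  also have "\<dots> = susp T ?c b \<cdot> ?s"
    by (subst shM_int_cmp) (simp_all add: n)
  also have "minv (susp T ?c b \<cdot> ?s) = minv ?s \<cdot> minv (susp T ?c b)"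
    by (rule minv_of_cmp) (simp_all add: n)
  finally have "shM T (susp_int n a b) \<cdot> susp T ?c b = minv ?s"
    by (simp add: n)
  \<comment> \<open>For \<open>k = 0\<close> the degree \<open>n + 1\<close> is 0, where
    \<open>susp_int\<close> switches to its branch for nonnegative degrees.\<close>
  moreover have "susp_int (n + 1) a b = minv ?s"
  proof (cases k)
    case 0
    then show ?thesis by (simp add: n)
  next
    case (Suc k')
    then have "\<not> 0 \<le> n + 1" "nat (- (n + 1)) = k" using n by auto
    then show ?thesis by (simp only: susp_int_def if_False)
  qed
  ultimately show ?thesis by simp
qed

lemma susp_int_natural:
  assumes [simp]: "src T f = a" "tgt T f = a'" "src T g = b" "tgt T g = b'"
  shows "susp_int n a' b' \<cdot> (shM_int n f \<boxtimes>\<^sub>m g) = shM_int n (f \<boxtimes>\<^sub>m g) \<cdot> susp_int n a b"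
proof (induction n rule: int_equiv_induct)
  case (2 n)
  have "susp_int (n + 1) a' b' \<cdot> (shM_int (n + 1) f \<boxtimes>\<^sub>m g) =
      shM T (susp_int n a' b') \<cdot> (susp T (shO_int n a') b' \<cdot> (shM T (shM_int n f) \<boxtimes>\<^sub>m g))"
    by (simp add: susp_int_Suc)
  also have "susp T (shO_int n a') b' \<cdot> (shM T (shM_int n f) \<boxtimes>\<^sub>m g) = shM T (shM_int n f \<boxtimes>\<^sub>m g) \<cdot> susp T (shO_int n a) b"
    by (rule susp_nat) simp_all
  finally have L: "susp_int (n + 1) a' b' \<cdot> (shM_int (n + 1) f \<boxtimes>\<^sub>m g) =
      shM T (susp_int n a' b' \<cdot> (shM_int n f \<boxtimes>\<^sub>m g)) \<cdot> susp T (shO_int n a) b"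
    by (simp add: shM_cmp')
  have R: "shM_int (n + 1) (f \<boxtimes>\<^sub>m g) \<cdot> susp_int (n + 1) a b =
      shM T (shM_int n (f \<boxtimes>\<^sub>m g) \<cdot> susp_int n a b) \<cdot> susp T (shO_int n a) b"
    by (simp add: susp_int_Suc shM_cmp')
  show ?case unfolding L R by (subst iso_cancel_right) (simp_all add: shM_inject)
qed simp

lemma susp_int_add: "susp_int (i + j) a b = shM_int j (susp_int i a b) \<cdot> susp_int j (shO_int i a) b"
proof (induction j rule: int_equiv_induct)
  case (2 j)
  have L: "susp_int (i + (j + 1)) a b = shM T (susp_int (i + j) a b) \<cdot> susp T (shO_int (i + j) a) b"
    using susp_int_Suc[of "i + j" a b] by (simp add: add.assoc)
  have R: "shM_int (j + 1) (susp_int i a b) \<cdot> susp_int (j + 1) (shO_int i a) b =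
     shM T (shM_int j (susp_int i a b) \<cdot> susp_int j (shO_int i a) b) \<cdot> susp T (shO_int (i + j) a) b"
    unfolding susp_int_Suc by (simp add: shM_cmp' add.commute)
  show ?case unfolding L R by (subst iso_cancel_right) (simp_all add: shM_inject add.commute)
qed simp

lemma susp_int_assoc:
  "susp_int n a (b \<boxtimes> c) \<cdot> assoc T (shO_int n a) b c =
    shM_int n (assoc T a b c) \<cdot> susp_int n (a \<boxtimes> b) c \<cdot> (susp_int n a b \<boxtimes>\<^sub>m idm T c)"
proof (induction n rule: int_equiv_induct)
  case (2 n)
  let ?Z = "susp T (shO_int n a \<boxtimes> b) c \<cdot> (susp T (shO_int n a) b \<boxtimes>\<^sub>m idm T c)"
  have "susp_int (n + 1) a (b \<boxtimes> c) \<cdot> assoc T (shO_int (n + 1) a) b c =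
    shM T (susp_int n a (b \<boxtimes> c)) \<cdot> (susp T (shO_int n a) (b \<boxtimes> c) \<cdot> assoc T (shO T (shO_int n a)) b c)"
    by (simp add: susp_int_Suc)
  also have "susp T (shO_int n a) (b \<boxtimes> c) \<cdot> assoc T (shO T (shO_int n a)) b c = shM T (assoc T (shO_int n a) b c) \<cdot> ?Z"
    by (rule susp_assoc)
  finally have L: "susp_int (n + 1) a (b \<boxtimes> c) \<cdot> assoc T (shO_int (n + 1) a) b c =
      shM T (susp_int n a (b \<boxtimes> c) \<cdot> assoc T (shO_int n a) b c) \<cdot> ?Z"
    by (simp add: shM_cmp')
  have "shM_int (n + 1) (assoc T a b c) \<cdot> susp_int (n + 1) (a \<boxtimes> b) c \<cdot> (susp_int (n + 1) a b \<boxtimes>\<^sub>m idm T c) =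
      shM_int (n + 1) (assoc T a b c) \<cdot> (shM T (susp_int n (a \<boxtimes> b) c) \<cdot> (susp T (shO_int n (a \<boxtimes> b)) c \<cdot>
        ((shM T (susp_int n a b) \<boxtimes>\<^sub>m idm T c) \<cdot> (susp T (shO_int n a) b \<boxtimes>\<^sub>m idm T c))))"
    by (simp add: susp_int_Suc tens_merge)
  also have "susp T (shO_int n (a \<boxtimes> b)) c \<cdot> ((shM T (susp_int n a b) \<boxtimes>\<^sub>m idm T c) \<cdot> (susp T (shO_int n a) b \<boxtimes>\<^sub>m idm T c)) =
     shM T (susp_int n a b \<boxtimes>\<^sub>m idm T c) \<cdot> ?Z"
    by (rule cmp_eq_cmp[OF susp_nat]) simp_all
  finally have R: "shM_int (n + 1) (assoc T a b c) \<cdot> susp_int (n + 1) (a \<boxtimes> b) c \<cdot> (susp_int (n + 1) a b \<boxtimes>\<^sub>m idm T c) =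
      shM T (shM_int n (assoc T a b c) \<cdot> susp_int n (a \<boxtimes> b) c \<cdot> (susp_int n a b \<boxtimes>\<^sub>m idm T c)) \<cdot> ?Z"
    by (simp add: shM_cmp')
  show ?case unfolding L R by (subst iso_cancel_right) (simp_all add: shM_inject)
qed simp

lemma susp_int_runit: "shM_int n (runit T a) \<cdot> susp_int n a \<bbbone> = runit T (shO_int n a)"
proof (induction n rule: int_equiv_induct)
  case (2 n)
  have L: "shM_int (n + 1) (runit T a) \<cdot> susp_int (n + 1) a \<bbbone> =
     shM T (shM_int n (runit T a) \<cdot> susp_int n a \<bbbone>) \<cdot> susp T (shO_int n a) \<bbbone>"
    by (simp add: susp_int_Suc shM_cmp')
  have R: "runit T (shO_int (n + 1) a) = shM T (runit T (shO_int n a)) \<cdot> susp T (shO_int n a) \<bbbone>"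
    using susp_runit[of "shO_int n a"] by simp
  show ?case unfolding L R by (subst iso_cancel_right) (simp_all add: shM_inject)
qed simp

lemma src_susp_right [simp]: "src T (susp_right a b) = a \<boxtimes> shO T b"
  and tgt_susp_right [simp]: "tgt T (susp_right a b) = shO T (a \<boxtimes> b)"
  and iso_susp_right [simp]: "iso (susp_right a b)"
  by (simp_all add: susp_right_def)

lemma susp_right_natural:
  assumes [simp]: "src T f = a" "tgt T f = a'" "src T g = b" "tgt T g = b'"
  shows "susp_right a' b' \<cdot> (f \<boxtimes>\<^sub>m shM T g) = shM T (f \<boxtimes>\<^sub>m g) \<cdot> susp_right a b"
proof -
  have "susp_right a' b' \<cdot> (f \<boxtimes>\<^sub>m shM T g) = shM T (braid T b' a') \<cdot> (susp T b' a' \<cdot> (braid T a' (shO T b') \<cdot> (f \<boxtimes>\<^sub>m shM T g)))"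
    by (simp add: susp_right_def)
  also have "braid T a' (shO T b') \<cdot> (f \<boxtimes>\<^sub>m shM T g) = (shM T g \<boxtimes>\<^sub>m f) \<cdot> braid T a (shO T b)"
    by (rule braid_nat) simp_all
  also have "susp T b' a' \<cdot> ((shM T g \<boxtimes>\<^sub>m f) \<cdot> braid T a (shO T b)) = shM T (g \<boxtimes>\<^sub>m f) \<cdot> (susp T b a \<cdot> braid T a (shO T b))"
    by (rule cmp_eq_cmp[OF susp_nat]) simp_all
  also have "shM T (braid T b' a') \<cdot> \<dots> = shM T (braid T b' a' \<cdot> (g \<boxtimes>\<^sub>m f)) \<cdot> (susp T b a \<cdot> braid T a (shO T b))"
    by (simp add: shM_cmp')
  also have "braid T b' a' \<cdot> (g \<boxtimes>\<^sub>m f) = (f \<boxtimes>\<^sub>m g) \<cdot> braid T b a" by (rule braid_nat) simp_all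
  finally show ?thesis by (simp add: susp_right_def shM_cmp')
qed

text \<open>The image of \<open>susp_runit\<close> under the symmetry.\<close>

lemma lunit_susp_right: "shM T (lunit T t) \<cdot> susp_right \<bbbone> t = lunit T (shO T t)"
proof -
  have "shM T (lunit T t) \<cdot> susp_right \<bbbone> t = shM T (lunit T t \<cdot> braid T t \<bbbone>) \<cdot> (susp T t \<bbbone> \<cdot> braid T \<bbbone> (shO T t))"
    by (simp add: susp_right_def shM_cmp')
  also have "\<dots> = runit T (shO T t) \<cdot> braid T \<bbbone> (shO T t)"
    unfolding lunit_braid by (rule cmp_eq_cmp1[OF susp_runit]) simp_all
  finally show ?thesis by (simp add: runit_braid)
qed

text \<open>Each degree contributes one application of \<open>susp_sign\<close>, so the suppressed
  sign is the n-th power of -1.\<close>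

lemma susp_int_sign:
  "shM T (susp_int n a t) \<cdot> susp_right (shO_int n a) t \<doteq> shM_int n (susp_right a t) \<cdot> susp_int n a (shO T t)"
proof (induction n rule: int_equiv_induct)
  case (2 n)
  let ?s = "susp T (shO_int n a) (shO T t)"
  have "shM T (susp_int (n + 1) a t) \<cdot> susp_right (shO_int (n + 1) a) t = shM T (shM T (susp_int n a t)) \<cdot>
      (shM T (susp T (shO_int n a) t) \<cdot> susp_right (shO T (shO_int n a)) t)"
    by (simp add: susp_int_Suc shM_cmp')
  also have "\<dots> = negm (shM T (shM T (susp_int n a t) \<cdot> susp_right (shO_int n a) t) \<cdot> ?s)"
    unfolding susp_sign by (simp add: shM_cmp')
  finally have L: "shM T (susp_int (n + 1) a t) \<cdot> susp_right (shO_int (n + 1) a) t =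
      negm (shM T (shM T (susp_int n a t) \<cdot> susp_right (shO_int n a) t) \<cdot> ?s)" .
  have R: "shM_int (n + 1) (susp_right a t) \<cdot> susp_int (n + 1) a (shO T t) =
     shM T (shM_int n (susp_right a t) \<cdot> susp_int n a (shO T t)) \<cdot> ?s"
    by (simp add: susp_int_Suc shM_cmp')
  show ?case unfolding L R pm_negm by (subst pm_cancel_right) (simp_all add: pm_shM)
qed simp

section \<open>The action of homogeneous elements by natural maps\<close>

lemma src_canonical [simp]: "f \<in> Hom \<bbbone> (shO_int n \<bbbone>) \<Longrightarrow> src T (canonical_map n f t) = t"
  and tgt_canonical [simp]: "f \<in> Hom \<bbbone> (shO_int n \<bbbone>) \<Longrightarrow> tgt T (canonical_map n f t) = shO_int n t"
  by (simp_all add: canonical_map_def)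

lemma canonical_lunit:
  "f \<in> Hom \<bbbone> (shO_int n \<bbbone>) \<Longrightarrow>
    canonical_map n f t \<cdot> lunit T t = shM_int n (lunit T t) \<cdot> (susp_int n \<bbbone> t \<cdot> (f \<boxtimes>\<^sub>m idm T t))"
  by (simp add: canonical_map_def)

lemma canonical_natural:
  assumes f: "f \<in> Hom \<bbbone> (shO_int n \<bbbone>)" and [simp]: "src T u = t" "tgt T u = t'"
  shows "canonical_map n f t' \<cdot> u = shM_int n u \<cdot> canonical_map n f t"
proof -
  have [simp]: "src T f = \<bbbone>" "tgt T f = shO_int n \<bbbone>" using f by auto
  have "(canonical_map n f t' \<cdot> u) \<cdot> lunit T t = canonical_map n f t' \<cdot> (u \<cdot> lunit T t)" by simp
  also have "u \<cdot> lunit T t = lunit T t' \<cdot> (idm T \<bbbone> \<boxtimes>\<^sub>m u)" by (rule lunit_nat[symmetric]) simp_all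
  also have "canonical_map n f t' \<cdot> (lunit T t' \<cdot> (idm T \<bbbone> \<boxtimes>\<^sub>m u)) =
      shM_int n (lunit T t') \<cdot> (susp_int n \<bbbone> t' \<cdot> ((idm T (shO_int n \<bbbone>) \<boxtimes>\<^sub>m u) \<cdot> (f \<boxtimes>\<^sub>m idm T t)))"
    using cmp_eq_cmp[OF canonical_lunit[OF f, of t'], of "idm T \<bbbone> \<boxtimes>\<^sub>m u"] by (simp add: tens_merge)
  also have "susp_int n \<bbbone> t' \<cdot> ((idm T (shO_int n \<bbbone>) \<boxtimes>\<^sub>m u) \<cdot> (f \<boxtimes>\<^sub>m idm T t)) =
      shM_int n (idm T \<bbbone> \<boxtimes>\<^sub>m u) \<cdot> (susp_int n \<bbbone> t \<cdot> (f \<boxtimes>\<^sub>m idm T t))"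
    using susp_int_natural[of "idm T \<bbbone>" \<bbbone> \<bbbone> u t t' n]
    by (intro cmp_eq_cmp) simp_all
  also have "shM_int n (lunit T t') \<cdot> \<dots> = shM_int n (lunit T t' \<cdot> (idm T \<bbbone> \<boxtimes>\<^sub>m u)) \<cdot> (susp_int n \<bbbone> t \<cdot> (f \<boxtimes>\<^sub>m idm T t))"
    by (simp add: shM_int_cmp)
  also have "lunit T t' \<cdot> (idm T \<bbbone> \<boxtimes>\<^sub>m u) = u \<cdot> lunit T t" by (rule lunit_nat) simp_all
  also have "shM_int n (u \<cdot> lunit T t) \<cdot> (susp_int n \<bbbone> t \<cdot> (f \<boxtimes>\<^sub>m idm T t)) = shM_int n u \<cdot> (canonical_map n f t \<cdot> lunit T t)"
    unfolding canonical_lunit[OF f] by (simp add: shM_int_cmp)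
  also have "\<dots> = (shM_int n u \<cdot> canonical_map n f t) \<cdot> lunit T t" using f by simp
  finally show ?thesis using f by (subst (asm) iso_cancel_right) simp_all
qed

lemma canonical_addm:
  "f \<in> Hom \<bbbone> (shO_int n \<bbbone>) \<Longrightarrow> g \<in> Hom \<bbbone> (shO_int n \<bbbone>) \<Longrightarrow>
    canonical_map n (f \<boxplus> g) t = canonical_map n f t \<boxplus> canonical_map n g t"
  by (simp add: canonical_map_def addm_tens addm_cmp' cmp_addm')

lemma canonical_zerom: "canonical_map n (zerom T \<bbbone> (shO_int n \<bbbone>)) t = zerom T t (shO_int n t)"
  by (simp add: canonical_map_def)

lemma canonical_unit: "canonical_map 0 (idm T \<bbbone>) t = idm T t"
  by (simp add: canonical_map_def)

lemma canonical_cmp: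
  assumes f: "f \<in> Hom \<bbbone> (shO_int i \<bbbone>)" and g: "g \<in> Hom \<bbbone> (shO_int j \<bbbone>)"
  shows "canonical_map (i + j) (shM_int j f \<cdot> g) t = shM_int j (canonical_map i f t) \<cdot> canonical_map j g t"
proof -
  have [simp]: "src T f = \<bbbone>" "tgt T f = shO_int i \<bbbone>" "src T g = \<bbbone>" "tgt T g = shO_int j \<bbbone>" using f g by auto
  have fg: "shM_int j f \<cdot> g \<in> Hom \<bbbone> (shO_int (i + j) \<bbbone>)" by (simp add: add.commute)
  let ?R = "shM_int j (canonical_map i f t) \<cdot> canonical_map j g t"
  have "?R \<cdot> lunit T t = shM_int j (canonical_map i f t) \<cdot> (shM_int j (lunit T t) \<cdot> (susp_int j \<bbbone> t \<cdot> (g \<boxtimes>\<^sub>m idm T t)))"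
    using canonical_lunit[OF g, of t] f g by simp
  also have "\<dots> = shM_int j (canonical_map i f t \<cdot> lunit T t) \<cdot> (susp_int j \<bbbone> t \<cdot> (g \<boxtimes>\<^sub>m idm T t))"
    using f g by (simp add: shM_int_cmp)
  also have "\<dots> = shM_int (i + j) (lunit T t) \<cdot> (shM_int j (susp_int i \<bbbone> t) \<cdot> (shM_int j (f \<boxtimes>\<^sub>m idm T t) \<cdot>
      (susp_int j \<bbbone> t \<cdot> (g \<boxtimes>\<^sub>m idm T t))))"
    unfolding canonical_lunit[OF f] by (simp add: shM_int_cmp add.commute)
  also have "shM_int j (f \<boxtimes>\<^sub>m idm T t) \<cdot> (susp_int j \<bbbone> t \<cdot> (g \<boxtimes>\<^sub>m idm T t)) =
      susp_int j (shO_int i \<bbbone>) t \<cdot> ((shM_int j f \<boxtimes>\<^sub>m idm T t) \<cdot> (g \<boxtimes>\<^sub>m idm T t))"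
    using susp_int_natural[of f \<bbbone> "shO_int i \<bbbone>" "idm T t" t t j, symmetric] by (intro cmp_eq_cmp) simp_all
  also have "shM_int j (susp_int i \<bbbone> t) \<cdot> \<dots> = susp_int (i + j) \<bbbone> t \<cdot> ((shM_int j f \<cdot> g) \<boxtimes>\<^sub>m idm T t)"
    unfolding susp_int_add by (simp add: tens_merge)
  also have "shM_int (i + j) (lunit T t) \<cdot> \<dots> = canonical_map (i + j) (shM_int j f \<cdot> g) t \<cdot> lunit T t"
    using canonical_lunit[OF fg] by simp
  finally show ?thesis using fg f g by (subst (asm) iso_cancel_right) (simp_all add: add.commute)
qed

text \<open>The suspension that is added on the right of the tensor product must pass the
  \<open>n\<close> suspensions on its left; this is the sign of
  \<open>susp_int_sign\<close>.\<close>

lemma canonical_shO: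
  assumes f: "f \<in> Hom \<bbbone> (shO_int n \<bbbone>)"
  shows "canonical_map n f (shO T t) \<doteq> shM T (canonical_map n f t)"
proof -
  have [simp]: "src T f = \<bbbone>" "tgt T f = shO_int n \<bbbone>" using f by auto
  let ?l = "shM_int (n + 1) (lunit T t)" and ?f = "f \<boxtimes>\<^sub>m idm T (shO T t)"
  have 1: "canonical_map n f (shO T t) \<cdot> lunit T (shO T t) =
     ?l \<cdot> ((shM_int n (susp_right \<bbbone> t) \<cdot> susp_int n \<bbbone> (shO T t)) \<cdot> ?f)"
    unfolding canonical_lunit[OF f] unfolding lunit_susp_right[symmetric] by (simp add: shM_int_cmp)
  have "shM T (canonical_map n f t) \<cdot> lunit T (shO T t) = shM T (canonical_map n f t \<cdot> lunit T t) \<cdot> susp_right \<bbbone> t"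
    unfolding lunit_susp_right[symmetric] using f by (simp add: shM_cmp')
  also have "\<dots> = ?l \<cdot> (shM T (susp_int n \<bbbone> t) \<cdot> (shM T (f \<boxtimes>\<^sub>m idm T t) \<cdot> susp_right \<bbbone> t))"
    unfolding canonical_lunit[OF f] by (simp add: shM_cmp')
  also have "shM T (f \<boxtimes>\<^sub>m idm T t) \<cdot> susp_right \<bbbone> t = susp_right (shO_int n \<bbbone>) t \<cdot> ?f"
    using susp_right_natural[of f \<bbbone> "shO_int n \<bbbone>" "idm T t" t t] by simp
  finally have 2: "shM T (canonical_map n f t) \<cdot> lunit T (shO T t) =
     ?l \<cdot> ((shM T (susp_int n \<bbbone> t) \<cdot> susp_right (shO_int n \<bbbone>) t) \<cdot> ?f)" by simp
  have "canonical_map n f (shO T t) \<cdot> lunit T (shO T t) \<doteq> shM T (canonical_map n f t) \<cdot> lunit T (shO T t)"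
    unfolding 1 2 by (intro pm_cmp pm_refl pm_sym[OF susp_int_sign]) simp_all
  then show ?thesis using f by (subst (asm) pm_cancel_right) simp_all
qed

lemma canonical_shO_int:
  assumes f: "f \<in> Hom \<bbbone> (shO_int n \<bbbone>)"
  shows "canonical_map n f (shO_int k t) \<doteq> shM_int k (canonical_map n f t)"
proof (induction k rule: int_equiv_induct)
  case (2 k)
  have 1: "canonical_map n f (shO_int (k + 1) t) \<doteq> shM T (canonical_map n f (shO_int k t))"
    using canonical_shO[OF f, of "shO_int k t"] by simp
  have 2: "shM T (canonical_map n f (shO_int k t)) \<doteq> shM_int (k + 1) (canonical_map n f t) \<longleftrightarrow>
    canonical_map n f (shO_int k t) \<doteq> shM_int k (canonical_map n f t)"
    by (simp flip: shM_shM_int)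
  show ?case using pm_trans[OF 1] pm_trans[OF pm_sym[OF 1]] 2 by blast
qed simp

lemma canonical_at_unit:
  assumes f: "f \<in> Hom \<bbbone> (shO_int n \<bbbone>)"
  shows "canonical_map n f \<bbbone> = f"
proof -
  have [simp]: "src T f = \<bbbone>" "tgt T f = shO_int n \<bbbone>" using f by auto
  have "canonical_map n f \<bbbone> \<cdot> lunit T \<bbbone> = runit T (shO_int n \<bbbone>) \<cdot> (f \<boxtimes>\<^sub>m idm T \<bbbone>)"
    unfolding canonical_lunit[OF f] unfolding lunit_unit by (rule cmp_eq_cmp1[OF susp_int_runit]) simp_all
  also have "\<dots> = f \<cdot> lunit T \<bbbone>" unfolding lunit_unit by (rule runit_nat) simp_all
  finally show ?thesis using f by (subst (asm) iso_cancel_right) simp_all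
qed

text \<open>The action of \<open>f\<close> at the unit is \<open>f\<close> itself, and it is natural
  along the arrow \<open>g\<close>. Comparing its value at the suspended unit with the suspension of
  \<open>f\<close> costs only a sign.\<close>

lemma graded_commute:
  assumes f: "f \<in> Hom \<bbbone> (shO_int i \<bbbone>)" and g: "g \<in> Hom \<bbbone> (shO_int j \<bbbone>)"
  shows "shM_int j f \<cdot> g \<doteq> shM_int i g \<cdot> f"
proof -
  have [simp]: "src T f = \<bbbone>" "tgt T f = shO_int i \<bbbone>" "src T g = \<bbbone>" "tgt T g = shO_int j \<bbbone>" using f g by auto
  have "canonical_map i f (shO_int j \<bbbone>) \<cdot> g = shM_int i g \<cdot> f"
    using canonical_natural[OF f, of g \<bbbone> "shO_int j \<bbbone>"] canonical_at_unit[OF f] by simp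
  moreover have "canonical_map i f (shO_int j \<bbbone>) \<doteq> shM_int j f"
    using canonical_shO_int[OF f, of j \<bbbone>] canonical_at_unit[OF f] by simp
  then have "canonical_map i f (shO_int j \<bbbone>) \<cdot> g \<doteq> shM_int j f \<cdot> g"
    using f by (intro pm_cmp) simp_all
  ultimately show ?thesis using pm_sym by simp
qed

text \<open>The action on a tensor product is induced from the first factor, so scalars that kill
  \<open>t\<close> also kill every t \<otimes> w.\<close>

lemma canonical_tens:
  assumes f: "f \<in> Hom \<bbbone> (shO_int n \<bbbone>)"
  shows "canonical_map n f (t \<boxtimes> w) = susp_int n t w \<cdot> (canonical_map n f t \<boxtimes>\<^sub>m idm T w)"
proof -
  have [simp]: "src T f = \<bbbone>" "tgt T f = shO_int n \<bbbone>" using f by auto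
  let ?a = "assoc T \<bbbone> t w"
  have "(canonical_map n f (t \<boxtimes> w) \<cdot> lunit T (t \<boxtimes> w)) \<cdot> ?a =
     shM_int n (lunit T (t \<boxtimes> w)) \<cdot> (susp_int n \<bbbone> (t \<boxtimes> w) \<cdot> ((f \<boxtimes>\<^sub>m (idm T t \<boxtimes>\<^sub>m idm T w)) \<cdot> ?a))"
    unfolding canonical_lunit[OF f] by simp
  also have "(f \<boxtimes>\<^sub>m (idm T t \<boxtimes>\<^sub>m idm T w)) \<cdot> ?a = assoc T (shO_int n \<bbbone>) t w \<cdot> ((f \<boxtimes>\<^sub>m idm T t) \<boxtimes>\<^sub>m idm T w)"
    by (rule assoc_nat[symmetric]) simp_all
  also have "susp_int n \<bbbone> (t \<boxtimes> w) \<cdot> \<dots> = shM_int n ?a \<cdot> ((susp_int n (\<bbbone> \<boxtimes> t) w \<cdot> (susp_int n \<bbbone> t \<boxtimes>\<^sub>m idm T w)) \<cdot> ((f \<boxtimes>\<^sub>m idm T t) \<boxtimes>\<^sub>m idm T w))"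
    by (rule cmp_eq_cmp[OF susp_int_assoc]) simp_all
  also have "shM_int n (lunit T (t \<boxtimes> w)) \<cdot> \<dots> = shM_int n (lunit T (t \<boxtimes> w) \<cdot> ?a) \<cdot>
      (susp_int n (\<bbbone> \<boxtimes> t) w \<cdot> ((susp_int n \<bbbone> t \<boxtimes>\<^sub>m idm T w) \<cdot> ((f \<boxtimes>\<^sub>m idm T t) \<boxtimes>\<^sub>m idm T w)))"
    by (simp add: shM_int_cmp)
  also have "\<dots> = shM_int n (lunit T t \<boxtimes>\<^sub>m idm T w) \<cdot> (susp_int n (\<bbbone> \<boxtimes> t) w \<cdot> ((susp_int n \<bbbone> t \<cdot> (f \<boxtimes>\<^sub>m idm T t)) \<boxtimes>\<^sub>m idm T w))"
    unfolding lunit_tens by (simp add: tens_merge)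
  also have "\<dots> = susp_int n t w \<cdot> ((shM_int n (lunit T t) \<boxtimes>\<^sub>m idm T w) \<cdot> ((susp_int n \<bbbone> t \<cdot> (f \<boxtimes>\<^sub>m idm T t)) \<boxtimes>\<^sub>m idm T w))"
    by (rule cmp_eq_cmp[OF susp_int_natural[symmetric]]) simp_all
  also have "\<dots> = susp_int n t w \<cdot> ((canonical_map n f t \<cdot> lunit T t) \<boxtimes>\<^sub>m idm T w)"
    unfolding canonical_lunit[OF f] by (simp add: tens_merge)
  also have "\<dots> = (susp_int n t w \<cdot> (canonical_map n f t \<boxtimes>\<^sub>m idm T w)) \<cdot> (lunit T t \<boxtimes>\<^sub>m idm T w)"
    using f by (simp add: tens_merge)
  also have "\<dots> = ((susp_int n t w \<cdot> (canonical_map n f t \<boxtimes>\<^sub>m idm T w)) \<cdot> lunit T (t \<boxtimes> w)) \<cdot> ?a"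
    unfolding lunit_tens[symmetric] using f by simp
  finally show ?thesis using f
    by (subst (asm) iso_cancel_right, simp, simp, simp) (subst (asm) iso_cancel_right, simp_all)
qed

text \<open>The triangle of \<open>f\<close> tensored with \<open>t\<close> becomes a triangle of
  the action on \<open>t\<close> after correcting its first two objects by unitors and suspension
  isomorphisms. Thus the cone of the action is the tensor product with the cone of
  \<open>f\<close>.\<close>

lemma canonical_tri:
  assumes t: "(f, g, h) \<in> tri T" and f: "f \<in> Hom \<bbbone> (shO_int n \<bbbone>)"
  shows "\<exists>g' h'. (canonical_map n f t, g', h') \<in> tri T \<and> tgt T g' = tgt T g \<boxtimes> t"
proof -
  have [simp]: "src T f = \<bbbone>" "tgt T f = shO_int n \<bbbone>" using f by auto
  note [simp] = tri_typed[OF t]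
  let ?v = "shM_int n (lunit T t) \<cdot> susp_int n \<bbbone> t"
  let ?g = "(g \<boxtimes>\<^sub>m idm T t) \<cdot> minv ?v"
  let ?h = "shM T (lunit T t) \<cdot> (susp T \<bbbone> t \<cdot> (h \<boxtimes>\<^sub>m idm T t))"
  have "(canonical_map n f t, ?g, ?h) \<in> tri T"
  proof (rule tri_iso[OF tens_tri[OF t, of t], of _ t "shO_int n t" _ "tgt T g \<boxtimes> t" _ "lunit T t" ?v "idm T (tgt T g \<boxtimes> t)"])
    show "?v \<cdot> (f \<boxtimes>\<^sub>m idm T t) = canonical_map n f t \<cdot> lunit T t" unfolding canonical_lunit[OF f] by simp
    have "iso ?v" by simp
    from cmp_eq_cmp1[OF minv_cmp[OF this]]
    show "idm T (tgt T g \<boxtimes> t) \<cdot> (g \<boxtimes>\<^sub>m idm T t) = ?g \<cdot> ?v" using minv_cmp[OF \<open>iso ?v\<close>] by simp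
  qed (use f in simp_all)
  then show ?thesis by (intro exI[of _ ?g] exI[of _ ?h]) simp
qed

text \<open>Let k be the action of \<open>f\<close> on the cone. By naturality k kills
  \<open>g\<close>, and \<open>h\<close> kills k, each up to sign. So k lifts through
  \<open>g\<close>, and composing k with the lift gives zero. The element \<open>f\<close> alone may
  act nontrivially on its cone, as 2 does on the mod 2 Moore spectrum.\<close>

lemma canonical_square_zero:
  assumes f: "f \<in> Hom \<bbbone> (shO_int n \<bbbone>)" and t: "(canonical_map n f t, g, h) \<in> tri T"
  shows "shM_int n (canonical_map n f (tgt T g)) \<cdot> canonical_map n f (tgt T g) = zerom T (tgt T g) (shO_int (n + n) (tgt T g))"
proof -
  define x where "x = tgt T g"
  define k where "k = canonical_map n f x"
  let ?c = "canonical_map n f t"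
  have k [simp]: "src T k = x" "tgt T k = shO_int n x" using f by (simp_all add: k_def)
  have [simp]: "src T ?c = t" "tgt T ?c = shO_int n t" "src T g = shO_int n t" "tgt T g = x" "src T h = x" "tgt T h = shO T t"
    using tri_typed[OF t] f by (simp_all add: x_def)
  have 1: "shM_int n g \<cdot> canonical_map n f (shO_int n t) \<doteq> shM_int n g \<cdot> shM_int n ?c"
    using f by (intro pm_cmp pm_refl canonical_shO_int) simp_all
  have 2: "shM_int n g \<cdot> shM_int n ?c = zerom T (shO_int n t) (shO_int n x)"
    using tri_cmp_zero1[OF t] by (simp flip: shM_int_cmp)
  have 3: "k \<cdot> g = shM_int n g \<cdot> canonical_map n f (shO_int n t)"
    unfolding k_def by (rule canonical_natural[OF f]) simp_all
  have kg: "k \<cdot> g = zerom T (shO_int n t) (shO_int n x)" unfolding 3 pm_zerom[OF 1] by (rule 2)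
  have 4: "canonical_map n f (shO T t) \<cdot> h \<doteq> shM T ?c \<cdot> h"
    using f by (intro pm_cmp pm_refl canonical_shO) simp_all
  have 5: "shM T ?c \<cdot> h = zerom T x (shO_int (n + 1) t)"
    using tri_cmp_zero3[OF t] by simp
  have 6: "canonical_map n f (shO T t) \<cdot> h = shM_int n h \<cdot> k"
    unfolding k_def by (rule canonical_natural[OF f]) simp_all
  have hk: "shM_int n h \<cdot> k = zerom T x (shO_int (n + 1) t)"
    unfolding 6[symmetric] pm_zerom[OF 4] by (rule 5)
  \<comment> \<open>Desuspended so that it ends in the cone itself, where exactness at
    \<open>h\<close> applies.\<close>
  define k' where "k' = shM_int (- n) k"
  have k' [simp]: "src T k' = shO_int (- n) x" "tgt T k' = x" by (simp_all add: k'_def)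
  have kk': "k = shM_int n k'" by (simp add: k'_def)
  have "shM_int n (h \<cdot> k') = zerom T x (shO_int (n + 1) t)" using hk by (simp add: shM_int_cmp k'_def)
  then have "h \<cdot> k' = zerom T (shO_int (- n) x) (shO T t)" by (subst (asm) shM_int_eq_zerom) simp_all
  then have "\<exists>l. src T l = src T k' \<and> tgt T l = tgt T ?c \<and> g \<cdot> l = k'"
    by (intro tri_weak_kernel2[OF t, of _ "shO_int (- n) x" "shO T t"]) simp_all
  then obtain l where l: "src T l = src T k'" "tgt T l = tgt T ?c" "g \<cdot> l = k'" by blast
  have "k \<cdot> k' = k \<cdot> (g \<cdot> l)" unfolding l(3) ..
  also have "\<dots> = zerom T (shO_int (- n) x) (shO_int n x)"
    using cmp_eq_cmp1[OF kg, of l] l(1,2) by simp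
  finally have "shM_int n (k \<cdot> k') = zerom T x (shO_int (n + n) x)" by simp
  then have "shM_int n k \<cdot> shM_int n k' = zerom T x (shO_int (n + n) x)" by (simp add: shM_int_cmp)
  then show ?thesis unfolding kk'[symmetric] by (simp add: k_def)
qed

text \<open>The action is taken at the actual target of \<open>m\<close>, so no degree of
  \<open>m\<close> has to be carried along. \<open>Ann\<close> instead suspends the action at the
  unsuspended object; \<open>kills_iff_shM_int\<close> shows that the difference, a sign, is
  harmless.\<close>

definition kills :: "int \<Rightarrow> 'm \<Rightarrow> 'm \<Rightarrow> bool" where
  "kills i f m \<longleftrightarrow> canonical_map i f (tgt T m) \<cdot> m = zerom T (src T m) (shO_int i (tgt T m))"

lemma kills_iff_shM_int:
  assumes f: "f \<in> Hom \<bbbone> (shO_int i \<bbbone>)" and m: "m \<in> Hom x (shO_int k t)"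
  shows "kills i f m \<longleftrightarrow> shM_int k (canonical_map i f t) \<cdot> m = zerom T x (shO_int (k + i) t)"
proof -
  have "canonical_map i f (shO_int k t) \<cdot> m \<doteq> shM_int k (canonical_map i f t) \<cdot> m"
    using f m by (intro pm_cmp pm_refl canonical_shO_int) simp_all
  then show ?thesis using m pm_zerom by (simp add: kills_def add.commute)
qed

text \<open>By naturality the scalar may act on either side of \<open>m\<close>; this is needed when
  a cone stands in the first variable of Hom.\<close>

lemma kills_iff_source:
  assumes f: "f \<in> Hom \<bbbone> (shO_int i \<bbbone>)"
  shows "kills i f m \<longleftrightarrow> shM_int i m \<cdot> canonical_map i f (src T m) = zerom T (src T m) (shO_int i (tgt T m))"
  unfolding kills_def using canonical_natural[OF f, of m] by simp

lemma kills_shM_int: "f \<in> Hom \<bbbone> (shO_int i \<bbbone>) \<Longrightarrow> kills i f (shM_int k m) \<longleftrightarrow> kills i f m"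
proof -
  assume f: "f \<in> Hom \<bbbone> (shO_int i \<bbbone>)"
  have 1: "canonical_map i f (shO_int k (tgt T m)) \<cdot> shM_int k m \<doteq> shM_int k (canonical_map i f (tgt T m)) \<cdot> shM_int k m"
    using f by (intro pm_cmp pm_refl canonical_shO_int) simp_all
  have 2: "shM_int k (canonical_map i f (tgt T m)) \<cdot> shM_int k m = shM_int k (canonical_map i f (tgt T m) \<cdot> m)"
    using f by (simp add: shM_int_cmp)
  have 3: "shM_int k (canonical_map i f (tgt T m) \<cdot> m) = zerom T (shO_int k (src T m)) (shO_int i (shO_int k (tgt T m)))
     \<longleftrightarrow> canonical_map i f (tgt T m) \<cdot> m = zerom T (src T m) (shO_int i (tgt T m))"
    using f by (subst shM_int_eq_zerom) (simp_all add: add.commute)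
  show ?thesis unfolding kills_def src_shM_int tgt_shM_int pm_zerom[OF 1] 2 3 ..
qed

lemma kills_cmp_left:
  assumes f: "f \<in> Hom \<bbbone> (shO_int i \<bbbone>)" and k: "kills i f m" and u: "src T u = tgt T m"
  shows "kills i f (u \<cdot> m)"
proof -
  have "canonical_map i f (tgt T u) \<cdot> (u \<cdot> m) = shM_int i u \<cdot> (canonical_map i f (tgt T m) \<cdot> m)"
    by (rule cmp_eq_cmp[OF canonical_natural[OF f u refl]]) (use f u in simp_all)
  then show ?thesis using k u by (simp add: kills_def)
qed

lemma kills_cmp_right:
  assumes f: "f \<in> Hom \<bbbone> (shO_int i \<bbbone>)" and k: "kills i f m" and u: "tgt T u = src T m"
  shows "kills i f (m \<cdot> u)"
  using cmp_eq_cmp1[OF k[unfolded kills_def], of u] f u by (simp add: kills_def)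

lemma kills_addm: "f \<in> Hom \<bbbone> (shO_int i \<bbbone>) \<Longrightarrow> kills i f m \<Longrightarrow> kills i f m' \<Longrightarrow> src T m' = src T m \<Longrightarrow>
    tgt T m' = tgt T m \<Longrightarrow> kills i f (m \<boxplus> m')"
  by (simp add: kills_def cmp_addm')

lemma kills_zerom: "f \<in> Hom \<bbbone> (shO_int i \<bbbone>) \<Longrightarrow> kills i f (zerom T a b)"
  by (simp add: kills_def)

lemma kills_add_scalar: "f \<in> Hom \<bbbone> (shO_int i \<bbbone>) \<Longrightarrow> g \<in> Hom \<bbbone> (shO_int i \<bbbone>) \<Longrightarrow>
    kills i f m \<Longrightarrow> kills i g m \<Longrightarrow> kills i (f \<boxplus> g) m"
  by (simp add: kills_def canonical_addm addm_cmp')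

lemma kills_zerom_scalar: "kills i (zerom T \<bbbone> (shO_int i \<bbbone>)) m"
  by (simp add: kills_def canonical_zerom)

lemma kills_unit: "kills 0 (idm T \<bbbone>) m \<longleftrightarrow> m = zerom T (src T m) (tgt T m)"
  by (simp add: kills_def canonical_unit)

lemma kills_mult_iff:
  assumes f: "f \<in> Hom \<bbbone> (shO_int i \<bbbone>)" and g: "g \<in> Hom \<bbbone> (shO_int j \<bbbone>)"
  shows "kills (i + j) (shM_int j f \<cdot> g) m \<longleftrightarrow> kills i f (canonical_map j g (tgt T m) \<cdot> m)"
proof -
  let ?n = "canonical_map j g (tgt T m) \<cdot> m"
  have n: "?n \<in> Hom (src T m) (shO_int j (tgt T m))" using g by simp
  have "canonical_map (i + j) (shM_int j f \<cdot> g) (tgt T m) \<cdot> m = shM_int j (canonical_map i f (tgt T m)) \<cdot> ?n"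
    unfolding canonical_cmp[OF f g] using f g by simp
  then show ?thesis unfolding kills_iff_shM_int[OF f n] by (simp add: kills_def add.commute)
qed

lemma kills_mult_left:
  assumes f: "f \<in> Hom \<bbbone> (shO_int i \<bbbone>)" and g: "g \<in> Hom \<bbbone> (shO_int j \<bbbone>)" and "kills j g m"
  shows "kills (i + j) (shM_int j f \<cdot> g) m"
  using kills_mult_iff[OF f g] assms(3) f unfolding kills_def[of j g] by (simp add: kills_zerom)

lemma kills_mult_right:
  assumes f: "f \<in> Hom \<bbbone> (shO_int i \<bbbone>)" and g: "g \<in> Hom \<bbbone> (shO_int j \<bbbone>)" and "kills i f m"
  shows "kills (i + j) (shM_int j f \<cdot> g) m"
  using kills_mult_iff[OF f g] kills_cmp_left[OF f assms(3)] g by simp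

lemma kills_idm_kills: "f \<in> Hom \<bbbone> (shO_int i \<bbbone>) \<Longrightarrow> kills i f (idm T t) \<Longrightarrow> m \<in> Hom x (shO_int k t) \<Longrightarrow> kills i f m"
  using kills_cmp_right[of f i "shM_int k (idm T t)" m] kills_shM_int[of f i k "idm T t"] by simp

lemma kills_idm_iff: "f \<in> Hom \<bbbone> (shO_int i \<bbbone>) \<Longrightarrow> kills i f (idm T t) \<longleftrightarrow> canonical_map i f t = zerom T t (shO_int i t)"
  by (simp add: kills_def)

lemma kills_idm_tens: "f \<in> Hom \<bbbone> (shO_int i \<bbbone>) \<Longrightarrow> kills i f (idm T t) \<Longrightarrow> kills i f (idm T (t \<boxtimes> w))"
  by (simp add: kills_idm_iff canonical_tens)

lemma kills_idm_retract:
  "f \<in> Hom \<bbbone> (shO_int i \<bbbone>) \<Longrightarrow> kills i f (idm T b) \<Longrightarrow> s \<in> Hom x b \<Longrightarrow> r \<in> Hom b x \<Longrightarrow> r \<cdot> s = idm T x \<Longrightarrow>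
    kills i f (idm T x)"
  using kills_cmp_left[of f i "idm T b \<cdot> s" r] kills_cmp_right[of f i "idm T b" s] by simp

lemma kills_idm_isomorphic: "f \<in> Hom \<bbbone> (shO_int i \<bbbone>) \<Longrightarrow> x \<simeq> y \<Longrightarrow> kills i f (idm T x) \<Longrightarrow> kills i f (idm T y)"
  unfolding isomorphic_def by (metis Hom_iff cmp_minv iso_minv kills_idm_retract src_minv tgt_minv)

subsection \<open>Homogeneous ideals\<close>

abbreviation S\<^sub>n :: "int \<Rightarrow> 'm set" where
  "S\<^sub>n n \<equiv> Hom \<bbbone> (shO_int n \<bbbone>)"

text \<open>The product of homogeneous elements, with \<open>j\<close> the degree of the second
  factor: an arrow does not determine its degree, so it must be supplied for suspending the first
  factor.\<close>

definition gmult :: "int \<Rightarrow> 'm \<Rightarrow> 'm \<Rightarrow> 'm" where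
  "gmult j f g = shM_int j f \<cdot> g"

lemma gmult_Hom: "f \<in> S\<^sub>n i \<Longrightarrow> g \<in> S\<^sub>n j \<Longrightarrow> gmult j f g \<in> S\<^sub>n (i + j)"
  by (simp add: gmult_def add.commute)

lemma gmult_assoc: "f \<in> S\<^sub>n i \<Longrightarrow> g \<in> S\<^sub>n j \<Longrightarrow> h \<in> S\<^sub>n k \<Longrightarrow>
    gmult k (gmult j f g) h = gmult (j + k) f (gmult k g h)"
  by (simp add: gmult_def shM_int_cmp add.commute)

lemma gmult_pm: "f \<in> S\<^sub>n i \<Longrightarrow> g \<in> S\<^sub>n j \<Longrightarrow> gmult j f g \<doteq> gmult i g f"
  unfolding gmult_def by (rule graded_commute)

section \<open>Homogeneous elements and homogeneous ideals of the graded ring\<close>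

lemma EndR_carrier: "r \<in> carrier EndR \<longleftrightarrow> (\<forall>n. r n \<in> S\<^sub>n n) \<and> finite {n. r n \<noteq> zerom T \<bbbone> (shO_int n \<bbbone>)}"
proof -
  have "carrier EndR = carrier (sum_group UNIV (\<lambda>n. hom_group \<bbbone> (shO_int n \<bbbone>)))" by (simp add: EndR_def)
  then show ?thesis unfolding carrier_sum_hom_group by (auto simp: PiE_iff)
qed

lemma EndR_mult: "r \<otimes>\<^bsub>EndR\<^esub> s = (\<lambda>n. msum \<bbbone> (shO_int n \<bbbone>) (\<lambda>i. shM_int (n - i) (r i) \<cdot> s (n - i))
       {i. r i \<noteq> zerom T \<bbbone> (shO_int i \<bbbone>)})"
  by (simp add: EndR_def)

lemma EndR_add: "r \<oplus>\<^bsub>EndR\<^esub> s = (\<lambda>n. r n \<boxplus> s n)"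
  and EndR_zero: "\<zero>\<^bsub>EndR\<^esub> = (\<lambda>n. zerom T \<bbbone> (shO_int n \<bbbone>))"
  and EndR_one: "\<one>\<^bsub>EndR\<^esub> = homog 0 (idm T \<bbbone>)"
  by (simp_all add: EndR_def homog_def fun_eq_iff)

lemma homog_same [simp]: "homog n f n = f"
  and homog_other: "m \<noteq> n \<Longrightarrow> homog n f m = zerom T \<bbbone> (shO_int m \<bbbone>)"
  by (simp_all add: homog_def)

lemma homog_zerom: "homog n (zerom T \<bbbone> (shO_int n \<bbbone>)) = \<zero>\<^bsub>EndR\<^esub>"
  by (auto simp: homog_def EndR_zero)

lemma homog_carrier: "f \<in> S\<^sub>n n \<Longrightarrow> homog n f \<in> carrier EndR"
proof -
  assume f: "f \<in> S\<^sub>n n"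
  have "finite {m. homog n f m \<noteq> zerom T \<bbbone> (shO_int m \<bbbone>)}"
    by (rule finite_subset[of _ "{n}"]) (auto simp: homog_def)
  moreover have "homog n f m \<in> S\<^sub>n m" for m using f by (cases "m = n") (auto simp: homog_def)
  ultimately show ?thesis by (simp only: EndR_carrier simp_thms)
qed

lemma homog_add: "homog n f \<oplus>\<^bsub>EndR\<^esub> homog n g = homog n (f \<boxplus> g)"
  by (auto simp: EndR_add homog_def fun_eq_iff)

lemma homog_mult:
  assumes f: "f \<in> S\<^sub>n i" and g: "g \<in> S\<^sub>n j"
  shows "homog i f \<otimes>\<^bsub>EndR\<^esub> homog j g = homog (i + j) (gmult j f g)"
proof (cases "f = zerom T \<bbbone> (shO_int i \<bbbone>)")
  case True
  then have "{k. homog i f k \<noteq> zerom T \<bbbone> (shO_int k \<bbbone>)} = {}" by (auto simp: homog_def)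
  moreover have "gmult j f g = zerom T \<bbbone> (shO_int (i + j) \<bbbone>)" using True g by (simp add: gmult_def add.commute)
  ultimately show ?thesis by (simp add: EndR_mult homog_zerom EndR_zero)
next
  case False
  then have s: "{k. homog i f k \<noteq> zerom T \<bbbone> (shO_int k \<bbbone>)} = {i}" by (auto simp: homog_def)
  show ?thesis
  proof
    fix n
    have "msum \<bbbone> (shO_int n \<bbbone>) (\<lambda>k. shM_int (n - k) (homog i f k) \<cdot> homog j g (n - k)) {i}
        = shM_int (n - i) f \<cdot> homog j g (n - i)"
      by (rule msum_delta[of _ i]) (use f g in \<open>auto simp: homog_def\<close>)
    also have "\<dots> = homog (i + j) (gmult j f g) n"
    proof (cases "n = i + j")
      case True
      then show ?thesis by (simp add: gmult_def)
    next
      case False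
      then have "n - i \<noteq> j" by auto
      then show ?thesis using f False by (simp add: homog_other)
    qed
    finally show "(homog i f \<otimes>\<^bsub>EndR\<^esub> homog j g) n = homog (i + j) (gmult j f g) n"
      unfolding EndR_mult s .
  qed
qed

text \<open>The predicate \<open>ideal\<close> includes the ring axioms for \<open>EndR\<close>. Any
  homogeneous ideal, in particular any homogeneous prime, therefore provides them, and every later
  argument about the ring starts from one.\<close>

lemma homog_idealD:
  assumes I: "homog_ideal I"
  shows homog_ideal_ring: "ring EndR" and homog_ideal_ideal: "ideal I EndR"
    and homog_ideal_subset: "I \<subseteq> carrier EndR"
    and homog_ideal_zero: "homog n (zerom T \<bbbone> (shO_int n \<bbbone>)) \<in> I"
    and homog_ideal_add: "homog n f \<in> I \<Longrightarrow> homog n g \<in> I \<Longrightarrow> homog n (f \<boxplus> g) \<in> I"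
    and homog_ideal_component: "r \<in> I \<Longrightarrow> homog n (r n) \<in> I"
proof -
  show i: "ideal I EndR" using I by (simp add: homog_ideal_def)
  interpret ideal I EndR by (rule i)
  show "ring EndR" by (rule ring_axioms)
  show "I \<subseteq> carrier EndR" by (rule a_subset)
  note sub = ideal.axioms(1)[OF i]
  show "homog n (zerom T \<bbbone> (shO_int n \<bbbone>)) \<in> I"
    unfolding homog_zerom by (rule additive_subgroup.zero_closed[OF sub])
  show "homog n f \<in> I \<Longrightarrow> homog n g \<in> I \<Longrightarrow> homog n (f \<boxplus> g) \<in> I"
    unfolding homog_add[symmetric] by (rule additive_subgroup.a_closed[OF sub])
  show "r \<in> I \<Longrightarrow> homog n (r n) \<in> I" using I by (simp add: homog_ideal_def)
qed

lemma homog_in_ideal_Hom: "homog_ideal I \<Longrightarrow> homog n f \<in> I \<Longrightarrow> f \<in> S\<^sub>n n"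
  using homog_ideal_subset[of I] EndR_carrier[of "homog n f"] by (metis homog_same subsetD)

lemma homog_ideal_mult_left:
  "homog_ideal I \<Longrightarrow> f \<in> S\<^sub>n i \<Longrightarrow> homog j g \<in> I \<Longrightarrow> homog (i + j) (gmult j f g) \<in> I"
  using ideal.I_l_closed[OF homog_ideal_ideal, of I "homog j g" "homog i f"] homog_carrier
    homog_in_ideal_Hom homog_mult by metis

lemma homog_ideal_mult_right:
  "homog_ideal I \<Longrightarrow> homog i f \<in> I \<Longrightarrow> g \<in> S\<^sub>n j \<Longrightarrow> homog (i + j) (gmult j f g) \<in> I"
  using ideal.I_r_closed[OF homog_ideal_ideal, of I "homog i f" "homog j g"] homog_carrier
    homog_in_ideal_Hom homog_mult by metis

text \<open>An element is the finite sum of its homogeneous components; the induction removes one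
  degree of the support at a time.\<close>

lemma homog_ideal_memI:
  assumes i: "ideal I EndR" and r: "r \<in> carrier EndR" and c: "\<And>n. homog n (r n) \<in> I"
  shows "r \<in> I"
proof -
  note zero_closed = additive_subgroup.zero_closed[OF ideal.axioms(1)[OF i]]
    and a_closed = additive_subgroup.a_closed[OF ideal.axioms(1)[OF i]]
  have "s \<in> I" if "finite A" "s \<in> carrier EndR" "\<And>n. homog n (s n) \<in> I" "{n. s n \<noteq> zerom T \<bbbone> (shO_int n \<bbbone>)} \<subseteq> A" for A s
    using that
  proof (induction A arbitrary: s rule: finite_induct)
    case empty
    then have "s = \<zero>\<^bsub>EndR\<^esub>" by (auto simp: EndR_zero)
    then show ?case using zero_closed by simp
  next
    case (insert a A)
    let ?s = "s(a := zerom T \<bbbone> (shO_int a \<bbbone>))"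
    have z: "homog n (?s n) \<in> I" for n
      using insert.prems(2)[of n] zero_closed homog_zerom[of n] by (cases "n = a") auto
    have "?s \<in> I"
    proof (rule insert.IH)
      have "s n \<in> S\<^sub>n n" for n using insert.prems(1) EndR_carrier by blast
      moreover have "{n. ?s n \<noteq> zerom T \<bbbone> (shO_int n \<bbbone>)} \<subseteq> {n. s n \<noteq> zerom T \<bbbone> (shO_int n \<bbbone>)}" by auto
      then have "finite {n. ?s n \<noteq> zerom T \<bbbone> (shO_int n \<bbbone>)}" using insert.prems(1) EndR_carrier finite_subset by blast
      ultimately show "?s \<in> carrier EndR" unfolding EndR_carrier by simp
      show "{n. ?s n \<noteq> zerom T \<bbbone> (shO_int n \<bbbone>)} \<subseteq> A" using insert.prems(3) by auto
    qed (rule z)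
    then have "?s \<oplus>\<^bsub>EndR\<^esub> homog a (s a) \<in> I" by (rule a_closed) (rule insert.prems(2))
    moreover have "?s \<oplus>\<^bsub>EndR\<^esub> homog a (s a) = s"
    proof
      fix n
      have "s k \<in> S\<^sub>n k" for k using insert.prems(1) EndR_carrier by blast
      then show "(?s \<oplus>\<^bsub>EndR\<^esub> homog a (s a)) n = s n" by (cases "n = a") (simp_all add: EndR_add homog_other)
    qed
    ultimately show ?case by simp
  qed
  then show ?thesis using r c EndR_carrier by blast
qed

text \<open>
  Homogeneous ideals in terms of their homogeneous elements, as sets of pairs of a degree and an
  element of that degree.  Closure under right multiplication follows from graded commutativity.
\<close>

definition hideal :: "(int \<times> 'm) set \<Rightarrow> bool" where
  "hideal J \<longleftrightarrow> (\<forall>(n, f)\<in>J. f \<in> S\<^sub>n n) \<and> (\<forall>n. (n, zerom T \<bbbone> (shO_int n \<bbbone>)) \<in> J) \<and>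
     (\<forall>n f g. (n, f) \<in> J \<longrightarrow> (n, g) \<in> J \<longrightarrow> (n, f \<boxplus> g) \<in> J) \<and>
     (\<forall>i f j g. f \<in> S\<^sub>n i \<longrightarrow> (j, g) \<in> J \<longrightarrow> (i + j, gmult j f g) \<in> J)"

lemma hidealD:
  assumes "hideal J"
  shows hideal_Hom: "(n, f) \<in> J \<Longrightarrow> f \<in> S\<^sub>n n" and hideal_zero: "(n, zerom T \<bbbone> (shO_int n \<bbbone>)) \<in> J"
    and hideal_add: "(n, f) \<in> J \<Longrightarrow> (n, g) \<in> J \<Longrightarrow> (n, f \<boxplus> g) \<in> J"
    and hideal_mult: "f \<in> S\<^sub>n i \<Longrightarrow> (j, g) \<in> J \<Longrightarrow> (i + j, gmult j f g) \<in> J"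
  using assms unfolding hideal_def by blast+

lemma hideal_negm:
  assumes J: "hideal J" and f: "(n, f) \<in> J"
  shows "(n, negm f) \<in> J"
proof -
  have "negm (idm T \<bbbone>) \<in> S\<^sub>n 0" by simp
  from hideal_mult[OF J this f] show ?thesis using hideal_Hom[OF J f] by (simp add: gmult_def)
qed

lemma hideal_pm: "hideal J \<Longrightarrow> f \<doteq> g \<Longrightarrow> (n, f) \<in> J \<longleftrightarrow> (n, g) \<in> J"
  using hideal_negm[of J n g] hideal_negm[of J n "negm g"] by (auto simp: pm_eq_def)

lemma hideal_commute:
  "hideal J \<Longrightarrow> f \<in> S\<^sub>n i \<Longrightarrow> g \<in> S\<^sub>n j \<Longrightarrow> (i + j, gmult j f g) \<in> J \<longleftrightarrow> (j + i, gmult i g f) \<in> J"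
  using hideal_pm[OF _ gmult_pm] by (metis add.commute)

lemma hideal_mult_right: "hideal J \<Longrightarrow> (i, f) \<in> J \<Longrightarrow> g \<in> S\<^sub>n j \<Longrightarrow> (i + j, gmult j f g) \<in> J"
  using hideal_commute hideal_mult hideal_Hom by metis

definition span_hideal :: "(int \<times> 'm) set \<Rightarrow> (int \<Rightarrow> 'm) set" where
  "span_hideal J = {r \<in> carrier EndR. \<forall>n. (n, r n) \<in> J}"

lemma homog_in_span_hideal: "hideal J \<Longrightarrow> homog n f \<in> span_hideal J \<longleftrightarrow> (n, f) \<in> J"
proof
  assume J: "hideal J" and f: "(n, f) \<in> J"
  have "(m, homog n f m) \<in> J" for m using f hideal_zero[OF J] by (cases "m = n") (auto simp: homog_other)
  then show "homog n f \<in> span_hideal J" using homog_carrier[OF hideal_Hom[OF J f]] by (simp add: span_hideal_def)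
next
  assume "homog n f \<in> span_hideal J"
  then have "(n, homog n f n) \<in> J" unfolding span_hideal_def by blast
  then show "(n, f) \<in> J" by simp
qed

text \<open>A component of a product is a finite sum of products of components, so closure under
  \<open>gmult\<close> and sums is enough.\<close>

lemma homog_ideal_span:
  assumes R: "ring EndR" and J: "hideal J"
  shows "homog_ideal (span_hideal J)"
proof -
  interpret ring EndR by (rule R)
  let ?I = "span_hideal J"
  have prod: "x \<otimes>\<^bsub>EndR\<^esub> y \<in> ?I" if x: "x \<in> carrier EndR" and y: "y \<in> carrier EndR"
    and *: "\<And>i j. (i + j, gmult j (x i) (y j)) \<in> J" for x y
  proof -
    have xy: "x i \<in> S\<^sub>n i" "y i \<in> S\<^sub>n i" for i using x y unfolding EndR_carrier by blast+
    have **: "(n, shM_int (n - i) (x i) \<cdot> y (n - i)) \<in> J" for n i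
      using *[of i "n - i"] by (simp add: gmult_def)
    have "(n, msum \<bbbone> (shO_int n \<bbbone>) (\<lambda>i. shM_int (n - i) (x i) \<cdot> y (n - i)) {i. x i \<noteq> zerom T \<bbbone> (shO_int i \<bbbone>)}) \<in> J" for n
    proof (rule msum_induct)
      show "finite {i. x i \<noteq> zerom T \<bbbone> (shO_int i \<bbbone>)}" using x unfolding EndR_carrier by blast
      show "shM_int (n - i) (x i) \<cdot> y (n - i) \<in> S\<^sub>n n" for i using hideal_Hom[OF J **] .
    qed (use hideal_zero[OF J] hideal_add[OF J **] in blast)+
    then show ?thesis unfolding span_hideal_def using m_closed[OF x y] by (auto simp: EndR_mult)
  qed
  have "ideal ?I EndR"
  proof (rule idealI[OF R])
    show "subgroup ?I (add_monoid EndR)"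
    proof (rule add.subgroupI)
      show "?I \<subseteq> carrier EndR" by (auto simp: span_hideal_def)
      show "?I \<noteq> {}" using homog_in_span_hideal[OF J] hideal_zero[OF J] by blast
      show "x \<oplus>\<^bsub>EndR\<^esub> y \<in> ?I" if "x \<in> ?I" "y \<in> ?I" for x y
        using that hideal_add[OF J] unfolding span_hideal_def by (auto simp: EndR_add simp del: EndR_carrier intro: a_closed[unfolded EndR_add])
      show "\<ominus>\<^bsub>EndR\<^esub> x \<in> ?I" if x: "x \<in> ?I" for x
      proof -
        have c: "x \<in> carrier EndR" "\<ominus>\<^bsub>EndR\<^esub> x \<in> carrier EndR" using x by (auto simp: span_hideal_def)
        \<comment> \<open>Negation in \<open>EndR\<close> is known only through the ring axioms, so
          its components are determined by uniqueness of additive inverses in each degree.\<close>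
        have "(\<ominus>\<^bsub>EndR\<^esub> x) n = negm (x n)" for n
        proof -
          have "x n \<boxplus> (\<ominus>\<^bsub>EndR\<^esub> x) n = (x \<oplus>\<^bsub>EndR\<^esub> (\<ominus>\<^bsub>EndR\<^esub> x)) n" by (simp add: EndR_add)
          also have "\<dots> = zerom T \<bbbone> (shO_int n \<bbbone>)" using r_neg[OF c(1)] by (simp add: EndR_zero)
          finally have "x n \<boxplus> (\<ominus>\<^bsub>EndR\<^esub> x) n = zerom T \<bbbone> (shO_int n \<bbbone>)" .
          moreover have "x n \<in> S\<^sub>n n" "(\<ominus>\<^bsub>EndR\<^esub> x) n \<in> S\<^sub>n n" using c unfolding EndR_carrier by blast+
          ultimately show ?thesis by (intro negm_eqI[symmetric]) simp_all
        qed
        then show ?thesis using c(2) hideal_negm[OF J] x unfolding span_hideal_def by simp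
      qed
    qed
    fix a x assume a: "a \<in> ?I" and x: "x \<in> carrier EndR"
    have ac: "a \<in> carrier EndR" and aJ: "\<And>n. (n, a n) \<in> J" using a by (auto simp: span_hideal_def)
    have xS: "x n \<in> S\<^sub>n n" for n using x unfolding EndR_carrier by blast
    show "x \<otimes>\<^bsub>EndR\<^esub> a \<in> ?I" by (rule prod[OF x ac]) (rule hideal_mult[OF J xS aJ])
    show "a \<otimes>\<^bsub>EndR\<^esub> x \<in> ?I" by (rule prod[OF ac x]) (rule hideal_mult_right[OF J aJ xS])
  qed
  moreover have "homog n (r n) \<in> ?I" if "r \<in> ?I" for r n
    using that unfolding homog_in_span_hideal[OF J] by (simp add: span_hideal_def)
  ultimately show ?thesis by (simp add: homog_ideal_def)
qed

section \<open>Homogeneous primes\<close>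

lemma SpechD:
  assumes p: "p \<in> Spech"
  shows Spech_ideal: "homog_ideal p"
    and Spech_unit: "homog 0 (idm T \<bbbone>) \<notin> p"
    and Spech_prime: "f \<in> S\<^sub>n i \<Longrightarrow> g \<in> S\<^sub>n j \<Longrightarrow> homog (i + j) (gmult j f g) \<in> p \<longleftrightarrow> homog i f \<in> p \<or> homog j g \<in> p"
proof -
  show I: "homog_ideal p" using p by (simp add: Spech_def)
  interpret ideal p EndR by (rule homog_ideal_ideal[OF I])
  show "homog 0 (idm T \<bbbone>) \<notin> p" using one_imp_carrier p by (auto simp: EndR_one Spech_def)
  assume f: "f \<in> S\<^sub>n i" and g: "g \<in> S\<^sub>n j"
  have h: "homog i f \<in> homog_elems" "homog j g \<in> homog_elems" using f g unfolding homog_elems_def by blast+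
  have "homog i f \<otimes>\<^bsub>EndR\<^esub> homog j g \<in> p \<Longrightarrow> homog i f \<in> p \<or> homog j g \<in> p"
    using p h unfolding Spech_def by blast
  then show "homog (i + j) (gmult j f g) \<in> p \<longleftrightarrow> homog i f \<in> p \<or> homog j g \<in> p"
    unfolding homog_mult[OF f g] using homog_ideal_mult_left[OF I f] homog_ideal_mult_right[OF I _ g] by blast
qed

lemma Spech_subsetI:
  assumes I: "homog_ideal I" and q: "q \<in> Spech" and *: "\<And>n f. f \<in> S\<^sub>n n \<Longrightarrow> homog n f \<in> I \<Longrightarrow> homog n f \<in> q"
  shows "I \<subseteq> q"
proof
  fix r assume r: "r \<in> I"
  then have c: "r \<in> carrier EndR" using homog_ideal_subset[OF I] by blast
  show "r \<in> q"
    by (rule homog_ideal_memI[OF homog_ideal_ideal[OF Spech_ideal[OF q]] c])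
      (use * homog_ideal_component[OF I r] homog_in_ideal_Hom[OF I] in blast)
qed

text \<open>Krull's theorem in graded form: an ideal maximal among those that contain
  \<open>J\<close> and miss the multiplicative system \<open>M\<close> is prime. Primality is needed
  for homogeneous elements only, so the argument stays within \<open>hideal\<close>.\<close>

lemma ex_homog_prime:
  assumes R: "ring EndR" and J: "hideal J"
    and M: "\<And>n f. M n f \<Longrightarrow> f \<in> S\<^sub>n n" "M 0 (idm T \<bbbone>)" "\<And>i f j g. M i f \<Longrightarrow> M j g \<Longrightarrow> M (i + j) (gmult j f g)"
    and disj: "\<And>n f. (n, f) \<in> J \<Longrightarrow> \<not> M n f"
  shows "\<exists>q\<in>Spech. (\<forall>(n, f)\<in>J. homog n f \<in> q) \<and> (\<forall>n f. M n f \<longrightarrow> homog n f \<notin> q)"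
proof -
  define \<A> where "\<A> = {K. hideal K \<and> J \<subseteq> K \<and> (\<forall>(n, f)\<in>K. \<not> M n f)}"
  have "\<exists>K\<in>\<A>. \<forall>X\<in>\<A>. K \<subseteq> X \<longrightarrow> X = K"
  proof (rule subset_Zorn_nonempty)
    show "\<A> \<noteq> {}" using J disj by (auto simp: \<A>_def)
    fix C assume C: "C \<noteq> {}" "subset.chain \<A> C"
    then have CA: "\<And>K. K \<in> C \<Longrightarrow> hideal K \<and> J \<subseteq> K \<and> (\<forall>(n, f)\<in>K. \<not> M n f)"
      by (auto simp: subset.chain_def \<A>_def)
    have "hideal (\<Union>C)"
      unfolding hideal_def
    proof (intro conjI allI impI)
      show "\<forall>(n, f)\<in>\<Union>C. f \<in> S\<^sub>n n" using CA hideal_Hom by blast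
      show "(n, zerom T \<bbbone> (shO_int n \<bbbone>)) \<in> \<Union>C" for n using C(1) CA hideal_zero by blast
      show "(n, f \<boxplus> g) \<in> \<Union>C" if fg: "(n, f) \<in> \<Union>C" "(n, g) \<in> \<Union>C" for n f g
      proof -
        obtain K1 K2 where K: "K1 \<in> C" "K2 \<in> C" "(n, f) \<in> K1" "(n, g) \<in> K2" using fg by blast
        then have "K1 \<subseteq> K2 \<or> K2 \<subseteq> K1" using C(2) by (auto simp: subset_chain_def)
        then show ?thesis using K CA hideal_add by blast
      qed
      show "(i + j, gmult j f g) \<in> \<Union>C" if "f \<in> S\<^sub>n i" "(j, g) \<in> \<Union>C" for i f j g
        using that CA hideal_mult by blast
    qed
    moreover have "J \<subseteq> \<Union>C" using CA C(1) by blast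
    moreover have "\<forall>(n, f)\<in>\<Union>C. \<not> M n f" using CA by blast
    ultimately show "\<Union>C \<in> \<A>" by (simp add: \<A>_def)
  qed
  then obtain K where KA: "K \<in> \<A>" and KX: "\<forall>X\<in>\<A>. K \<subseteq> X \<longrightarrow> X = K" by (elim bexE)
  have K: "hideal K" "J \<subseteq> K" using KA by (simp_all add: \<A>_def)
  have KM: "\<not> M n f" if "(n, f) \<in> K" for n f using KA that by (auto simp: \<A>_def)
  have max: "X = K" if "hideal X" "K \<subseteq> X" "\<And>n f. (n, f) \<in> X \<Longrightarrow> \<not> M n f" for X
  proof -
    have "X \<in> \<A>" using that K(2) by (auto simp: \<A>_def)
    then show ?thesis using KX that(2) by simp
  qed
  \<comment> \<open>The elements multiplying \<open>g\<close> into \<open>K\<close> form an ideal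
    containing \<open>K\<close>, strictly because of \<open>f\<close>; by maximality it meets
    \<open>M\<close>.\<close>
  have colon: "\<exists>k m. M k m \<and> (k + j, gmult j m g) \<in> K"
    if f: "f \<in> S\<^sub>n i" "(i, f) \<notin> K" and g: "g \<in> S\<^sub>n j" and fg: "(i + j, gmult j f g) \<in> K" for i f j g
  proof (rule ccontr)
    assume no: "\<not> (\<exists>k m. M k m \<and> (k + j, gmult j m g) \<in> K)"
    define X where "X = {(k, a). a \<in> S\<^sub>n k \<and> (k + j, gmult j a g) \<in> K}"
    have gadd: "gmult j (a \<boxplus> b) g = gmult j a g \<boxplus> gmult j b g" if "a \<in> S\<^sub>n k" "b \<in> S\<^sub>n k" for a b k
      using that g by (simp add: gmult_def shM_int_addm addm_cmp')
    have gzero: "gmult j (zerom T \<bbbone> (shO_int k \<bbbone>)) g = zerom T \<bbbone> (shO_int (k + j) \<bbbone>)" for k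
      using g by (simp add: gmult_def add.commute)
    have "hideal X"
      unfolding hideal_def
    proof (intro conjI allI impI)
      show "\<forall>(n, f)\<in>X. f \<in> S\<^sub>n n" by (auto simp: X_def simp del: Hom_iff)
      show "(n, zerom T \<bbbone> (shO_int n \<bbbone>)) \<in> X" for n using hideal_zero[OF K(1)] by (simp add: X_def gzero)
      show "(n, a \<boxplus> b) \<in> X" if "(n, a) \<in> X" "(n, b) \<in> X" for n a b
        using that hideal_add[OF K(1)] gadd[of a n b] addm_Hom[of a] unfolding X_def by simp
      show "(i + k, gmult k b a) \<in> X" if b: "b \<in> S\<^sub>n i" and a: "(k, a) \<in> X" for i b k a
      proof -
        have a': "a \<in> S\<^sub>n k" "(k + j, gmult j a g) \<in> K" using a by (auto simp: X_def simp del: Hom_iff)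
        have "(i + (k + j), gmult (k + j) b (gmult j a g)) \<in> K" by (rule hideal_mult[OF K(1) b a'(2)])
        then have "(i + k + j, gmult j (gmult k b a) g) \<in> K" unfolding gmult_assoc[OF b a'(1) g] by (simp add: add.assoc)
        then show ?thesis using gmult_Hom[OF b a'(1)] by (simp add: X_def del: Hom_iff)
      qed
    qed
    moreover have "K \<subseteq> X"
      using hideal_Hom[OF K(1)] hideal_mult_right[OF K(1) _ g] by (auto simp: X_def simp del: Hom_iff)
    moreover have "\<not> M n f" if "(n, f) \<in> X" for n f using that no by (auto simp: X_def simp del: Hom_iff)
    ultimately have "X = K" by (rule max)
    then show False using f fg by (auto simp: X_def simp del: Hom_iff)
  qed
  \<comment> \<open>If both factors are missing, two uses of \<open>colon\<close>, with graded
    commutativity in between, put a product of two members of \<open>M\<close> into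
    \<open>K\<close>.\<close>
  have prime: "(i, f) \<in> K \<or> (j, g) \<in> K" if f: "f \<in> S\<^sub>n i" and g: "g \<in> S\<^sub>n j" and fg: "(i + j, gmult j f g) \<in> K" for i f j g
  proof (rule ccontr)
    assume no: "\<not> ((i, f) \<in> K \<or> (j, g) \<in> K)"
    obtain k m where m: "M k m" "(k + j, gmult j m g) \<in> K" using colon[OF f _ g fg] no by blast
    have "(j + k, gmult k g m) \<in> K" using m(2) hideal_commute[OF K(1) M(1)[OF m(1)] g] by simp
    then obtain l m' where "M l m'" "(l + k, gmult k m' m) \<in> K" using colon[OF g _ M(1)[OF m(1)]] no by blast
    then show False using KM M(3) m(1) by blast
  qed
  let ?q = "span_hideal K"
  have hi: "homog_ideal ?q" by (rule homog_ideal_span[OF R K(1)])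
  have "homog 0 (idm T \<bbbone>) \<notin> ?q" using KM M(2) homog_in_span_hideal[OF K(1)] by blast
  then have "?q \<noteq> carrier EndR" using homog_carrier[of "idm T \<bbbone>" 0] by auto
  moreover have "r \<in> ?q \<or> s \<in> ?q" if rs: "r \<in> homog_elems" "s \<in> homog_elems" "r \<otimes>\<^bsub>EndR\<^esub> s \<in> ?q" for r s
  proof -
    obtain i f j g where f: "f \<in> S\<^sub>n i" "r = homog i f" and g: "g \<in> S\<^sub>n j" "s = homog j g"
      using rs unfolding homog_elems_def by blast
    show ?thesis using rs(3) prime[OF f(1) g(1)] homog_in_span_hideal[OF K(1)]
      unfolding f(2) g(2) homog_mult[OF f(1) g(1)] by blast
  qed
  ultimately have "?q \<in> Spech" using hi by (simp add: Spech_def)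
  moreover have "\<forall>(n, f)\<in>J. homog n f \<in> ?q" using K homog_in_span_hideal[OF K(1)] by blast
  moreover have "\<forall>n f. M n f \<longrightarrow> homog n f \<notin> ?q" using KM homog_in_span_hideal[OF K(1)] by blast
  ultimately show ?thesis by blast
qed

text \<open>A relation between a degree and a power, since the degree of a power grows with its
  exponent and has to be carried along.\<close>

inductive hpower :: "int \<Rightarrow> 'm \<Rightarrow> int \<Rightarrow> 'm \<Rightarrow> bool" for d f where
  hpower_0: "hpower d f 0 (idm T \<bbbone>)"
| hpower_Suc: "hpower d f n g \<Longrightarrow> hpower d f (n + d) (gmult d g f)"

lemma hpower_Hom:
  assumes f: "f \<in> S\<^sub>n d" and "hpower d f n g"
  shows "g \<in> S\<^sub>n n"
  using assms(2)
proof (induction rule: hpower.induct)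
  case (hpower_Suc n g)
  then show ?case using gmult_Hom f by blast
qed simp

lemma hpower_1: "f \<in> S\<^sub>n d \<Longrightarrow> hpower d f d f"
  using hpower_Suc[OF hpower_0, of d f] by (simp add: gmult_def)

lemma hpower_mult:
  assumes f: "f \<in> S\<^sub>n d" and a: "hpower d f i a" and "hpower d f j b"
  shows "hpower d f (i + j) (gmult j a b)"
  using assms(3)
proof (induction rule: hpower.induct)
  case hpower_0
  then show ?case using a hpower_Hom[OF f a] by (simp add: gmult_def)
next
  case (hpower_Suc j b)
  have "gmult (j + d) a (gmult d b f) = gmult d (gmult j a b) f"
    using gmult_assoc[OF hpower_Hom[OF f a] hpower_Hom[OF f hpower_Suc(1)] f] by simp
  then show ?case using hpower.hpower_Suc[OF hpower_Suc(2)] by (simp add: add.assoc)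
qed

lemma hpower_Spech:
  assumes q: "q \<in> Spech" and f: "f \<in> S\<^sub>n d" and "hpower d f n g" "homog n g \<in> q"
  shows "homog d f \<in> q"
  using assms(3,4)
proof (induction rule: hpower.induct)
  case hpower_0
  then show ?case using Spech_unit[OF q] by blast
next
  case (hpower_Suc n g)
  then show ?case using Spech_prime[OF q hpower_Hom[OF f hpower_Suc(1)] f] by blast
qed

text \<open>The multiplicative system of powers of \<open>f\<close> in Krull's theorem: whatever
  lies in all homogeneous primes over \<open>J\<close> has a power in \<open>J\<close>.\<close>

lemma ex_prime_avoiding_power:
  assumes R: "ring EndR" and J: "hideal J" and f: "f \<in> S\<^sub>n d" and no: "\<And>n g. hpower d f n g \<Longrightarrow> (n, g) \<notin> J"
  shows "\<exists>q\<in>Spech. (\<forall>(n, g)\<in>J. homog n g \<in> q) \<and> homog d f \<notin> q"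
proof -
  have "\<exists>q\<in>Spech. (\<forall>(n, f)\<in>J. homog n f \<in> q) \<and> (\<forall>n g. hpower d f n g \<longrightarrow> homog n g \<notin> q)"
    by (rule ex_homog_prime[OF R J]) (use no hpower_Hom[OF f] hpower_0 hpower_mult[OF f] in blast)+
  then show ?thesis using hpower_1[OF f] by blast
qed

text \<open>Zorn's lemma downwards, since the intersection of a nonempty chain of primes is prime.
  It is the source of weakly associated primes, which are minimal over annihilators.\<close>

lemma ex_minimal_prime:
  assumes q: "q \<in> Spech" "I \<subseteq> q"
  shows "\<exists>p\<in>Spech. I \<subseteq> p \<and> p \<subseteq> q \<and> (\<forall>p'\<in>Spech. I \<subseteq> p' \<longrightarrow> p' \<subseteq> p \<longrightarrow> p' = p)"
proof -
  interpret R: ring EndR by (rule homog_ideal_ring[OF Spech_ideal[OF q(1)]])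
  define A where "A = {p \<in> Spech. I \<subseteq> p \<and> p \<subseteq> q}"
  have qA: "q \<in> A" using q by (simp add: A_def)
  have "\<exists>m\<in>A. \<forall>a\<in>A. a \<subseteq> m \<longrightarrow> a = m"
  proof (rule predicate_Zorn[where P = "\<lambda>a b. b \<subseteq> a"])
    show "partial_order_on A (relation_of (\<lambda>a b. b \<subseteq> a) A)"
      by (rule partial_order_on_relation_ofI) auto
    fix C assume C: "C \<in> Chains (relation_of (\<lambda>a b. b \<subseteq> a) A)"
    then have CA: "C \<subseteq> A" and ch: "\<And>a b. a \<in> C \<Longrightarrow> b \<in> C \<Longrightarrow> a \<subseteq> b \<or> b \<subseteq> a"
      unfolding Chains_def relation_of_def by blast+
    show "\<exists>u\<in>A. \<forall>a\<in>C. u \<subseteq> a"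
    proof (cases "C = {}")
      case True
      then show ?thesis using qA by blast
    next
      case False
      have CS: "p \<in> Spech" if "p \<in> C" for p using that CA by (auto simp: A_def)
      have "ideal (\<Inter>C) EndR"
        by (rule R.i_Intersect) (use False homog_ideal_ideal[OF Spech_ideal[OF CS]] in blast)+
      then have "homog_ideal (\<Inter>C)"
        unfolding homog_ideal_def using homog_ideal_component[OF Spech_ideal[OF CS]] by blast
      moreover have "\<Inter>C \<noteq> carrier EndR"
        using Spech_unit[OF CS] False homog_carrier[of "idm T \<bbbone>" 0] by fastforce
      moreover have "r \<in> \<Inter>C \<or> s \<in> \<Inter>C" if rs: "r \<in> homog_elems" "s \<in> homog_elems" "r \<otimes>\<^bsub>EndR\<^esub> s \<in> \<Inter>C" for r s
      proof (rule ccontr)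
        assume "\<not> (r \<in> \<Inter>C \<or> s \<in> \<Inter>C)"
        then obtain p1 p2 where p: "p1 \<in> C" "r \<notin> p1" "p2 \<in> C" "s \<notin> p2" by blast
        then obtain p where "p \<in> C" "r \<notin> p" "s \<notin> p" using ch[OF p(1,3)] by blast
        then show False using CS[of p] rs unfolding Spech_def by blast
      qed
      ultimately have "\<Inter>C \<in> Spech" unfolding Spech_def by blast
      then have "\<Inter>C \<in> A" using CA False by (auto simp: A_def)
      then show ?thesis by blast
    qed
  qed
  then obtain p where "p \<in> A" "\<forall>a\<in>A. a \<subseteq> p \<longrightarrow> a = p" by blast
  then show ?thesis unfolding A_def by (intro bexI[of _ p] conjI ballI impI) blast+
qed

section \<open>The Zariski topology on the homogeneous spectrum\<close>

lemma one_homog_elems: "homog 0 (idm T \<bbbone>) \<in> homog_elems"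
  unfolding homog_elems_def by (intro CollectI exI[of _ 0] exI[of _ "idm T \<bbbone>"]) simp

lemma topspace_Spech [simp]: "topspace Spech_top = Spech"
proof -
  have "\<Union>{{p \<in> Spech. r \<notin> p} |r. r \<in> homog_elems} = Spech"
  proof (intro equalityI subsetI)
    fix p assume "p \<in> Spech"
    then have "p \<in> {p \<in> Spech. homog 0 (idm T \<bbbone>) \<notin> p}" using Spech_unit by simp
    then show "p \<in> \<Union>{{p \<in> Spech. r \<notin> p} |r. r \<in> homog_elems}" using one_homog_elems by blast
  qed blast
  then show ?thesis by (simp add: Spech_top_def)
qed

lemma openin_Spech_basic: "r \<in> homog_elems \<Longrightarrow> openin Spech_top {p \<in> Spech. r \<notin> p}"
  unfolding Spech_top_def by (rule topology_generated_by_Basis) blast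

text \<open>The generating sets are a basis: by primality the intersection of two of them belongs to
  the product of the two elements.\<close>

lemma openin_Spech_ex_basic:
  assumes "openin Spech_top U" "p \<in> U"
  shows "\<exists>r\<in>homog_elems. r \<notin> p \<and> {p \<in> Spech. r \<notin> p} \<subseteq> U"
proof -
  have "generate_topology_on {{p \<in> Spech. r \<notin> p} |r. r \<in> homog_elems} U"
    using assms(1) unfolding Spech_top_def by (rule openin_topology_generated_by)
  then have "\<forall>p\<in>U. p \<in> Spech \<and> (\<exists>r\<in>homog_elems. r \<notin> p \<and> {p \<in> Spech. r \<notin> p} \<subseteq> U)"
  proof (induction rule: generate_topology_on.induct)
    case (Int U V)
    show ?case
    proof
      fix p assume "p \<in> U \<inter> V"
      then have pU: "p \<in> U" "p \<in> V" by auto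
      have pS: "p \<in> Spech" using bspec[OF Int.IH(1) pU(1)] by simp
      obtain r where r: "r \<in> homog_elems" "r \<notin> p" "{p \<in> Spech. r \<notin> p} \<subseteq> U"
        using bspec[OF Int.IH(1) pU(1)] by (elim conjE bexE)
      obtain s where s: "s \<in> homog_elems" "s \<notin> p" "{p \<in> Spech. s \<notin> p} \<subseteq> V"
        using bspec[OF Int.IH(2) pU(2)] by (elim conjE bexE)
      obtain i f where f: "f \<in> S\<^sub>n i" "r = homog i f" using r(1) unfolding homog_elems_def by blast
      obtain j g where g: "g \<in> S\<^sub>n j" "s = homog j g" using s(1) unfolding homog_elems_def by blast
      let ?t = "homog (i + j) (gmult j f g)"
      have t: "?t \<in> p' \<longleftrightarrow> r \<in> p' \<or> s \<in> p'" if "p' \<in> Spech" for p'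
        using Spech_prime[OF that f(1) g(1)] f(2) g(2) by simp
      have t1: "?t \<in> homog_elems" unfolding homog_elems_def using gmult_Hom[OF f(1) g(1)] by blast
      have t2: "?t \<notin> p" using t[OF pS] r(2) s(2) by simp
      have t3: "{p \<in> Spech. ?t \<notin> p} \<subseteq> U \<inter> V"
      proof
        fix x assume "x \<in> {p \<in> Spech. ?t \<notin> p}"
        then have "x \<in> {p \<in> Spech. r \<notin> p}" "x \<in> {p \<in> Spech. s \<notin> p}" using t[of x] by auto
        then show "x \<in> U \<inter> V" using subsetD[OF r(3)] subsetD[OF s(3)] by (intro IntI)
      qed
      show "p \<in> Spech \<and> (\<exists>r\<in>homog_elems. r \<notin> p \<and> {p \<in> Spech. r \<notin> p} \<subseteq> U \<inter> V)"
        by (rule conjI[OF pS], rule bexI[OF _ t1], rule conjI[OF t2 t3])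
    qed
  next
    case (UN K)
    show ?case
    proof
      fix p assume "p \<in> \<Union>K"
      then obtain k where k: "k \<in> K" "p \<in> k" by blast
      obtain r where r: "p \<in> Spech" "r \<in> homog_elems" "r \<notin> p" "{p \<in> Spech. r \<notin> p} \<subseteq> k"
        using bspec[OF UN.IH[OF k(1)] k(2)] by (elim conjE bexE)
      have "{p \<in> Spech. r \<notin> p} \<subseteq> \<Union>K" using r(4) Union_upper[OF k(1)] by (rule subset_trans)
      then show "p \<in> Spech \<and> (\<exists>r\<in>homog_elems. r \<notin> p \<and> {p \<in> Spech. r \<notin> p} \<subseteq> \<Union>K)"
        using r(1-3) by (intro conjI bexI[of _ r])
    qed
  next
    case (Basis U)
    then obtain r where r: "r \<in> homog_elems" "U = {p \<in> Spech. r \<notin> p}" by blast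
    show ?case
    proof
      fix p assume "p \<in> U"
      then show "p \<in> Spech \<and> (\<exists>r\<in>homog_elems. r \<notin> p \<and> {p \<in> Spech. r \<notin> p} \<subseteq> U)"
        unfolding r(2) using r(1) by (intro conjI bexI[of _ r]) simp_all
    qed
  qed simp
  from bspec[OF this assms(2)] show ?thesis by (rule conjunct2)
qed

text \<open>If no power of \<open>f\<close> lay in the radical ideal generated by the elements whose
  basic open sets refine the cover, a prime would contain that ideal and avoid \<open>f\<close>. It
  would lie in a member of the cover, hence in one of these basic open sets, which is impossible.
  Since membership in the radical involves only finitely many generators, it yields a finite
  subcover.\<close>

lemma compactin_Spech_basic:
  assumes f: "f \<in> S\<^sub>n d"
  shows "compactin Spech_top {p \<in> Spech. homog d f \<notin> p}"
  unfolding compactin_def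
proof (intro conjI allI impI)
  fix \<U> assume *: "Ball \<U> (openin Spech_top) \<and> {p \<in> Spech. homog d f \<notin> p} \<subseteq> \<Union>\<U>"
  show "\<exists>\<F>. finite \<F> \<and> \<F> \<subseteq> \<U> \<and> {p \<in> Spech. homog d f \<notin> p} \<subseteq> \<Union>\<F>"
  proof (cases "Spech = {}")
    case True
    then show ?thesis by (intro exI[of _ "{}"]) auto
  next
    case False
    then have R: "ring EndR" using homog_ideal_ring[OF Spech_ideal] by blast
    define B where "B = {r \<in> homog_elems. \<exists>U\<in>\<U>. {p \<in> Spech. r \<notin> p} \<subseteq> U}"
    \<comment> \<open>The radical of the ideal generated by \<open>B\<close>, expressed by primes
      and with the finiteness of the generators used built in.\<close>
    define J where "J = {(k, a). a \<in> S\<^sub>n k \<and> (\<exists>F. finite F \<and> F \<subseteq> B \<and> (\<forall>q\<in>Spech. F \<subseteq> q \<longrightarrow> homog k a \<in> q))}"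
    have J: "(k, a) \<in> J \<longleftrightarrow> a \<in> S\<^sub>n k \<and> (\<exists>F. finite F \<and> F \<subseteq> B \<and> (\<forall>q\<in>Spech. F \<subseteq> q \<longrightarrow> homog k a \<in> q))" for k a
      by (simp only: J_def mem_Collect_eq prod.case)
    have "hideal J"
      unfolding hideal_def
    proof (intro conjI allI impI)
      show "\<forall>(n, f)\<in>J. f \<in> S\<^sub>n n" using J by (auto simp del: Hom_iff)
      show "(n, zerom T \<bbbone> (shO_int n \<bbbone>)) \<in> J" for n
        unfolding J using homog_ideal_zero[OF Spech_ideal] by (intro conjI exI[of _ "{}"]) simp_all
      show "(n, a \<boxplus> b) \<in> J" if ab: "(n, a) \<in> J" "(n, b) \<in> J" for n a b
      proof -
        obtain F1 where F1: "finite F1" "F1 \<subseteq> B" "\<forall>q\<in>Spech. F1 \<subseteq> q \<longrightarrow> homog n a \<in> q" and a: "a \<in> S\<^sub>n n"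
          using ab(1) unfolding J by (elim conjE exE)
        obtain F2 where F2: "finite F2" "F2 \<subseteq> B" "\<forall>q\<in>Spech. F2 \<subseteq> q \<longrightarrow> homog n b \<in> q" and b: "b \<in> S\<^sub>n n"
          using ab(2) unfolding J by (elim conjE exE)
        show ?thesis
          unfolding J
        proof (intro conjI exI ballI impI)
          show "finite (F1 \<union> F2)" "F1 \<union> F2 \<subseteq> B" using F1 F2 by auto
          show "a \<boxplus> b \<in> S\<^sub>n n" by (rule addm_Hom[OF a b])
          show "homog n (a \<boxplus> b) \<in> q" if "q \<in> Spech" "F1 \<union> F2 \<subseteq> q" for q
            using F1(3) F2(3) that by (intro homog_ideal_add[OF Spech_ideal]) auto
        qed
      qed
      show "(i + j, gmult j a b) \<in> J" if a: "a \<in> S\<^sub>n i" and b: "(j, b) \<in> J" for i a j b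
      proof -
        obtain F where F: "finite F" "F \<subseteq> B" "\<forall>q\<in>Spech. F \<subseteq> q \<longrightarrow> homog j b \<in> q" and b': "b \<in> S\<^sub>n j"
          using b unfolding J by (elim conjE exE)
        show ?thesis
          unfolding J
        proof (intro conjI exI ballI impI)
          show "finite F" "F \<subseteq> B" "gmult j a b \<in> S\<^sub>n (i + j)" using F gmult_Hom[OF a b'] by auto
          show "homog (i + j) (gmult j a b) \<in> q" if "q \<in> Spech" "F \<subseteq> q" for q
            using F(3) that by (intro homog_ideal_mult_left[OF Spech_ideal a]) auto
        qed
      qed
    qed
    have "\<exists>n g. hpower d f n g \<and> (n, g) \<in> J"
    proof (rule ccontr)
      assume "\<not> (\<exists>n g. hpower d f n g \<and> (n, g) \<in> J)"
      then obtain q where q: "q \<in> Spech" "\<forall>(n, g)\<in>J. homog n g \<in> q" "homog d f \<notin> q"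
        using ex_prime_avoiding_power[OF R \<open>hideal J\<close> f] by (auto simp del: Hom_iff)
      then have "q \<in> \<Union>\<U>" using * by blast
      then obtain U where U: "U \<in> \<U>" "q \<in> U" by blast
      then have "openin Spech_top U" using * by blast
      then obtain r where r: "r \<in> homog_elems" "r \<notin> q" "{p \<in> Spech. r \<notin> p} \<subseteq> U"
        using openin_Spech_ex_basic[OF \<open>openin Spech_top U\<close> U(2)] by (elim bexE conjE)
      obtain n a where a: "r = homog n a" "a \<in> S\<^sub>n n" using r(1) unfolding homog_elems_def by blast
      have "r \<in> B" using r U by (auto simp: B_def)
      then have "finite {r} \<and> {r} \<subseteq> B \<and> (\<forall>q\<in>Spech. {r} \<subseteq> q \<longrightarrow> homog n a \<in> q)" using a(1) by simp
      then have "(n, a) \<in> J" unfolding J by (rule conjI[OF a(2) exI])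
      then show False using q(2) r(2) a by blast
    qed
    then obtain n g F where g: "hpower d f n g" and F: "finite F" "F \<subseteq> B" "\<forall>q\<in>Spech. F \<subseteq> q \<longrightarrow> homog n g \<in> q"
      unfolding J by (elim conjE exE)
    have Fd: "homog d f \<in> q" if "q \<in> Spech" "F \<subseteq> q" for q
      using hpower_Spech[OF that(1) f g] F(3) that by blast
    have "\<forall>r\<in>F. \<exists>U. U \<in> \<U> \<and> {p \<in> Spech. r \<notin> p} \<subseteq> U" using F(2) unfolding B_def by blast
    then obtain h where h: "\<forall>r\<in>F. h r \<in> \<U> \<and> {p \<in> Spech. r \<notin> p} \<subseteq> h r" by metis
    have "{p \<in> Spech. homog d f \<notin> p} \<subseteq> \<Union>(h ` F)" using Fd h by blast
    then show ?thesis using F(1) h by (intro exI[of _ "h ` F"]) auto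
  qed
qed auto

text \<open>The complement is covered by basic open sets; finitely many suffice, and their elements
  cut out \<open>Z\<close>.\<close>

lemma closed_cocompact_Spech:
  assumes Z: "closedin Spech_top Z" and c: "compactin Spech_top (Spech - Z)"
  shows "\<exists>F. finite F \<and> F \<subseteq> homog_elems \<and> Z = Vset F"
proof -
  have ZS: "Z \<subseteq> Spech" and op: "openin Spech_top (Spech - Z)" using Z by (auto simp: closedin_def)
  let ?U = "(\<lambda>r. {p \<in> Spech. r \<notin> p}) ` {r \<in> homog_elems. {p \<in> Spech. r \<notin> p} \<subseteq> Spech - Z}"
  have "Spech - Z \<subseteq> \<Union>?U" using openin_Spech_ex_basic[OF op] by blast
  moreover have "\<forall>U\<in>?U. openin Spech_top U" using openin_Spech_basic by blast
  ultimately obtain \<F> where \<F>: "finite \<F>" "\<F> \<subseteq> ?U" "Spech - Z \<subseteq> \<Union>\<F>"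
    using c unfolding compactin_def by meson
  obtain F where F: "F \<subseteq> {r \<in> homog_elems. {p \<in> Spech. r \<notin> p} \<subseteq> Spech - Z}" "finite F"
     "\<F> = (\<lambda>r. {p \<in> Spech. r \<notin> p}) ` F"
    using finite_subset_image[OF \<F>(1,2)] by blast
  have "Z = Vset F" unfolding Vset_def
  proof
    show "Z \<subseteq> {q \<in> Spech. F \<subseteq> q}" using F(1) ZS by blast
    show "{q \<in> Spech. F \<subseteq> q} \<subseteq> Z" using \<F>(3) F(3) by blast
  qed
  then show ?thesis using F by blast
qed

text \<open>The homogeneous elements of the generated ideal span an ideal that contains
  \<open>F\<close>, hence contains the generated ideal; so components of its elements stay in
  it.\<close>

lemma fg_homog_ideal_gen:
  assumes R: "ring EndR" and F: "finite F" "F \<subseteq> homog_elems"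
  shows "fg_homog_ideal (genideal EndR F)"
proof -
  interpret ring EndR by (rule R)
  let ?I = "genideal EndR F"
  have Fc: "F \<subseteq> carrier EndR" using F(2) homog_carrier unfolding homog_elems_def by blast
  interpret I: ideal ?I EndR by (rule genideal_ideal[OF Fc])
  note I_zero = additive_subgroup.zero_closed[OF I.additive_subgroup_axioms]
    and I_add = additive_subgroup.a_closed[OF I.additive_subgroup_axioms]
  define J where "J = {(n, a). a \<in> S\<^sub>n n \<and> homog n a \<in> ?I}"
  have J: "hideal J"
    unfolding hideal_def
  proof (intro conjI allI impI)
    show "\<forall>(n, f)\<in>J. f \<in> S\<^sub>n n" by (auto simp: J_def simp del: Hom_iff)
    show "(n, zerom T \<bbbone> (shO_int n \<bbbone>)) \<in> J" for n using I_zero by (simp add: J_def homog_zerom)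
    show "(n, a \<boxplus> b) \<in> J" if "(n, a) \<in> J" "(n, b) \<in> J" for n a b
      using that I_add[of "homog n a" "homog n b"] addm_Hom[of a _ _ b] unfolding J_def homog_add by blast
    show "(i + j, gmult j a b) \<in> J" if a: "a \<in> S\<^sub>n i" and b: "(j, b) \<in> J" for i a j b
    proof -
      have b': "b \<in> S\<^sub>n j" "homog j b \<in> ?I" using b unfolding J_def by blast+
      show ?thesis using I.I_l_closed[OF b'(2) homog_carrier[OF a]] gmult_Hom[OF a b'(1)]
        unfolding J_def homog_mult[OF a b'(1)] by blast
    qed
  qed
  have "F \<subseteq> span_hideal J"
  proof
    fix r assume r: "r \<in> F"
    then obtain n a where a: "r = homog n a" "a \<in> S\<^sub>n n" using F(2) unfolding homog_elems_def by blast
    then have "(n, a) \<in> J" unfolding J_def using genideal_self[OF Fc] r by blast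
    then show "r \<in> span_hideal J" unfolding a(1) homog_in_span_hideal[OF J] .
  qed
  then have "?I \<subseteq> span_hideal J"
    by (rule genideal_minimal[OF homog_ideal_ideal[OF homog_ideal_span[OF R J]]])
  then have "homog n (r n) \<in> ?I" if "r \<in> ?I" for r n
    using that unfolding span_hideal_def J_def by blast
  then have "homog_ideal ?I" unfolding homog_ideal_def using I.is_ideal by blast
  then show ?thesis unfolding fg_homog_ideal_def using F(1) Fc by blast
qed

lemma Vset_genideal:
  assumes R: "ring EndR" and F: "F \<subseteq> homog_elems"
  shows "Vset (genideal EndR F) = Vset F"
proof -
  interpret ring EndR by (rule R)
  have Fc: "F \<subseteq> carrier EndR" using F homog_carrier unfolding homog_elems_def by blast
  show ?thesis
    unfolding Vset_def using genideal_self[OF Fc] genideal_minimal[OF homog_ideal_ideal[OF Spech_ideal]] by blast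
qed

text \<open>The given generators need not be homogeneous. In a homogeneous ideal they may be
  replaced by their nonzero components, of which there are finitely many.\<close>

lemma Vset_fg:
  assumes a: "fg_homog_ideal a"
  shows "\<exists>F. finite F \<and> F \<subseteq> homog_elems \<and> Vset a = Vset F"
proof -
  have ha: "homog_ideal a" using a by (simp add: fg_homog_ideal_def)
  interpret ring EndR by (rule homog_ideal_ring[OF ha])
  obtain F where F: "finite F" "F \<subseteq> carrier EndR" "a = genideal EndR F" using a by (auto simp: fg_homog_ideal_def)
  define H where "H = (\<Union>r\<in>F. (\<lambda>n. homog n (r n)) ` {n. r n \<noteq> zerom T \<bbbone> (shO_int n \<bbbone>)})"
  have FS: "r n \<in> S\<^sub>n n" "finite {n. r n \<noteq> zerom T \<bbbone> (shO_int n \<bbbone>)}" if "r \<in> F" for r n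
    using that F(2) EndR_carrier by blast+
  have H: "finite H" unfolding H_def using F(1) FS(2) by blast
  have Hh: "H \<subseteq> homog_elems" unfolding H_def homog_elems_def using FS(1) by blast
  have "Vset a = Vset H"
  proof (intro equalityI subsetI)
    fix q assume q: "q \<in> Vset a"
    have "homog n (r n) \<in> a" if "r \<in> F" for r n
      using homog_ideal_component[OF ha] genideal_self[OF F(2)] that F(3) by blast
    then show "q \<in> Vset H" using q unfolding Vset_def H_def by blast
  next
    fix q assume q: "q \<in> Vset H"
    then have qS: "q \<in> Spech" by (simp add: Vset_def)
    note I = homog_ideal_ideal[OF Spech_ideal[OF qS]]
    have "r \<in> q" if r: "r \<in> F" for r
    proof (rule homog_ideal_memI[OF I])
      show "r \<in> carrier EndR" using r F(2) by blast
      show "homog n (r n) \<in> q" for n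
      proof (cases "r n = zerom T \<bbbone> (shO_int n \<bbbone>)")
        case True
        then show ?thesis using homog_ideal_zero[OF Spech_ideal[OF qS]] by simp
      next
        case False
        then show ?thesis using q r unfolding Vset_def H_def by blast
      qed
    qed
    then have "a \<subseteq> q" unfolding F(3) by (intro genideal_minimal[OF I]) blast
    then show "q \<in> Vset a" using qS by (simp add: Vset_def)
  qed
  then show ?thesis using H Hh by blast
qed

section \<open>The comparison map and annihilators in terms of homogeneous elements\<close>

lemma comparison_mem:
  assumes "f \<in> S\<^sub>n n" "(f, g, h) \<in> tri T" "tgt T g \<notin> P"
  shows "homog n f \<in> comparison P"
  using assms unfolding comparison_def genideal_def by blast

lemma comparison_subset:
  assumes q: "q \<in> Spech" and *: "\<And>n f g h. f \<in> S\<^sub>n n \<Longrightarrow> (f, g, h) \<in> tri T \<Longrightarrow> tgt T g \<notin> P \<Longrightarrow> homog n f \<in> q"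
  shows "comparison P \<subseteq> q"
proof -
  interpret ring EndR by (rule homog_ideal_ring[OF Spech_ideal[OF q]])
  show ?thesis unfolding comparison_def
    by (rule genideal_minimal[OF homog_ideal_ideal[OF Spech_ideal[OF q]]]) (use * in blast)
qed

text \<open>The annihilator is given by conditions on the components, and a homogeneous ideal is
  determined by its homogeneous elements, so the inclusion needs testing only on these.\<close>

lemma Ann_subset_iff:
  assumes q: "q \<in> Spech" and m: "m \<in> Hom x (shO_int k t)"
  shows "Ann x t k m \<subseteq> q \<longleftrightarrow> (\<forall>i f. f \<in> S\<^sub>n i \<longrightarrow> kills i f m \<longrightarrow> homog i f \<in> q)"
proof
  assume A: "Ann x t k m \<subseteq> q"
  show "\<forall>i f. f \<in> S\<^sub>n i \<longrightarrow> kills i f m \<longrightarrow> homog i f \<in> q"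
  proof (intro allI impI)
    fix i f assume f: "f \<in> S\<^sub>n i" and kf: "kills i f m"
    have "shM_int k (canonical_map j (homog i f j) t) \<cdot> m = zerom T x (shO_int (k + j) t)" for j
    proof (cases "j = i")
      case True
      then show ?thesis using kf kills_iff_shM_int[OF f m] by simp
    next
      case False
      then show ?thesis using m by (simp add: homog_other canonical_zerom)
    qed
    then have "homog i f \<in> Ann x t k m" unfolding Ann_def using homog_carrier[OF f] by blast
    then show "homog i f \<in> q" using A by blast
  qed
next
  assume *: "\<forall>i f. f \<in> S\<^sub>n i \<longrightarrow> kills i f m \<longrightarrow> homog i f \<in> q"
  show "Ann x t k m \<subseteq> q"
  proof
    fix r assume "r \<in> Ann x t k m"
    then have r: "r \<in> carrier EndR" and z: "\<And>i. shM_int k (canonical_map i (r i) t) \<cdot> m = zerom T x (shO_int (k + i) t)"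
      unfolding Ann_def by blast+
    have rS: "r i \<in> S\<^sub>n i" for i using r EndR_carrier by blast
    have "kills i (r i) m" for i using kills_iff_shM_int[OF rS m] z by blast
    then show "r \<in> q"
      using homog_ideal_memI[OF homog_ideal_ideal[OF Spech_ideal[OF q]] r] * rS by blast
  qed
qed

lemma hideal_kills: "hideal {(i, f). f \<in> S\<^sub>n i \<and> kills i f m}"
  unfolding hideal_def
proof (intro conjI allI impI)
  show "(i + j, gmult j f g) \<in> {(i, f). f \<in> S\<^sub>n i \<and> kills i f m}"
    if f: "f \<in> S\<^sub>n i" and g: "(j, g) \<in> {(i, f). f \<in> S\<^sub>n i \<and> kills i f m}" for i f j g
  proof -
    have g': "g \<in> S\<^sub>n j" "kills j g m" using g by blast+
    show ?thesis using gmult_Hom[OF f g'(1)] kills_mult_left[OF f g'] unfolding gmult_def by blast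
  qed
  show "(n, f \<boxplus> g) \<in> {(i, f). f \<in> S\<^sub>n i \<and> kills i f m}"
    if "(n, f) \<in> {(i, f). f \<in> S\<^sub>n i \<and> kills i f m}" "(n, g) \<in> {(i, f). f \<in> S\<^sub>n i \<and> kills i f m}" for n f g
    using that kills_add_scalar[of f n g m] addm_Hom[of f _ _ g] by blast
qed (use kills_zerom_scalar in \<open>auto\<close>)

end

section \<open>Exactness in an arbitrary degree and intersections of localizing
  subcategories\<close>

context triangulated_category
begin

text \<open>The arrow is desuspended, lifted by the unshifted statement and suspended again, so the
  triangle itself is never rotated \<open>k\<close> times.\<close>

lemma tri_weak_kernel2_shift:
  assumes t: "(f, g, h) \<in> tri T" and m: "m \<in> Hom x (shO_int k (tgt T g))"
    and 0: "shM_int k h \<cdot> m = zerom T a b" and ab: "a = x" "b = shO_int (k + 1) (src T f)"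
  shows "\<exists>n. n \<in> Hom x (shO_int k (tgt T f)) \<and> shM_int k g \<cdot> n = m"
proof -
  note [simp] = tri_typed[OF t]
  have [simp]: "src T m = x" "tgt T m = shO_int k (tgt T g)" using m by auto
  have "shM_int (- k) (shM_int k h \<cdot> m) = zerom T (shO_int (- k) x) (shO T (src T f))"
    using 0 ab by (simp add: shO_int_1)
  then have "h \<cdot> shM_int (- k) m = zerom T (shO_int (- k) x) (shO T (src T f))" by (simp add: shM_int_cmp)
  then have "\<exists>n. src T n = src T (shM_int (- k) m) \<and> tgt T n = tgt T f \<and> g \<cdot> n = shM_int (- k) m"
    by (rule tri_weak_kernel2[OF t, rotated]) simp_all
  then obtain n where n: "src T n = src T (shM_int (- k) m)" "tgt T n = tgt T f" "g \<cdot> n = shM_int (- k) m" by blast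
  have "shM_int k g \<cdot> shM_int k n = shM_int k (g \<cdot> n)" using n(2) by (simp add: shM_int_cmp)
  also have "\<dots> = m" unfolding n(3) by simp
  finally show ?thesis using n(1,2) by (intro exI[of _ "shM_int k n"]) simp
qed

lemma tri_weak_kernel_shift:
  assumes t: "(f, g, h) \<in> tri T" and m: "m \<in> Hom x (shO_int k (tgt T f))"
    and 0: "shM_int k g \<cdot> m = zerom T a b" and ab: "a = x" "b = shO_int k (tgt T g)"
  shows "\<exists>n. n \<in> Hom x (shO_int k (src T f)) \<and> shM_int k f \<cdot> n = m"
proof -
  note [simp] = tri_typed[OF t]
  have [simp]: "src T m = x" "tgt T m = shO_int k (tgt T f)" using m by auto
  have "shM_int (- k) (shM_int k g \<cdot> m) = zerom T (shO_int (- k) x) (tgt T g)"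
    using 0 ab by simp
  then have "g \<cdot> shM_int (- k) m = zerom T (shO_int (- k) x) (tgt T g)" by (simp add: shM_int_cmp)
  then have "\<exists>n. src T n = src T (shM_int (- k) m) \<and> tgt T n = src T f \<and> f \<cdot> n = shM_int (- k) m"
    by (rule tri_weak_kernel[OF t, rotated]) simp_all
  then obtain n where n: "src T n = src T (shM_int (- k) m)" "tgt T n = src T f" "f \<cdot> n = shM_int (- k) m" by blast
  have "shM_int k f \<cdot> shM_int k n = shM_int k (f \<cdot> n)" using n(2) by (simp add: shM_int_cmp)
  also have "\<dots> = m" unfolding n(3) by simp
  finally show ?thesis using n(1,2) by (intro exI[of _ "shM_int k n"]) simp
qed

lemma tri_weak_kernel3_shift:
  assumes t: "(f, g, h) \<in> tri T" and m: "m \<in> Hom x (shO_int k (src T f))"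
    and 0: "shM_int k f \<cdot> m = zerom T a b" and ab: "a = x" "b = shO_int k (tgt T f)"
  shows "\<exists>n. n \<in> Hom x (shO_int (k - 1) (tgt T g)) \<and> shM_int (k - 1) h \<cdot> n = m"
proof -
  note [simp] = tri_typed[OF t]
  have [simp]: "src T m = x" "tgt T m = shO_int k (src T f)" using m by auto
  have "shM_int (k - 1) (negm (shM T f)) \<cdot> m = negm (shM_int k f \<cdot> m)" by simp
  also have "\<dots> = zerom T x (shO_int k (tgt T f))" unfolding 0 ab by simp
  finally show ?thesis by (intro tri_weak_kernel2_shift[OF tri_rotated[OF t]]) simp_all
qed

lemma localizing_INT:
  assumes "\<And>i. i \<in> A \<Longrightarrow> localizing (L i)"
  shows "localizing {t. \<forall>i\<in>A. t \<in> L i}"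
  unfolding localizing_def triangulated_sub_def
proof (intro conjI allI impI; (elim CollectE)?; (intro CollectI ballI)?)
  note L = localizing_triangulated[OF assms]
  show "z \<in> L i" if "zero_object z" "i \<in> A" for z i using triangulated_sub_zero[OF L] that by blast
  show "shO T x \<in> {t. \<forall>i\<in>A. t \<in> L i} \<longleftrightarrow> x \<in> {t. \<forall>i\<in>A. t \<in> L i}" for x
    using triangulated_sub_shO[OF L] by blast
  show "tgt T g \<in> L i" if "(f, g, h) \<in> tri T" "\<forall>i\<in>A. src T f \<in> L i" "\<forall>i\<in>A. tgt T f \<in> L i" "i \<in> A" for f g h i
    using triangulated_sub_cone[OF L] that by blast
  show "d \<in> L i" if "small_coproduct I X d \<iota>" "\<forall>j\<in>I. X j \<in> {t. \<forall>i\<in>A. t \<in> L i}" "i \<in> A" for I X d \<iota> i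
    using assms[OF that(3)] that unfolding localizing_def by blast
qed

lemma triangulated_zero_objects: "triangulated_sub (Collect zero_object)"
  unfolding triangulated_sub_def
proof (intro conjI allI impI)
  fix f g h assume t: "(f, g, h) \<in> tri T" and z: "src T f \<in> Collect zero_object" "tgt T f \<in> Collect zero_object"
  have "iso f"
    by (rule isoI[of "zerom T (tgt T f) (src T f)"]) (use z in \<open>auto simp: zero_object_iff\<close>)
  then show "tgt T g \<in> Collect zero_object" using tri_iso_iff[OF t] by simp
qed auto

end

context rigidly_compactly_generated
begin

subsection \<open>Torsion objects\<close>

text \<open>For a prime \<open>q\<close>: the image of \<open>m\<close> in the homogeneous
  localization at \<open>q\<close> is zero. The localized module itself is never formed.\<close>

definition killed_off :: "(int \<Rightarrow> 'm) set \<Rightarrow> 'm \<Rightarrow> bool" where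
  "killed_off q m \<longleftrightarrow> (\<exists>i f. f \<in> S\<^sub>n i \<and> homog i f \<notin> q \<and> kills i f m)"

lemma killed_offI: "f \<in> S\<^sub>n i \<Longrightarrow> homog i f \<notin> q \<Longrightarrow> kills i f m \<Longrightarrow> killed_off q m"
  unfolding killed_off_def by blast

lemma killed_off_zero: "q \<in> Spech \<Longrightarrow> m = zerom T (src T m) (tgt T m) \<Longrightarrow> killed_off q m"
  using killed_offI[of "idm T \<bbbone>" 0 q m] Spech_unit kills_unit by simp

lemma killed_off_cmp_left: "killed_off q m \<Longrightarrow> src T u = tgt T m \<Longrightarrow> killed_off q (u \<cdot> m)"
  unfolding killed_off_def using kills_cmp_left by blast

text \<open>The product of the two killing elements kills both arrows and stays outside
  \<open>q\<close> by primality.\<close>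

lemma killed_off_addm:
  assumes q: "q \<in> Spech" and m: "killed_off q m" "killed_off q m'" and eq: "src T m' = src T m" "tgt T m' = tgt T m"
  shows "killed_off q (m \<boxplus> m')"
proof -
  obtain i f where f: "f \<in> S\<^sub>n i" "homog i f \<notin> q" "kills i f m" using m(1) unfolding killed_off_def by blast
  obtain j g where g: "g \<in> S\<^sub>n j" "homog j g \<notin> q" "kills j g m'" using m(2) unfolding killed_off_def by blast
  have fg: "gmult j f g \<in> S\<^sub>n (i + j)" by (rule gmult_Hom[OF f(1) g(1)])
  have "kills (i + j) (gmult j f g) m" "kills (i + j) (gmult j f g) m'"
    unfolding gmult_def using kills_mult_right[OF f(1) g(1) f(3)] kills_mult_left[OF f(1) g(1) g(3)] by auto
  then have "kills (i + j) (gmult j f g) (m \<boxplus> m')" by (intro kills_addm[OF fg] eq)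
  then show ?thesis using killed_offI[OF fg] Spech_prime[OF q f(1) g(1)] f(2) g(2) by blast
qed

text \<open>Exactness of localization, by elements: some f outside \<open>q\<close> kills the image
  of \<open>m\<close> under \<open>w\<close>, so f times \<open>m\<close> comes from the middle
  object; some g outside \<open>q\<close> kills that, and the product of g and f kills
  \<open>m\<close>.\<close>

lemma killed_off_cone:
  assumes q: "q \<in> Spech" and t: "(u, v, w) \<in> tri T" and m: "m \<in> Hom x (shO_int k (tgt T v))"
    and w: "killed_off q (shM_int k w \<cdot> m)"
    and v: "\<And>i n. n \<in> Hom x (shO_int i (tgt T u)) \<Longrightarrow> killed_off q n"
  shows "killed_off q m"
proof -
  note [simp] = tri_typed[OF t]
  have [simp]: "src T m = x" "tgt T m = shO_int k (tgt T v)" using m by auto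
  obtain i f where f: "f \<in> S\<^sub>n i" "homog i f \<notin> q" "kills i f (shM_int k w \<cdot> m)" using w unfolding killed_off_def by blast
  let ?n = "canonical_map i f (shO_int k (tgt T v)) \<cdot> m"
  have n: "?n \<in> Hom x (shO_int (i + k) (tgt T v))" using f(1) by simp
  have "shM_int (i + k) w \<cdot> ?n = canonical_map i f (shO_int (k + 1) (src T u)) \<cdot> (shM_int k w \<cdot> m)"
    using cmp_eq_cmp[OF canonical_natural[OF f(1), of "shM_int k w" "shO_int k (tgt T v)" "shO_int (k + 1) (src T u)"], of m]
      f(1) by simp
  also have "\<dots> = zerom T x (shO_int (i + k + 1) (src T u))"
    using f(3) by (simp add: kills_def add.assoc)
  finally obtain n' where n': "n' \<in> Hom x (shO_int (i + k) (tgt T u))" "shM_int (i + k) v \<cdot> n' = ?n"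
    using tri_weak_kernel2_shift[OF t n] by blast
  have "killed_off q ?n" unfolding n'(2)[symmetric] using killed_off_cmp_left[OF v[OF n'(1)]] n'(1) by simp
  then obtain j g where g: "g \<in> S\<^sub>n j" "homog j g \<notin> q" "kills j g ?n" unfolding killed_off_def by blast
  have "kills (j + i) (gmult i g f) m" unfolding gmult_def using kills_mult_iff[OF g(1) f(1), of m] g(3) by simp
  then show ?thesis
    using killed_offI[OF gmult_Hom[OF g(1) f(1)]] Spech_prime[OF q g(1) f(1)] g(2) f(2) by blast
qed

text \<open>The objects \<open>t\<close> for which the localization at \<open>q\<close> of graded
  Hom from every compact object to \<open>t\<close> vanishes.\<close>

definition locally_killed :: "(int \<Rightarrow> 'm) set \<Rightarrow> 'o set" where
  "locally_killed q = {t. \<forall>x k m. compact x \<longrightarrow> m \<in> Hom x (shO_int k t) \<longrightarrow> killed_off q m}"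

lemma locally_killedD: "t \<in> locally_killed q \<Longrightarrow> compact x \<Longrightarrow> m \<in> Hom x (shO_int k t) \<Longrightarrow> killed_off q m"
  unfolding locally_killed_def by blast

text \<open>Cones are handled by \<open>killed_off_cone\<close>. For coproducts compactness is
  essential: an arrow is a finite sum, so finitely many elements outside \<open>q\<close>
  suffice.\<close>

lemma localizing_locally_killed:
  assumes q: "q \<in> Spech"
  shows "localizing (locally_killed q)"
  unfolding localizing_def triangulated_sub_def
proof (intro conjI allI impI)
  fix z assume z: "zero_object z"
  show "z \<in> locally_killed q"
    unfolding locally_killed_def
  proof (intro CollectI allI impI)
    fix x k m assume "m \<in> Hom x (shO_int k z)"
    then show "killed_off q m" using zero_object_to[of "shO_int k z" m] z by (intro killed_off_zero[OF q]) simp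
  qed
next
  fix t
  have 1: "shO_int k t \<in> locally_killed q" if t: "t \<in> locally_killed q" for t k
    unfolding locally_killed_def
  proof (intro CollectI allI impI)
    fix x l m assume x: "compact x" and m: "m \<in> Hom x (shO_int l (shO_int k t))"
    show "killed_off q m" by (rule locally_killedD[OF t x, of _ "l + k"]) (use m in simp)
  qed
  show "shO T t \<in> locally_killed q \<longleftrightarrow> t \<in> locally_killed q"
    using 1[of t 1] 1[of "shO T t" "- 1"] by (auto simp: shO_int_1)
next
  fix u v w assume t: "(u, v, w) \<in> tri T" and u: "src T u \<in> locally_killed q" "tgt T u \<in> locally_killed q"
  note [simp] = tri_typed[OF t]
  show "tgt T v \<in> locally_killed q"
    unfolding locally_killed_def
  proof (intro CollectI allI impI)
    fix x k m assume x: "compact x" and m: "m \<in> Hom x (shO_int k (tgt T v))"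
    show "killed_off q m"
    proof (rule killed_off_cone[OF q t m])
      show "killed_off q (shM_int k w \<cdot> m)" by (rule locally_killedD[OF u(1) x, of _ "k + 1"]) (use m in simp)
    qed (rule locally_killedD[OF u(2) x])
  qed
next
  fix I X d \<iota> assume sc: "small_coproduct I X d \<iota>" and X: "\<forall>i\<in>I. X i \<in> locally_killed q"
  show "d \<in> locally_killed q"
    unfolding locally_killed_def
  proof (intro CollectI allI impI)
    fix x k m assume x: "compact x" and m: "m \<in> Hom x (shO_int k d)"
    have sc': "small_coproduct I (\<lambda>i. shO_int k (X i)) (shO_int k d) (\<lambda>i. shM_int k (\<iota> i))"
      by (rule small_coproduct_shO_int[OF sc])
    then have c': "coproduct I (\<lambda>i. shO_int k (X i)) (shO_int k d) (\<lambda>i. shM_int k (\<iota> i))"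
      by (simp add: small_coproduct_def)
    from compactD[OF x sc' m] show "killed_off q m"
    proof (induction rule: fin_comb.induct)
      case (fin_comb_step i \<phi> m)
      have "killed_off q \<phi>" using X fin_comb_step(1,2) locally_killedD[OF _ x] by blast
      moreover have "src T (shM_int k (\<iota> i)) = tgt T \<phi>" "tgt T (shM_int k (\<iota> i)) = shO_int k d" "src T \<phi> = x"
        using coproduct_Hom[OF c' fin_comb_step(1)] fin_comb_step(2) by auto
      moreover have "src T m = x" "tgt T m = shO_int k d" using fin_comb_Hom[OF c' fin_comb_step(3)] by auto
      ultimately show ?case using fin_comb_step(4) by (intro killed_off_addm[OF q] killed_off_cmp_left) simp_all
    qed (rule killed_off_zero[OF q], simp)
  qed
qed

definition spec_closed :: "(int \<Rightarrow> 'm) set set \<Rightarrow> bool" where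
  "spec_closed V \<longleftrightarrow> V \<subseteq> Spech \<and> (\<forall>q\<in>V. \<forall>q'\<in>Spech. q \<subseteq> q' \<longrightarrow> q' \<in> V)"

text \<open>If \<open>m\<close> survives at a prime \<open>q\<close>, then Ann(m) lies in
  \<open>q\<close>, and a minimal prime over it inside \<open>q\<close> is weakly associated; it
  belongs to \<open>V\<close>, and \<open>V\<close> is closed under specialization. Conversely,
  nothing survives at a prime outside \<open>V\<close>, while a weakly associated prime contains the
  annihilator of some arrow.\<close>

lemma torsion_sub_eq:
  assumes V: "spec_closed V"
  shows "torsion_sub V = {t. \<forall>q\<in>Spech - V. t \<in> locally_killed q}"
proof (intro equalityI subsetI)
  fix t assume t: "t \<in> torsion_sub V"
  have "killed_off q m" if q: "q \<in> Spech" "q \<notin> V" and x: "compact x" and m: "m \<in> Hom x (shO_int k t)" for q x k m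
  proof (rule ccontr)
    assume "\<not> killed_off q m"
    then have "Ann x t k m \<subseteq> q" unfolding Ann_subset_iff[OF q(1) m] killed_off_def by blast
    then obtain p where p: "p \<in> Spech" "Ann x t k m \<subseteq> p" "p \<subseteq> q"
        "\<forall>p'\<in>Spech. Ann x t k m \<subseteq> p' \<longrightarrow> p' \<subseteq> p \<longrightarrow> p' = p"
      using ex_minimal_prime[OF q(1)] by blast
    then have "p \<in> weak_ass x t" unfolding weak_ass_def using m by blast
    then have "p \<in> V" using t x unfolding torsion_sub_def by blast
    then show False using V q p(3) unfolding spec_closed_def by blast
  qed
  then show "t \<in> {t. \<forall>q\<in>Spech - V. t \<in> locally_killed q}" unfolding locally_killed_def by blast
next
  fix t assume t: "t \<in> {t. \<forall>q\<in>Spech - V. t \<in> locally_killed q}"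
  have "p \<in> V" if x: "compact x" and p: "p \<in> weak_ass x t" for x p
  proof (rule ccontr)
    assume "p \<notin> V"
    obtain k m where pS: "p \<in> Spech" and m: "m \<in> Hom x (shO_int k t)" "Ann x t k m \<subseteq> p"
      using p unfolding weak_ass_def by blast
    have "t \<in> locally_killed p" using t pS \<open>p \<notin> V\<close> by blast
    then have "killed_off p m" using x m(1) by (rule locally_killedD)
    then show False using m(2) unfolding Ann_subset_iff[OF pS m(1)] killed_off_def by blast
  qed
  then show "t \<in> torsion_sub V" unfolding torsion_sub_def by blast
qed

lemma localizing_torsion_sub: "spec_closed V \<Longrightarrow> localizing (torsion_sub V)"
  unfolding torsion_sub_eq by (rule localizing_INT) (use localizing_locally_killed in blast)

lemma spec_closed_Vset: "spec_closed (Vset F)" and spec_closed_Zset: "spec_closed (Zset p)"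
  unfolding spec_closed_def Vset_def Zset_def by blast+

subsection \<open>Prime ideals\<close>

lemma thick_idealD:
  assumes "thick_ideal J"
  shows thick_ideal_compact: "x \<in> J \<Longrightarrow> compact x" and thick_ideal_thick: "thick J"
    and thick_ideal_triangulated: "triangulated_sub J"
    and thick_ideal_tens: "compact a \<Longrightarrow> x \<in> J \<Longrightarrow> a \<boxtimes> x \<in> J"
  using assms unfolding thick_ideal_def thick_def by blast+

lemma thick_ideal_isomorphic: "thick_ideal J \<Longrightarrow> x \<simeq> y \<Longrightarrow> x \<in> J \<Longrightarrow> y \<in> J"
  using triangulated_sub_isomorphic thick_ideal_triangulated by blast

lemma thick_ideal_tens_right: "thick_ideal J \<Longrightarrow> compact a \<Longrightarrow> x \<in> J \<Longrightarrow> x \<boxtimes> a \<in> J"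
  using thick_ideal_isomorphic[OF _ tens_comm_isomorphic thick_ideal_tens] by blast

lemma biproduct_retract:
  "biproduct x y b \<Longrightarrow> \<exists>s r. s \<in> Hom x b \<and> r \<in> Hom b x \<and> r \<cdot> s = idm T x"
  unfolding biproduct_def by blast

text \<open>The ideal quotient of \<open>J\<close> by \<open>b\<close>, used for primality of a
  maximal thick ideal as the colon ideal is used in a commutative ring.\<close>

lemma thick_ideal_colon:
  assumes J: "thick_ideal J" and b: "compact b"
  shows "thick_ideal {x. compact x \<and> x \<boxtimes> b \<in> J}" and "J \<subseteq> {x. compact x \<and> x \<boxtimes> b \<in> J}"
proof -
  let ?X = "{x. compact x \<and> x \<boxtimes> b \<in> J}"
  note tJ = thick_ideal_triangulated[OF J]
  show "J \<subseteq> ?X" using thick_ideal_compact[OF J] thick_ideal_tens_right[OF J b] by blast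
  have "triangulated_sub ?X"
    unfolding triangulated_sub_def
  proof (intro conjI allI impI)
    show "z \<in> ?X" if "zero_object z" for z
      using that compact_zero triangulated_sub_zero[OF tJ] zero_object_tens_left by blast
    show "shO T x \<in> ?X \<longleftrightarrow> x \<in> ?X" for x
      using triangulated_sub_shO[OF tJ, of "x \<boxtimes> b"] thick_ideal_isomorphic[OF J shO_tens_isomorphic]
        thick_ideal_isomorphic[OF J isomorphic_sym[OF shO_tens_isomorphic]] by auto
    show "tgt T g \<in> ?X" if t: "(f, g, h) \<in> tri T" and "src T f \<in> ?X" "tgt T f \<in> ?X" for f g h
      using that compact_cone[OF t] triangulated_sub_cone[OF tJ tens_tri[OF t, of b]] by simp
  qed
  moreover have "x \<in> ?X" if bp: "biproduct x y z" and z: "z \<in> ?X" for x y z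
  proof -
    obtain s r where s: "s \<in> Hom x z" and r: "r \<in> Hom z x" and rs: "r \<cdot> s = idm T x"
      using biproduct_retract[OF bp] by blast
    have "x \<boxtimes> b \<in> J"
    proof (rule thick_retract[OF thick_ideal_thick[OF J]])
      show "s \<boxtimes>\<^sub>m idm T b \<in> Hom (x \<boxtimes> b) (z \<boxtimes> b)" "r \<boxtimes>\<^sub>m idm T b \<in> Hom (z \<boxtimes> b) (x \<boxtimes> b)" using s r by auto
      show "(r \<boxtimes>\<^sub>m idm T b) \<cdot> (s \<boxtimes>\<^sub>m idm T b) = idm T (x \<boxtimes> b)" using s r rs by (simp add: tens_merge)
    qed (use z in blast)
    then show ?thesis using compact_retract[OF s r rs] z by blast
  qed
  moreover have "a \<boxtimes> x \<in> ?X" if "compact a" "x \<in> ?X" for a x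
    using that compact_tens thick_ideal_tens[OF J that(1)]
      thick_ideal_isomorphic[OF J isomorphic_sym[OF tens_assoc_isomorphic]] by blast
  ultimately show "thick_ideal ?X" unfolding thick_ideal_def thick_def by blast
qed

lemma thick_ideal_chain_Union:
  assumes ne: "C \<noteq> {}" and ch: "\<And>J K. J \<in> C \<Longrightarrow> K \<in> C \<Longrightarrow> J \<subseteq> K \<or> K \<subseteq> J" and C: "\<And>J. J \<in> C \<Longrightarrow> thick_ideal J"
  shows "thick_ideal (\<Union>C)"
proof -
  note tJ = thick_ideal_triangulated[OF C]
  have "triangulated_sub (\<Union>C)"
    unfolding triangulated_sub_def
  proof (intro conjI allI impI)
    show "z \<in> \<Union>C" if "zero_object z" for z using ne triangulated_sub_zero[OF tJ that] by blast
    show "shO T x \<in> \<Union>C \<longleftrightarrow> x \<in> \<Union>C" for x using triangulated_sub_shO[OF tJ] by blast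
    show "tgt T g \<in> \<Union>C" if t: "(f, g, h) \<in> tri T" and f: "src T f \<in> \<Union>C" "tgt T f \<in> \<Union>C" for f g h
    proof -
      obtain J where J: "J \<in> C" "src T f \<in> J" using f(1) by blast
      obtain K where K: "K \<in> C" "tgt T f \<in> K" using f(2) by blast
      obtain M where "M \<in> C" "src T f \<in> M" "tgt T f \<in> M" using ch[OF J(1) K(1)] J K by blast
      then show ?thesis using triangulated_sub_cone[OF tJ t] by blast
    qed
  qed
  moreover have "x \<in> \<Union>C" if "biproduct x y b" "b \<in> \<Union>C" for x y b
    using that thick_ideal_thick[OF C] unfolding thick_def by blast
  ultimately show ?thesis
    unfolding thick_ideal_def thick_def using thick_ideal_compact[OF C] thick_ideal_tens[OF C] by blast
qed

primrec tpow :: "'o \<Rightarrow> nat \<Rightarrow> 'o" where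
  "tpow c 0 = \<bbbone>"
| "tpow c (Suc k) = c \<boxtimes> tpow c k"

lemma tpow_add: "tpow c l \<boxtimes> tpow c k \<simeq> tpow c (l + k)"
proof (induction l)
  case (Suc l)
  have "tpow c (Suc l) \<boxtimes> tpow c k \<simeq> c \<boxtimes> (tpow c l \<boxtimes> tpow c k)" using tens_assoc_isomorphic by simp
  also have "\<dots> \<simeq> c \<boxtimes> tpow c (l + k)" by (intro tens_isomorphic isomorphic_refl Suc)
  finally show ?case by simp
qed (simp add: unit_tens_isomorphic)

lemma compact_tpow: "compact c \<Longrightarrow> compact (tpow c k)"
  by (induction k) (simp_all add: compact_unit compact_tens)

text \<open>Krull's argument for thick tensor ideals, with the positive tensor powers of
  \<open>c\<close> as the multiplicative system: an ideal maximal among those missing them is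
  prime.\<close>

lemma ex_prime_avoiding:
  assumes J0: "thick_ideal J0" and c: "compact c" and no: "\<And>k. tpow c (Suc k) \<notin> J0"
  shows "\<exists>P\<in>Spc. J0 \<subseteq> P \<and> c \<notin> P"
proof -
  define \<A> where "\<A> = {J. thick_ideal J \<and> J0 \<subseteq> J \<and> (\<forall>k. tpow c (Suc k) \<notin> J)}"
  have "\<exists>K\<in>\<A>. \<forall>X\<in>\<A>. K \<subseteq> X \<longrightarrow> X = K"
  proof (rule subset_Zorn_nonempty)
    show "\<A> \<noteq> {}" using J0 no by (auto simp: \<A>_def simp del: tpow.simps)
    fix C assume C: "C \<noteq> {}" "subset.chain \<A> C"
    then have ch: "J \<subseteq> K \<or> K \<subseteq> J" if "J \<in> C" "K \<in> C" for J K
      using that by (auto simp: subset_chain_def)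
    have CA: "C \<subseteq> \<A>" using C(2) by (simp add: subset_chain_def)
    have "thick_ideal (\<Union>C)"
      by (rule thick_ideal_chain_Union[OF C(1) ch]) (use CA in \<open>auto simp: \<A>_def\<close>)
    moreover have "J0 \<subseteq> \<Union>C" using C(1) CA by (auto simp: \<A>_def)
    moreover have "tpow c (Suc k) \<notin> \<Union>C" for k using CA by (auto simp: \<A>_def simp del: tpow.simps)
    ultimately show "\<Union>C \<in> \<A>" by (simp add: \<A>_def del: tpow.simps)
  qed
  then obtain K where KA: "K \<in> \<A>" and KX: "\<forall>X\<in>\<A>. K \<subseteq> X \<longrightarrow> X = K" by (elim bexE)
  have K: "thick_ideal K" "J0 \<subseteq> K" and Kc: "tpow c (Suc k) \<notin> K" for k
    using KA by (simp_all add: \<A>_def del: tpow.simps)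
  have colon: "\<exists>k. tpow c (Suc k) \<boxtimes> b \<in> K" if a: "compact a" "a \<notin> K" and b: "compact b" and ab: "a \<boxtimes> b \<in> K" for a b
  proof (rule ccontr)
    assume no: "\<not> (\<exists>k. tpow c (Suc k) \<boxtimes> b \<in> K)"
    let ?X = "{x. compact x \<and> x \<boxtimes> b \<in> K}"
    have "?X \<in> \<A>" unfolding \<A>_def using thick_ideal_colon[OF K(1) b] K(2) no by blast
    then have "?X = K" using KX thick_ideal_colon(2)[OF K(1) b] by blast
    then show False using a ab by blast
  qed
  have "a \<in> K \<or> b \<in> K" if a: "compact a" and b: "compact b" and ab: "a \<boxtimes> b \<in> K" for a b
  proof (rule ccontr)
    assume no: "\<not> (a \<in> K \<or> b \<in> K)"
    obtain k where k: "tpow c (Suc k) \<boxtimes> b \<in> K" using colon[OF a _ b ab] no by blast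
    have "b \<boxtimes> tpow c (Suc k) \<in> K" by (rule thick_ideal_isomorphic[OF K(1) tens_comm_isomorphic k])
    then obtain l where "tpow c (Suc l) \<boxtimes> tpow c (Suc k) \<in> K"
      using colon[OF b _ compact_tpow[OF c, of "Suc k"]] no by blast
    then have "tpow c (Suc l + Suc k) \<in> K" by (rule thick_ideal_isomorphic[OF K(1) tpow_add])
    moreover have "Suc l + Suc k = Suc (l + Suc k)" by simp
    ultimately show False using Kc[of "l + Suc k"] by metis
  qed
  moreover have cK: "c \<notin> K"
  proof
    assume "c \<in> K"
    then have "c \<boxtimes> \<bbbone> \<in> K" by (rule thick_ideal_tens_right[OF K(1) compact_unit])
    then show False using Kc[of 0] by simp
  qed
  then have "K \<noteq> Collect compact" using c by blast
  ultimately have "K \<in> Spc" unfolding Spc_def using K(1) by blast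
  then show ?thesis using K(2) cK by blast
qed

text \<open>The kernel of localization at \<open>q\<close> on compact objects. Since every arrow
  into an object factors through its identity, killing the identity suffices, and cones are covered
  by \<open>killed_off_cone\<close> applied to the identity of the cone.\<close>

lemma thick_ideal_killed_off:
  assumes q: "q \<in> Spech"
  shows "thick_ideal {x. compact x \<and> killed_off q (idm T x)}" (is "thick_ideal ?X")
proof -
  have iso: "killed_off q (idm T y)" if "x \<simeq> y" "killed_off q (idm T x)" for x y
    using that kills_idm_isomorphic unfolding killed_off_def by blast
  have shift: "killed_off q (idm T (shO_int k x)) \<longleftrightarrow> killed_off q (idm T x)" for k x
    unfolding killed_off_def using kills_shM_int[of _ _ k "idm T x"] by (metis shM_int_idm)
  have "triangulated_sub ?X"
    unfolding triangulated_sub_def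
  proof (intro conjI allI impI)
    show "z \<in> ?X" if "zero_object z" for z
      using that compact_zero killed_off_zero[OF q, of "idm T z"] by (simp add: zero_object_iff)
    show "shO T x \<in> ?X \<longleftrightarrow> x \<in> ?X" for x using shift[of 1 x] by (simp add: shO_int_1)
    show "tgt T v \<in> ?X" if t: "(u, v, w) \<in> tri T" and u: "src T u \<in> ?X" "tgt T u \<in> ?X" for u v w
    proof -
      note [simp] = tri_typed[OF t]
      have kill: "killed_off q m" if "killed_off q (idm T y)" "m \<in> Hom x (shO_int k y)" for x y k m
        using that kills_idm_kills unfolding killed_off_def by blast
      have "killed_off q (idm T (tgt T v))"
      proof (rule killed_off_cone[OF q t, of _ "tgt T v" 0])
        show "killed_off q (shM_int 0 w \<cdot> idm T (tgt T v))"
          by (rule kill[of "src T u" _ _ 1]) (use u in \<open>simp_all add: shO_int_1\<close>)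
        show "killed_off q n" if "n \<in> Hom (tgt T v) (shO_int i (tgt T u))" for i n
          by (rule kill[OF _ that]) (use u in blast)
      qed simp
      then show ?thesis using compact_cone[OF t] u by simp
    qed
  qed
  moreover have "x \<in> ?X" if bp: "biproduct x y b" and b: "b \<in> ?X" for x y b
  proof -
    obtain s r where sr: "s \<in> Hom x b" "r \<in> Hom b x" "r \<cdot> s = idm T x" using biproduct_retract[OF bp] by blast
    then have "killed_off q (idm T x)" using b kills_idm_retract[OF _ _ sr] unfolding killed_off_def by blast
    then show ?thesis using compact_retract[OF sr] b by blast
  qed
  moreover have "a \<boxtimes> x \<in> ?X" if "compact a" "x \<in> ?X" for a x
  proof -
    have "killed_off q (idm T (x \<boxtimes> a))" using that(2) kills_idm_tens unfolding killed_off_def by blast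
    then have "killed_off q (idm T (a \<boxtimes> x))" by (rule iso[OF tens_comm_isomorphic])
    then show ?thesis using that compact_tens by blast
  qed
  ultimately show ?thesis unfolding thick_ideal_def thick_def by blast
qed

text \<open>Rigidity makes c a retract of c \<otimes> d \<otimes> c, hence c \<otimes> z a retract
  of a tensor multiple of c \<otimes> c \<otimes> z. One factor at a time can thus be removed from a
  tensor power without losing the vanishing of the action.\<close>

lemma kills_tpow:
  assumes c: "compact c" and f: "f \<in> S\<^sub>n i" and "kills i f (idm T (tpow c (Suc k)))"
  shows "kills i f (idm T c)"
  using assms(3)
proof (induction k)
  case 0
  have "tpow c (Suc 0) \<simeq> c" by (rule isomorphicI[of "runit T c"]) simp_all
  then show ?case using kills_idm_isomorphic[OF f] 0 by blast
next
  case (Suc k)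
  let ?z = "tpow c k"
  obtain d s r where sr: "s \<in> Hom c (c \<boxtimes> (d \<boxtimes> c))" "r \<in> Hom (c \<boxtimes> (d \<boxtimes> c)) c" "r \<cdot> s = idm T c"
    using rigid_retract c compact_iff_rigid by metis
  have "(c \<boxtimes> (c \<boxtimes> ?z)) \<boxtimes> d \<simeq> d \<boxtimes> (c \<boxtimes> (c \<boxtimes> ?z))" by (rule tens_comm_isomorphic)
  also have "\<dots> \<simeq> c \<boxtimes> (d \<boxtimes> (c \<boxtimes> ?z))" by (rule tens_left_comm_isomorphic)
  also have "\<dots> \<simeq> c \<boxtimes> ((d \<boxtimes> c) \<boxtimes> ?z)"
    by (intro tens_isomorphic isomorphic_refl isomorphic_sym[OF tens_assoc_isomorphic])
  also have "\<dots> \<simeq> (c \<boxtimes> (d \<boxtimes> c)) \<boxtimes> ?z" by (rule isomorphic_sym[OF tens_assoc_isomorphic])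
  finally have "(c \<boxtimes> (c \<boxtimes> ?z)) \<boxtimes> d \<simeq> (c \<boxtimes> (d \<boxtimes> c)) \<boxtimes> ?z" .
  moreover have "kills i f (idm T ((c \<boxtimes> (c \<boxtimes> ?z)) \<boxtimes> d))"
    using kills_idm_tens[OF f Suc.prems] by simp
  ultimately have k: "kills i f (idm T ((c \<boxtimes> (d \<boxtimes> c)) \<boxtimes> ?z))" using kills_idm_isomorphic[OF f] by blast
  have "kills i f (idm T (c \<boxtimes> ?z))"
  proof (rule kills_idm_retract[OF f k])
    show "s \<boxtimes>\<^sub>m idm T ?z \<in> Hom (c \<boxtimes> ?z) ((c \<boxtimes> (d \<boxtimes> c)) \<boxtimes> ?z)"
      "r \<boxtimes>\<^sub>m idm T ?z \<in> Hom ((c \<boxtimes> (d \<boxtimes> c)) \<boxtimes> ?z) (c \<boxtimes> ?z)" using sr(1,2) by auto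
    show "(r \<boxtimes>\<^sub>m idm T ?z) \<cdot> (s \<boxtimes>\<^sub>m idm T ?z) = idm T (c \<boxtimes> ?z)" using sr by (simp add: tens_merge)
  qed
  then show ?case by (intro Suc.IH) simp
qed

lemma cone_killed:
  assumes f: "f \<in> S\<^sub>n n" and t: "(f, g, h) \<in> tri T"
  shows "kills (n + n) (gmult n f f) (idm T (tgt T g))"
proof -
  have ff: "shM_int n f \<cdot> f \<in> S\<^sub>n (n + n)" using f by simp
  have "(canonical_map n f \<bbbone>, g, h) \<in> tri T" using t canonical_at_unit[OF f] by simp
  from canonical_square_zero[OF f this] show ?thesis
    unfolding gmult_def kills_idm_iff[OF ff] canonical_cmp[OF f f] .
qed

text \<open>Choose P to contain all compact objects killed off at \<open>q\<close> but not
  \<open>c\<close>. If f is outside \<open>q\<close>, then so is its square, which kills cone(f);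
  hence cone(f) lies in P, and f is not among the generators of \<rho>(P).\<close>

lemma ex_prime_over:
  assumes c: "compact c" and q: "q \<in> Spech" and no: "\<not> killed_off q (idm T c)"
  shows "\<exists>P\<in>Spc. c \<notin> P \<and> comparison P \<subseteq> q"
proof -
  have "\<exists>P\<in>Spc. {x. compact x \<and> killed_off q (idm T x)} \<subseteq> P \<and> c \<notin> P"
  proof (rule ex_prime_avoiding[OF thick_ideal_killed_off[OF q] c])
    show "tpow c (Suc k) \<notin> {x. compact x \<and> killed_off q (idm T x)}" for k
      using no kills_tpow[OF c] unfolding killed_off_def by blast
  qed
  then obtain P where P: "P \<in> Spc" "{x. compact x \<and> killed_off q (idm T x)} \<subseteq> P" "c \<notin> P" by blast
  have "comparison P \<subseteq> q"
  proof (rule comparison_subset[OF q], rule ccontr)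
    fix n f g h assume f: "f \<in> S\<^sub>n n" and t: "(f, g, h) \<in> tri T" and nP: "tgt T g \<notin> P" and nq: "homog n f \<notin> q"
    have "killed_off q (idm T (tgt T g))"
      using killed_offI[OF gmult_Hom[OF f f] _ cone_killed[OF f t]] Spech_prime[OF q f f] nq by blast
    moreover have "compact (tgt T g)" using compact_cone[OF t] f compact_unit by simp
    ultimately show False using P(2) nP by blast
  qed
  then show ?thesis using P by blast
qed

definition preimage :: "(int \<Rightarrow> 'm) set set \<Rightarrow> 'o set set" where
  "preimage V = {P \<in> Spc. comparison P \<in> V}"

lemma compacts_on_torsion:
  assumes V: "spec_closed V"
  shows "compacts_on (preimage V) \<subseteq> torsion_sub V"
  unfolding torsion_sub_eq[OF V]
proof (intro subsetI CollectI ballI)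
  fix c q assume c: "c \<in> compacts_on (preimage V)" and q: "q \<in> Spech - V"
  have cc: "compact c" and supp: "supp c \<subseteq> preimage V" using c by (auto simp: compacts_on_def)
  have "killed_off q (idm T c)"
  proof (rule ccontr)
    assume "\<not> killed_off q (idm T c)"
    then obtain P where "P \<in> Spc" "c \<notin> P" "comparison P \<subseteq> q" using ex_prime_over[OF cc] q by blast
    moreover from this have "comparison P \<in> V" using supp by (auto simp: supp_def preimage_def)
    ultimately show False using V q unfolding spec_closed_def by blast
  qed
  then show "c \<in> locally_killed q"
    unfolding locally_killed_def killed_off_def using kills_idm_kills by blast
qed

subsection \<open>Koszul objects\<close>

definition is_cone :: "int \<Rightarrow> 'm \<Rightarrow> 'o \<Rightarrow> bool" where
  "is_cone n f C \<longleftrightarrow> f \<in> S\<^sub>n n \<and> (\<exists>g h. (f, g, h) \<in> tri T \<and> tgt T g = C)"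

lemma ex_cone: "f \<in> S\<^sub>n n \<Longrightarrow> \<exists>C. is_cone n f C"
  unfolding is_cone_def using tri_complete by blast

lemma is_cone_tri:
  assumes "is_cone n f C"
  obtains g h where "(canonical_map n f t, g, h) \<in> tri T" "tgt T g = C \<boxtimes> t"
  using assms canonical_tri[of f _ _ n t] unfolding is_cone_def by blast

lemma is_cone_compact: "is_cone n f C \<Longrightarrow> compact C"
  unfolding is_cone_def using compact_cone compact_unit by (metis Hom_iff compact_shO_int_iff)

lemma is_cone_comparison: "is_cone n f C \<Longrightarrow> C \<notin> P \<Longrightarrow> homog n f \<in> comparison P"
  unfolding is_cone_def using comparison_mem by blast

text \<open>
  Both \<open>Hom\<^sup>*(C \<otimes> z, y) = 0\<close> and \<open>Hom\<^sup>*(z, C \<otimes> y) = 0\<close> mean that \<open>f\<close> acts bijectively on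
  \<open>Hom\<^sup>*(z, y)\<close>, if \<open>C\<close> is the cone of \<open>f\<close>.
\<close>

definition act_inj :: "int \<Rightarrow> 'm \<Rightarrow> 'o \<Rightarrow> 'o \<Rightarrow> bool" where
  "act_inj n f z y \<longleftrightarrow> (\<forall>k m. m \<in> Hom z (shO_int k y) \<longrightarrow> kills n f m \<longrightarrow> m = zerom T z (shO_int k y))"

definition act_surj :: "int \<Rightarrow> 'm \<Rightarrow> 'o \<Rightarrow> 'o \<Rightarrow> bool" where
  "act_surj n f z y \<longleftrightarrow> (\<forall>k M. M \<in> Hom z (shO_int (n + k) y) \<longrightarrow>
     (\<exists>m. m \<in> Hom z (shO_int k y) \<and> canonical_map n f (shO_int k y) \<cdot> m = M))"

text \<open>The long exact sequence of graded Hom from \<open>z\<close> for the triangle y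
  \<rightarrow> y \<rightarrow> C \<otimes> y, with suspensions omitted: the Hom into C \<otimes> y
  vanishes iff the action of \<open>f\<close> has neither kernel nor cokernel.\<close>

lemma orth_target_iff:
  assumes C: "is_cone n f C"
  shows "orth z (C \<boxtimes> y) \<longleftrightarrow> act_inj n f z y \<and> act_surj n f z y"
proof -
  have f: "f \<in> S\<^sub>n n" using C by (simp add: is_cone_def)
  obtain g h where t: "(canonical_map n f y, g, h) \<in> tri T" and g: "tgt T g = C \<boxtimes> y" by (rule is_cone_tri[OF C])
  let ?c = "canonical_map n f y"
  have typ1 [simp]: "src T ?c = y" "tgt T ?c = shO_int n y" "src T g = shO_int n y" "tgt T g = C \<boxtimes> y"
    "src T h = C \<boxtimes> y" "tgt T h = shO T y"
    using tri_typed[OF t] f g by simp_all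
  have gc: "g \<cdot> ?c = zerom T y (C \<boxtimes> y)" using tri_cmp_zero1[OF t] by simp
  have ch: "shM T ?c \<cdot> h = zerom T (C \<boxtimes> y) (shO_int (n + 1) y)" using tri_cmp_zero3[OF t] by simp
  show ?thesis
  proof (intro iffI conjI)
    assume o: "orth z (C \<boxtimes> y)"
    show "act_inj n f z y"
      unfolding act_inj_def
    proof (intro allI impI)
      fix k m assume m: "m \<in> Hom z (shO_int k y)" and "kills n f m"
      then have "shM_int k ?c \<cdot> m = zerom T z (shO_int (k + n) y)" using kills_iff_shM_int[OF f m] by blast
      then have "\<exists>l. l \<in> Hom z (shO_int (k - 1) (tgt T g)) \<and> shM_int (k - 1) h \<cdot> l = m"
        by (intro tri_weak_kernel3_shift[OF t]) (use m in simp_all)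
      then obtain l where l: "l \<in> Hom z (shO_int (k - 1) (tgt T g))" "shM_int (k - 1) h \<cdot> l = m" by blast
      have "l = zerom T z (shO_int (k - 1) (C \<boxtimes> y))" by (rule orthD[OF o]) (use l(1) in simp_all)
      then have "shM_int (k - 1) h \<cdot> l = zerom T z (shO_int k y)" by simp
      then show "m = zerom T z (shO_int k y)" unfolding l(2) .
    qed
    show "act_surj n f z y"
      unfolding act_surj_def
    proof (intro allI impI)
      fix k M assume M: "M \<in> Hom z (shO_int (n + k) y)"
      have "shM_int k g \<cdot> M = zerom T z (shO_int k (C \<boxtimes> y))" by (rule orthD[OF o]) (use M in \<open>simp_all add: add.commute\<close>)
      then have "\<exists>l. l \<in> Hom z (shO_int k (src T ?c)) \<and> shM_int k ?c \<cdot> l = M"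
        by (intro tri_weak_kernel_shift[OF t]) (use M in \<open>simp_all add: add.commute\<close>)
      then obtain l where l0: "l \<in> Hom z (shO_int k (src T ?c))" and l1: "shM_int k ?c \<cdot> l = M" by blast
      have l: "l \<in> Hom z (shO_int k y)" "shM_int k ?c \<cdot> l = M" using l0 l1 by simp_all
      \<comment> \<open>The triangle gives a preimage under the suspended action; if that differs
        from the action at the suspended object by a sign, the preimage is negated.\<close>
      have "canonical_map n f (shO_int k y) = shM_int k ?c \<or> canonical_map n f (shO_int k y) = negm (shM_int k ?c)"
        using canonical_shO_int[OF f, of k y] by (simp add: pm_eq_def)
      then show "\<exists>m. m \<in> Hom z (shO_int k y) \<and> canonical_map n f (shO_int k y) \<cdot> m = M"
      proof
        assume "canonical_map n f (shO_int k y) = shM_int k ?c"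
        then show ?thesis using l by (intro exI[of _ l]) simp
      next
        assume "canonical_map n f (shO_int k y) = negm (shM_int k ?c)"
        then show ?thesis using l by (intro exI[of _ "negm l"]) simp
      qed
    qed
  next
    assume *: "act_inj n f z y \<and> act_surj n f z y"
    show "orth z (C \<boxtimes> y)"
      unfolding orth_def
    proof (intro allI impI)
      fix k l assume l: "l \<in> Hom z (shO_int k (C \<boxtimes> y))"
      then have [simp]: "src T l = z" "tgt T l = shO_int k (C \<boxtimes> y)" by auto
      let ?m = "shM_int k h \<cdot> l"
      have m: "?m \<in> Hom z (shO_int (k + 1) y)" by simp
      have "shM_int (k + 1) ?c \<cdot> shM_int k h = shM_int k (shM T ?c \<cdot> h)" by (simp add: shM_int_cmp)
      also have "\<dots> = zerom T (shO_int k (C \<boxtimes> y)) (shO_int (k + 1 + n) y)" unfolding ch by (simp add: ac_simps)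
      finally have "shM_int (k + 1) ?c \<cdot> ?m = zerom T z (shO_int (k + 1 + n) y)"
        using cmp_eq_cmp1[of "shM_int (k + 1) ?c" "shM_int k h" _ l] by simp
      then have "kills n f ?m" unfolding kills_iff_shM_int[OF f m] .
      then have "?m = zerom T z (shO_int (k + 1) y)" using * m unfolding act_inj_def by blast
      then have "\<exists>l'. l' \<in> Hom z (shO_int k (tgt T ?c)) \<and> shM_int k g \<cdot> l' = l"
        by (intro tri_weak_kernel2_shift[OF t]) simp_all
      then obtain l' where l': "l' \<in> Hom z (shO_int k (tgt T ?c))" "shM_int k g \<cdot> l' = l" by blast
      have "l' \<in> Hom z (shO_int (n + k) y)" using l'(1) by (simp add: add.commute)
      then obtain m' where m': "m' \<in> Hom z (shO_int k y)" "canonical_map n f (shO_int k y) \<cdot> m' = l'"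
        using * unfolding act_surj_def by blast
      have "shM_int k g \<cdot> canonical_map n f (shO_int k y) \<doteq> shM_int k g \<cdot> shM_int k ?c"
        by (intro pm_cmp pm_refl canonical_shO_int[OF f]) (use f in \<open>simp add: add.commute\<close>)
      moreover have "shM_int k g \<cdot> shM_int k ?c = zerom T (shO_int k y) (shO_int k (C \<boxtimes> y))"
        using gc by (simp flip: shM_int_cmp)
      ultimately have z: "shM_int k g \<cdot> canonical_map n f (shO_int k y) = zerom T (shO_int k y) (shO_int k (C \<boxtimes> y))"
        using pm_zerom by blast
      have "shM_int k g \<cdot> (canonical_map n f (shO_int k y) \<cdot> m') = zerom T z (shO_int k (C \<boxtimes> y))"
        using cmp_eq_cmp1[OF z, of m'] m'(1) f by (simp add: add.commute)
      then show "l = zerom T z (shO_int k (C \<boxtimes> y))" unfolding m'(2) l'(2) .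
    qed
  qed
qed

text \<open>The long exact sequence in the other variable. There \<open>f\<close> acts by
  precomposition on \<open>z\<close>, and naturality (\<open>act\<close>) identifies this with the
  action on the target.\<close>

lemma orth_source_iff:
  assumes C: "is_cone n f C"
  shows "orth (C \<boxtimes> z) y \<longleftrightarrow> act_inj n f z y \<and> act_surj n f z y"
proof -
  have f: "f \<in> S\<^sub>n n" using C by (simp add: is_cone_def)
  obtain g h where t: "(canonical_map n f z, g, h) \<in> tri T" and g: "tgt T g = C \<boxtimes> z" by (rule is_cone_tri[OF C])
  let ?c = "canonical_map n f z"
  have typ1 [simp]: "src T ?c = z" "tgt T ?c = shO_int n z" "src T g = shO_int n z" "tgt T g = C \<boxtimes> z"
    "src T h = C \<boxtimes> z" "tgt T h = shO T z"
    using tri_typed[OF t] f g by simp_all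
  have gc: "g \<cdot> ?c = zerom T z (C \<boxtimes> z)" using tri_cmp_zero1[OF t] by simp
  have ch: "shM T ?c \<cdot> h = zerom T (C \<boxtimes> z) (shO_int (n + 1) z)" using tri_cmp_zero3[OF t] by simp
  have act: "canonical_map n f (shO_int k y) \<cdot> m = shM_int n m \<cdot> ?c" if "m \<in> Hom z (shO_int k y)" for k m
    by (rule canonical_natural[OF f]) (use that in auto)
  have kills: "kills n f m \<longleftrightarrow> shM_int n m \<cdot> ?c = zerom T z (shO_int (n + k) y)" if "m \<in> Hom z (shO_int k y)" for k m
    using kills_iff_source[OF f, of m] that by simp
  show ?thesis
  proof (intro iffI conjI)
    assume o: "orth (C \<boxtimes> z) y"
    show "act_inj n f z y"
      unfolding act_inj_def
    proof (intro allI impI)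
      fix k m assume m: "m \<in> Hom z (shO_int k y)" and "kills n f m"
      then have "shM_int n m \<cdot> ?c = zerom T z (shO_int (n + k) y)" using kills by blast
      then have "\<exists>l. src T l = tgt T g \<and> tgt T l = tgt T (shM_int n m) \<and> l \<cdot> g = shM_int n m"
        by (rule tri_weak_cokernel[OF t, rotated]) (use m in simp_all)
      then obtain l where l: "src T l = tgt T g" "tgt T l = tgt T (shM_int n m)" "l \<cdot> g = shM_int n m" by blast
      have "l = zerom T (C \<boxtimes> z) (shO_int (n + k) y)" by (rule orthD[OF o]) (use l(1,2) m in simp_all)
      then have "shM_int n m = zerom T (shO_int n z) (shO_int (n + k) y)" unfolding l(3)[symmetric] by simp
      then have "shM_int n m = shM_int n (zerom T z (shO_int k y))" by simp
      then show "m = zerom T z (shO_int k y)" by (simp only: shM_int_inject)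
    qed
    show "act_surj n f z y"
      unfolding act_surj_def
    proof (intro allI impI)
      fix k M assume M: "M \<in> Hom z (shO_int (n + k) y)"
      have "shM T M \<cdot> h = zerom T (C \<boxtimes> z) (shO_int (n + k + 1) y)" by (rule orthD[OF o]) (use M in simp_all)
      then have "\<exists>l. src T l = shO T (tgt T ?c) \<and> tgt T l = tgt T (shM T M) \<and> l \<cdot> shM T ?c = shM T M"
        by (rule tri_weak_cokernel3[OF t, rotated]) (use M in simp_all)
      then obtain l where l: "src T l = shO T (tgt T ?c)" "tgt T l = tgt T (shM T M)" "l \<cdot> shM T ?c = shM T M" by blast
      define m where "m = shM_int (- n - 1) l"
      have m: "m \<in> Hom z (shO_int k y)" using l(1,2) M by (simp add: m_def)
      have lm: "l = shM T (shM_int n m)" by (simp add: m_def)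
      have "shM T (shM_int n m \<cdot> ?c) = shM T M" unfolding l(3)[symmetric] using m by (simp add: lm shM_cmp')
      then have "shM_int n m \<cdot> ?c = M" by (simp only: shM_inject)
      then show "\<exists>m. m \<in> Hom z (shO_int k y) \<and> canonical_map n f (shO_int k y) \<cdot> m = M" using m act[OF m] by metis
    qed
  next
    assume *: "act_inj n f z y \<and> act_surj n f z y"
    show "orth (C \<boxtimes> z) y"
      unfolding orth_def
    proof (intro allI impI)
      fix k l assume l: "l \<in> Hom (C \<boxtimes> z) (shO_int k y)"
      then have [simp]: "src T l = C \<boxtimes> z" "tgt T l = shO_int k y" by auto
      define m where "m = shM_int (- n) (l \<cdot> g)"
      have m: "m \<in> Hom z (shO_int (- n + k) y)" by (simp add: m_def)
      have mm: "shM_int n m = l \<cdot> g" by (simp add: m_def)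
      have "shM_int n m \<cdot> ?c = zerom T z (shO_int (n + (- n + k)) y)" unfolding mm using gc by simp
      then have "kills n f m" unfolding kills[OF m] .
      then have "m = zerom T z (shO_int (- n + k) y)" using * m unfolding act_inj_def by blast
      then have "l \<cdot> g = zerom T (shO_int n z) (shO_int k y)" unfolding mm[symmetric] by simp
      then have "\<exists>l'. src T l' = shO T (src T ?c) \<and> tgt T l' = tgt T l \<and> l' \<cdot> h = l"
        by (rule tri_weak_cokernel2[OF t, rotated]) simp_all
      then obtain l' where l': "src T l' = shO T (src T ?c)" "tgt T l' = tgt T l" "l' \<cdot> h = l" by blast
      define L where "L = shM_int (- 1) l'"
      have L: "L \<in> Hom z (shO_int (n + (k - n - 1)) y)" using l'(1,2) by (simp add: L_def)
      then obtain m' where m': "m' \<in> Hom z (shO_int (k - n - 1) y)" "canonical_map n f (shO_int (k - n - 1) y) \<cdot> m' = L"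
        using * unfolding act_surj_def by blast
      have "L = shM_int n m' \<cdot> ?c" using act[OF m'(1)] m'(2) by simp
      then have "shM T L = shM T (shM_int n m') \<cdot> shM T ?c" using m'(1) by (simp add: shM_cmp')
      moreover have "shM T L = l'" by (simp add: L_def)
      ultimately have "l' \<cdot> h = shM T (shM_int n m') \<cdot> (shM T ?c \<cdot> h)" using m'(1) by simp
      then show "l = zerom T (C \<boxtimes> z) (shO_int k y)" unfolding l'(3) ch using m'(1) by simp
    qed
  qed
qed

text \<open>Takes the place of the self-duality of the cone up to suspension: both sides say that
  \<open>f\<close> acts bijectively, so no dual object has to be computed.\<close>

lemma orth_cone: "is_cone n f C \<Longrightarrow> orth (C \<boxtimes> z) y \<longleftrightarrow> orth z (C \<boxtimes> y)"
  using orth_target_iff orth_source_iff by blast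

abbreviation koszul :: "'o list \<Rightarrow> 'o \<Rightarrow> 'o" where
  "koszul Cs z \<equiv> foldr (\<lambda>C x. C \<boxtimes> x) Cs z"

abbreviation cones :: "'o list \<Rightarrow> bool" where
  "cones Cs \<equiv> \<forall>C\<in>set Cs. \<exists>n f. is_cone n f C"

text \<open>The cones move across one at a time, outermost first, and so arrive in reverse
  order.\<close>

lemma koszul_orth: "cones Cs \<Longrightarrow> orth (koszul Cs z) y \<longleftrightarrow> orth z (koszul (rev Cs) y)"
proof (induction Cs arbitrary: y)
  case (Cons C Cs)
  then obtain n f where "is_cone n f C" by auto
  then show ?case using Cons orth_cone[of n f C "koszul Cs z" y] by simp
qed simp

lemma koszul_tens: "koszul Cs (y \<boxtimes> w) \<simeq> koszul Cs y \<boxtimes> w"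
proof (induction Cs)
  case (Cons C Cs)
  have "koszul (C # Cs) (y \<boxtimes> w) \<simeq> C \<boxtimes> (koszul Cs y \<boxtimes> w)" using Cons by (simp add: tens_isomorphic)
  also have "\<dots> \<simeq> koszul (C # Cs) y \<boxtimes> w" using isomorphic_sym[OF tens_assoc_isomorphic] by simp
  finally show ?case .
qed simp

lemma koszul_compact: "cones Cs \<Longrightarrow> compact z \<Longrightarrow> compact (koszul Cs z)"
  by (induction Cs) (auto intro: compact_tens is_cone_compact)

lemma koszul_in_ideal:
  "thick_ideal P \<Longrightarrow> cones Cs \<Longrightarrow> compact z \<Longrightarrow> C \<in> set Cs \<Longrightarrow> C \<in> P \<Longrightarrow> koszul Cs z \<in> P"
proof (induction Cs)
  case (Cons D Cs)
  show ?case
  proof (cases "C = D")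
    case True
    then show ?thesis using Cons.prems koszul_compact[of Cs z] by (simp add: thick_ideal_tens_right)
  next
    case False
    then have "koszul Cs z \<in> P" using Cons by simp
    moreover have "compact D" using Cons.prems(2) is_cone_compact by auto
    ultimately show ?thesis using Cons.prems(1) by (simp add: thick_ideal_tens)
  qed
qed simp

text \<open>Besides the equality of the two subcategories this records that localization triangles
  exist, since compact objects with given support need not form a small set, and that the right
  orthogonal is closed under tensoring.\<close>

definition localizes :: "(int \<Rightarrow> 'm) set set \<Rightarrow> bool" where
  "localizes V \<longleftrightarrow> torsion_sub V = Loc (compacts_on (preimage V)) \<and>
     (\<forall>x. \<exists>e f. localization_triangle (torsion_sub V) x e f) \<and>
     (\<forall>y w. (\<forall>s\<in>torsion_sub V. orth s y) \<longrightarrow> (\<forall>s\<in>torsion_sub V. orth s (y \<boxtimes> w)))"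

text \<open>\<open>K\<close> is a small family of lists of cones. Its Koszul objects must be
  supported on the preimage of \<open>V\<close> (\<open>supp\<close>) and must detect torsion
  objects (\<open>tors\<close>).\<close>

lemma localizesI:
  assumes V: "spec_closed V" and K: "small K" "\<And>Cs. Cs \<in> K \<Longrightarrow> cones Cs"
    and supp: "\<And>Cs P. Cs \<in> K \<Longrightarrow> P \<in> Spc \<Longrightarrow> comparison P \<notin> V \<Longrightarrow> \<exists>C\<in>set Cs. C \<in> P"
    and tors: "\<And>y z. y \<in> torsion_sub V \<Longrightarrow> compact z \<Longrightarrow> (\<And>Cs. Cs \<in> K \<Longrightarrow> orth (koszul Cs z) y) \<Longrightarrow> orth z y"
  shows "localizes V"
proof -
  obtain G where G: "small G" "\<forall>g\<in>G. compact g" "\<forall>t. (\<forall>g\<in>G. orth g t) \<longrightarrow> zero_object t"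
    using ex_generators by blast
  \<comment> \<open>Koszul objects on generators instead of on all compact objects: a small set, as
    the construction of localization triangles requires.\<close>
  define S where "S = (\<lambda>(Cs, g). koszul Cs g) ` (K \<times> G)"
  have smallS: "small S" unfolding S_def by (intro small_image small_Sigma K(1) G(1))
  have S: "koszul Cs g \<in> S" if "Cs \<in> K" "g \<in> G" for Cs g using that by (auto simp: S_def)
  have SC: "S \<subseteq> compacts_on (preimage V)"
  proof
    fix s assume "s \<in> S"
    then obtain Cs g where s: "s = koszul Cs g" "Cs \<in> K" "g \<in> G" unfolding S_def by auto
    have g: "compact g" using G(2) s(3) by blast
    have "P \<in> preimage V" if P: "P \<in> Spc" "s \<notin> P" for P
    proof (rule ccontr)
      assume "P \<notin> preimage V"
      then have "\<exists>C\<in>set Cs. C \<in> P" using supp[OF s(2) P(1)] P(1) by (auto simp: preimage_def)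
      moreover have "thick_ideal P" using P(1) by (simp add: Spc_def)
      ultimately have "koszul Cs g \<in> P" using koszul_in_ideal K(2)[OF s(2)] g by blast
      then show False using P(2) s(1) by simp
    qed
    then show "s \<in> compacts_on (preimage V)"
      unfolding compacts_on_def supp_def s(1) using koszul_compact[OF K(2)[OF s(2)] g] by blast
  qed
  have cS: "compact s" if "s \<in> S" for s using SC that unfolding compacts_on_def by blast
  note LT = localizing_torsion_sub[OF V]
  have 1: "Loc S \<subseteq> Loc (compacts_on (preimage V))" by (rule Loc_mono[OF SC])
  have 2: "Loc (compacts_on (preimage V)) \<subseteq> torsion_sub V" by (rule Loc_minimal[OF LT compacts_on_torsion[OF V]])
  \<comment> \<open>The third object of the localization triangle of a torsion object is again
    torsion, and it is orthogonal to all Koszul objects on generators. By \<open>tors\<close> it is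
    orthogonal to the generators, hence zero.\<close>
  have 3: "torsion_sub V \<subseteq> Loc S"
  proof
    fix t assume t: "t \<in> torsion_sub V"
    obtain e y where lt: "localization_triangle (Loc S) t e y" using ex_localization_triangle[OF smallS cS] by blast
    then obtain u v w where tri: "(u, v, w) \<in> tri T" "u \<in> Hom e t" "v \<in> Hom t y" and e: "e \<in> Loc S"
      unfolding localization_triangle_def by blast
    have [simp]: "src T u = e" "tgt T u = t" "tgt T v = y" using tri by auto
    have "e \<in> torsion_sub V" using e 1 2 by blast
    then have "tgt T v \<in> torsion_sub V" using triangulated_sub_cone[OF localizing_triangulated[OF LT] tri(1)] t by simp
    then have yt: "y \<in> torsion_sub V" by simp
    have "orth g y" if g: "g \<in> G" for g
    proof (rule tors[OF yt])
      show "compact g" using G(2) g by blast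
      show "orth (koszul Cs g) y" if "Cs \<in> K" for Cs
        using localization_triangle_orth[OF lt] Loc_superset S[OF that g] by blast
    qed
    then have "zero_object y" using G(3) by blast
    then have "tgt T v \<in> Loc S" using triangulated_sub_zero[OF localizing_triangulated[OF localizing_Loc]] by simp
    then show "t \<in> Loc S"
      using triangulated_sub_middle[OF localizing_triangulated[OF localizing_Loc] tri(1)] e by simp
  qed
  have TS: "torsion_sub V = Loc S" using 1 2 3 by blast
  \<comment> \<open>Moved to the second variable, the Koszul construction on \<open>y\<close> is
    orthogonal to all generators and hence zero. Unlike a Hom condition, this survives tensoring
    with \<open>w\<close>.\<close>
  have ideal: "orth s (y \<boxtimes> w)" if y: "\<forall>s\<in>torsion_sub V. orth s y" and s: "s \<in> torsion_sub V" for y w s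
  proof -
    have "orth s' (y \<boxtimes> w)" if s': "s' \<in> S" for s'
    proof -
      obtain Cs g where sg: "s' = koszul Cs g" "Cs \<in> K" "g \<in> G" using s' unfolding S_def by auto
      have "orth g' (koszul (rev Cs) y)" if g': "g' \<in> G" for g'
        using y S[OF sg(2) g'] Loc_superset TS koszul_orth[OF K(2)[OF sg(2)], of g' y] by blast
      then have "zero_object (koszul (rev Cs) y)" using G(3) by blast
      then have "zero_object (koszul (rev Cs) (y \<boxtimes> w))"
        using zero_object_isomorphic[OF isomorphic_sym[OF koszul_tens]] zero_object_tens_left by blast
      then show ?thesis unfolding sg(1) koszul_orth[OF K(2)[OF sg(2)]] by (rule orth_zero_right)
    qed
    then show ?thesis using Loc_orth s TS by blast
  qed
  have "\<exists>e f. localization_triangle (torsion_sub V) x e f" for x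
    unfolding TS by (rule ex_localization_triangle[OF smallS cS])
  then show ?thesis unfolding localizes_def using 1 2 3 ideal by blast
qed

text \<open>Single cones suffice, one for each homogeneous f outside \<open>p\<close>. If \<rho>(P)
  is contained in \<open>p\<close>, such an f is not in \<rho>(P), so its cone belongs to P; and
  every arrow into a torsion object is killed by one such f, which acts injectively once its cone is
  orthogonal.\<close>

lemma localizes_Zset:
  assumes p: "p \<in> Spech" and Spc: "\<And>P. P \<in> Spc \<Longrightarrow> comparison P \<in> Spech"
  shows "localizes (Zset p)"
proof -
  define A where "A = {(n, f). f \<in> S\<^sub>n n \<and> homog n f \<notin> p}"
  have "\<forall>a. \<exists>C. a \<in> A \<longrightarrow> is_cone (fst a) (snd a) C" using ex_cone by (auto simp: A_def simp del: Hom_iff)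
  then obtain c where c: "\<And>n f. (n, f) \<in> A \<Longrightarrow> is_cone n f (c (n, f))" by (metis fst_conv snd_conv)
  define K where "K = (\<lambda>a. [c a]) ` A"
  have "small (SIGMA n:(UNIV::int set). S\<^sub>n n)" by (intro small_Sigma small_countable small_Hom) auto
  then have sA: "small A" by (rule small_subset) (auto simp: A_def simp del: Hom_iff)
  show ?thesis
  proof (rule localizesI[OF spec_closed_Zset, of K])
    show "small K" unfolding K_def by (rule small_image[OF sA])
    show "cones Cs" if Cs: "Cs \<in> K" for Cs
    proof -
      obtain n f where "(n, f) \<in> A" "Cs = [c (n, f)]" using Cs unfolding K_def by auto
      then show ?thesis using c by auto
    qed
    show "\<exists>C\<in>set Cs. C \<in> P" if Cs: "Cs \<in> K" and P: "P \<in> Spc" "comparison P \<notin> Zset p" for Cs P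
    proof -
      obtain n f where a: "(n, f) \<in> A" "Cs = [c (n, f)]" using Cs unfolding K_def by auto
      have "comparison P \<subseteq> p" using P Spc[OF P(1)] by (auto simp: Zset_def)
      then have "c (n, f) \<in> P" using is_cone_comparison[OF c[OF a(1)], of P] a(1) unfolding A_def by blast
      then show ?thesis using a(2) by simp
    qed
    fix y z assume y: "y \<in> torsion_sub (Zset p)" and z: "compact z" and o: "\<And>Cs. Cs \<in> K \<Longrightarrow> orth (koszul Cs z) y"
    \<comment> \<open>Of the primes outside \<open>Zset p\<close>, the prime \<open>p\<close> itself
      is the only one that has to be inspected.\<close>
    have yp: "y \<in> locally_killed p" using y p unfolding torsion_sub_eq[OF spec_closed_Zset] by (auto simp: Zset_def)
    show "orth z y"
      unfolding orth_def
    proof (intro allI impI)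
      fix k m assume m: "m \<in> Hom z (shO_int k y)"
      obtain n f where f: "f \<in> S\<^sub>n n" "homog n f \<notin> p" "kills n f m"
        using locally_killedD[OF yp z m] unfolding killed_off_def by blast
      then have a: "(n, f) \<in> A" unfolding A_def by blast
      then have "orth (c (n, f) \<boxtimes> z) y" using o[of "[c (n, f)]"] unfolding K_def by simp
      then have "act_inj n f z y" using orth_source_iff[OF c[OF a]] by blast
      then show "m = zerom T z (shO_int k y)" using m f(3) unfolding act_inj_def by blast
    qed
  qed
qed

text \<open>An injective action stays injective after iteration; the induction passes from
  \<open>m\<close> to its multiple by \<open>f\<close>.\<close>

lemma power_torsion_zero:
  assumes f: "f \<in> S\<^sub>n n" and inj: "act_inj n f z y" and "hpower n f i a" "kills i a m" "m \<in> Hom z (shO_int k y)"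
  shows "m = zerom T z (shO_int k y)"
  using assms(3-5)
proof (induction arbitrary: m k rule: hpower.induct)
  case hpower_0
  then show ?case using kills_unit[of m] by simp
next
  case (hpower_Suc i a)
  let ?m = "canonical_map n f (shO_int k y) \<cdot> m"
  have m: "?m \<in> Hom z (shO_int (n + k) y)" using f hpower_Suc.prems(2) by simp
  have "kills i a ?m"
    using hpower_Suc.prems kills_mult_iff[OF hpower_Hom[OF f hpower_Suc.hyps] f, of m] by (simp add: gmult_def)
  then have "?m = zerom T z (shO_int (n + k) y)" using m by (rule hpower_Suc.IH)
  then have "kills n f m" using hpower_Suc.prems(2) by (simp add: kills_def)
  then show ?case using inj hpower_Suc.prems(2) unfolding act_inj_def by blast
qed

text \<open>One Koszul object on all of \<open>F\<close> suffices. Torsion here means that each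
  element of \<open>F\<close> acts nilpotently on every arrow from a compact object, which lets the
  cones be removed one after the other.\<close>

lemma localizes_Vset:
  assumes R: "ring EndR" and F: "finite F" "F \<subseteq> homog_elems" and Spc: "\<And>P. P \<in> Spc \<Longrightarrow> comparison P \<in> Spech"
  shows "localizes (Vset F)"
proof -
  have "\<forall>r\<in>F. \<exists>C n f. r = homog n f \<and> is_cone n f C"
    using F(2) ex_cone unfolding homog_elems_def by blast
  then obtain c where c: "\<And>r. r \<in> F \<Longrightarrow> \<exists>n f. r = homog n f \<and> is_cone n f (c r)" by metis
  obtain fs where fs: "set fs = F" using finite_list[OF F(1)] by blast
  let ?Cs = "map c fs"
  have cones: "cones ?Cs" using c fs by fastforce
  show ?thesis
  proof (rule localizesI[OF spec_closed_Vset, of "{?Cs}"])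
    show "small {?Cs}" by (rule small_countable) simp
    show "cones Cs" if "Cs \<in> {?Cs}" for Cs using that cones by simp
    show "\<exists>C\<in>set Cs. C \<in> P" if Cs: "Cs \<in> {?Cs}" and P: "P \<in> Spc" "comparison P \<notin> Vset F" for Cs P
    proof -
      obtain r where r: "r \<in> F" "r \<notin> comparison P" using P Spc[OF P(1)] by (auto simp: Vset_def)
      then have "c r \<in> P" using c[OF r(1)] is_cone_comparison by blast
      then show ?thesis using Cs r(1) fs by auto
    qed
    fix y z assume y: "y \<in> torsion_sub (Vset F)" and z: "compact z" and o: "\<And>Cs. Cs \<in> {?Cs} \<Longrightarrow> orth (koszul Cs z) y"
    \<comment> \<open>Otherwise some prime contains all scalars killing \<open>m\<close> but not
      \<open>f\<close>. It lies outside \<open>Vset F\<close>, so torsion provides a scalar outside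
      it that kills \<open>m\<close>, a contradiction.\<close>
    have power: "\<exists>i a. hpower n f i a \<and> kills i a m"
      if f: "f \<in> S\<^sub>n n" "homog n f \<in> F" and x: "compact x" and m: "m \<in> Hom x (shO_int k y)" for n f x k m
    proof (rule ccontr)
      assume no: "\<not> (\<exists>i a. hpower n f i a \<and> kills i a m)"
      have "\<exists>q\<in>Spech. (\<forall>(i, g)\<in>{(i, f). f \<in> S\<^sub>n i \<and> kills i f m}. homog i g \<in> q) \<and> homog n f \<notin> q"
        by (rule ex_prime_avoiding_power[OF R hideal_kills f(1)]) (use no in blast)
      then obtain q where q: "q \<in> Spech" "homog n f \<notin> q" and k: "\<And>i g. g \<in> S\<^sub>n i \<Longrightarrow> kills i g m \<Longrightarrow> homog i g \<in> q"
        by blast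
      have "y \<in> locally_killed q"
        using y q f(2) unfolding torsion_sub_eq[OF spec_closed_Vset] by (auto simp: Vset_def)
      then have "killed_off q m" using x m by (rule locally_killedD)
      then show False using k unfolding killed_off_def by blast
    qed
    \<comment> \<open>Orthogonality of the outermost cone makes its element act injectively; as some
      power of that element kills each arrow, all arrows vanish already without this cone.\<close>
    have *: "orth z y" if "set gs \<subseteq> F" "orth (koszul (map c gs) z) y" for gs
      using that
    proof (induction gs)
      case (Cons r gs)
      let ?K = "koszul (map c gs) z"
      obtain n f where r: "r = homog n f" and C: "is_cone n f (c r)" using c[of r] Cons.prems(1) by auto
      have f: "f \<in> S\<^sub>n n" using C by (simp add: is_cone_def)
      have "act_inj n f ?K y" using Cons.prems(2) orth_source_iff[OF C, of ?K y] by simp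
      moreover have "cones (map c gs)" using c Cons.prems(1) by fastforce
      then have Kc: "compact ?K" using koszul_compact z by blast
      ultimately have "orth ?K y"
        unfolding orth_def using power[OF f _ Kc] power_torsion_zero[OF f] r Cons.prems(1) by (metis insert_subset list.simps(15))
      then show ?case using Cons by simp
    qed simp
    show "orth z y" by (rule *[of fs]) (use o fs in simp_all)
  qed
qed

subsection \<open>The comparison of supports\<close>

lemma localizes_ideal:
  assumes V: "localizes V" and s: "s \<in> torsion_sub V"
  shows "s \<boxtimes> t \<in> torsion_sub V"
proof -
  have T: "torsion_sub V = Loc (compacts_on (preimage V))" using V unfolding localizes_def by blast
  have "c \<boxtimes> a \<in> compacts_on (preimage V)" if c: "c \<in> compacts_on (preimage V)" and a: "compact a" for c a
  proof -
    have "supp (c \<boxtimes> a) \<subseteq> supp c"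
      unfolding supp_def Spc_def using thick_ideal_tens_right a by blast
    then show ?thesis using c compact_tens a unfolding compacts_on_def by blast
  qed
  then show ?thesis using Loc_ideal s unfolding T by blast
qed

lemma localizes_orth:
  "localizes V \<Longrightarrow> localization_triangle (torsion_sub V) x e f \<Longrightarrow> s \<in> torsion_sub V \<Longrightarrow> orth s f"
  using localization_triangle_orth unfolding localizes_def by metis

text \<open>Both sides of the triangle for the unit are tensor ideals: the torsion objects by
  generation from compact ones, their right orthogonal by \<open>localizes\<close>. Tensoring with
  \<open>t\<close> therefore gives the triangle for \<open>t\<close>.\<close>

lemma localization_triangle_tens:
  assumes V: "localizes V" and lt: "localization_triangle (torsion_sub V) \<bbbone> e f"
  shows "localization_triangle (torsion_sub V) t (e \<boxtimes> t) (f \<boxtimes> t)"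
proof -
  obtain u v w where tri: "(u, v, w) \<in> tri T" "u \<in> Hom e \<bbbone>" "v \<in> Hom \<bbbone> f" and e: "e \<in> torsion_sub V"
    using lt unfolding localization_triangle_def by blast
  note [simp] = tri(2,3)[unfolded Hom_iff] tri_typed[OF tri(1)]
  let ?u = "lunit T t \<cdot> (u \<boxtimes>\<^sub>m idm T t)" and ?v = "(v \<boxtimes>\<^sub>m idm T t) \<cdot> minv (lunit T t)"
    and ?w = "susp T e t \<cdot> (w \<boxtimes>\<^sub>m idm T t)"
  have "(?u, ?v, ?w) \<in> tri T"
    by (rule tri_iso[OF tens_tri[OF tri(1), of t], of _ "e \<boxtimes> t" t _ "f \<boxtimes> t" _ "idm T (e \<boxtimes> t)" "lunit T t" "idm T (f \<boxtimes> t)"])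
      simp_all
  moreover have "?u \<in> Hom (e \<boxtimes> t) t" "?v \<in> Hom t (f \<boxtimes> t)" by simp_all
  moreover have "\<forall>s\<in>torsion_sub V. orth s (f \<boxtimes> t)"
    using V localizes_orth[OF V lt] unfolding localizes_def by blast
  then have "\<forall>s\<in>torsion_sub V. Hom s (f \<boxtimes> t) = {zerom T s (f \<boxtimes> t)}" using orth_Hom by blast
  ultimately show ?thesis
    unfolding localization_triangle_def using localizes_ideal[OF V e] by blast
qed

lemma localizes_shO: "localizes V \<Longrightarrow> s \<in> torsion_sub V \<Longrightarrow> shO T s \<in> torsion_sub V"
  using triangulated_sub_shO[OF localizing_triangulated[OF localizing_Loc]] unfolding localizes_def by metis

lemma orth_self_zero: "orth x x \<Longrightarrow> zero_object x"
  using orthD[of x x "idm T x" 0] by (simp add: zero_object_iff)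

text \<open>The product is torsion because of \<open>e\<close> and orthogonal to torsion objects
  because of \<open>f\<close>; hence its identity vanishes.\<close>

lemma localizes_tens_zero:
  assumes V: "localizes V" and e: "e \<in> torsion_sub V" and f: "\<And>s. s \<in> torsion_sub V \<Longrightarrow> orth s f"
  shows "zero_object (e \<boxtimes> f)"
proof -
  have "f \<boxtimes> e \<in> torsion_sub V"
    using localizes_ideal[OF V e] triangulated_sub_isomorphic[OF localizing_triangulated[OF localizing_Loc] tens_comm_isomorphic]
      V unfolding localizes_def by metis
  then have "orth (f \<boxtimes> e) (f \<boxtimes> e)" using V f unfolding localizes_def by blast
  then show ?thesis using orth_self_zero zero_object_isomorphic[OF tens_comm_isomorphic] by blast
qed

text \<open>The unit is an extension of \<open>f\<close> by \<open>e\<close>, so \<open>w\<close> is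
  an extension of f \<otimes> w by e \<otimes> w.\<close>

lemma zero_object_by_idempotents:
  assumes lt: "localization_triangle L \<bbbone> e f" and z: "zero_object (e \<boxtimes> w)" "zero_object (f \<boxtimes> w)"
  shows "zero_object w"
proof -
  obtain u v h where tri: "(u, v, h) \<in> tri T" "u \<in> Hom e \<bbbone>" "v \<in> Hom \<bbbone> f"
    using lt unfolding localization_triangle_def by blast
  have "tgt T (u \<boxtimes>\<^sub>m idm T w) \<in> Collect zero_object"
    by (rule triangulated_sub_middle[OF triangulated_zero_objects tens_tri[OF tri(1), of w]]) (use tri z in simp_all)
  then have "zero_object (\<bbbone> \<boxtimes> w)" using tri by simp
  then show ?thesis using zero_object_isomorphic[OF unit_tens_isomorphic] by blast
qed

lemma topspace_Spc [simp]: "topspace Spc_top = Spc"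
proof -
  obtain z where z: "zero_object z" using ex_zero_object by blast
  then have "z \<in> P" if "P \<in> Spc" for P
    using that triangulated_sub_zero[OF thick_ideal_triangulated z] by (auto simp: Spc_def)
  then have "Spc - supp z = Spc" by (auto simp: supp_def)
  then have "\<Union>{Spc - supp a |a. compact a} = Spc" using compact_zero[OF z] by blast
  then show ?thesis by (simp add: Spc_top_def)
qed

lemma closedin_Vset:
  assumes F: "finite F" "F \<subseteq> homog_elems"
  shows "closedin Spech_top (Vset F)" and "compactin Spech_top (Spech - Vset F)"
proof -
  have eq: "Spech - Vset F = \<Union>((\<lambda>r. {p \<in> Spech. r \<notin> p}) ` F)" unfolding Vset_def by blast
  have "openin Spech_top (Spech - Vset F)"
    unfolding eq by (rule openin_Union) (use F(2) openin_Spech_basic in blast)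
  then show "closedin Spech_top (Vset F)" by (auto simp: closedin_def Vset_def)
  have "compactin Spech_top {p \<in> Spech. r \<notin> p}" if "r \<in> F" for r
    using F(2) that compactin_Spech_basic unfolding homog_elems_def by blast
  then show "compactin Spech_top (Spech - Vset F)"
    unfolding eq using F(1) by (intro compactin_Union) auto
qed

end

section \<open>Transport along the homeomorphism and the two inclusions\<close>

locale comparison_homeomorphism = rigidly_compactly_generated T for T :: "('o, 'm, 'u) tt_data" (structure) +
  assumes homeo: "homeomorphic_map Spc_top Spech_top comparison"
begin

lemma comparison_image: "comparison ` Spc = Spech" and comparison_inj: "inj_on comparison Spc"
  using homeomorphic_imp_surjective_map[OF homeo] homeomorphic_imp_injective_map[OF homeo] by simp_all

lemma comparison_Spech: "P \<in> Spc \<Longrightarrow> comparison P \<in> Spech"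
  using comparison_image by blast

lemma image_preimage: "V \<subseteq> Spech \<Longrightarrow> comparison ` preimage V = V"
  and image_preimage_compl: "comparison ` (Spc - preimage V) = Spech - V"
  and preimage_subset: "preimage V \<subseteq> Spc"
  unfolding preimage_def comparison_image[symmetric] by blast+

lemma preimage_image: "Z \<subseteq> Spc \<Longrightarrow> preimage (comparison ` Z) = Z"
  using inj_on_image_mem_iff[OF comparison_inj] unfolding preimage_def by blast

lemma closedin_preimage_Vset:
  assumes F: "finite F" "F \<subseteq> homog_elems"
  shows "closedin Spc_top (preimage (Vset F))" and "compactin Spc_top (Spc - preimage (Vset F))"
proof -
  have "Vset F \<subseteq> Spech" by (auto simp: Vset_def)
  then show "closedin Spc_top (preimage (Vset F))"
    using homeomorphic_map_closedness_eq[OF homeo, of "preimage (Vset F)"] closedin_Vset(1)[OF F]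
      image_preimage preimage_subset by simp
  show "compactin Spc_top (Spc - preimage (Vset F))"
    using homeomorphic_map_compactness_eq[OF homeo, of "Spc - preimage (Vset F)"] closedin_Vset(2)[OF F]
      image_preimage_compl by simp
qed

lemma thomason_preimage_Vset: "finite F \<Longrightarrow> F \<subseteq> homog_elems \<Longrightarrow> thomason Spc_top (preimage (Vset F))"
  unfolding thomason_def using closedin_preimage_Vset by (intro exI[of _ "{preimage (Vset F)}"]) simp

text \<open>A prime fails to lie in \<open>p\<close> iff it contains a homogeneous r outside
  \<open>p\<close>, so \<open>Zset p\<close> is the union of the sets \<open>Vset {r}\<close>, whose
  complements are quasi-compact.\<close>

lemma thomason_preimage_Zset:
  assumes p: "p \<in> Spech"
  shows "thomason Spc_top (preimage (Zset p))"
proof -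
  have "q \<in> Zset p \<longleftrightarrow> (\<exists>r\<in>homog_elems. r \<notin> p \<and> q \<in> Vset {r})" if q: "q \<in> Spech" for q
  proof
    assume "q \<in> Zset p"
    then have "\<not> q \<subseteq> p" by (simp add: Zset_def)
    then obtain n f where "f \<in> S\<^sub>n n" "homog n f \<in> q" "homog n f \<notin> p" using Spech_subsetI[OF Spech_ideal[OF q] p] by blast
    moreover from this have "homog n f \<in> homog_elems" unfolding homog_elems_def by blast
    ultimately show "\<exists>r\<in>homog_elems. r \<notin> p \<and> q \<in> Vset {r}" using q by (auto simp: Vset_def)
  qed (use q in \<open>auto simp: Zset_def Vset_def\<close>)
  then have "preimage (Zset p) = \<Union>((\<lambda>r. preimage (Vset {r})) ` {r \<in> homog_elems. r \<notin> p})"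
    unfolding preimage_def using comparison_Spech by blast
  then show ?thesis
    unfolding thomason_def using closedin_preimage_Vset
    by (intro exI[of _ "(\<lambda>r. preimage (Vset {r})) ` {r \<in> homog_elems. r \<notin> p}"]) simp
qed

text \<open>A closed subset of \<open>Y\<close> misses a basic neighbourhood of \<rho>(P), given by
  some r outside \<rho>(P). All its points then contain r, so none of them is contained in
  \<rho>(P).\<close>

lemma thomason_subset_Zset:
  assumes Y: "thomason Spc_top Y" and P: "P \<in> Spc" "P \<notin> Y"
  shows "Y \<subseteq> preimage (Zset (comparison P))"
proof
  fix Q assume "Q \<in> Y"
  then obtain Z where Z: "closedin Spc_top Z" "Q \<in> Z" "Z \<subseteq> Y" using Y unfolding thomason_def by blast
  have ZS: "Z \<subseteq> Spc" using closedin_subset[OF Z(1)] by simp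
  then have Q: "Q \<in> Spc" using Z(2) by blast
  have cl: "closedin Spech_top (comparison ` Z)" using homeomorphic_map_closedness_eq[OF homeo] Z(1) by blast
  have "comparison P \<notin> comparison ` Z" using inj_on_image_mem_iff[OF comparison_inj P(1) ZS] P(2) Z(3) by blast
  then have "comparison P \<in> Spech - comparison ` Z" using comparison_Spech[OF P(1)] by blast
  moreover have "openin Spech_top (Spech - comparison ` Z)" using cl by (simp add: closedin_def)
  ultimately obtain r where r: "r \<notin> comparison P" "{p \<in> Spech. r \<notin> p} \<subseteq> Spech - comparison ` Z"
    using openin_Spech_ex_basic by blast
  have "r \<in> comparison Q" using r(2) Z(2) comparison_Spech[OF Q] by blast
  then show "Q \<in> preimage (Zset (comparison P))"
    using r(1) Q comparison_Spech[OF Q] unfolding preimage_def Zset_def by blast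
qed

lemma localizes_idempotent:
  "localizes V \<Longrightarrow> idempotent_triangle (preimage V) e f \<longleftrightarrow> localization_triangle (torsion_sub V) \<bbbone> e f"
  unfolding idempotent_triangle_def localizes_def by simp

text \<open>The set \<open>?W\<close> is weakly visible, so membership in \<open>Supp\<close>
  applies to it directly. Uniqueness of localization triangles carries the result from tensor
  products to the arbitrary representatives \<open>l\<close> and \<open>g\<close>.\<close>

lemma comparison_Supp_subset:
  assumes P: "P \<in> Supp t"
  shows "comparison P \<in> Supp_BIK t"
  unfolding Supp_BIK_def
proof (intro CollectI conjI allI impI)
  let ?p = "comparison P"
  have PS: "P \<in> Spc" using P by (simp add: Supp_def)
  show pS: "?p \<in> Spech" by (rule comparison_Spech[OF PS])
  fix a l g assume a: "fg_homog_ideal a" "a \<subseteq> ?p" and l: "is_L (Zset ?p) t l" and g: "is_Gamma (Vset a) l g"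
  have R: "ring EndR" by (rule homog_ideal_ring[OF Spech_ideal[OF pS]])
  obtain F where F: "finite F" "F \<subseteq> homog_elems" "Vset a = Vset F" using Vset_fg[OF a(1)] by blast
  have V1: "localizes (Vset a)" unfolding F(3) by (rule localizes_Vset[OF R F(1,2) comparison_Spech])
  have V2: "localizes (Zset ?p)" by (rule localizes_Zset[OF pS comparison_Spech])
  obtain e1 f1 where 1: "localization_triangle (torsion_sub (Vset a)) \<bbbone> e1 f1" using V1 unfolding localizes_def by blast
  obtain e2 f2 where 2: "localization_triangle (torsion_sub (Zset ?p)) \<bbbone> e2 f2" using V2 unfolding localizes_def by blast
  let ?W = "preimage (Vset a) \<inter> (topspace Spc_top - preimage (Zset ?p))"
  have th: "thomason Spc_top (preimage (Vset a))" "thomason Spc_top (preimage (Zset ?p))"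
    unfolding F(3) by (rule thomason_preimage_Vset[OF F(1,2)], rule thomason_preimage_Zset[OF pS])
  then have W: "weakly_visible Spc_top ?W" unfolding weakly_visible_def by blast
  have PW: "P \<in> ?W" using PS pS a(2) by (auto simp: preimage_def Vset_def Zset_def)
  have "is_g ?W (e1 \<boxtimes> f2)"
    unfolding is_g_def using th 1 2 localizes_idempotent[OF V1] localizes_idempotent[OF V2] by blast
  then have nz: "\<not> zero_object ((e1 \<boxtimes> f2) \<boxtimes> t)" using P W PW unfolding Supp_def by blast
  obtain g1 where "localization_triangle (torsion_sub (Zset ?p)) t g1 l" using l unfolding is_L_def by blast
  then have lf: "f2 \<boxtimes> t \<simeq> l"
    using localization_triangle_unique[OF localizes_shO[OF V2] localization_triangle_tens[OF V2 2]] by blast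
  obtain l2 where "localization_triangle (torsion_sub (Vset a)) l g l2" using g unfolding is_Gamma_def by blast
  then have ge: "e1 \<boxtimes> l \<simeq> g"
    using localization_triangle_unique[OF localizes_shO[OF V1] localization_triangle_tens[OF V1 1]] by blast
  have "(e1 \<boxtimes> f2) \<boxtimes> t \<simeq> e1 \<boxtimes> (f2 \<boxtimes> t)" by (rule tens_assoc_isomorphic)
  also have "\<dots> \<simeq> e1 \<boxtimes> l" by (intro tens_isomorphic isomorphic_refl lf)
  also note ge
  finally have "(e1 \<boxtimes> f2) \<boxtimes> t \<simeq> g" .
  then show "\<not> zero_object g" using nz zero_object_isomorphic isomorphic_sym by blast
qed

text \<open>A vanishing g \<otimes> t is refuted inside \<open>W\<close>: a closed subset of
  \<open>U\<close> through P supplies the ideal \<open>a\<close>, the Thomason set \<open>V\<close>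
  is enlarged to the preimage of \<open>Zset ?p\<close>, and \<open>?w\<close>, nonzero by
  assumption, turns out to be zero.\<close>

lemma Supp_BIK_subset:
  assumes P: "P \<in> Spc" and p: "comparison P \<in> Supp_BIK t"
  shows "P \<in> Supp t"
  unfolding Supp_def
proof (intro CollectI conjI allI impI notI)
  let ?p = "comparison P"
  have pS: "?p \<in> Spech" by (rule comparison_Spech[OF P])
  have R: "ring EndR" by (rule homog_ideal_ring[OF Spech_ideal[OF pS]])
  fix W g assume PW: "P \<in> W" and g: "is_g W g" and zero: "zero_object (g \<boxtimes> t)"
  obtain U V eU fU eV fV where U: "thomason Spc_top U" and V: "thomason Spc_top V"
    and W: "W = U \<inter> (topspace Spc_top - V)"
    and iU: "idempotent_triangle U eU fU" and iV: "idempotent_triangle V eV fV" and geq: "g = eU \<boxtimes> fV"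
    using g unfolding is_g_def by blast
  \<comment> \<open>The Thomason set \<open>U\<close> contains a closed set through P with
    quasi-compact complement; its image is cut out by finitely many homogeneous elements, which
    generate \<open>a\<close>.\<close>
  obtain Z where Z: "closedin Spc_top Z" "compactin Spc_top (topspace Spc_top - Z)" "P \<in> Z" "Z \<subseteq> U"
    using U PW W unfolding thomason_def by blast
  have ZS: "Z \<subseteq> Spc" using closedin_subset[OF Z(1)] by simp
  have cZ: "closedin Spech_top (comparison ` Z)" using homeomorphic_map_closedness_eq[OF homeo] Z(1) by blast
  have "comparison ` (Spc - Z) = Spech - comparison ` Z"
    using inj_on_image_set_diff[OF comparison_inj, of Spc Z] ZS comparison_image by auto
  then have "compactin Spech_top (Spech - comparison ` Z)"
    using homeomorphic_map_compactness_eq[OF homeo, of "Spc - Z"] Z(2) by simp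
  then obtain F where F: "finite F" "F \<subseteq> homog_elems" "comparison ` Z = Vset F"
    using closed_cocompact_Spech[OF cZ] by blast
  define a where "a = genideal EndR F"
  have a: "fg_homog_ideal a" "Vset a = Vset F"
    unfolding a_def by (rule fg_homog_ideal_gen[OF R F(1,2)], rule Vset_genideal[OF R F(2)])
  have "?p \<in> Vset a" using Z(3) F(3) a(2) by blast
  then have ap: "a \<subseteq> ?p" by (simp add: Vset_def)
  have preZ: "preimage (Vset a) = Z" unfolding a(2) F(3)[symmetric] by (rule preimage_image[OF ZS])
  have V1: "localizes (Vset a)" unfolding a(2) by (rule localizes_Vset[OF R F(1,2) comparison_Spech])
  have V2: "localizes (Zset ?p)" by (rule localizes_Zset[OF pS comparison_Spech])
  obtain e1 f1 where 1: "localization_triangle (torsion_sub (Vset a)) \<bbbone> e1 f1" using V1 unfolding localizes_def by blast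
  obtain e2 f2 where 2: "localization_triangle (torsion_sub (Zset ?p)) \<bbbone> e2 f2" using V2 unfolding localizes_def by blast
  let ?w = "e1 \<boxtimes> (f2 \<boxtimes> t)"
  have "is_L (Zset ?p) t (f2 \<boxtimes> t)" unfolding is_L_def using localization_triangle_tens[OF V2 2] by blast
  moreover have "is_Gamma (Vset a) (f2 \<boxtimes> t) ?w" unfolding is_Gamma_def using localization_triangle_tens[OF V1 1] by blast
  ultimately have nz: "\<not> zero_object ?w" using p a(1) ap unfolding Supp_BIK_def by blast
  have T1: "torsion_sub (Vset a) = Loc (compacts_on Z)" using V1 preZ unfolding localizes_def by simp
  have T2: "torsion_sub (Zset ?p) = Loc (compacts_on (preimage (Zset ?p)))" using V2 unfolding localizes_def by simp
  have "P \<notin> V" using PW W by blast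
  then have VZ: "V \<subseteq> preimage (Zset ?p)" by (rule thomason_subset_Zset[OF V P])
  have e1: "e1 \<in> torsion_sub (Vset a)" using 1 unfolding localization_triangle_def by blast
  have "orth s fU" if "s \<in> torsion_sub (Vset a)" for s
  proof (rule localization_triangle_orth[OF iU[unfolded idempotent_triangle_def]])
    have "compacts_on Z \<subseteq> compacts_on U" using Z(4) by (auto simp: compacts_on_def)
    then show "s \<in> Loc (compacts_on U)" using that Loc_mono unfolding T1 by blast
  qed
  then have z1: "zero_object (e1 \<boxtimes> fU)" by (rule localizes_tens_zero[OF V1 e1])
  have "eV \<in> Loc (compacts_on V)" using iV unfolding idempotent_triangle_def localization_triangle_def by blast
  moreover have "compacts_on V \<subseteq> compacts_on (preimage (Zset ?p))" using VZ by (auto simp: compacts_on_def)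
  ultimately have "eV \<in> torsion_sub (Zset ?p)" unfolding T2 using Loc_mono by blast
  then have z2: "zero_object (eV \<boxtimes> f2)" by (rule localizes_tens_zero[OF V2 _ localizes_orth[OF V2 2]])
  \<comment> \<open>The triangle of \<open>U\<close>, then that of \<open>V\<close>, cuts
    \<open>?w\<close> into three pieces. Those with fU and with eV vanish because e1 \<otimes> fU
    and eV \<otimes> f2 do (\<open>z1\<close>, \<open>z2\<close>); the remaining one, with eU and
    fV, is a tensor multiple of g \<otimes> t.\<close>
  have "zero_object ?w"
  proof (rule zero_object_by_idempotents[OF iU[unfolded idempotent_triangle_def]])
    have "(e1 \<boxtimes> fU) \<boxtimes> (f2 \<boxtimes> t) \<simeq> (fU \<boxtimes> e1) \<boxtimes> (f2 \<boxtimes> t)" by (intro tens_isomorphic tens_comm_isomorphic isomorphic_refl)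
    also have "\<dots> \<simeq> fU \<boxtimes> ?w" by (rule tens_assoc_isomorphic)
    finally show "zero_object (fU \<boxtimes> ?w)" using zero_object_isomorphic zero_object_tens_left[OF z1] by blast
    show "zero_object (eU \<boxtimes> ?w)"
    proof (rule zero_object_by_idempotents[OF iV[unfolded idempotent_triangle_def]])
      have "(eV \<boxtimes> f2) \<boxtimes> (eU \<boxtimes> (e1 \<boxtimes> t)) \<simeq> eV \<boxtimes> (f2 \<boxtimes> (eU \<boxtimes> (e1 \<boxtimes> t)))" by (rule tens_assoc_isomorphic)
      also have "\<dots> \<simeq> eV \<boxtimes> (eU \<boxtimes> (f2 \<boxtimes> (e1 \<boxtimes> t)))" by (intro tens_isomorphic tens_left_comm_isomorphic isomorphic_refl)
      also have "\<dots> \<simeq> eV \<boxtimes> (eU \<boxtimes> ?w)" by (intro tens_isomorphic tens_left_comm_isomorphic isomorphic_refl)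
      finally show "zero_object (eV \<boxtimes> (eU \<boxtimes> ?w))" using zero_object_isomorphic zero_object_tens_left[OF z2] by blast
      have "(g \<boxtimes> t) \<boxtimes> (e1 \<boxtimes> f2) \<simeq> g \<boxtimes> (t \<boxtimes> (e1 \<boxtimes> f2))" by (rule tens_assoc_isomorphic)
      also have "\<dots> \<simeq> g \<boxtimes> ((e1 \<boxtimes> f2) \<boxtimes> t)" by (intro tens_isomorphic tens_comm_isomorphic isomorphic_refl)
      also have "\<dots> \<simeq> g \<boxtimes> ?w" by (intro tens_isomorphic tens_assoc_isomorphic isomorphic_refl)
      also have "\<dots> \<simeq> eU \<boxtimes> (fV \<boxtimes> ?w)" unfolding geq by (rule tens_assoc_isomorphic)
      also have "\<dots> \<simeq> fV \<boxtimes> (eU \<boxtimes> ?w)" by (rule tens_left_comm_isomorphic)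
      finally show "zero_object (fV \<boxtimes> (eU \<boxtimes> ?w))" using zero_object_isomorphic zero_object_tens_left[OF zero] by blast
    qed
  qed
  then show False using nz by blast
qed (rule P)

end

theorem theorem3:
  fixes T :: "('o, 'm, 'u) tt_data" and t :: 'o
  assumes "rigidly_compactly_generated T"
    and "homeomorphic_map (tt_struct.Spc_top T) (tt_struct.Spech_top T) (tt_struct.comparison T)"
  shows "tt_struct.comparison T ` tt_struct.Supp T t = tt_struct.Supp_BIK T t"
proof -
  interpret comparison_homeomorphism T
    using assms by (simp add: comparison_homeomorphism_def comparison_homeomorphism_axioms_def)
  show ?thesis
  proof (intro equalityI subsetI)
    fix p assume "p \<in> comparison ` Supp t"
    then show "p \<in> Supp_BIK t" using comparison_Supp_subset by blast
  next
    fix p assume p: "p \<in> Supp_BIK t"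
    then have "p \<in> comparison ` Spc" using comparison_image by (simp add: Supp_BIK_def)
    then show "p \<in> comparison ` Supp t" using Supp_BIK_subset p by blast
  qed
qed

end
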